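(* Let $X$ be a Riemann surface, $\Sigma\subset X$ a discrete closed subset, $\Omega$ a smooth Hermitian metric on $X$ with induced distance $\operatorname{dist}$. Let $\omega$ be a smooth Hermitian metric on $X\setminus\Sigma$ such that $\omega\ge c\,\Omega$ for some continuous function $c:X\to(0,\infty)$ and $\operatorname{Ric}_\omega\le-\lambda\omega$ on $X\setminus\Sigma$ for some constant $\lambda>0$. Fix $x_j\in\Sigma$ and $R_j>0$ such that $x_j$ has a coordinate neighborhood $U_{x_j}$ with holomorphic coordinate $z$ centered at $x_j$, the coordinate disc $B(x_j,2R_j)=\{|z|<2R_j\}$ is relatively compact in $U_{x_j}$, and $\operatorname{dist}(B(x_j,2R_j),\Sigma\setminus\{x_j\})\ge R_j$. On $B(x_j,2R_j)\setminus\{x_j\}$ write $\omega=\frac i2\rho_j\,dz\wedge d\overline z$, put $\varphi_j=\frac12(\log\rho_j-\log2)$, and write $\varphi_j(z)=\nu_j\log|z|+\psi_j(z)$ with $\nu_j\in\mathbb R$ and $\psi_j\in\mathcal C^3(B(x_j,2R_j)\setminus\{x_j\})$. Assume that there are constants $A_j>0$, $\alpha_j\ge0$, $A_j'>0$, $\beta_j\ge0$ such that for all $z\in B(x_j,2R_j)\setminus\{x_j\}$: $|D^\mu\psi_j(z)|\le A_j|z|^{-\alpha_j}$ for all third order derivatives ($|\mu|=3$), and $|D\rho_j(z)|\le A_j'|z|^{-\beta_j}$ for the first order derivatives. Set $\delta_j=\max\{8/3,\,8\beta_j/3,\,8\alpha_j\}$. Let $P_p$ be the Bergman kernel function of $H^0_{(2)}(X\setminus\Sigma,K_X^p)$.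 Then there exists a constant $C_j>1$ such that if $x\in B(x_j,R_j)\setminus\{x_j\}$ and $p\in\mathbb N$ satisfies $p>C_j\operatorname{dist}(x,x_j)^{-\delta_j}$, then $$\left|\frac{P_p(x)}{p}\left(-\frac{2\pi}{R_\omega(x)}\right)-1\right|\le C_j\Big(p^{-1/8}\operatorname{dist}(x,x_j)^{-\alpha_j}+p^{-3/8}\operatorname{dist}(x,x_j)^{-\beta_j}\Big),$$ where $R_\omega$ is the Gauss curvature of $\omega$.
   Context: If locally $\omega=\frac i2\rho\,dz\wedge d\overline z$, then $\operatorname{Ric}_\omega=-i\,\partial\overline\partial\log\rho=R_\omega\,\omega$, where the Gauss curvature is $R_\omega=-\frac2\rho\,\frac{\partial^2}{\partial z\partial\overline z}\log\rho$. $K_X$ is the canonical bundle of $X$. The metric $\omega$ induces the Hermitian metric $h^{K_X}$ on $K_X|_{X\setminus\Sigma}$ given by $|dz|^2_\omega=2/\rho$ (so $\varphi_j$ is its weight in the frame $dz$). $K_X^p=K_X^{\otimes p}$ carries the metric $h_p=(h^{K_X})^{\otimes p}$. $H^0_{(2)}(X\setminus\Sigma,K_X^p)$ is the Hilbert space of holomorphic sections $S$ of $K_X^p$ over $X\setminus\Sigma$ with $\|S\|_p^2=\int_{X\setminus\Sigma}|S|^2_{h_p}\,\omega<\infty$. Its Bergman kernel function is $P_p(x)=\sum_\ell|S_\ell^p(x)|^2_{h_p}$ for any orthonormal basis $\{S_\ell^p\}_\ell$. $B(x_j,r)$ denotes the disc $\{|z|<r\}$ in the coordinate $z$ centered at $x_j$.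 *)

theory Defs
  imports "HOL-Analysis.Analysis"
begin

section \<open>Real partial derivatives in the complex plane\<close>

definition pdx :: "(complex \<Rightarrow> real) \<Rightarrow> complex \<Rightarrow> real" where
  "pdx f w = frechet_derivative f (at w) 1"

definition pdy :: "(complex \<Rightarrow> real) \<Rightarrow> complex \<Rightarrow> real" where
  "pdy f w = frechet_derivative f (at w) \<i>"

definition partial :: "nat \<Rightarrow> nat \<Rightarrow> (complex \<Rightarrow> real) \<Rightarrow> complex \<Rightarrow> real" where
  "partial a b f = (pdx ^^ a) ((pdy ^^ b) f)"

text \<open>Used for open sets only.\<close>

fun Ck_on :: "nat \<Rightarrow> (complex \<Rightarrow> real) \<Rightarrow> complex set \<Rightarrow> bool" where
  "Ck_on 0 f S \<longleftrightarrow> continuous_on S f"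
| "Ck_on (Suc k) f S \<longleftrightarrow>
     (\<forall>w\<in>S. f differentiable (at w)) \<and> Ck_on k (pdx f) S \<and> Ck_on k (pdy f) S"

definition smooth_on :: "(complex \<Rightarrow> real) \<Rightarrow> complex set \<Rightarrow> bool" where
  "smooth_on f S \<longleftrightarrow> (\<forall>k. Ck_on k f S)"

text \<open>The operator \<open>\<partial>\<^sup>2 / \<partial>z \<partial>z\<bar>\<close>, that is, one quarter of the Laplacian.\<close>

definition d_dbar :: "(complex \<Rightarrow> real) \<Rightarrow> complex \<Rightarrow> real" where
  "d_dbar f w = (partial 2 0 f w + partial 0 2 f w) / 4"


section \<open>Riemann surfaces\<close>

text \<open>
  A chart is a pair of its domain and its coordinate function; values of the coordinate
  outside the domain are irrelevant.  The surface is the whole type \<open>'a\<close>.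
\<close>

type_synonym 'a chart = "'a set \<times> ('a \<Rightarrow> complex)"

definition is_chart :: "('a::topological_space) chart \<Rightarrow> bool" where
  "is_chart = (\<lambda>(U, z). open U \<and> open (z ` U) \<and> inj_on z U \<and>
                 homeomorphism U (z ` U) z (inv_into U z))"

text \<open>The coordinate of the second chart as a function of the coordinate of the first.\<close>

definition transition :: "'a chart \<Rightarrow> 'a chart \<Rightarrow> complex \<Rightarrow> complex" where
  "transition = (\<lambda>(U, z) (V, w). w \<circ> inv_into U z)"

definition compatible :: "'a chart \<Rightarrow> 'a chart \<Rightarrow> bool" where
  "compatible k l \<longleftrightarrow>
     transition k l holomorphic_on (snd k ` (fst k \<inter> fst l)) \<and>
     transition l k holomorphic_on (snd l ` (fst k \<inter> fst l))"

text \<open>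
  Second countability, part of the type constraint, is no restriction on connected
  Riemann surfaces (Rad\'o).
\<close>

definition riemann_surface :: "('a::{t2_space,second_countable_topology}) chart set \<Rightarrow> bool" where
  "riemann_surface A \<longleftrightarrow>
     connected (UNIV :: 'a set) \<and> (\<forall>k\<in>A. is_chart k) \<and> (\<Union>k\<in>A. fst k) = UNIV \<and>
     (\<forall>k\<in>A. \<forall>l\<in>A. compatible k l)"

text \<open>The maximal atlas: all holomorphic coordinates of the surface.\<close>

definition charts :: "('a::topological_space) chart set \<Rightarrow> 'a chart set" where
  "charts A = {k. is_chart k \<and> (\<forall>l\<in>A. compatible k l)}"

definition chart_at :: "('a::topological_space) chart set \<Rightarrow> 'a \<Rightarrow> 'a chart" where
  "chart_at A x = (SOME k. k \<in> charts A \<and> x \<in> fst k)"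

text \<open>The derivative \<open>dw/dz\<close> at \<open>x\<close>, for \<open>z\<close> and \<open>w\<close> the coordinates of \<open>k\<close> and \<open>l\<close>.\<close>

definition jac :: "'a chart \<Rightarrow> 'a chart \<Rightarrow> 'a \<Rightarrow> complex" where
  "jac k l x = deriv (transition k l) (snd k x)"

definition coord_disc :: "'a chart \<Rightarrow> real \<Rightarrow> 'a set" where
  "coord_disc k r = {x \<in> fst k. cmod (snd k x) < r}"

definition in_coord :: "'a chart \<Rightarrow> ('a \<Rightarrow> 'b) \<Rightarrow> complex \<Rightarrow> 'b" where
  "in_coord k f = f \<circ> inv_into (fst k) (snd k)"


section \<open>Hermitian metrics and curvature\<close>

text \<open>
  A real (1,1)-form is given by its coefficients: the value \<open>\<omega> k x\<close> is the coefficient \<open>\<rho>\<close>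
  at \<open>x\<close> in \<open>\<omega> = (i/2) \<rho> dz \<and> dz\<bar>\<close>, where \<open>z\<close> is the coordinate of the chart \<open>k\<close>.
\<close>

type_synonym 'a form11 = "'a chart \<Rightarrow> 'a \<Rightarrow> real"

definition hermitian_metric_on ::
    "('a::topological_space) chart set \<Rightarrow> 'a set \<Rightarrow> 'a form11 \<Rightarrow> bool" where
  "hermitian_metric_on A Y \<omega> \<longleftrightarrow>
     (\<forall>k\<in>charts A. smooth_on (in_coord k (\<omega> k)) (snd k ` (fst k \<inter> Y)) \<and>
                   (\<forall>x\<in>fst k \<inter> Y. \<omega> k x > 0)) \<and>
     (\<forall>k\<in>charts A. \<forall>l\<in>charts A. \<forall>x\<in>fst k \<inter> fst l \<inter> Y.
        \<omega> k x = \<omega> l x * (cmod (jac k l x))\<^sup>2)"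

definition form_le_on ::
    "('a::topological_space) chart set \<Rightarrow> 'a set \<Rightarrow> 'a form11 \<Rightarrow> 'a form11 \<Rightarrow> bool" where
  "form_le_on A Y \<eta> \<omega> \<longleftrightarrow> (\<forall>k\<in>charts A. \<forall>x\<in>fst k \<inter> Y. \<eta> k x \<le> \<omega> k x)"

text \<open>The form \<open>-i \<partial>\<partial>\<bar> log \<rho> = (i/2) (-2 \<partial>\<^sup>2 log \<rho> / \<partial>z \<partial>z\<bar>) dz \<and> dz\<bar>\<close>.\<close>

definition ricci :: "'a form11 \<Rightarrow> 'a form11" where
  "ricci \<omega> k x = - 2 * d_dbar (\<lambda>w. ln (in_coord k (\<omega> k) w)) (snd k x)"

definition gauss_curvature :: "('a::topological_space) chart set \<Rightarrow> 'a form11 \<Rightarrow> 'a \<Rightarrow> real" where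
  "gauss_curvature A \<omega> x =
     (let k = chart_at A x
      in - (2 / \<omega> k x) * d_dbar (\<lambda>w. ln (in_coord k (\<omega> k) w)) (snd k x))"


section \<open>The induced distance\<close>

definition piecewise_C1_path :: "('a::topological_space) chart set \<Rightarrow> (real \<Rightarrow> 'a) \<Rightarrow> bool" where
  "piecewise_C1_path A \<gamma> \<longleftrightarrow> continuous_on {0..1} \<gamma> \<and>
     (\<exists>F. finite F \<and>
        (\<forall>k\<in>charts A. (snd k \<circ> \<gamma>) C1_differentiable_on {t \<in> {0<..<1} - F. \<gamma> t \<in> fst k}))"

text \<open>
  The Riemannian metric of \<open>(i/2) \<rho> dz \<and> dz\<bar>\<close> is \<open>\<rho> |dz|\<^sup>2\<close>.  The length takes values in
  \<open>ennreal\<close> because the derivative of a path may be unbounded near the exceptional points.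
\<close>

definition path_length ::
    "('a::topological_space) chart set \<Rightarrow> 'a form11 \<Rightarrow> (real \<Rightarrow> 'a) \<Rightarrow> ennreal" where
  "path_length A \<omega> \<gamma> =
     (\<integral>\<^sup>+t\<in>{0<..<1}. ennreal (let k = chart_at A (\<gamma> t)
        in sqrt (\<omega> k (\<gamma> t)) * cmod (vector_derivative (snd k \<circ> \<gamma>) (at t))) \<partial>lborel)"

definition rdist :: "('a::topological_space) chart set \<Rightarrow> 'a form11 \<Rightarrow> 'a \<Rightarrow> 'a \<Rightarrow> real" where
  "rdist A \<omega> x y =
     enn2real (INF \<gamma>\<in>{\<gamma>. piecewise_C1_path A \<gamma> \<and> \<gamma> 0 = x \<and> \<gamma> 1 = y}. path_length A \<omega> \<gamma>)"


section \<open>Integration against the metric\<close>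

text \<open>
  The measure on \<open>Y\<close> defined by the form \<open>(i/2) \<rho> dz \<and> dz\<bar> = \<rho> dx \<and> dy\<close>.  It is unique
  since \<open>Y\<close> is covered by countably many charts.
\<close>

definition area_measure ::
    "('a::topological_space) chart set \<Rightarrow> 'a set \<Rightarrow> 'a form11 \<Rightarrow> 'a measure" where
  "area_measure A Y \<omega> =
     (THE M. sets M = sets (restrict_space borel Y) \<and>
        (\<forall>k\<in>charts A. \<forall>E\<in>sets M. E \<subseteq> fst k \<longrightarrow>
           emeasure M E = (\<integral>\<^sup>+w\<in>snd k ` E. ennreal (in_coord k (\<omega> k) w) \<partial>lborel)))"


section \<open>Pluricanonical sections and the Bergman kernel\<close>

text \<open>
  A section of \<open>K\<^sub>X\<^sup>p\<close> is given by its coefficients: \<open>S k x\<close> is the coefficient at \<open>x\<close> with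
  respect to \<open>dz\<^sup>p\<close>, where \<open>z\<close> is the coordinate of \<open>k\<close>.  The last clause normalises irrelevant
  values to 0, so that sections are equal iff they are equal as functions.
\<close>

type_synonym 'a sect = "'a chart \<Rightarrow> 'a \<Rightarrow> complex"

definition holomorphic_section ::
    "('a::topological_space) chart set \<Rightarrow> 'a set \<Rightarrow> nat \<Rightarrow> 'a sect \<Rightarrow> bool" where
  "holomorphic_section A Y p S \<longleftrightarrow>
     (\<forall>k\<in>charts A. in_coord k (S k) holomorphic_on (snd k ` (fst k \<inter> Y))) \<and>
     (\<forall>k\<in>charts A. \<forall>l\<in>charts A. \<forall>x\<in>fst k \<inter> fst l \<inter> Y. S k x = S l x * jac k l x ^ p) \<and>
     (\<forall>k x. k \<notin> charts A \<or> x \<notin> fst k \<inter> Y \<longrightarrow> S k x = 0)"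

text \<open>The metric \<open>h\<^sub>p\<close> on \<open>K\<^sub>X\<^sup>p\<close> induced by \<open>|dz|\<^sup>2 = 2 / \<rho>\<close>.\<close>

definition hprod ::
    "('a::topological_space) chart set \<Rightarrow> 'a form11 \<Rightarrow> nat \<Rightarrow> 'a sect \<Rightarrow> 'a sect \<Rightarrow> 'a \<Rightarrow> complex" where
  "hprod A \<omega> p S T x =
     (let k = chart_at A x in S k x * cnj (T k x) * of_real ((2 / \<omega> k x) ^ p))"

definition hnorm_sq ::
    "('a::topological_space) chart set \<Rightarrow> 'a form11 \<Rightarrow> nat \<Rightarrow> 'a sect \<Rightarrow> 'a \<Rightarrow> real" where
  "hnorm_sq A \<omega> p S x = (let k = chart_at A x in (cmod (S k x))\<^sup>2 * (2 / \<omega> k x) ^ p)"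

definition L2_norm_sq ::
    "('a::topological_space) chart set \<Rightarrow> 'a set \<Rightarrow> 'a form11 \<Rightarrow> nat \<Rightarrow> 'a sect \<Rightarrow> ennreal" where
  "L2_norm_sq A Y \<omega> p S = (\<integral>\<^sup>+x. ennreal (hnorm_sq A \<omega> p S x) \<partial>area_measure A Y \<omega>)"

definition L2_inner ::
    "('a::topological_space) chart set \<Rightarrow> 'a set \<Rightarrow> 'a form11 \<Rightarrow> nat \<Rightarrow> 'a sect \<Rightarrow> 'a sect \<Rightarrow> complex" where
  "L2_inner A Y \<omega> p S T = (LINT x|area_measure A Y \<omega>. hprod A \<omega> p S T x)"

text \<open>The space \<open>H\<^sup>0\<^sub>(\<^sub>2\<^sub>)(Y, K\<^sub>X\<^sup>p)\<close>.\<close>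

definition L2_sections ::
    "('a::topological_space) chart set \<Rightarrow> 'a set \<Rightarrow> 'a form11 \<Rightarrow> nat \<Rightarrow> 'a sect set" where
  "L2_sections A Y \<omega> p = {S. holomorphic_section A Y p S \<and> L2_norm_sq A Y \<omega> p S < \<infinity>}"

definition orthonormal_basis ::
    "('a::topological_space) chart set \<Rightarrow> 'a set \<Rightarrow> 'a form11 \<Rightarrow> nat \<Rightarrow> 'a sect set \<Rightarrow> bool" where
  "orthonormal_basis A Y \<omega> p B \<longleftrightarrow>
     B \<subseteq> L2_sections A Y \<omega> p \<and>
     (\<forall>S\<in>B. \<forall>T\<in>B. L2_inner A Y \<omega> p S T = (if S = T then 1 else 0)) \<and>
     (\<forall>S\<in>L2_sections A Y \<omega> p. \<forall>e>0. \<exists>F a. finite F \<and> F \<subseteq> B \<and>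
        L2_norm_sq A Y \<omega> p (\<lambda>k x. S k x - (\<Sum>T\<in>F. a T * T k x)) < ennreal e)"

text \<open>The value does not depend on the choice of the orthonormal basis.\<close>

definition bergman_kernel ::
    "('a::topological_space) chart set \<Rightarrow> 'a set \<Rightarrow> 'a form11 \<Rightarrow> nat \<Rightarrow> 'a \<Rightarrow> real" where
  "bergman_kernel A Y \<omega> p x =
     (\<Sum>\<^sub>\<infinity>S\<in>(SOME B. orthonormal_basis A Y \<omega> p B). hnorm_sq A \<omega> p S x)"

end

theory Submission
 imports Defs "HOL-Complex_Analysis.Complex_Analysis"
begin
text \<open>
  Put p = q + 1. In a coordinate the norm of sections of \<open>K\<^sup>p\<close> has the weight \<open>(2/\<rho>)\<^sup>p \<rho> = exp (-2p\<phi>) \<rho>\<close>. At distance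
  r from the puncture, Taylor's formula gives \<open>\<phi> = Re G + K |v|\<^sup>2 + O(r\<^sup>-\<^sup>\<alpha> |v|\<^sup>3)\<close> with G holomorphic and
  \<open>K = -R\<^sub>\<omega> \<rho>/4 > 0\<close>; the logarithmic part of \<open>\<phi>\<close> is harmonic and goes into Re G (\<open>local_expansion\<close>). On the disc of
  radius s = p^(-3/8) the weight is Gaussian up to a factor 1 + O(p^(-1/8) r^(-\<open>\<alpha>\<close>)), because p s^3 = p^(-1/8), and
  \<open>\<rho>\<close> is constant up to O(p^(-3/8) r^(-\<open>\<beta>\<close>)). These are the two error terms of the theorem.

  Upper bound: the mean value property against a Gaussian bounds \<open>|S(x)|\<^sup>2\<close> by the norm of S
  (\<open>co_section_bound\<close>), and the kernel is the squared norm of the evaluation at x (\<open>bergman_bounds\<close>).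

  Lower bound: exp (pG) times a cutoff has almost the extremal norm but is not holomorphic. Its projection S to the
  holomorphic sections differs from it by little. The orthogonal complement of the holomorphic sections is the
  closure of the image of the adjoint of \<open>\<partial>\<close>-bar on compactly supported sections of \<open>K\<^sup>q\<close> (Weyl's lemma,
  \<open>weyl_section\<close>). By the Bochner-Kodaira identity the bound on the Ricci form makes this adjoint bounded below
  (\<open>energy\<close>), and by duality the squared norm of the difference is at most 4/(q\<open>\<kappa>\<close>) times that of \<open>\<partial>\<close>-bar of the
  cutoff section (\<open>peak_projection\<close>), which is exponentially small. All test sections have compact support, so no
  boundary terms arise.

  The distance to the puncture enters only through being positive and at most a multiple of |z|
  (\<open>rdist_pos\<close>, \<open>rdist_upper\<close>): the estimate is proved with |z| in its place and then rescaled.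
\<close>

abbreviation sq :: "complex => real" where "sq w \<equiv> (cmod w)\<^sup>2"

section \<open>Wirtinger calculus\<close>

definition dz :: "(complex => complex) => complex => complex" where
 "dz f w = (frechet_derivative f (at w) 1 - \<i> * frechet_derivative f (at w) \<i>) / 2"

definition dzb :: "(complex => complex) => complex => complex" where
 "dzb f w = (frechet_derivative f (at w) 1 + \<i> * frechet_derivative f (at w) \<i>) / 2"

text \<open>Differentiability classes of complex functions through the two Wirtinger derivatives, which suit products with holomorphic functions.\<close>
fun CK :: "nat => (complex => complex) => complex set => bool" where "CK 0 f S \<longleftrightarrow> continuous_on S f"
| "CK (Suc n) f S \<longleftrightarrow> (\<forall>w\<in>S. f differentiable (at w)) & CK n (dz f) S & CK n (dzb f) S"

lemma real_linear_complex: fixes L :: "complex => 'b::real_vector" assumes "linear L" shows "L h = Re h *\<^sub>R L 1 + Im h *\<^sub>R L \<i>"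
proof -
 have "h = Re h *\<^sub>R 1 + Im h *\<^sub>R \<i>" by (simp add: complex_eq_iff)
 then have "L h = L (Re h *\<^sub>R 1 + Im h *\<^sub>R \<i>)" by simp
 then show ?thesis by (simp add: linear_add[OF assms] linear_scale[OF assms])
qed

lemma has_wirtinger_derivative: assumes "f differentiable (at w)" shows "(f has_derivative (%h. dz f w * h + dzb f w * cnj h)) (at w)"
proof -
 let ?L = "frechet_derivative f (at w)"
 have d: "(f has_derivative ?L) (at w)" using assms frechet_derivative_works by blast
 have "?L h = dz f w * h + dzb f w * cnj h" for h
 proof -
  have "?L h = Re h *\<^sub>R ?L 1 + Im h *\<^sub>R ?L \<i>" by (rule real_linear_complex) (use d has_derivative_linear in blast)
  also have "... = dz f w * h + dzb f w * cnj h" unfolding dz_def dzb_def by (simp add: complex_eq_iff field_simps)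
  finally show ?thesis .
 qed
 then have "?L = (%h. dz f w * h + dzb f w * cnj h)" by (rule ext)
 then show ?thesis using d by simp
qed

lemma wirtinger_unique: assumes "(f has_derivative (%h. p * h + q * cnj h)) (at w)" shows "f differentiable (at w)" "dz f w = p" "dzb f w = q"
proof -
 show "f differentiable (at w)" using assms differentiable_def by blast
 have "frechet_derivative f (at w) = (%h. p * h + q * cnj h)" using frechet_derivative_at[OF assms] by simp
 then show "dz f w = p" "dzb f w = q" by (simp_all add: dz_def dzb_def algebra_simps)
qed

lemma wirtinger_cong: assumes "open S" "w : S" "!!x. x : S ==> f x = g x"
 shows "dz f w = dz g w" "dzb f w = dzb g w" "f differentiable (at w) \<longleftrightarrow> g differentiable (at w)"
proof -
 have *: "(f has_derivative L) (at w) \<longleftrightarrow> (g has_derivative L) (at w)" for L using has_derivative_transform_within_open[OF _ assms(1,2)] assms(3) by metis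
 show "dz f w = dz g w" "dzb f w = dzb g w" "f differentiable (at w) \<longleftrightarrow> g differentiable (at w)"
  unfolding dz_def dzb_def frechet_derivative_def differentiable_def * by auto
qed

lemma CK_cong: assumes "open S" "!!x. x : S ==> f x = g x" shows "CK n f S \<longleftrightarrow> CK n g S" using assms
proof (induction n arbitrary: f g)
 case 0
 then show ?case by (auto cong: continuous_on_cong)
next
 case (Suc n)
 have "CK n (dz f) S \<longleftrightarrow> CK n (dz g) S" by (rule Suc.IH[OF Suc.prems(1)]) (rule wirtinger_cong(1)[OF Suc.prems(1) _ Suc.prems(2)])
 moreover have "CK n (dzb f) S \<longleftrightarrow> CK n (dzb g) S" by (rule Suc.IH[OF Suc.prems(1)]) (rule wirtinger_cong(2)[OF Suc.prems(1) _ Suc.prems(2)])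
 ultimately have "CK n (dz f) S \<longleftrightarrow> CK n (dz g) S" "CK n (dzb f) S \<longleftrightarrow> CK n (dzb g) S" by auto
 then show ?case using wirtinger_cong[OF Suc.prems(1) _ Suc.prems(2)] by auto
qed

lemma CK_Suc_cong: assumes "open S" and "!!w. w : S ==> (f has_derivative (%h. p w * h + q w * cnj h)) (at w)" and "CK n p S" "CK n q S"
 shows "CK (Suc n) f S" using assms wirtinger_unique[OF assms(2)]
  CK_cong[OF assms(1), of "dz f" p n] CK_cong[OF assms(1), of "dzb f" q n] by auto

lemma CK_D: "CK (Suc n) f S ==> w : S ==> (f has_derivative (%h. dz f w * h + dzb f w * cnj h)) (at w)"
 by (intro has_wirtinger_derivative) auto

lemma CK_Suc: "CK (Suc n) f S ==> CK n f S"
proof (induction n arbitrary: f)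
 case 0
 then show ?case by (auto intro!: continuous_at_imp_continuous_on differentiable_imp_continuous_within)
next
 case (Suc n)
 then have "CK n (dz f) S" "CK n (dzb f) S" "\<forall>w\<in>S. f differentiable (at w)" unfolding CK.simps(2)[of "Suc n"] by blast+
 then show ?case unfolding CK.simps(2)[of n] by (intro conjI) assumption+
qed

lemma CK_le: "CK m f S ==> n <= m ==> CK n f S" by (induction m) (use CK_Suc le_Suc_eq in \<open>metis le_0_eq\<close>)+

lemma CK_continuous: "CK n f S ==> continuous_on S f" using CK_le[of n f S 0] by simp

lemma CK_subset: "CK n f S ==> T \<subseteq> S ==> CK n f T" by (induction n arbitrary: f) (auto intro: continuous_on_subset)

lemma CK_Un: "open S ==> open T ==> CK n f S ==> CK n f T ==> CK n f (S \<union> T)"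
 by (induction n arbitrary: f) (auto intro: continuous_on_open_Un)

lemma CK_const [simp]: "CK n (%_. c) S"
proof (induction n arbitrary: c)
 case (Suc n)
 have "((%_. c) has_derivative (%h. 0 * h + 0 * cnj h)) (at w)" for w by simp
 from wirtinger_unique[OF this] have *: "dz (%_. c) = (%_. 0)" "dzb (%_. c) = (%_. 0)" by auto
 show ?case using Suc by (simp add: *)
qed simp

text \<open>Extension by zero: the domain and the complement of the support form an open cover of the plane.\<close>
lemma CK_zero_off_compact: assumes "open W" "CK n f W" "compact K" "K \<subseteq> W" "!!w. w ~: K ==> f w = 0" shows "CK n f UNIV"
proof -
 have "open (- K)" using compact_imp_closed[OF assms(3)] by auto
 moreover have "CK n f (- K)" using CK_cong[OF \<open>open (- K)\<close>, of f "%_. 0" n] assms(5) by auto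
 ultimately have "CK n f (W \<union> - K)" by (intro CK_Un assms)
 moreover have "W \<union> - K = UNIV" using assms(4) by auto
 ultimately show ?thesis by simp
qed

lemma wirtinger_add: assumes "f differentiable (at w)" "g differentiable (at w)"
 shows "dz (%x. f x + g x) w = dz f w + dz g w" "dzb (%x. f x + g x) w = dzb f w + dzb g w"
proof -
 have "((%x. f x + g x) has_derivative (%h. (dz f w + dz g w) * h + (dzb f w + dzb g w) * cnj h)) (at w)"
  by (rule derivative_eq_intros has_wirtinger_derivative assms refl)+ (auto simp: algebra_simps)
 from wirtinger_unique(2,3)[OF this]
 show "dz (%x. f x + g x) w = dz f w + dz g w" "dzb (%x. f x + g x) w = dzb f w + dzb g w" by auto
qed

lemma CK_add: assumes "open S" "CK n f S" "CK n g S" shows "CK n (%x. f x + g x) S" using assms(2,3)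
proof (induction n arbitrary: f g)
 case (Suc n)
 show ?case
 proof (rule CK_Suc_cong[OF assms(1), where p = "%w. dz f w + dz g w" and q = "%w. dzb f w + dzb g w"])
  fix w assume "w : S"
  show "((%x. f x + g x) has_derivative (%h. (dz f w + dz g w) * h + (dzb f w + dzb g w) * cnj h)) (at w)"
   by (rule derivative_eq_intros CK_D[OF Suc.prems(1) \<open>w : S\<close>] CK_D[OF Suc.prems(2) \<open>w : S\<close>] refl)+ (auto simp: algebra_simps)
 qed (use Suc in auto)
qed (auto intro: continuous_intros)

lemma wirtinger_mult: assumes "f differentiable (at w)" "g differentiable (at w)" shows "dz (%x. f x * g x) w = dz f w * g w + f w * dz g w"
  "dzb (%x. f x * g x) w = dzb f w * g w + f w * dzb g w" "(%x. f x * g x) differentiable (at w)"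
proof -
 have "((%x. f x * g x) has_derivative (%h. (dz f w * g w + f w * dz g w) * h + (dzb f w * g w + f w * dzb g w) * cnj h)) (at w)"
  by (rule derivative_eq_intros has_wirtinger_derivative assms refl)+ (auto simp: algebra_simps)
 from wirtinger_unique[OF this]
 show "dz (%x. f x * g x) w = dz f w * g w + f w * dz g w" "dzb (%x. f x * g x) w = dzb f w * g w + f w * dzb g w"
  "(%x. f x * g x) differentiable (at w)" by auto
qed

lemma CK_mult: assumes "open S" "CK n f S" "CK n g S" shows "CK n (%x. f x * g x) S" using assms(2,3)
proof (induction n arbitrary: f g)
 case (Suc n)
 note c = CK_Suc[OF Suc.prems(1)] CK_Suc[OF Suc.prems(2)]
 show ?case
 proof (rule CK_Suc_cong[OF assms(1), where p = "%w. dz f w * g w + f w * dz g w" and q = "%w. dzb f w * g w + f w * dzb g w"])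
  fix w assume "w : S"
  show "((%x. f x * g x) has_derivative (%h. (dz f w * g w + f w * dz g w) * h + (dzb f w * g w + f w * dzb g w) * cnj h)) (at w)"
   by (rule derivative_eq_intros CK_D[OF Suc.prems(1) \<open>w : S\<close>] CK_D[OF Suc.prems(2) \<open>w : S\<close>] refl)+ (auto simp: algebra_simps)
 qed (use Suc c in \<open>auto intro!: CK_add assms(1)\<close>)
qed (auto intro: continuous_intros)

lemma CK_uminus: "open S ==> CK n f S ==> CK n (%x. - f x) S" using CK_mult[of S n "%_. -1" f] by simp

lemma wirtinger_diff: assumes "f differentiable (at w)" "g differentiable (at w)"
 shows "dz (%x. f x - g x) w = dz f w - dz g w" "dzb (%x. f x - g x) w = dzb f w - dzb g w"
proof -
 have "((%x. f x - g x) has_derivative (%h. (dz f w - dz g w) * h + (dzb f w - dzb g w) * cnj h)) (at w)"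
  by (rule derivative_eq_intros has_wirtinger_derivative assms refl)+ (auto simp: algebra_simps)
 from wirtinger_unique(2,3)[OF this]
 show "dz (%x. f x - g x) w = dz f w - dz g w" "dzb (%x. f x - g x) w = dzb f w - dzb g w" by auto
qed

lemma CK_diff: "open S ==> CK n f S ==> CK n g S ==> CK n (%x. f x - g x) S"
 using CK_add[of S n f "%x. - g x"] CK_uminus[of S n g] by simp

lemma CK_power: "open S ==> CK n f S ==> CK n (%x. f x ^ k) S" by (induction k) (auto intro: CK_mult)

lemma wirtinger_cnj: assumes "f differentiable (at w)" shows "dz (%x. cnj (f x)) w = cnj (dzb f w)" "dzb (%x. cnj (f x)) w = cnj (dz f w)"
  "(%x. cnj (f x)) differentiable (at w)"
proof -
 have "((%x. cnj (f x)) has_derivative (%h. cnj (dzb f w) * h + cnj (dz f w) * cnj h)) (at w)"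
  by (rule derivative_eq_intros has_wirtinger_derivative assms refl)+ (auto simp: algebra_simps)
 from wirtinger_unique[OF this]
 show "dz (%x. cnj (f x)) w = cnj (dzb f w)" "dzb (%x. cnj (f x)) w = cnj (dz f w)" "(%x. cnj (f x)) differentiable (at w)" by auto
qed

lemma CK_cnj: assumes "open S" "CK n f S" shows "CK n (%x. cnj (f x)) S" using assms(2)
proof (induction n arbitrary: f)
 case (Suc n)
 show ?case
 proof (rule CK_Suc_cong[OF assms(1), where p = "%w. cnj (dzb f w)" and q = "%w. cnj (dz f w)"])
  fix w assume "w : S"
  show "((%x. cnj (f x)) has_derivative (%h. cnj (dzb f w) * h + cnj (dz f w) * cnj h)) (at w)"
   by (rule derivative_eq_intros CK_D[OF Suc.prems(1) \<open>w : S\<close>] refl)+ (auto simp: algebra_simps)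
 qed (use Suc in auto)
qed (auto intro: continuous_intros)

lemma wirtinger_inverse: assumes "f differentiable (at w)" "f w ~= 0"
 shows "dz (%x. inverse (f x)) w = - dz f w / (f w)^2" "dzb (%x. inverse (f x)) w = - dzb f w / (f w)^2"
proof -
 have "((%x. inverse (f x)) has_derivative (%h. (- dz f w / (f w)^2) * h + (- dzb f w / (f w)^2) * cnj h)) (at w)"
  by (rule derivative_eq_intros has_wirtinger_derivative assms refl)+ (auto simp: power2_eq_square assms(2) divide_inverse algebra_simps)
 from wirtinger_unique[OF this]
 show "dz (%x. inverse (f x)) w = - dz f w / (f w)^2" "dzb (%x. inverse (f x)) w = - dzb f w / (f w)^2" by auto
qed

lemma CK_inverse: assumes "open S" "CK n f S" "!!w. w : S ==> f w ~= 0" shows "CK n (%x. inverse (f x)) S" using assms(2)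
proof (induction n)
 case (Suc n)
 note i = Suc.IH[OF CK_Suc[OF Suc.prems]]
 show ?case
 proof (rule CK_Suc_cong[OF assms(1), where p = "%w. - (dz f w * (inverse (f w))^2)" and q = "%w. - (dzb f w * (inverse (f w))^2)"])
  fix w assume "w : S"
  show "((%x. inverse (f x)) has_derivative (%h. - (dz f w * (inverse (f w))^2) * h
     + - (dzb f w * (inverse (f w))^2) * cnj h)) (at w)"
   by (rule derivative_eq_intros CK_D[OF Suc.prems(1) \<open>w : S\<close>] refl assms(3) \<open>w : S\<close>)+
    (auto simp: power2_eq_square divide_inverse algebra_simps)
 qed (use Suc.prems i in \<open>auto intro!: CK_uminus CK_mult CK_power assms(1)\<close>)
qed (use assms in \<open>auto intro: continuous_intros\<close>)

lemma wirtinger_holomorphic: assumes "f holomorphic_on S" "open S" "w : S" shows "dz f w = deriv f w" "dzb f w = 0" "f differentiable (at w)"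
proof -
 have "(f has_field_derivative deriv f w) (at w)" using assms holomorphic_derivI by blast
 then have "(f has_derivative (%h. deriv f w * h + 0 * cnj h)) (at w)" by (simp add: has_field_derivative_def)
 from wirtinger_unique[OF this] show "dz f w = deriv f w" "dzb f w = 0" "f differentiable (at w)" by auto
qed

lemma CK_holomorphic: assumes "open S" "f holomorphic_on S" shows "CK n f S" using assms(2)
proof (induction n arbitrary: f)
 case (Suc n)
 show ?case
 proof (rule CK_Suc_cong[OF assms(1), where p = "deriv f" and q = "%_. 0"])
  fix w assume "w : S"
  then show "(f has_derivative (%h. deriv f w * h + 0 * cnj h)) (at w)" using holomorphic_derivI[OF Suc.prems assms(1)] by (simp add: has_field_derivative_def)
 qed (use Suc assms(1) holomorphic_deriv in auto)
qed (auto intro: holomorphic_on_imp_continuous_on)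

lemma wirtinger_compose: assumes "t holomorphic_on S" "open S" "w : S" "f differentiable (at (t w))"
 shows "dz (%x. f (t x)) w = dz f (t w) * deriv t w" "dzb (%x. f (t x)) w = dzb f (t w) * cnj (deriv t w)" "(%x. f (t x)) differentiable (at w)"
proof -
 have "(t has_derivative (%h. deriv t w * h)) (at w)" using holomorphic_derivI[OF assms(1,2,3)] by (simp add: has_field_derivative_def)
 from has_derivative_compose[OF this has_wirtinger_derivative[OF assms(4)]]
 have "((%x. f (t x)) has_derivative (%h. (dz f (t w) * deriv t w) * h + (dzb f (t w) * cnj (deriv t w)) * cnj h)) (at w)" by (simp add: algebra_simps)
 from wirtinger_unique[OF this]
 show "dz (%x. f (t x)) w = dz f (t w) * deriv t w" "dzb (%x. f (t x)) w = dzb f (t w) * cnj (deriv t w)" "(%x. f (t x)) differentiable (at w)" by auto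
qed

lemma CK_compose: assumes "open S" "t holomorphic_on S" "t ` S \<subseteq> T" "CK n f T" shows "CK n (%x. f (t x)) S" using assms(4)
proof (induction n arbitrary: f)
 case 0
 then show ?case using continuous_on_compose2[of T f S t] holomorphic_on_imp_continuous_on[OF assms(2)] assms(3) by auto
next
 case (Suc n)
 have d: "CK n (deriv t) S" by (intro CK_holomorphic holomorphic_deriv assms)
 show ?case
 proof (rule CK_Suc_cong[OF assms(1), where p = "%w. dz f (t w) * deriv t w" and q = "%w. dzb f (t w) * cnj (deriv t w)"])
  fix w assume w: "w : S"
  have f: "f differentiable (at (t w))" using Suc.prems w assms(3) by auto
  show "((%x. f (t x)) has_derivative (%h. dz f (t w) * deriv t w * h + dzb f (t w) * cnj (deriv t w) * cnj h)) (at w)"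
   using has_wirtinger_derivative[OF wirtinger_compose(3)[OF assms(2,1) w f]]
    wirtinger_compose(1,2)[OF assms(2,1) w f] by simp
 next
  show "CK n (%w. dz f (t w) * deriv t w) S" using Suc by (intro CK_mult assms d) auto
  show "CK n (%w. dzb f (t w) * cnj (deriv t w)) S" using Suc by (intro CK_mult CK_cnj assms d) auto
 qed
qed

section \<open>Real-valued functions\<close>

lemma has_real_wirtinger_derivative: assumes "(f :: complex => real) differentiable (at w)"
 shows "(f has_derivative (%h. pdx f w * Re h + pdy f w * Im h)) (at w)"
proof -
 let ?L = "frechet_derivative f (at w)"
 have d: "(f has_derivative ?L) (at w)" using assms frechet_derivative_works by blast
 have "?L h = pdx f w * Re h + pdy f w * Im h" for h using real_linear_complex[of ?L h] d has_derivative_linear by (force simp: pdx_def pdy_def)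
 then have "?L = (%h. pdx f w * Re h + pdy f w * Im h)" by auto
 then show ?thesis using d by simp
qed

lemma pd_unique: assumes "((f :: complex => real) has_derivative (%h. p * Re h + q * Im h)) (at w)"
 shows "f differentiable (at w)" "pdx f w = p" "pdy f w = q"
proof -
 show "f differentiable (at w)" using assms differentiable_def by blast
 have "frechet_derivative f (at w) = (%h. p * Re h + q * Im h)" using frechet_derivative_at[OF assms] by simp
 then show "pdx f w = p" "pdy f w = q" by (simp_all add: pdx_def pdy_def)
qed

lemma pd_cong: assumes "open S" "w : S" "!!x. x : S ==> f x = g x"
 shows "pdx f w = pdx g w" "pdy f w = pdy g w" "f differentiable (at w) \<longleftrightarrow> g differentiable (at w)"
proof -
 have *: "(f has_derivative L) (at w) \<longleftrightarrow> (g has_derivative L) (at w)" for L using has_derivative_transform_within_open[OF _ assms(1,2)] assms(3) by metis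
 show "pdx f w = pdx g w" "pdy f w = pdy g w" "f differentiable (at w) \<longleftrightarrow> g differentiable (at w)"
  unfolding pdx_def pdy_def frechet_derivative_def differentiable_def * by auto
qed

lemma Ck_on_cong: assumes "open S" "!!x. x : S ==> f x = g x" shows "Ck_on n f S \<longleftrightarrow> Ck_on n g S" using assms
proof (induction n arbitrary: f g)
 case 0
 then show ?case by (auto cong: continuous_on_cong)
next
 case (Suc n)
 have "Ck_on n (pdx f) S \<longleftrightarrow> Ck_on n (pdx g) S" by (rule Suc.IH[OF Suc.prems(1)]) (rule pd_cong(1)[OF Suc.prems(1) _ Suc.prems(2)])
 moreover have "Ck_on n (pdy f) S \<longleftrightarrow> Ck_on n (pdy g) S" by (rule Suc.IH[OF Suc.prems(1)]) (rule pd_cong(2)[OF Suc.prems(1) _ Suc.prems(2)])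
 ultimately have "Ck_on n (pdx f) S \<longleftrightarrow> Ck_on n (pdx g) S" "Ck_on n (pdy f) S \<longleftrightarrow> Ck_on n (pdy g) S" by auto
 then show ?case using pd_cong[OF Suc.prems(1) _ Suc.prems(2)] by auto
qed

lemma wirtinger_of_real: assumes "(f :: complex => real) differentiable (at w)"
 shows "dz (%x. of_real (f x)) w = (of_real (pdx f w) - \<i> * of_real (pdy f w)) / 2"
  "dzb (%x. of_real (f x)) w = (of_real (pdx f w) + \<i> * of_real (pdy f w)) / 2" "(%x. of_real (f x) :: complex) differentiable (at w)"
proof -
 have "((%x. of_real (f x) :: complex) has_derivative (%h. of_real (pdx f w * Re h + pdy f w * Im h))) (at w)"
  by (rule derivative_eq_intros has_real_wirtinger_derivative assms refl)+
 also have "(%h. of_real (pdx f w * Re h + pdy f w * Im h) :: complex) =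
   (%h. (of_real (pdx f w) - \<i> * of_real (pdy f w)) / 2 * h + (of_real (pdx f w) + \<i> * of_real (pdy f w)) / 2 * cnj h)"
  by (auto simp: fun_eq_iff complex_eq_iff field_simps)
 finally have *: "((%x. of_real (f x) :: complex) has_derivative
   (%h. (of_real (pdx f w) - \<i> * of_real (pdy f w)) / 2 * h + (of_real (pdx f w) + \<i> * of_real (pdy f w)) / 2 * cnj h)) (at w)" .
 from wirtinger_unique[OF this]
 show "dz (%x. of_real (f x)) w = (of_real (pdx f w) - \<i> * of_real (pdy f w)) / 2"
  "dzb (%x. of_real (f x)) w = (of_real (pdx f w) + \<i> * of_real (pdy f w)) / 2" "(%x. of_real (f x) :: complex) differentiable (at w)" by auto
qed

lemma CK_of_real: assumes "open S" "Ck_on n f S" shows "CK n (%x. of_real (f x)) S" using assms(2)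
proof (induction n arbitrary: f)
 case (Suc n)
 have x: "CK n (%x. of_real (pdx f x)) S" "CK n (%x. of_real (pdy f x)) S" using Suc by auto
 show ?case
 proof (rule CK_Suc_cong[OF assms(1), where p = "%w. (of_real (pdx f w) + (- \<i>) * of_real (pdy f w)) * (1/2)" and
   q = "%w. (of_real (pdx f w) + \<i> * of_real (pdy f w)) * (1/2)"])
  fix w assume w: "w : S"
  have f: "f differentiable (at w)" using Suc.prems w by auto
  show "((%x. complex_of_real (f x)) has_derivative (%h. (complex_of_real (pdx f w) + - \<i> * complex_of_real (pdy f w)) * (1 / 2) * h
       + (complex_of_real (pdx f w) + \<i> * complex_of_real (pdy f w)) * (1 / 2) * cnj h)) (at w)"
   using has_wirtinger_derivative[OF wirtinger_of_real(3)[OF f]] wirtinger_of_real(1,2)[OF f] by simp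
 qed (intro CK_mult CK_add assms x CK_const)+
qed (auto intro: continuous_intros)

lemma pd_Re: assumes "f differentiable (at w)" shows "pdx (%x. Re (f x)) w = Re (dz f w + dzb f w)" "pdy (%x. Re (f x)) w = Re (\<i> * (dz f w - dzb f w))"
  "(%x. Re (f x)) differentiable (at w)"
proof -
 have "((%x. Re (f x)) has_derivative (%h. Re (dz f w + dzb f w) * Re h + Re (\<i> * (dz f w - dzb f w)) * Im h)) (at w)"
  by (rule derivative_eq_intros has_wirtinger_derivative assms refl)+ (auto simp: algebra_simps)
 from pd_unique[OF this]
 show "pdx (%x. Re (f x)) w = Re (dz f w + dzb f w)" "pdy (%x. Re (f x)) w = Re (\<i> * (dz f w - dzb f w))"
  "(%x. Re (f x)) differentiable (at w)" by auto
qed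

lemma Ck_on_Re: assumes "open S" "CK n f S" shows "Ck_on n (%x. Re (f x)) S" using assms(2)
proof (induction n arbitrary: f)
 case (Suc n)
 have 1: "Ck_on n (%w. Re (dz f w + dzb f w)) S" using Suc.prems by (intro Suc.IH CK_add assms) auto
 have 2: "Ck_on n (%w. Re (\<i> * (dz f w - dzb f w))) S" using Suc by (intro Suc.IH CK_mult CK_diff assms) auto
 have d: "f differentiable (at w)" if "w : S" for w using Suc.prems that by auto
 have "Ck_on n (pdx (%x. Re (f x))) S" "Ck_on n (pdy (%x. Re (f x))) S"
  using Ck_on_cong[OF assms(1), of "pdx (%x. Re (f x))" "%w. Re (dz f w + dzb f w)" n] 1
   Ck_on_cong[OF assms(1), of "pdy (%x. Re (f x))" "%w. Re (\<i> * (dz f w - dzb f w))" n] 2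
  pd_Re d by blast+
 then show ?case using pd_Re(3) d by auto
qed (auto intro: continuous_intros)

lemma line_derivative: fixes f :: "complex => real" assumes "f differentiable (at (w + of_real t * v))"
 shows "((%t. f (w + of_real t * v)) has_real_derivative
  pdx f (w + of_real t * v) * Re v + pdy f (w + of_real t * v) * Im v) (at t)"
proof -
 have l: "((%t. w + of_real t * v) has_derivative (%h. of_real h * v)) (at t)" by (auto intro!: derivative_eq_intros)
 show ?thesis unfolding has_field_derivative_def by (rule has_derivative_eq_rhs[OF has_derivative_compose[OF l has_real_wirtinger_derivative[OF assms]]])
   (simp add: fun_eq_iff algebra_simps)
qed

text \<open>The mean value theorem, applied once in each direction. Exchanging the two directions leaves the left-hand side unchanged, which is why mixed derivatives commute.\<close>
lemma second_difference: fixes f :: "complex => real"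
 defines "D \<equiv> %(f::complex => real) v x. pdx f x * Re v + pdy f x * Im v"
 assumes h: "h > 0" and f: "!!s t. 0 <= s ==> s <= h ==> 0 <= t ==> t <= h ==>
  f differentiable (at (w + of_real s * a + of_real t * b)) & D f a differentiable (at (w + of_real s * a + of_real t * b))"
 shows "\<exists>s t. 0 < s & s < h & 0 < t & t < h \<and>
  f (w + of_real h * a + of_real h * b) - f (w + of_real h * a) - f (w + of_real h * b) + f w
   = h^2 * D (D f a) b (w + of_real s * a + of_real t * b)"
proof -
 define g where "g s = f ((w + of_real h * b) + of_real s * a) - f (w + of_real s * a)" for s
 have "\<exists>s>0. s < h & g h - g 0 = (h - 0) * (D f a ((w + of_real h * b) + of_real s * a) - D f a (w + of_real s * a))" unfolding g_def
 proof (rule MVT2[OF h])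
  fix s assume "0 <= s" "s <= h"
  then show "((%s. f ((w + of_real h * b) + of_real s * a) - f (w + of_real s * a)) has_real_derivative
    D f a ((w + of_real h * b) + of_real s * a) - D f a (w + of_real s * a)) (at s)"
   unfolding D_def using f[of s h] f[of s 0] h by (intro DERIV_diff line_derivative) (auto simp: algebra_simps)
 qed
 then obtain s where s: "0 < s" "s < h" "g h - g 0 = h * (D f a ((w + of_real h * b) + of_real s * a) - D f a (w + of_real s * a))" by auto
 have "\<exists>t>0. t < h & D f a ((w + of_real s * a) + of_real h * b) - D f a ((w + of_real s * a) + of_real 0 * b) =
   (h - 0) * D (D f a) b ((w + of_real s * a) + of_real t * b)"
 proof (rule MVT2[OF h])
  fix t assume "0 <= t" "t <= h"
  then show "((%t. D f a ((w + of_real s * a) + of_real t * b)) has_real_derivative D (D f a) b ((w + of_real s * a) + of_real t * b)) (at t)"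
   using f[of s t] s unfolding D_def by (intro line_derivative) auto
 qed
 then obtain t where t: "0 < t" "t < h" "D f a ((w + of_real s * a) + of_real h * b) - D f a (w + of_real s * a) =
   h * D (D f a) b ((w + of_real s * a) + of_real t * b)" by auto
 have "g h - g 0 = h * (h * D (D f a) b ((w + of_real s * a) + of_real t * b))" unfolding s(3) t(3)[symmetric] by (simp add: algebra_simps)
 then show ?thesis using s t by (intro exI[of _ s] exI[of _ t]) (simp add: g_def power2_eq_square algebra_simps)
qed

lemma pd_comm: fixes f :: "complex => real" assumes "open S" "Ck_on 2 f S" "w : S" shows "pdx (pdy f) w = pdy (pdx f) w"
proof -
 have ck: "\<forall>w\<in>S. f differentiable (at w)" "\<forall>w\<in>S. pdx f differentiable (at w)" "\<forall>w\<in>S. pdy f differentiable (at w)"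
  "continuous_on S (pdx (pdy f))" "continuous_on S (pdy (pdx f))" using assms(2) by (auto simp: numeral_2_eq_2)
 obtain r where r: "r > 0" "ball w r \<subseteq> S" using assms openE by blast
 define h where "h n = r / 3 / real (Suc n)" for n
 have h: "h n > 0" "h n <= r / 3" for n using r by (auto simp: h_def divide_le_eq mult_le_cancel_left1 simp del: of_nat_Suc)
 have h0: "h \<longlonglongrightarrow> 0" using tendsto_mult[OF tendsto_const[of "r/3"] LIMSEQ_Suc[OF lim_1_over_n]] by (simp add: h_def[abs_def])
 define Q where "Q n = (f (w + of_real (h n) * 1 + of_real (h n) * \<i>) - f (w + of_real (h n) * 1) - f (w + of_real (h n) * \<i>) + f w) / (h n)^2" for n
 \<comment> \<open>both mixed derivatives are limits of the symmetric second difference quotient\<close>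
 have lim: "Q \<longlonglongrightarrow> e w"
  if c: "continuous_on S e" and q: "!!n. \<exists>s t. 0 < s & s < h n & 0 < t & t < h n & Q n = e (w + of_real s + of_real t * \<i>)" for e
 proof -
  obtain s t where st: "!!n. 0 < s n & s n < h n & 0 < t n & t n < h n & Q n = e (w + of_real (s n) + of_real (t n) * \<i>)" using q by metis
  have "s \<longlonglongrightarrow> 0" "t \<longlonglongrightarrow> 0"
   by (rule tendsto_sandwich[OF _ _ tendsto_const h0]; use st in \<open>auto intro!: always_eventually less_imp_le\<close>)+
  then have "(%n. w + of_real (s n) + of_real (t n) * \<i>) \<longlonglongrightarrow> w + of_real 0 + of_real 0 * \<i>" by (intro tendsto_intros)
  then have "(%n. e (w + of_real (s n) + of_real (t n) * \<i>)) \<longlonglongrightarrow> e w"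
   using c assms(1,3) by (intro isCont_tendsto_compose[of w e]) (auto simp: continuous_on_eq_continuous_at)
  moreover have "Q = (%n. e (w + of_real (s n) + of_real (t n) * \<i>))" using st by blast
  ultimately show ?thesis by simp
 qed
 have inS: "w + of_real s + of_real t * \<i> \<in> S" if "0 <= s" "s <= h n" "0 <= t" "t <= h n" for s t n
 proof -
  have "cmod (of_real s + of_real t * \<i>) <= \<bar>s\<bar> + \<bar>t\<bar>" by (rule norm_triangle_le) (simp add: norm_mult)
  then have "dist (w + of_real s + of_real t * \<i>) w < r" using that h(2)[of n] r(1) by (simp add: dist_norm add.assoc)
  then show ?thesis using r by (auto simp: dist_commute)
 qed
 have D1: "(%x. pdx f x * Re 1 + pdy f x * Im 1) = pdx f" "(%x. pdx f x * Re \<i> + pdy f x * Im \<i>) = pdy f" by auto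
 have "Q \<longlonglongrightarrow> pdy (pdx f) w"
 proof (rule lim[OF ck(5)])
  fix n
  obtain s t where "0 < s" "s < h n" "0 < t" "t < h n" "f (w + of_real (h n) * 1 + of_real (h n) * \<i>) - f (w + of_real (h n) * 1) - f (w + of_real (h n) * \<i>) + f w
     = (h n)^2 * pdy (pdx f) (w + of_real s * 1 + of_real t * \<i>)" using second_difference[OF h(1)[of n], of f w 1 \<i>, unfolded D1] inS ck by auto
  then show "\<exists>s t. 0 < s & s < h n & 0 < t & t < h n & Q n = pdy (pdx f) (w + of_real s + of_real t * \<i>)"
   using h(1)[of n] unfolding Q_def by (intro exI[of _ s] exI[of _ t]) simp
 qed
 moreover have "Q \<longlonglongrightarrow> pdx (pdy f) w"
 proof (rule lim[OF ck(4)])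
  fix n
  obtain s t where "0 < s" "s < h n" "0 < t" "t < h n" "f (w + of_real (h n) * \<i> + of_real (h n) * 1) - f (w + of_real (h n) * \<i>) - f (w + of_real (h n) * 1) + f w
     = (h n)^2 * pdx (pdy f) (w + of_real s * \<i> + of_real t * 1)" using second_difference[OF h(1)[of n], of f w \<i> 1, unfolded D1] inS ck by (auto simp: add_ac)
  then show "\<exists>s t. 0 < s & s < h n & 0 < t & t < h n & Q n = pdx (pdy f) (w + of_real s + of_real t * \<i>)"
   using h(1)[of n] unfolding Q_def by (intro exI[of _ t] exI[of _ s]) (simp add: algebra_simps)
 qed
 ultimately show ?thesis using LIMSEQ_unique by blast
qed

lemma Im_dz_dzb: assumes "open S" "CK 2 f S" "w : S" shows "Im (dz (dzb f) w) = Im (dzb (dz f) w)"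
proof -
 have d: "f differentiable (at x)" "dz f differentiable (at x)" "dzb f differentiable (at x)" if "x : S" for x using assms(2) that by (auto simp: numeral_2_eq_2)
 have d2: "(%x. dz f x + dzb f x) differentiable at x" "(%x. dz f x - dzb f x) differentiable at x"
  "(%x. \<i> * (dz f x - dzb f x)) differentiable at x" if "x : S" for x using d(2,3)[OF that] by (auto intro!: derivative_intros)
 let ?g = "%x. Re (f x)"
 have "Ck_on 2 ?g S" by (rule Ck_on_Re[OF assms(1,2)])
 then have "pdx (pdy ?g) w = pdy (pdx ?g) w" using pd_comm assms by blast
 moreover have "pdx (pdy ?g) w = pdx (%x. Re (\<i> * (dz f x - dzb f x))) w" by (rule pd_cong[OF assms(1,3)]) (simp add: pd_Re d)
 moreover have "pdy (pdx ?g) w = pdy (%x. Re (dz f x + dzb f x)) w" by (rule pd_cong[OF assms(1,3)]) (simp add: pd_Re d)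
 ultimately have "Re (dz (%x. \<i> * (dz f x - dzb f x)) w + dzb (%x. \<i> * (dz f x - dzb f x)) w) =
   Re (\<i> * (dz (%x. dz f x + dzb f x) w - dzb (%x. dz f x + dzb f x) w))" unfolding pd_Re(1)[OF d2(3)[OF assms(3)]] pd_Re(2)[OF d2(1)[OF assms(3)]] by simp
 then show ?thesis using assms(3) d d2 wirtinger_mult(1,2)[of "%_. \<i>" w "%x. dz f x - dzb f x"]
   wirtinger_add[of "dz f" w "dzb f"] wirtinger_diff[of "dz f" w "dzb f"]
   wirtinger_holomorphic(1,2)[of "%_. c" UNIV w for c] by simp
qed

lemma dz_dzb_comm: assumes "open S" "CK 2 f S" "w : S" shows "dz (dzb f) w = dzb (dz f) w"
proof -
 have d: "f differentiable (at x)" "dz f differentiable (at x)" "dzb f differentiable (at x)" if "x : S" for x using assms(2) that by (auto simp: numeral_2_eq_2)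
 have c: "CK 2 (%x. \<i> * f x) S" by (intro CK_mult assms CK_const)
 have e: "dzb (%x. \<i> * f x) x = \<i> * dzb f x" "dz (%x. \<i> * f x) x = \<i> * dz f x" if "x : S" for x
  using that d wirtinger_mult(1,2)[of "%_. \<i>" x f] wirtinger_holomorphic(1,2)[of "%_. c" UNIV x for c] by auto
 have "dz (dzb (%x. \<i> * f x)) w = dz (%x. \<i> * dzb f x) w" "dzb (dz (%x. \<i> * f x)) w = dzb (%x. \<i> * dz f x) w"
  by (rule wirtinger_cong[OF assms(1,3)]; simp add: e)+
 then have "Im (\<i> * dz (dzb f) w) = Im (\<i> * dzb (dz f) w)" using Im_dz_dzb[OF assms(1) c assms(3)] d[OF assms(3)] wirtinger_mult(1,2)[of "%_. \<i>" w "dz f"]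
   wirtinger_mult(1,2)[of "%_. \<i>" w "dzb f"] wirtinger_holomorphic(1,2)[of "%_. c" UNIV w for c] by auto
 then show ?thesis using Im_dz_dzb[OF assms] by (simp add: complex_eq_iff)
qed

section \<open>Change of variables in the plane\<close>

text \<open>The area formula is available for \<open>real^2\<close>; this isometry transports it to the complex plane.\<close>
definition c2v :: "complex => real^2" where "c2v w = (\<chi> i. if i = 1 then Re w else Im w)"
definition v2c :: "real^2 => complex" where "v2c v = Complex (v $ 1) (v $ 2)"

lemma v2c_c2v [simp]: "v2c (c2v w) = w" "c2v (v2c v) = v" by (auto simp: v2c_def c2v_def vec_eq_iff complex_eq_iff exhaust_2) (metis exhaust_2)

lemma linear_c2v: "linear c2v" "linear v2c" by (auto simp: linear_iff v2c_def c2v_def vec_eq_iff complex_eq_iff)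

lemma c2v_measurable [measurable]: "c2v : borel_measurable borel" "v2c : borel_measurable borel"
 using linear_continuous_on[OF linear_linear[THEN iffD2, OF linear_c2v(1)]]
  linear_continuous_on[OF linear_linear[THEN iffD2, OF linear_c2v(2)]] by (auto intro!: borel_measurable_continuous_onI)

lemma distr_c2v: "distr lborel borel c2v = lborel"
proof (rule lborel_eqI[symmetric])
 fix l u :: "real^2"
 assume lu: "!!b. b : Basis ==> l \<bullet> b <= u \<bullet> b"
 have B: "(Basis :: (real^2) set) = {axis 1 1, axis 2 1}" by (auto simp: Basis_vec_def UNIV_2)
 have ne: "axis 1 1 ~= (axis 2 1 :: real^2)" by (simp add: axis_eq_axis)
 have le: "l $ 1 <= u $ 1" "l $ 2 <= u $ 2" using lu[of "axis 1 1"] lu[of "axis 2 1"] B by (auto simp: inner_axis)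
 have "emeasure (distr lborel borel c2v) (box l u) = emeasure lborel (c2v -` box l u)" by (subst emeasure_distr) auto
 also have "c2v -` box l u = box (v2c l) (v2c u)" by (auto simp: mem_box_cart c2v_def v2c_def box_complex_eq exhaust_2 mem_box Basis_complex_def forall_2)
 also have "emeasure lborel (box (v2c l) (v2c u)) = (\<Prod>b\<in>Basis. (v2c u - v2c l) \<bullet> b)"
  using le by (intro emeasure_lborel_box) (auto simp: Basis_complex_def v2c_def)
 also have "... = (\<Prod>b\<in>Basis. (u - l) \<bullet> b)" using ne by (simp add: B Basis_complex_def v2c_def inner_axis complex_eq_iff)
 finally show "emeasure (distr lborel borel c2v) (box l u) = (\<Prod>b\<in>Basis. (u - l) \<bullet> b)" .
qed simp

lemma nn_integral_c2v: assumes [measurable]: "f : borel_measurable borel"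
 shows "(\<integral>\<^sup>+v. f v \<partial>lborel) = (\<integral>\<^sup>+w. f (c2v w) \<partial>lborel)" by (subst distr_c2v[symmetric], subst nn_integral_distr) auto

lemma emeasure_c2v_image: assumes [measurable]: "X : sets borel" shows "c2v ` X : sets borel" "emeasure lborel (c2v ` X) = emeasure lborel X"
proof -
 have e: "c2v ` X = v2c -` X" by (auto simp: image_iff) (metis v2c_c2v(2))
 have "v2c -` X Int space borel : sets borel" by (rule measurable_sets[of v2c borel borel]) auto
 then show s: "c2v ` X : sets borel" unfolding e by simp
 have "emeasure lborel (c2v ` X) = emeasure (distr lborel borel c2v) (c2v ` X)" by (simp add: distr_c2v)
 also have "... = emeasure lborel X" using s by (subst emeasure_distr) (auto simp: inj_vimage_image_eq[OF inj_on_inverseI[of _ v2c]])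
 finally show "emeasure lborel (c2v ` X) = emeasure lborel X" .
qed

lemma borel_holomorphic_image: assumes "open U" "t holomorphic_on U" "inj_on t U" "E : sets borel" "E \<subseteq> U" shows "t ` E : sets borel"
proof -
 obtain g where g: "g holomorphic_on (t ` U)" "!!z. z : U ==> g (t z) = z" using holomorphic_has_inverse[OF assms(2,1,3)] by metis
 have o: "open (t ` U)" using open_mapping_thm3[OF assms(2,1,3)] .
 have "g : borel_measurable (restrict_space borel (t ` U))" by (intro borel_measurable_continuous_on_restrict holomorphic_on_imp_continuous_on g)
 then have "g -` E Int space (restrict_space borel (t ` U)) : sets (restrict_space borel (t ` U))" using assms(4) by (rule measurable_sets)
 moreover have "g -` E Int space (restrict_space borel (t ` U)) = t ` E" using g(2) assms(5) by (force simp: space_restrict_space)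
 ultimately show ?thesis using o by (simp add: sets_restrict_space_iff)
qed

lemma deriv_measurable: assumes "open U" "t holomorphic_on U" shows "(%w. indicator U w *\<^sub>R deriv t w) : borel_measurable borel"
 using assms by (intro borel_measurable_continuous_on_indicator holomorphic_on_imp_continuous_on holomorphic_deriv) auto

text \<open>The Jacobian determinant of multiplication by a is \<open>|a|\<^sup>2\<close>.\<close>
theorem emeasure_holomorphic_image: assumes "open U" "t holomorphic_on U" "inj_on t U" "E : sets borel" "E \<subseteq> U"
 shows "emeasure lborel (t ` E) = (\<integral>\<^sup>+w\<in>E. ennreal (sq (deriv t w)) \<partial>lborel)"
proof -
 define J where "J = (%w. indicator E w * sq (deriv t w))"
 have J: "J = (%w. indicator E w * sq (indicator U w *\<^sub>R deriv t w))"
  by (rule ext) (use assms(5) in \<open>auto simp: J_def indicator_def split: if_splits\<close>)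
 have Jm [measurable]: "J : borel_measurable borel" unfolding J using deriv_measurable[OF assms(1,2)] assms(4) by measurable
 have J0: "J w >= 0" for w by (simp add: J_def)
 define S where "S = c2v ` E"
 define G where "G = c2v \<circ> t \<circ> v2c"
 define G' where "G' v = c2v \<circ> (%h. deriv t (v2c v) * h) \<circ> v2c" for v
 have Sb: "S : sets borel" unfolding S_def by (rule emeasure_c2v_image) fact
 then have Sl: "S : sets lebesgue" by simp
 have lin: "(c2v has_derivative c2v) F" "(v2c has_derivative v2c) F'" for F F' using linear_c2v by (auto intro!: bounded_linear_imp_has_derivative simp: linear_linear)
 have der: "(G has_derivative G' v) (at v within S)" if "v : S" for v
 proof -
  have "(t has_derivative (%h. deriv t (v2c v) * h)) (at (v2c v))" using that assms holomorphic_derivI[OF assms(2,1)] by (force simp: S_def has_field_derivative_def)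
  from has_derivative_compose[OF has_derivative_compose[OF lin(2) this] lin(1)]
  show ?thesis unfolding G_def G'_def comp_def by (rule has_derivative_at_withinI)
 qed
 have inj: "inj_on G S"
 proof (rule inj_onI)
  fix x y assume "x : S" "y : S" "G x = G y"
  then have "v2c (G x) = v2c (G y)" "v2c x : E" "v2c y : E" unfolding S_def by auto
  then have "t (v2c x) = t (v2c y)" "v2c x : E" "v2c y : E" by (simp_all add: G_def)
  then have "v2c x = v2c y" using assms(3,5) by (meson inj_onD subsetD)
  then show "x = y" using v2c_c2v(2) by metis
 qed
 have det: "\<bar>det (matrix (G' v))\<bar> = sq (deriv t (v2c v))" for v
  unfolding cmod_power2 by (simp add: det_2 matrix_def G'_def c2v_def v2c_def axis_def power2_eq_square)
 have GS: "G ` S = c2v ` (t ` E)" by (auto simp: G_def S_def image_image)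
 have tE: "t ` E : sets borel" by (rule borel_holomorphic_image[OF assms])
 have emG: "emeasure lebesgue (G ` S) = emeasure lborel (t ` E)" using emeasure_c2v_image[OF tE] by (simp add: GS)
 have Gb: "G ` S : sets lebesgue" unfolding GS using emeasure_c2v_image(1)[OF tE] by simp
 have key: "G ` S : lmeasurable & measure lebesgue (G ` S) = m \<longleftrightarrow> ((%v. J (v2c v)) has_integral m) UNIV" for m
 proof -
  have "((%v. \<bar>det (matrix (G' v))\<bar>) has_integral m) S \<longleftrightarrow> ((%v. J (v2c v)) has_integral m) UNIV"
   unfolding has_integral_restrict_UNIV[symmetric, of "%v. \<bar>det (matrix (G' v))\<bar>"]
  proof (intro has_integral_cong)
   fix v :: "real^2"
   have "v : S \<longleftrightarrow> v2c v : E" unfolding S_def image_iff using v2c_c2v by metis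
   then show "(if v : S then \<bar>det (matrix (G' v))\<bar> else 0) = J (v2c v)" by (simp add: det J_def)
  qed
  then show ?thesis using has_measure_differentiable_image[OF Sl der inj] by blast
 qed
 have nnJ: "(\<integral>\<^sup>+w\<in>E. ennreal (sq (deriv t w)) \<partial>lborel) = (\<integral>\<^sup>+v. ennreal (J (v2c v)) \<partial>lborel)"
 proof -
  have "(\<integral>\<^sup>+v. ennreal (J (v2c v)) \<partial>lborel) = (\<integral>\<^sup>+w. ennreal (J (v2c (c2v w))) \<partial>lborel)" by (rule nn_integral_c2v) measurable
  then show ?thesis by (auto intro!: nn_integral_cong simp: J_def indicator_def)
 qed
 show ?thesis
 proof (cases "(\<integral>\<^sup>+v. ennreal (J (v2c v)) \<partial>lborel) < \<infinity>")
  case True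
  then obtain m where m: "(\<integral>\<^sup>+v. ennreal (J (v2c v)) \<partial>lborel) = ennreal m" "m >= 0"
   by (cases "\<integral>\<^sup>+v. ennreal (J (v2c v)) \<partial>lborel" rule: ennreal_cases) auto
  have "((%v. J (v2c v)) has_integral m) UNIV" by (rule nn_integral_has_integral) (use m J0 in auto)
  then have "G ` S : lmeasurable" "measure lebesgue (G ` S) = m" using key by auto
  then have "emeasure lebesgue (G ` S) = ennreal m" by (simp add: emeasure_eq_measure2)
  then show ?thesis using emG m nnJ by simp
 next
  case False
  have "emeasure lborel (t ` E) = \<infinity>"
  proof (rule ccontr)
   assume "emeasure lborel (t ` E) ~= \<infinity>"
   then have "G ` S : lmeasurable" using emG Gb by (simp add: fmeasurable_def top.not_eq_extremum)
   then have "((%v. J (v2c v)) has_integral (measure lebesgue (G ` S))) UNIV" using key by blast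
   from nn_integral_has_integral_lborel[OF _ _ this] J0 False show False by auto
  qed
  then show ?thesis using False nnJ by (simp add: less_top[symmetric])
 qed
qed

theorem nn_integral_holomorphic_image: assumes "open U" "t holomorphic_on U" "inj_on t U" "E : sets borel" "E \<subseteq> U"
  and [measurable]: "g : borel_measurable borel"
 shows "(\<integral>\<^sup>+y\<in>t ` E. g y \<partial>lborel) = (\<integral>\<^sup>+w\<in>E. g (t w) * ennreal (sq (deriv t w)) \<partial>lborel)"
proof -
 have [measurable]: "E : sets borel" by fact
 define J where "J = (%w. indicator E w * ennreal (sq (indicator U w *\<^sub>R deriv t w)))"
 have [measurable]: "J : borel_measurable borel" unfolding J_def using deriv_measurable[OF assms(1,2)] by measurable
 define T where "T = (%w. indicator E w *\<^sub>R (indicator U w *\<^sub>R t w))"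
 have [measurable]: "T : borel_measurable borel" unfolding T_def using assms(1,2) by (intro borel_measurable_scaleR borel_measurable_continuous_on_indicator
   holomorphic_on_imp_continuous_on) auto
 have TE: "T w = t w" if "w : E" for w using that assms(5) by (auto simp: T_def)
 have JE: "J w = ennreal (sq (deriv t w)) * indicator E w" for w using assms(5) by (auto simp: J_def indicator_def)
 have tE [measurable]: "t ` E : sets borel" by (rule borel_holomorphic_image[OF assms(1-5)])
 have "distr (density lborel J) borel T = density lborel (indicator (t ` E))"
 proof (rule measure_eqI)
  fix X assume "X : sets (distr (density lborel J) borel T)"
  then have [measurable]: "X : sets borel" by simp
  have [measurable]: "T -` X : sets borel" using measurable_sets[of T borel borel X] by simp
  have "emeasure (distr (density lborel J) borel T) X = (\<integral>\<^sup>+w. J w * indicator (T -` X) w \<partial>lborel)"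
   by (subst emeasure_distr) (auto simp: emeasure_density)
  also have "... = (\<integral>\<^sup>+w\<in>E Int T -` X. ennreal (sq (deriv t w)) \<partial>lborel)"
   by (intro nn_integral_cong) (auto simp: JE indicator_def)
  also have "... = emeasure lborel (t ` (E Int T -` X))" by (rule emeasure_holomorphic_image[symmetric, OF assms(1-3)]) (use assms(5) in auto)
  also have "t ` (E Int T -` X) = t ` E Int X" using TE by force
  also have "emeasure lborel (t ` E Int X) = emeasure (density lborel (indicator (t ` E))) X" by (simp add: emeasure_density flip: indicator_inter_arith)
  finally show "emeasure (distr (density lborel J) borel T) X = emeasure (density lborel (indicator (t ` E))) X" .
 qed simp
 note e = this
 have "(\<integral>\<^sup>+y\<in>t ` E. g y \<partial>lborel) = (\<integral>\<^sup>+y. g y \<partial>density lborel (indicator (t ` E)))"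
  by (simp add: nn_integral_density mult.commute)
 also have "... = (\<integral>\<^sup>+w. J w * g (T w) \<partial>lborel)" by (simp add: e[symmetric] nn_integral_distr nn_integral_density)
 also have "... = (\<integral>\<^sup>+w\<in>E. g (t w) * ennreal (sq (deriv t w)) \<partial>lborel)"
  by (intro nn_integral_cong) (auto simp: JE TE indicator_def mult.commute)
 finally show ?thesis .
qed

lemma lborel_distr_rotation: assumes "cmod u = 1" shows "distr lborel borel (%w. u * w) = (lborel :: complex measure)"
proof (rule measure_eqI)
 fix X assume "X : sets (distr lborel borel (%w. u * w))"
 then have X: "X : sets borel" by simp
 have u: "u ~= 0" using assms by auto
 have "emeasure lborel ((%w. inverse u * w) ` X) = (\<integral>\<^sup>+w\<in>X. ennreal (sq (deriv (%w. inverse u * w) w)) \<partial>lborel)"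
  by (rule emeasure_holomorphic_image[of UNIV]) (use X u in \<open>auto intro!: inj_onI holomorphic_intros\<close>)
 also have "... = emeasure lborel X" using assms X by (simp add: norm_inverse)
 also have "(%w. inverse u * w) ` X = (%w. u * w) -` X" using u by (auto simp: image_iff field_simps intro: bexI[of _ "u * x" for x])
 finally have "emeasure lborel ((%w. u * w) -` X) = emeasure lborel X" .
 then show "emeasure (distr lborel borel (%w. u * w)) X = emeasure lborel X" using X by (subst emeasure_distr) auto
qed simp

lemma integral_rotation: fixes f :: "complex => complex" assumes "cmod u = 1" "f : borel_measurable borel"
 shows "(LINT w|lborel. f (u * w)) = (LINT w|lborel. f w)"
proof -
 have "(LINT w|lborel. f w) = (LINT w|distr lborel borel (%w. u * w). f w)" by (simp add: lborel_distr_rotation[OF assms(1)])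
 also have "... = (LINT w|lborel. f (u * w))" using assms(2) by (intro integral_distr) auto
 finally show ?thesis by simp
qed

lemma integral_translation: fixes f :: "complex => complex" assumes "f : borel_measurable borel" shows "(LINT w|lborel. f (c + w)) = (LINT w|lborel. f w)"
proof -
 have "(LINT w|lborel. f w) = (LINT w|distr lborel borel (%w. c + w). f w)" using lborel_distr_plus[of c] by simp
 also have "... = (LINT w|lborel. f (c + w))" using assms by (intro integral_distr) auto
 finally show ?thesis by simp
qed

lemma nn_integral_translation: fixes f :: "complex => ennreal" assumes "f : borel_measurable borel"
 shows "(\<integral>\<^sup>+w. f (c + w) \<partial>lborel) = (\<integral>\<^sup>+w. f w \<partial>lborel)"
proof -
 have "(\<integral>\<^sup>+w. f w \<partial>lborel) = (\<integral>\<^sup>+w. f w \<partial>distr lborel borel (%w. c + w))" using lborel_distr_plus[of c] by simp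
 also have "... = (\<integral>\<^sup>+w. f (c + w) \<partial>lborel)" using assms by (intro nn_integral_distr) auto
 finally show ?thesis by simp
qed

text \<open>Both sides integrate g against a measure on the line, and these measures agree on all half-lines by the area of discs.\<close>
lemma nn_integral_radial_disc: assumes "s > 0" and [measurable]: "g : borel_measurable borel"
 shows "(\<integral>\<^sup>+w\<in>ball (0::complex) s. g (sq w) \<partial>lborel) = (\<integral>\<^sup>+t\<in>{0..s^2}. ennreal pi * g t \<partial>lborel)"
proof -
 define M where "M = distr (density lborel (indicator (ball (0::complex) s))) borel (%w. sq w)"
 have [measurable, simp]: "(indicator (ball (0::complex) s) :: complex => ennreal) : borel_measurable borel" by (rule borel_measurable_indicator) simp
 define N where "N = density lborel (%t. ennreal pi * indicator {0<..<s^2} t)"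
 have tail: "emeasure M {x<..} = ennreal (pi * (s^2 - max 0 (min x (s^2))))" for x
 proof -
  have m: "{w::complex. x < sq w} : sets borel" by measurable
  have "emeasure M {x<..} = emeasure (density lborel (indicator (ball (0::complex) s))) {w. x < sq w}"
   unfolding M_def by (subst emeasure_distr) (auto simp: vimage_def)
  also have "... = (\<integral>\<^sup>+w. indicator (ball (0::complex) s) w * indicator {w. x < sq w} w \<partial>lborel)"
  proof (rule emeasure_density)
   show "indicator (ball (0::complex) s) : borel_measurable lborel" by (rule borel_measurable_indicator) simp
   show "{w::complex. x < sq w} : sets lborel" unfolding sets_lborel by (rule m)
  qed
  also have "... = emeasure lborel (ball (0::complex) s Int {w. x < sq w})" using m by (simp flip: indicator_inter_arith)
  also have "... = ennreal (pi * (s^2 - max 0 (min x (s^2))))"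
  proof (cases "x < 0")
   case True
   then have "ball (0::complex) s Int {w. x < sq w} = ball 0 s" by (auto intro: less_le_trans)
   then show ?thesis using assms(1) True by (simp add: emeasure_ball unit_ball_vol_2 min_def max_def) (smt (verit) zero_le_power2)
  next
   case x: False
   have "ball (0::complex) s Int {w. x < sq w} = ball 0 s - cball 0 (sqrt x)"
   proof -
    have eq: "x < sq w \<longleftrightarrow> sqrt x < cmod w" for w :: complex using real_sqrt_less_iff[of x "sq w"] by simp
    have "ball (0::complex) s Int {w. x < sq w} = ball 0 s Int {w. sqrt x < cmod w}" unfolding eq by (rule refl)
    also have "... = ball 0 s - cball 0 (sqrt x)" by (auto simp: not_le)
    finally show ?thesis .
   qed
   also have "emeasure lborel ... = ennreal (pi * (s^2 - max 0 (min x (s^2))))"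
   proof (cases "x < s^2")
    case True
    then have "sqrt x < s" using assms(1) x by (simp add: real_less_lsqrt)
    then have "emeasure lborel (ball 0 s - cball (0::complex) (sqrt x)) = emeasure lborel (ball (0::complex) s) - emeasure lborel (cball (0::complex) (sqrt x))"
     by (intro emeasure_Diff) (use emeasure_lborel_cball_finite[of "0::complex" "sqrt x"] in auto)
    also have "... = ennreal (pi * s^2) - ennreal (pi * x)" using assms(1) x by (simp add: emeasure_ball emeasure_cball unit_ball_vol_2)
    also have "... = ennreal (pi * s^2 - pi * x)" using x by (simp add: ennreal_minus)
    finally show ?thesis using True x by (simp add: right_diff_distrib)
   next
    case False
    then have "s <= sqrt x" using assms(1) by (simp add: real_le_rsqrt)
    then have em: "ball 0 s - cball (0::complex) (sqrt x) = {}" by auto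
    show ?thesis unfolding em using False x by simp
   qed
   finally show ?thesis .
  qed
  finally show ?thesis .
 qed
 have tailN: "emeasure N {x<..} = ennreal (pi * (s^2 - max 0 (min x (s^2))))" for x
 proof -
  have "emeasure N {x<..} = (\<integral>\<^sup>+t. ennreal pi * indicator ({0<..<s^2} Int {x<..}) t \<partial>lborel)"
   unfolding N_def by (subst emeasure_density) (auto intro!: nn_integral_cong simp: indicator_def)
  also have "... = ennreal pi * emeasure lborel ({0<..<s^2} Int {x<..})" by (subst nn_integral_cmult_indicator) auto
  also have "{0<..<s^2} Int {x<..} = {max 0 (min x (s^2))<..<s^2}" by (auto simp: max_def min_def)
  also have "emeasure lborel ... = ennreal (s^2 - max 0 (min x (s^2)))" by (subst emeasure_lborel_Ioo) auto
  finally show ?thesis by (simp add: ennreal_mult)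
 qed
 have MN: "M = N" by (rule measure_eqI_lessThan) (auto simp: tail tailN, auto simp: M_def N_def)
 have "(\<integral>\<^sup>+w\<in>ball (0::complex) s. g (sq w) \<partial>lborel) = (\<integral>\<^sup>+t. g t \<partial>M)"
  unfolding M_def by (subst nn_integral_distr) (auto simp: nn_integral_density mult.commute)
 also have "... = (\<integral>\<^sup>+t. ennreal pi * indicator {0<..<s^2} t * g t \<partial>lborel)" unfolding MN N_def by (subst nn_integral_density) auto
 also have "... = (\<integral>\<^sup>+t\<in>{0..s^2}. ennreal pi * g t \<partial>lborel)" using AE_lborel_singleton[of "0::real"] AE_lborel_singleton[of "s^2"]
  by (intro nn_integral_cong_AE) (auto simp: indicator_def)
 finally show ?thesis .
qed

lemma nn_integral_gaussian_disc: assumes "s > 0" "k > 0"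
 shows "(\<integral>\<^sup>+w\<in>ball (0::complex) s. ennreal (exp (- k * sq w)) \<partial>lborel) = ennreal (pi / k * (1 - exp (- k * s^2)))"
proof -
 have "(\<integral>\<^sup>+w\<in>ball (0::complex) s. ennreal (exp (- k * sq w)) \<partial>lborel) =
   (\<integral>\<^sup>+t\<in>{0..s^2}. ennreal pi * ennreal (exp (- k * t)) \<partial>lborel)" by (rule nn_integral_radial_disc[OF assms(1)]) measurable
 also have "... = (\<integral>\<^sup>+t. ennreal (pi * exp (- k * t)) * indicator {0..s^2} t \<partial>lborel)" by (simp add: ennreal_mult)
 also have "... = ennreal ((- pi / k * exp (- k * s^2)) - (- pi / k * exp (- k * 0)))"
  by (rule nn_integral_FTC_Icc) (use assms in \<open>auto intro!: derivative_eq_intros\<close>)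
 also have "... = ennreal (pi / k * (1 - exp (- k * s^2)))" by (simp add: algebra_simps)
 finally show ?thesis .
qed

section \<open>Stokes\<close>

lemma integrable_compact_support: fixes f :: "complex => complex" assumes "continuous_on UNIV f" "compact K" "!!w. w ~: K ==> f w = 0"
 shows "integrable lborel f"
proof -
 have "integrable lborel (%x. indicator K x *\<^sub>R f x)" using assms by (intro borel_integrable_compact) (auto intro: continuous_on_subset)
 moreover have "(%x. indicator K x *\<^sub>R f x) = f" using assms(3) by (auto simp: indicator_def)
 ultimately show ?thesis by simp
qed

text \<open>The integral of f(w + e) - f(w) vanishes by translation invariance. Writing the difference as the integral of the derivative along the segment and exchanging integrals gives the claim.\<close>
lemma integral_directional_derivative_zero: assumes f: "CK 1 f UNIV" and K: "compact K" "!!w. w ~: K ==> f w = 0"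
 shows "(LINT w|lborel. dz f w * e + dzb f w * cnj e) = 0"
proof -
 define D where "D = (%w. dz f w * e + dzb f w * cnj e)"
 have der: "(f has_derivative (%h. dz f w * h + dzb f w * cnj h)) (at w)" for w using CK_D[of 0 f UNIV w] f by simp
 have cont: "continuous_on UNIV D" "continuous_on UNIV f" using f CK_continuous[OF f] unfolding D_def by (auto intro!: continuous_intros)
 note [measurable] = cont[THEN borel_measurable_continuous_onI]
 have D0: "D w = 0" if "w ~: K" for w
 proof -
  have "open (- K)" using compact_imp_closed[OF K(1)] by auto
  then show ?thesis unfolding D_def using wirtinger_cong(1,2)[of "- K" w f "%_. 0"] K(2) that wirtinger_holomorphic(1,2)[of "%_. 0" UNIV w] by auto
 qed
 have Di: "integrable lborel D" and fi: "integrable lborel f" by (rule integrable_compact_support[OF _ K(1)]; use cont D0 K(2) in auto)+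
 have shift: "integrable lborel (%w. g (c + w))" "(LINT w|lborel. g (c + w)) = (LINT w|lborel. g w)"
  if "integrable lborel g" for g :: "complex => complex" and c
 proof -
  have [measurable]: "g : borel_measurable borel" using that by auto
  have "integrable (distr lborel borel ((+) c)) g" unfolding lborel_distr_plus by (rule that)
  then show "integrable lborel (%w. g (c + w))" by (subst (asm) integrable_distr_eq) auto
  show "(LINT w|lborel. g (c + w)) = (LINT w|lborel. g w)" by (rule integral_translation) measurable
 qed
 define F where "F = (%(w, t). indicator {0..1::real} t *\<^sub>R D (of_real t * e + w))"
 have [measurable]: "F : borel_measurable (lborel \<Otimes>\<^sub>M lborel)" unfolding F_def by measurable
 have i01: "integrable lborel (%t. indicator {0..1::real} t * c)" for c :: real by (intro integrable_mult_left integrable_real_indicator) auto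
 have F1: "integrable lborel (%w. F (w, t))" for t unfolding F_def using shift(1)[OF Di] by simp
 have "integrable (lborel \<Otimes>\<^sub>M lborel) (%(t, w). F (w, t))"
 proof (rule lborel_pair.Fubini_integrable)
  have n: "(LINT w|lborel. norm (F (w, t))) = indicator {0..1} t * (LINT w|lborel. norm (D w))" for t
  proof -
   have "(LINT w|lborel. norm (F (w, t))) = indicator {0..1} t * (LINT w|lborel. norm (D (of_real t * e + w)))" unfolding F_def by (simp add: indicator_def)
   also have "(LINT w|lborel. norm (D (of_real t * e + w))) = (LINT w|lborel. norm (D w))"
    using integral_translation[of "%w. complex_of_real (norm (D w))" "of_real t * e"] by simp
   finally show ?thesis .
  qed
  show "integrable lborel (%t. LINT w|lborel. norm (case (t, w) of (t, w) => F (w, t)))" unfolding prod.case n by (rule i01)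
 qed (use F1 in \<open>simp_all add: F_def\<close>)
 then have swap: "(LINT t|lborel. LINT w|lborel. F (w, t)) = (LINT w|lborel. LINT t|lborel. F (w, t))" using lborel_pair.Fubini_integral[of "%t w. F (w, t)"] by simp
 have "(LINT w|lborel. F (w, t)) = indicator {0..1} t *\<^sub>R (LINT w|lborel. D w)" for t unfolding F_def using shift(2)[OF Di] by simp
 then have l: "(LINT t|lborel. LINT w|lborel. F (w, t)) = (LINT w|lborel. D w)" using i01[of 1] by simp
 have r: "(LINT t|lborel. F (w, t)) = f (e + w) - f w" for w
 proof -
  have "(LINT t|lborel. indicator {0..1} t *\<^sub>R D (of_real t * e + w)) = f (of_real 1 * e + w) - f (of_real 0 * e + w)"
  proof (rule integral_FTC_Icc)
   fix t :: real
   have l: "((%t. of_real t * e + w) has_derivative (%t. of_real t * e)) (at t)" by (auto intro!: derivative_eq_intros)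
   have "((%t. f (of_real t * e + w)) has_vector_derivative D (of_real t * e + w)) (at t)" unfolding has_vector_derivative_def
    by (rule has_derivative_eq_rhs[OF has_derivative_compose[OF l der]]) (simp add: D_def fun_eq_iff scaleR_conv_of_real algebra_simps)
   then show "((%t. f (of_real t * e + w)) has_vector_derivative D (of_real t * e + w)) (at t within {0..1})" by (rule has_vector_derivative_at_within)
  qed (auto intro!: continuous_intros continuous_on_compose2[OF cont(1)])
  then show ?thesis by (simp add: F_def)
 qed
 have "(LINT w|lborel. D w) = (LINT w|lborel. f (e + w) - f w)" using l r swap by simp
 also have "... = 0" using shift[OF fi, of e] fi by simp
 finally show ?thesis by (simp add: D_def)
qed

lemma integral_wirtinger_zero: assumes f: "CK 1 f UNIV" and K: "compact K" "!!w. w ~: K ==> f w = 0"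
 shows "integrable lborel (dz f)" "integrable lborel (dzb f)" "(LINT w|lborel. dz f w) = 0" "(LINT w|lborel. dzb f w) = 0"
proof -
 have zero: "dz f w = 0" "dzb f w = 0" if "w ~: K" for w
 proof -
  have "open (- K)" using compact_imp_closed[OF K(1)] by auto
  then show "dz f w = 0" "dzb f w = 0" using wirtinger_cong(1,2)[of "- K" w f "%_. 0"] K(2) that wirtinger_holomorphic(1,2)[of "%_. 0" UNIV w] by auto
 qed
 show i: "integrable lborel (dz f)" "integrable lborel (dzb f)" using f by (auto intro!: integrable_compact_support[OF _ K(1)] zero)
 have "(LINT w|lborel. dz f w) + (LINT w|lborel. dzb f w) = 0" using integral_directional_derivative_zero[OF f K, of 1] i by simp
 moreover have "(LINT w|lborel. dz f w) * \<i> - (LINT w|lborel. dzb f w) * \<i> = 0" using integral_directional_derivative_zero[OF f K, of \<i>] i by simp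
 then have "(LINT w|lborel. dz f w) - (LINT w|lborel. dzb f w) = 0" by (metis complex_i_not_zero left_diff_distrib mult_eq_0_iff)
 ultimately show "(LINT w|lborel. dz f w) = 0" "(LINT w|lborel. dzb f w) = 0" by (simp_all add: algebra_simps)
qed

section \<open>Mean value\<close>

text \<open>In the power series all terms but the constant one integrate to zero, by invariance of the weight under rotation by \<open>\<pi>/n\<close>.\<close>
lemma mean_value_radial: assumes h: "h holomorphic_on ball c R" and e: "0 < e" "e < R"
  and [measurable]: "g : borel_measurable borel" and g: "!!t. \<bar>g t\<bar> <= B" "!!t. t >= e ==> g t = 0"
 shows "integrable lborel (%z. h (c + z) * of_real (g (cmod z)))" "(LINT z|lborel. h (c + z) * of_real (g (cmod z))) = h c * (LINT z|lborel. of_real (g (cmod z)))"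
proof -
 define a where "a n = (deriv ^^ n) h c / fact n" for n
 have ps: "(%n. a n * z ^ n) sums h (c + z)" if "cmod z < R" for z using holomorphic_power_series[OF h, of "c + z"] that by (simp add: a_def dist_norm)
 have "summable (%n. norm (a n * of_real e ^ n))"
 proof (rule powser_insidea)
  show "summable (%n. a n * of_real ((e + R) / 2) ^ n)" using ps[of "of_real ((e + R) / 2)"] e by (intro sums_summable) (simp add: norm_of_real flip: of_real_add)
  show "norm (complex_of_real e) < norm (complex_of_real ((e + R) / 2))" using e by (simp add: norm_of_real flip: of_real_add)
 qed
 then have sm: "summable (%n. cmod (a n) * e ^ n)" using e by (simp add: norm_mult norm_power)
 have B0: "B >= 0" using g(1)[of 0] by linarith
 define G where "G z = complex_of_real (g (cmod z))" for z :: complex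
 have [measurable]: "G : borel_measurable borel" unfolding G_def by measurable
 have G: "cmod (G z) <= B" "cmod z >= e ==> G z = 0" for z using g by (auto simp: G_def)
 have bnd: "integrable lborel (%z::complex. indicator (cball 0 e) z * (b::real))" for b
  by (intro integrable_mult_left integrable_real_indicator) (use emeasure_lborel_cball_finite in auto)
 have Gi: "integrable lborel (%z. z ^ n * G z)" for n
 proof (rule Bochner_Integration.integrable_bound[OF bnd[of "e ^ n * B"]])
  show "AE z in lborel. norm (z ^ n * G z) <= norm (indicator (cball 0 e) z * (e ^ n * B))"
   using G e B0 by (intro AE_I2) (auto simp: indicator_def norm_mult norm_power not_le intro!: mult_mono power_mono)
 qed measurable
 have rot: "(LINT z|lborel. z ^ n * G z) = 0" if "n > 0" for n
 proof -
  define u where "u = cis (pi / n)"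
  have un: "u ^ n = -1" unfolding u_def Complex.DeMoivre using that by simp
  have "(LINT z|lborel. z ^ n * G z) = (LINT z|lborel. (u * z) ^ n * G (u * z))" by (rule integral_rotation[symmetric]) (auto simp: u_def)
  also have "... = (LINT z|lborel. - (z ^ n * G z))" by (intro Bochner_Integration.integral_cong refl) (simp add: power_mult_distrib un G_def norm_mult, simp add: u_def)
  also have "... = - (LINT z|lborel. z ^ n * G z)" by simp
  finally show ?thesis by simp
 qed
 define P where "P N z = (\<Sum>n<N. a n * z ^ n) * G z" for N z
 have P: "P N z = (\<Sum>n<N. a n * (z ^ n * G z))" for N z by (simp add: P_def sum_distrib_right mult.assoc)
 have intP: "(LINT z|lborel. P N z) = a 0 * (LINT z|lborel. G z)" if "N > 0" for N
 proof -
  have "(LINT z|lborel. P N z) = (\<Sum>n<N. a n * (LINT z|lborel. z ^ n * G z))" unfolding P using Gi by (simp add: Bochner_Integration.integral_sum)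
  also have "... = (\<Sum>n\<in>{0}. a n * (LINT z|lborel. z ^ n * G z))" using that rot by (intro sum.mono_neutral_right) auto
  finally show ?thesis by simp
 qed
 have hc: "h (c + z) * G z = (if cmod z < e then h (c + z) else 0) * G z" for z using G(2)[of z] by auto
 have lims: "(%N. P N z) \<longlonglongrightarrow> h (c + z) * G z" for z
 proof (cases "cmod z < e")
  case True
  then show ?thesis unfolding P_def using ps[of z] e by (intro tendsto_mult_right) (auto simp: sums_def)
 qed (simp add: P_def G(2))
 have dom: "norm (P N z) <= indicator (cball 0 e) z * ((\<Sum>n. cmod (a n) * e ^ n) * B)" for N z
 proof (cases "cmod z <= e")
  case True
  have "norm (\<Sum>n<N. a n * z ^ n) <= (\<Sum>n<N. cmod (a n) * e ^ n)"
   using True by (intro sum_norm_le) (auto simp: norm_mult norm_power intro!: mult_left_mono power_mono)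
  also have "... <= (\<Sum>n. cmod (a n) * e ^ n)" using e by (intro sum_le_suminf sm) auto
  finally show ?thesis using True G(1)[of z] B0 unfolding P_def norm_mult by (auto intro!: mult_mono suminf_nonneg sm simp: e less_imp_le)
 qed (simp add: P_def G(2))
 have Pm: "(%z. P N z) : borel_measurable lborel" for N unfolding P_def by measurable
 have hm: "(%z. h (c + z) * G z) : borel_measurable lborel" by (rule borel_measurable_LIMSEQ_metric[OF Pm lims])
 note dc = bnd[of "(\<Sum>n. cmod (a n) * e ^ n) * B"]
 have "integrable lborel (%z. h (c + z) * G z)" by (rule integrable_dominated_convergence[where s = P, OF hm Pm dc]) (use lims dom in auto)
 then show "integrable lborel (%z. h (c + z) * of_real (g (cmod z)))" by (simp add: G_def)
 have "(%N. LINT z|lborel. P N z) \<longlonglongrightarrow> (LINT z|lborel. h (c + z) * G z)"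
  by (rule integral_dominated_convergence[where s = P, OF hm Pm dc]) (use lims dom in auto)
 moreover have "(%N. LINT z|lborel. P N z) \<longlonglongrightarrow> a 0 * (LINT z|lborel. G z)"
  by (rule tendsto_eventually, rule eventually_mono[OF eventually_gt_at_top[of 0]]) (rule intP)
 ultimately have "(LINT z|lborel. h (c + z) * G z) = a 0 * (LINT z|lborel. G z)" using LIMSEQ_unique by blast
 then show "(LINT z|lborel. h (c + z) * of_real (g (cmod z))) = h c * (LINT z|lborel. of_real (g (cmod z)))" by (simp add: G_def a_def)
qed

section \<open>Weyl's lemma\<close>

lemma DERIV_max_power: fixes t :: real shows "((%t. max 0 t ^ Suc (Suc n)) has_real_derivative (of_nat (Suc (Suc n)) * max 0 t ^ Suc n)) (at t)"
proof -
 consider "t > 0" | "t < 0" | "t = 0" by linarith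
 then show ?thesis
 proof cases
  case 1
  have "((%t. t ^ Suc (Suc n)) has_real_derivative (of_nat (Suc (Suc n)) * t ^ Suc n)) (at t)" using DERIV_pow[of "Suc (Suc n)" t] by simp
  then have "((%t. max 0 t ^ Suc (Suc n)) has_real_derivative (of_nat (Suc (Suc n)) * t ^ Suc n)) (at t)"
   by (rule has_field_derivative_transform_within_open[where S = "{0<..}"]) (use 1 in auto)
  then show ?thesis using 1 by (simp add: max_def)
 next
  case 2
  have "((%t. 0) has_real_derivative 0) (at t)" by simp
  then have "((%t. max 0 t ^ Suc (Suc n)) has_real_derivative 0) (at t)" by (rule has_field_derivative_transform_within_open[where S = "{..<0}"]) (use 2 in auto)
  then show ?thesis using 2 by (simp add: max_def)
 next
  case 3
  have "((%h. max 0 h ^ Suc (Suc n) / h) \<longlongrightarrow> 0) (at (0::real))"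
  proof (rule Lim_null_comparison)
   show "\<forall>\<^sub>F h in at (0::real). norm (max 0 h ^ Suc (Suc n) / h) <= \<bar>h\<bar> ^ Suc n"
   proof (rule always_eventually, rule allI)
    fix h :: real
    show "norm (max 0 h ^ Suc (Suc n) / h) <= \<bar>h\<bar> ^ Suc n"
    proof (cases "h > 0")
     case False
     then show ?thesis by (simp add: max_def del: power_Suc)
    qed (simp add: max_def)
   qed
   have "((%h::real. \<bar>h\<bar> ^ Suc n) \<longlongrightarrow> \<bar>0\<bar> ^ Suc n) (at 0)" by (intro tendsto_intros)
   then show "((%h::real. \<bar>h\<bar> ^ Suc n) \<longlongrightarrow> 0) (at 0)" by simp
  qed
  then show ?thesis using 3 by (simp add: DERIV_def)
 qed
qed

lemma has_derivative_max_power: assumes "(%w. complex_of_real (g w)) differentiable (at w)"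
 shows "((%w. complex_of_real (max 0 (g w)) ^ Suc (Suc n)) has_derivative
   (%h. of_nat (Suc (Suc n)) * of_real (max 0 (g w)) ^ Suc n * dz (%w. of_real (g w)) w * h
    + of_nat (Suc (Suc n)) * of_real (max 0 (g w)) ^ Suc n * dzb (%w. of_real (g w)) w * cnj h)) (at w)"
proof -
 let ?G = "%w. complex_of_real (g w)"
 have 1: "(?G has_derivative (%h. dz ?G w * h + dzb ?G w * cnj h)) (at w)" by (rule has_wirtinger_derivative[OF assms])
 have im: "Im (dz ?G w * h + dzb ?G w * cnj h) = 0" for h
 proof -
  have a: "((%w. Im (?G w)) has_derivative (%h. Im (dz ?G w * h + dzb ?G w * cnj h))) (at w)" by (rule has_derivative_Im[OF 1])
  have "((%w. Im (?G w)) has_derivative (%h. 0)) (at w)" by simp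
  from has_derivative_unique[OF a this] show ?thesis by metis
 qed
 have 2: "(g has_derivative (%h. Re (dz ?G w * h + dzb ?G w * cnj h))) (at w)" using has_derivative_Re[OF 1] by simp
 have 3: "((%t. max 0 t ^ Suc (Suc n)) has_derivative (*) (of_nat (Suc (Suc n)) * max 0 (g w) ^ Suc n)) (at (g w))"
  using DERIV_max_power[of n "g w"] by (simp add: has_field_derivative_def)
 have "((%w. complex_of_real (max 0 (g w) ^ Suc (Suc n))) has_derivative
   (%h. complex_of_real (of_nat (Suc (Suc n)) * max 0 (g w) ^ Suc n * Re (dz ?G w * h + dzb ?G w * cnj h)))) (at w)"
  by (rule has_derivative_of_real[OF has_derivative_compose[OF 2 3]])
 also have "(%h. complex_of_real (of_nat (Suc (Suc n)) * max 0 (g w) ^ Suc n * Re (dz ?G w * h + dzb ?G w * cnj h)))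
   = (%h. of_nat (Suc (Suc n)) * of_real (max 0 (g w)) ^ Suc n * (dz ?G w * h + dzb ?G w * cnj h))" using im by (auto simp: fun_eq_iff complex_eq_iff)
 finally show ?thesis by (simp add: algebra_simps)
qed

lemma CK_max_power: assumes "open S" "CK n (%w. complex_of_real (g w)) S" shows "CK n (%w. complex_of_real (max 0 (g w)) ^ Suc n) S" using assms(2)
proof (induction n)
 case 0
 then have "continuous_on S (%w. Re (complex_of_real (g w)))" by (auto intro: continuous_intros)
 then have "continuous_on S g" by simp
 then show ?case by (auto intro!: continuous_intros)
next
 case (Suc n)
 let ?G = "%w. complex_of_real (g w)"
 note i = Suc.IH[OF CK_Suc[OF Suc.prems]]
 show ?case
 proof (rule CK_Suc_cong[OF assms(1),
   where p = "%w. of_nat (Suc (Suc n)) * of_real (max 0 (g w)) ^ Suc n * dz ?G w" and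
    q = "%w. of_nat (Suc (Suc n)) * of_real (max 0 (g w)) ^ Suc n * dzb ?G w"])
  fix w assume "w : S"
  then show "((%w. complex_of_real (max 0 (g w)) ^ Suc (Suc n)) has_derivative (%h. of_nat (Suc (Suc n)) * of_real (max 0 (g w)) ^ Suc n * dz ?G w * h
    + of_nat (Suc (Suc n)) * of_real (max 0 (g w)) ^ Suc n * dzb ?G w * cnj h)) (at w)" using Suc.prems by (intro has_derivative_max_power) auto
 qed (intro CK_mult assms(1) i CK_const; use Suc.prems in auto)+
qed

text \<open>A radial test function of class \<open>C\<^sup>2\<close> with support in the disc of radius e. No smoother one is needed to differentiate an average once with a quadratic remainder.\<close>
definition bump :: "real => complex => complex" where "bump e w = of_real (max 0 (e^2 - sq w)) ^ 3"

lemma of_real_sq_diff: "complex_of_real (e^2 - sq (w - c)) = of_real (e^2) - (w - c) * cnj (w - c)" by (simp only: of_real_diff complex_norm_square)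

lemma CK_sq_diff: "open S ==> CK n (%w. complex_of_real (e^2 - sq (w - c))) S" unfolding of_real_sq_diff
 by (intro CK_diff CK_mult CK_cnj CK_const) (auto intro!: CK_holomorphic holomorphic_intros)

lemma CK_bump: "CK 2 (%w. bump e (w - c)) UNIV" using CK_max_power[OF open_UNIV CK_sq_diff[OF open_UNIV], of 2 e c]
 by (simp add: bump_def numeral_3_eq_3 numeral_2_eq_2 del: CK.simps)

lemma cnj_dz_bump: "cnj (dz (%w. bump e (w - c)) w) = dzb (%w. bump e (w - c)) w"
 using wirtinger_cnj(2)[of "%w. bump e (w - c)" w] CK_bump[of e c] by (auto simp: bump_def numeral_2_eq_2)

lemma bump_zero: "cmod w >= e ==> e > 0 ==> bump e w = 0" by (auto simp: bump_def max_def power_mono)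

lemma bump_bound: "cmod (bump e w) <= e ^ 6"
proof -
 have "max 0 (e^2 - sq w) ^ 3 <= (e^2) ^ 3" by (rule power_mono) auto
 then show ?thesis by (simp add: bump_def norm_power flip: power_mult)
qed

lemma bump_measurable [measurable]: "bump e : borel_measurable borel" unfolding bump_def by measurable

lemma bump_even: "bump e (- w) = bump e w" "bump e (w - c) = bump e (c - w)" by (simp_all add: bump_def norm_minus_commute)

definition bump_mass :: "real => complex" where "bump_mass e = (LINT w|lborel. bump e w)"

lemma bump_integrable: "e > 0 ==> integrable lborel (%w. bump e (w - c))" by (rule integrable_compact_support[where K = "cball c e"])
  (use CK_continuous[OF CK_bump] in \<open>auto intro!: bump_zero simp: dist_norm norm_minus_commute\<close>)

lemma bump_mass_translate: "(LINT w|lborel. bump e (w - c)) = bump_mass e" using integral_translation[of "bump e" "- c"] by (simp add: bump_mass_def add.commute)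

lemma bump_mass_nonzero: assumes "e > 0" shows "bump_mass e ~= 0"
proof -
 define b where "b w = max 0 (e^2 - sq w) ^ 3" for w
 have b: "bump e w = of_real (b w)" for w by (simp add: bump_def b_def)
 have i: "integrable lborel b" using integrable_bounded_linear[OF bounded_linear_Re bump_integrable[OF assms, of 0]] by (simp add: b)
 have ge: "b w >= indicator (ball 0 (e/2)) w * ((e^2 - (e/2)^2) ^ 3)" for w
 proof (cases "cmod w < e/2")
  case True
  then have "sq w <= (e/2)^2" by (intro power_mono) auto
  moreover have "(e/2)^2 <= e^2" using assms by (intro power_mono) auto
  ultimately have "(e^2 - (e/2)^2) ^ 3 <= b w" unfolding b_def by (intro power_mono) auto
  then show ?thesis using True by simp
 qed (simp add: b_def)
 have "(LINT w::complex|lborel. indicator (ball 0 (e/2)) w * ((e^2 - (e/2)^2) ^ 3)) <= (LINT w|lborel. b w)"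
  by (intro integral_mono i ge integrable_mult_left integrable_real_indicator) (use emeasure_lborel_ball_finite[of "0::complex" "e/2"] in auto)
 moreover have "(LINT w::complex|lborel. indicator (ball 0 (e/2)) w * ((e^2 - (e/2)^2) ^ 3)) > 0"
 proof -
  have "(e^2 - (e/2)^2) ^ 3 > 0" using assms by (simp add: power2_eq_square)
  then show ?thesis using assms by simp
 qed
 ultimately show ?thesis by (simp add: bump_mass_def b)
qed

lemma wirtinger_off_support: assumes K: "closed K" "!!w. w ~: K ==> f w = 0" and w: "w ~: K" shows "dz f w = 0" "dzb f w = 0"
proof -
 have "open (- K)" "w : - K" using K w by auto
 then show "dz f w = 0" "dzb f w = 0" using wirtinger_cong(1,2)[of "- K" w f "%_. 0"] K(2) wirtinger_holomorphic(1,2)[of "%_. 0" UNIV w] by auto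
qed

lemma compact_support_bounded: fixes g :: "complex => complex" assumes "continuous_on UNIV g" "compact K" "!!w. w ~: K ==> g w = 0"
 obtains B where "B > 0" "!!w. cmod (g w) <= B"
proof -
 have "bounded (g ` K)" using assms(1,2) by (intro compact_imp_bounded compact_continuous_image) (auto intro: continuous_on_subset)
 then obtain B where B: "B > 0" "!!w. w : K ==> cmod (g w) <= B" by (metis bounded_pos image_eqI)
 have "cmod (g w) <= B" for w using B assms(3)[of w] by (cases "w : K") auto
 then show ?thesis using that B(1) by blast
qed

lemma compact_support_lipschitz: assumes g: "CK 1 g UNIV" and K: "compact K" "!!w. w ~: K ==> g w = 0"
 obtains L where "L > 0" "!!x y. cmod (g x - g y) <= L * cmod (x - y)"
proof -
 note z = wirtinger_off_support[OF compact_imp_closed[OF K(1)] K(2)]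
 have c: "continuous_on UNIV (dz g)" "continuous_on UNIV (dzb g)" using g by auto
 obtain A B where A: "A > 0" "!!w. cmod (dz g w) <= A" and B: "B > 0" "!!w. cmod (dzb g w) <= B"
  using compact_support_bounded[OF c(1) K(1) z(1)] compact_support_bounded[OF c(2) K(1) z(2)] by metis
 have "cmod (g x - g y) <= (A + B) * cmod (x - y)" for x y
 proof (rule differentiable_bound[OF convex_UNIV, where f' = "%x h. dz g x * h + dzb g x * cnj h"])
  fix x show "(g has_derivative (%h. dz g x * h + dzb g x * cnj h)) (at x)" using CK_D[of 0 g UNIV x] g by simp
  show "onorm (%h. dz g x * h + dzb g x * cnj h) <= A + B"
  proof (rule onorm_le)
   fix h show "cmod (dz g x * h + dzb g x * cnj h) <= (A + B) * cmod h" using A(2)[of x] B(2)[of x] norm_triangle_ineq[of "dz g x * h" "dzb g x * cnj h"]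
     mult_right_mono[of "cmod (dz g x)" A "cmod h"] mult_right_mono[of "cmod (dzb g x)" B "cmod h"] by (simp add: norm_mult distrib_right)
  qed
 qed auto
 then show ?thesis using that[of "A + B"] A(1) B(1) by simp
qed

lemma compact_support_taylor: assumes f: "CK 2 f UNIV" and K: "compact K" "!!w. w ~: K ==> f w = 0"
 obtains C where "C > 0" "!!x h. cmod (f (x + h) - f x - (dz f x * h + dzb f x * cnj h)) <= C * sq h"
proof -
 note z = wirtinger_off_support[OF compact_imp_closed[OF K(1)] K(2)]
 have c: "CK 1 (dz f) UNIV" "CK 1 (dzb f) UNIV" using f by (auto simp: numeral_2_eq_2)
 obtain A B where A: "A > 0" "!!x y. cmod (dz f x - dz f y) <= A * cmod (x - y)" and B: "B > 0" "!!x y. cmod (dzb f x - dzb f y) <= B * cmod (x - y)"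
  using compact_support_lipschitz[OF c(1) K(1) z(1)] compact_support_lipschitz[OF c(2) K(1) z(2)] by metis
 have "cmod (f (x + h) - f x - (dz f x * h + dzb f x * cnj h)) <= (A + B) * sq h" for x h
 proof -
  define g where "g y = f y - (dz f x * y + dzb f x * cnj y)" for y
  have "cmod (g (x + h) - g x) <= ((A + B) * cmod h) * cmod (x + h - x)"
  proof (rule differentiable_bound[OF convex_cball, where f' = "%y v. (dz f y - dz f x) * v + (dzb f y - dzb f x) * cnj v"])
   fix y assume y: "y : cball x (cmod h)"
   have "(f has_derivative (%h. dz f y * h + dzb f y * cnj h)) (at y)" using CK_D[of 1 f UNIV y] f by (simp add: numeral_2_eq_2)
   then have "(g has_derivative (%v. (dz f y * v + dzb f y * cnj v) - (dz f x * v + dzb f x * cnj v))) (at y)"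
    unfolding g_def by (rule has_derivative_diff) (auto intro!: derivative_eq_intros)
   moreover have "(%v. (dz f y * v + dzb f y * cnj v) - (dz f x * v + dzb f x * cnj v)) = (%v. (dz f y - dz f x) * v + (dzb f y - dzb f x) * cnj v)"
    by (simp add: fun_eq_iff left_diff_distrib)
   ultimately show "(g has_derivative (%v. (dz f y - dz f x) * v + (dzb f y - dzb f x) * cnj v)) (at y within cball x (cmod h))"
    by (simp only: has_derivative_at_withinI)
   have d: "cmod (y - x) <= cmod h" using y by (simp add: dist_norm norm_minus_commute)
   show "onorm (%v. (dz f y - dz f x) * v + (dzb f y - dzb f x) * cnj v) <= (A + B) * cmod h"
   proof (rule onorm_le)
    fix v
    have "cmod (dz f y - dz f x) <= A * cmod h" "cmod (dzb f y - dzb f x) <= B * cmod h"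
     using A(2)[of y x] B(2)[of y x] mult_left_mono[OF d, of A] mult_left_mono[OF d, of B] A(1) B(1) by linarith+
    from this[THEN mult_right_mono, of "cmod v"]
    show "cmod ((dz f y - dz f x) * v + (dzb f y - dzb f x) * cnj v) <= (A + B) * cmod h * cmod v"
     using norm_triangle_ineq[of "(dz f y - dz f x) * v" "(dzb f y - dzb f x) * cnj v"] by (simp add: norm_mult distrib_right)
   qed
  qed (auto simp: dist_norm)
  then show ?thesis by (simp add: g_def power2_eq_square algebra_simps)
 qed
 then show ?thesis using that[of "A + B"] A(1) B(1) by simp
qed

lemma cball_enlarge: assumes "open W" "cball c e \<subseteq> W" "e > (0::real)"
 obtains d where "d > 0" "d <= 1" "cball (c::complex) (e + d) \<subseteq> W"
proof -
 obtain r where r: "r > 0" "(\<Union>x\<in>cball c e. ball x r) \<subseteq> W" using compact_subset_open_imp_ball_epsilon_subset[OF compact_cball assms(1,2)] by auto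
 define d where "d = min 1 (r/2)"
 have "cball c (e + d) \<subseteq> (\<Union>x\<in>cball c e. ball x r)"
 proof
  fix y assume y: "y : cball c (e + d)"
  show "y : (\<Union>x\<in>cball c e. ball x r)"
  proof (cases "dist c y <= e")
   case True
   then show ?thesis using r by (intro UN_I[of y]) auto
  next
   case False
   define x where "x = c + of_real (e / dist c y) * (y - c)"
   have n: "norm (y - c) = dist c y" by (simp add: dist_norm norm_minus_commute)
   have cy: "c ~= y" "dist c y > e" using False assms(3) by auto
   have "dist c x = e" using cy assms(3) by (simp add: x_def dist_norm norm_mult norm_divide norm_minus_commute)
   moreover have "x - y = of_real (e / dist c y - 1) * (y - c)" by (simp add: x_def algebra_simps)
   then have "dist x y = \<bar>e / dist c y - 1\<bar> * dist c y" unfolding dist_norm[of x y] by (simp only: norm_mult norm_of_real n)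
   then have d1: "dist x y = \<bar>(e / dist c y - 1) * dist c y\<bar>" by (simp add: abs_mult)
   have d2: "(e / dist c y - 1) * dist c y = e - dist c y" using cy by (simp add: field_simps)
   have "dist x y = \<bar>e - dist c y\<bar>" using d1 by (simp only: d2)
   then have "dist x y < r" using y False r(1) by (auto simp: d_def min_def split: if_splits)
   ultimately show ?thesis by (intro UN_I[of x]) auto
  qed
 qed
 then show ?thesis using r that[of d] by (auto simp: d_def)
qed

text \<open>A distributional solution of \<open>\<partial>u/\<partial>z\<close>-bar = 0, tested against bump functions only.\<close>
locale weakly_holomorphic = fixes W :: "complex set" and u :: "complex => complex" assumes W: "open W" and um [measurable]: "u : borel_measurable borel"
  and ui: "!!K. compact K ==> K \<subseteq> W ==> integrable lborel (%w. indicator K w *\<^sub>R u w)"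
  and weak: "!!c e. e > 0 ==> cball c e \<subseteq> W ==> (LINT w|lborel. u w * dzb (%w. bump e (w - c)) w) = 0"
begin

definition av :: "real => complex => complex" where "av e c = (LINT w|lborel. u w * bump e (w - c))"

lemma integrable_against:
 assumes [measurable]: "g : borel_measurable borel" and K: "compact K" "K \<subseteq> W" "!!w. w ~: K ==> g w = 0" and B: "!!w. cmod (g w) <= B"
 shows "integrable lborel (%w. u w * g w)"
proof (rule Bochner_Integration.integrable_bound[of _ "%w. of_real B * (indicator K w *\<^sub>R u w)"])
 show "integrable lborel (%w. of_real B * (indicator K w *\<^sub>R u w))" by (rule integrable_mult_right) (rule ui[OF K(1,2)])
 have "B >= 0" using B[of 0] norm_ge_zero order_trans by blast
 then show "AE w in lborel. norm (u w * g w) <= norm (of_real B * (indicator K w *\<^sub>R u w))"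
  using K(3) B by (intro AE_I2) (auto simp: indicator_def norm_mult mult.commute intro!: mult_mono)
qed measurable

lemma av_integrable: "e > 0 ==> cball c e \<subseteq> W ==> integrable lborel (%w. u w * bump e (w - c))"
 by (rule integrable_against[where K = "cball c e", OF _ _ _ _ bump_bound]) (auto intro!: bump_zero simp: dist_norm norm_minus_commute)

text \<open>Differentiate the bump under the integral sign. Its z-bar derivative drops out by the weak equation, so the derivative is complex linear.\<close>
lemma av_derivative: assumes e: "e > 0" "cball c e \<subseteq> W" shows "(av e has_field_derivative (- (LINT w|lborel. u w * dz (%w. bump e (w - c)) w))) (at c)"
proof -
 obtain r where r: "r > 0" "r <= 1" "cball c (e + r) \<subseteq> W" using cball_enlarge[OF W e(2,1)] .
 let ?K = "cball c (e + r)"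
 let ?b = "%w. bump e (w - c)"
 have b0: "?b w = 0" if "w ~: cball c e" for w by (rule bump_zero) (use that e in \<open>auto simp: dist_norm norm_minus_commute\<close>)
 have z: "dz ?b w = 0" "dzb ?b w = 0" if w: "w ~: cball c e" for w by (rule wirtinger_off_support[OF closed_cball _ w]; erule b0)+
 obtain C where C: "C > 0" "!!x h. cmod (?b (x + h) - ?b x - (dz ?b x * h + dzb ?b x * cnj h)) <= C * sq h"
  using compact_support_taylor[OF CK_bump compact_cball b0] by blast
 define I where "I = (LINT w|lborel. cmod (indicator ?K w *\<^sub>R u w))"
 have Ki: "integrable lborel (%w. indicator ?K w *\<^sub>R u w)" using ui r by auto
 have I0: "I >= 0" by (simp add: I_def)
 have C0: "C >= 0" using C(1) by simp
 have di: "integrable lborel (%w. u w * dz (%w. bump e (w - c)) w)" "integrable lborel (%w. u w * dzb (%w. bump e (w - c)) w)"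
 proof -
  have c: "continuous_on UNIV (dz ?b)" "continuous_on UNIV (dzb ?b)" using CK_bump[of e c] by (auto simp: numeral_2_eq_2 intro!: CK_continuous[of "Suc 0"])
  note m = this[THEN borel_measurable_continuous_onI]
  obtain B B' where B: "!!w. cmod (dz ?b w) <= B" and B': "!!w. cmod (dzb ?b w) <= B'"
   using compact_support_bounded[OF c(1) compact_cball z(1)] compact_support_bounded[OF c(2) compact_cball z(2)] by metis
  show "integrable lborel (%w. u w * dz ?b w)" "integrable lborel (%w. u w * dzb ?b w)"
   by (rule integrable_against[OF m(1) compact_cball e(2) z(1) B]; assumption) (rule integrable_against[OF m(2) compact_cball e(2) z(2) B']; assumption)
 qed
 have bound: "cmod (av e (c + h) - av e c + (LINT w|lborel. u w * dz (%w. bump e (w - c)) w) * h) <= C * I * sq h" if h: "cmod h <= r" for h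
 proof -
  have sub: "cball (c + h) e \<subseteq> W"
  proof -
   have "cball (c + h) e \<subseteq> ?K" using h by (auto simp: dist_norm) (smt (verit, best) diff_diff_eq norm_triangle_ineq2 norm_minus_commute add_diff_eq)
   then show ?thesis using r by auto
  qed
  define F where "F w = bump e (w - c - h) - bump e (w - c) + dz (%w. bump e (w - c)) w * h + dzb (%w. bump e (w - c)) w * cnj h" for w
  have "av e (c + h) - av e c + (LINT w|lborel. u w * dz (%w. bump e (w - c)) w) * h
    + (LINT w|lborel. u w * dzb (%w. bump e (w - c)) w) * cnj h = (LINT w|lborel. u w * F w)"
   unfolding av_def F_def using av_integrable[OF e] av_integrable[OF e(1) sub] di by (simp add: algebra_simps)
  then have "cmod (av e (c + h) - av e c + (LINT w|lborel. u w * dz (%w. bump e (w - c)) w) * h) = cmod (LINT w|lborel. u w * F w)" using weak[OF e] by simp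
  also have "... <= (LINT w|lborel. cmod (indicator ?K w *\<^sub>R u w) * (C * sq h))"
  proof (rule Bochner_Integration.integral_norm_bound_integral)
   show "integrable lborel (%w. u w * F w)"
   proof -
    have "(%w. u w * F w) = (%w. u w * bump e (w - (c + h)) - u w * bump e (w - c) + u w * dz (%w. bump e (w - c)) w * h + u w * dzb (%w. bump e (w - c)) w * cnj h)"
     by (simp add: F_def algebra_simps)
    then show ?thesis using av_integrable[OF e] av_integrable[OF e(1) sub] di by simp
   qed
   show "integrable lborel (%w. cmod (indicator ?K w *\<^sub>R u w) * (C * sq h))" using integrable_norm[OF Ki] by simp
   fix w
   show "norm (u w * F w) <= cmod (indicator ?K w *\<^sub>R u w) * (C * sq h)"
   proof (cases "w : ?K")
    case True
    have "F w = ?b (w + - h) - ?b w - (dz ?b w * - h + dzb ?b w * cnj (- h))" by (simp add: F_def algebra_simps)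
    then have "cmod (F w) <= C * sq h" using C(2)[of w "- h"] by simp
    then show ?thesis using True by (simp add: norm_mult mult_left_mono)
   next
    case False
    then have n: "cmod (w - c) > e + r" by (simp add: dist_norm norm_minus_commute)
    then have "cmod (w - c - h) >= e" using h norm_triangle_ineq2[of "w - c" h] by linarith
    moreover have "cmod (w - c) >= e" using n r by linarith
    moreover have "w ~: cball c e" using n r(1) by (simp add: dist_norm norm_minus_commute)
    ultimately have "F w = 0" unfolding F_def using e(1) z[of w] by (simp add: bump_zero)
    then show ?thesis using C0 by simp
   qed
  qed
  also have "... = C * I * sq h" unfolding integral_mult_left_zero I_def by (simp only: ac_simps)
  finally show ?thesis .
 qed
 show ?thesis unfolding has_field_derivative_def has_derivative_at
 proof (intro conjI bounded_linear_mult_right)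
  show "(%h. norm (av e (c + h) - av e c - (- (LINT w|lborel. u w * dz (%w. bump e (w - c)) w)) * h) / norm h) \<midarrow>0\<rightarrow> 0"
  proof (rule Lim_null_comparison)
   show "((%h. C * I * cmod h) \<longlongrightarrow> 0) (at 0)" by (auto intro!: tendsto_eq_intros)
   have "\<forall>\<^sub>F h in at (0::complex). cmod h <= r" using r(1) by (auto simp: eventually_at intro!: exI[of _ r])
   then show "\<forall>\<^sub>F h in at 0. norm (norm (av e (c + h) - av e c - (- (LINT w|lborel. u w * dz (%w. bump e (w - c)) w)) * h) / norm h) <= C * I * cmod h"
   proof eventually_elim
    case (elim h)
    show ?case
    proof (cases "h = 0")
     case False
     then show ?thesis using bound[OF elim] by (simp add: divide_le_eq power2_eq_square mult.assoc)
    qed (simp add: C0 I0)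
   qed
  qed
 qed
qed

lemma av_holomorphic: "e > 0 ==> (!!y. y : S ==> cball y e \<subseteq> W) ==> av e holomorphic_on S"
 unfolding holomorphic_on_def field_differentiable_def using av_derivative has_field_derivative_at_within by blast

lemma av_mean: assumes e: "e > 0" "f > 0" "cball c (e + f) \<subseteq> W" shows "(LINT y|lborel. av e y * bump f (y - c)) = av e c * bump_mass f"
  "integrable lborel (%y. av e y * bump f (y - c))"
proof -
 have "e + f > 0" using e by simp
 from cball_enlarge[OF W e(3) this] obtain d where d: "d > 0" "cball c (e + f + d) \<subseteq> W" by metis
 have sub: "cball y e \<subseteq> W" if "y : ball c (f + d)" for y
 proof -
  have "cball y e \<subseteq> cball c (e + f + d)" using that by (auto simp: dist_norm) (smt (verit, best) dist_norm dist_triangle)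
  then show ?thesis using d by auto
 qed
 have hol: "av e holomorphic_on ball c (f + d)" by (rule av_holomorphic[OF e(1) sub])
 define g where "g t = max 0 (f^2 - t^2) ^ 3" for t :: real
 define g1 where "g1 t = (if t >= f then 0 else if t <= - f then 0 else g t)" for t :: real
 have gm: "g1 : borel_measurable borel" unfolding g1_def g_def by measurable
 have gb: "\<bar>g1 t\<bar> <= f ^ 6" for t
 proof -
  have "max 0 (f^2 - t^2) ^ 3 <= (f^2) ^ 3" by (rule power_mono) auto
  then show ?thesis using e(2) by (auto simp: g1_def g_def simp flip: power_mult)
 qed
 have bg: "bump f z = of_real (g1 (cmod z))" for z using bump_zero[of f z] e(2) by (auto simp: g1_def g_def bump_def) (smt (verit) norm_ge_zero)
 note mv = mean_value_radial[OF hol e(2) _ gm gb, folded bg]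
 have m: "(%z. av e (c + z) * bump f z) : borel_measurable borel" "integrable lborel (%z. av e (c + z) * bump f z)" using mv(1) d(1) by (auto simp: g1_def)
 have e1: "(%z. av e (- c + z + c) * bump f (- c + z)) = (%y. av e y * bump f (y - c))" by (auto simp: algebra_simps)
 show "(LINT y|lborel. av e y * bump f (y - c)) = av e c * bump_mass f"
  using integral_translation[OF m(1), of "- c"] mv(2) d(1) by (simp add: algebra_simps bump_mass_def g1_def)
 have "integrable (distr lborel borel ((+) (- c))) (%z. av e (c + z) * bump f z)" unfolding lborel_distr_plus by (rule m)
 then show "integrable lborel (%y. av e y * bump f (y - c))" by (subst (asm) integrable_distr_eq) (use m(1) in auto)
qed

lemma bump_convolution_comm: "(LINT y|lborel. bump e (w - y) * bump f (y - c)) = (LINT y|lborel. bump f (w - y) * bump e (y - c))"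
proof -
 define F where "F y = bump e (w - y) * bump f (y - c)" for y
 have [measurable]: "F : borel_measurable borel" unfolding F_def by measurable
 have "(LINT y|lborel. F y) = (LINT y|lborel. F ((w + c) + y))" by (rule integral_translation[symmetric]) measurable
 also have "... = (LINT y|lborel. F ((w + c) + (-1) * y))" by (rule integral_rotation[symmetric, of "-1" "%y. F ((w + c) + y)"]) auto
 also have "... = (LINT y|lborel. bump f (w - y) * bump e (y - c))" by (intro Bochner_Integration.integral_cong refl) (simp add: F_def mult.commute algebra_simps)
 finally show ?thesis by (simp add: F_def)
qed

lemma fubini_bump: assumes e: "e > 0" and K: "compact K" "K \<subseteq> W" and g [measurable]: "g : borel_measurable borel" "!!y. cmod (g y) <= B"
  and L: "compact L" "!!y. y ~: L ==> g y = 0" "!!y w. y : L ==> w ~: K ==> bump e (w - y) = 0"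
 shows "(LINT y|lborel. av e y * g y) = (LINT w|lborel. u w * (LINT y|lborel. bump e (w - y) * g y))"
  "integrable lborel (%w. u w * (LINT y|lborel. bump e (w - y) * g y))"
proof -
 have [measurable]: "K : sets borel" "L : sets borel" using K L by (auto simp: compact_imp_closed)
 define F where "F = (%(y, w). u w * bump e (w - y) * g y)"
 have [measurable]: "F : borel_measurable (lborel \<Otimes>\<^sub>M lborel)" unfolding F_def by measurable
 define uK where "uK w = indicator K w *\<^sub>R u w" for w
 have uK: "integrable lborel uK" unfolding uK_def by (rule ui[OF K])
 have B0: "B >= 0" using g(2)[of 0] norm_ge_zero order_trans by blast
 have Fb: "norm (F (y, w)) <= norm (uK w) * (e ^ 6 * B * indicator L y)" for y w
 proof (cases "y : L & w : K")
  case True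
  then show ?thesis unfolding F_def uK_def using mult_mono[OF bump_bound[of e "w - y"] g(2)[of y]] e by (simp add: norm_mult mult.assoc mult_left_mono)
 next
  case False
  then have "F (y, w) = 0" using L(2)[of y] L(3)[of y w] by (auto simp: F_def)
  then show ?thesis using B0 e by simp
 qed
 have Li: "integrable lborel (%y. e ^ 6 * B * indicator L y)" by (intro integrable_mult_right integrable_real_indicator) (use emeasure_compact_finite[OF L(1)] in auto)
 have Fi1: "integrable lborel (%w. F (y, w))" for y by (rule Bochner_Integration.integrable_bound[of _ "%w. norm (uK w) * (e ^ 6 * B * indicator L y)"])
   (use uK Fb B0 e in \<open>auto simp: norm_mult intro!: integrable_norm\<close>)
 have Fi: "integrable (lborel \<Otimes>\<^sub>M lborel) F"
 proof (rule lborel_pair.Fubini_integrable)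
  show "integrable lborel (%y. LINT w|lborel. norm (F (y, w)))"
  proof (rule Bochner_Integration.integrable_bound[of _ "%y. (LINT w|lborel. norm (uK w)) * (e ^ 6 * B * indicator L y)"])
   show "integrable lborel (%y. (LINT w|lborel. norm (uK w)) * (e ^ 6 * B * indicator L y))" using Li by (rule integrable_mult_right)
   show "AE y in lborel. norm (LINT w|lborel. norm (F (y, w))) <= norm ((LINT w|lborel. norm (uK w)) * (e ^ 6 * B * indicator L y))"
   proof (rule AE_I2)
    fix y
    have "(LINT w|lborel. norm (F (y, w))) <= (LINT w|lborel. norm (uK w) * (e ^ 6 * B * indicator L y))"
     by (intro integral_mono integrable_norm Fi1 integrable_mult_left uK Fb)
    moreover have "(LINT w|lborel. norm (F (y, w))) >= 0" by simp
    ultimately show "norm (LINT w|lborel. norm (F (y, w))) <= norm ((LINT w|lborel. norm (uK w)) * (e ^ 6 * B * indicator L y))" by simp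
   qed
  qed measurable
 qed (use Fi1 in \<open>auto\<close>)
 have 1: "(LINT w|lborel. LINT y|lborel. F (y, w)) = (LINT y|lborel. LINT w|lborel. F (y, w))" using lborel_pair.Fubini_integral[of "%y w. F (y, w)"] Fi by simp
 have 2: "(LINT y|lborel. F (y, w)) = u w * (LINT y|lborel. bump e (w - y) * g y)" for w by (simp add: F_def mult.assoc)
 have 3: "(LINT w|lborel. F (y, w)) = av e y * g y" for y by (simp add: F_def av_def)
 show "(LINT y|lborel. av e y * g y) = (LINT w|lborel. u w * (LINT y|lborel. bump e (w - y) * g y))" using 1 unfolding 2 3 by simp
 show "integrable lborel (%w. u w * (LINT y|lborel. bump e (w - y) * g y))"
  using lborel_pair.integrable_snd[of "%y w. F (y, w)"] Fi unfolding 2[symmetric] by simp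
qed

text \<open>Averaging the average of radius e over radius f can be done in either order, and each average is holomorphic, hence reproduced by the other one.\<close>
lemma av_normalized_unique0: assumes e: "e > 0" "f > 0" "cball c (e + f) \<subseteq> W" shows "av e c * bump_mass f = av f c * bump_mass e"
proof -
 have sup: "bump a (w - y) = 0" if "y : cball c b" "w ~: cball c (e + f)" "a + b = e + f" "a > 0" for a b y w
 proof (rule bump_zero)
  show "a <= cmod (w - y)" using that by (simp add: dist_norm) (smt (verit, best) dist_norm dist_triangle2 dist_commute)
 qed fact
 have "av e c * bump_mass f = (LINT y|lborel. av e y * bump f (y - c))" using av_mean[OF e] by simp
 also have "... = (LINT w|lborel. u w * (LINT y|lborel. bump e (w - y) * bump f (y - c)))"
  by (rule fubini_bump(1)[OF e(1) compact_cball e(3), where L = "cball c f", OF _ bump_bound])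
   (use e sup in \<open>auto intro!: bump_zero simp: dist_norm norm_minus_commute\<close>)
 also have "... = (LINT w|lborel. u w * (LINT y|lborel. bump f (w - y) * bump e (y - c)))" by (subst bump_convolution_comm) simp
 also have "... = (LINT y|lborel. av f y * bump e (y - c))" by (rule fubini_bump(1)[OF e(2) compact_cball e(3), where L = "cball c e", OF _ bump_bound, symmetric])
   (use e sup in \<open>auto intro!: bump_zero simp: dist_norm norm_minus_commute\<close>)
 also have "... = av f c * bump_mass e" using av_mean[OF e(2,1)] e(3) by (simp add: add.commute)
 finally show ?thesis .
qed

lemma av_normalized_unique: assumes e: "e > 0" "f > 0" "cball c e \<subseteq> W" "cball c f \<subseteq> W" shows "av e c / bump_mass e = av f c / bump_mass f"
proof -
 obtain d1 where d1: "d1 > 0" "cball c (e + d1) \<subseteq> W" using cball_enlarge[OF W e(3,1)] by metis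
 obtain d2 where d2: "d2 > 0" "cball c (f + d2) \<subseteq> W" using cball_enlarge[OF W e(4,2)] by metis
 define d where "d = min d1 d2"
 have d: "d > 0" "cball c (e + d) \<subseteq> W" "cball c (f + d) \<subseteq> W" using d1 d2 by (auto simp: d_def intro: order_trans[rotated] subset_cball)
 show ?thesis using av_normalized_unique0[OF e(1) d(1,2)] av_normalized_unique0[OF e(2) d(1,3)]
   frac_eq_eq[OF bump_mass_nonzero[OF e(1)] bump_mass_nonzero[OF d(1)]] frac_eq_eq[OF bump_mass_nonzero[OF e(2)] bump_mass_nonzero[OF d(1)]] by metis
qed

text \<open>The common value of all normalised averages.\<close>
definition rep :: "complex => complex" where "rep c = (let e = (SOME e. e > 0 & cball c e \<subseteq> W) in av e c / bump_mass e)"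

lemma rep_eq: assumes "e > 0" "cball c e \<subseteq> W" shows "rep c = av e c / bump_mass e"
proof -
 have "\<exists>e>0. cball c e \<subseteq> W" using assms by blast
 from someI_ex[OF this] show ?thesis unfolding rep_def Let_def using av_normalized_unique assms by blast
qed

lemma rep_holomorphic: "rep holomorphic_on W"
proof -
 have "rep field_differentiable at c" if c: "c : W" for c
 proof -
  obtain r where r: "r > 0" "cball c r \<subseteq> W" using W c open_contains_cball by blast
  have s: "cball y (r/2) \<subseteq> W" if "y : ball c (r/2)" for y
  proof -
   have "cball y (r/2) \<subseteq> cball c r" using that by (auto simp: dist_norm) (smt (verit, best) dist_norm dist_triangle field_sum_of_halves)
   then show ?thesis using r by auto
  qed
  have "(%y. av (r/2) y / bump_mass (r/2)) holomorphic_on ball c (r/2)"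
   using av_holomorphic[of "r/2" "ball c (r/2)"] r s bump_mass_nonzero[of "r/2"] by (intro holomorphic_intros) auto
  then have "rep holomorphic_on ball c (r/2)" by (rule holomorphic_transform) (use rep_eq[OF _ s] r in auto)
  then show ?thesis using r by (auto intro!: holomorphic_on_imp_differentiable_at[of _ "ball c (r/2)"])
 qed
 then show ?thesis by (auto simp: holomorphic_on_def field_differentiable_at_within)
qed

lemma bump_average_bound: assumes e: "e > 0" and Q: "Q : sets borel" shows "cmod (LINT y|lborel. bump e (w - y) * indicator Q y) <= cmod (bump_mass e)"
proof -
 define b where "b w = max 0 (e^2 - sq w) ^ 3" for w
 have b: "bump e w = of_real (b w)" "b w >= 0" for w by (simp_all add: bump_def b_def)
 have i: "integrable lborel (%y. bump e (w - y))" using bump_integrable[OF e, of w] by (simp add: bump_even(2)[of e _ w])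
 then have i': "integrable lborel (%y. b (w - y))" using integrable_bounded_linear[OF bounded_linear_Re i] by (simp add: b)
 have "cmod (LINT y|lborel. bump e (w - y) * indicator Q y) <= (LINT y|lborel. b (w - y))"
 proof (rule Bochner_Integration.integral_norm_bound_integral)
  show "integrable lborel (%y. bump e (w - y) * indicator Q y)"
  proof (rule Bochner_Integration.integrable_bound[OF i])
   have [measurable]: "Q : sets borel" by fact
   show "(%y. bump e (w - y) * indicator Q y) : borel_measurable lborel" by measurable
  qed (auto simp: indicator_def)
  fix y show "norm (bump e (w - y) * indicator Q y) <= b (w - y)" using b(2) by (auto simp: b(1) indicator_def)
 qed (rule i')
 also have "(LINT y|lborel. b (w - y)) = cmod (of_real (LINT y|lborel. b (w - y)))" unfolding norm_of_real using b(2) by (simp add: integral_nonneg)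
 also have "of_real (LINT y|lborel. b (w - y)) = (LINT y|lborel. bump e (w - y))" by (simp add: b)
 also have "... = bump_mass e" using bump_mass_translate[of e w] by (simp add: bump_even(2)[of e _ w])
 finally show ?thesis .
qed

text \<open>Smooth the indicator of the box by bumps. Boxes are used because their boundary is a null set and they are stable under intersection.\<close>
lemma box_average: assumes Q: "box l r \<subseteq> box a b" and W': "cbox a b \<subseteq> W"
 shows "(LINT w|lborel. u w * indicator (box l r) w) = (LINT w|lborel. rep w * indicator (box l r) w)" "integrable lborel (%w. rep w * indicator (cbox a b) w)"
proof -
 let ?Q = "box l r"
 obtain d0 where d0: "d0 > 0" "(\<Union>x\<in>cbox a b. ball x d0) \<subseteq> W" using compact_subset_open_imp_ball_epsilon_subset[OF compact_cbox W W'] by auto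
 define d where "d = d0/2"
 define K where "K = {x + y | x y. x : cbox a b & y : cball 0 d}"
 have K: "compact K" unfolding K_def by (rule compact_sums[OF compact_cbox compact_cball])
 have KW: "K \<subseteq> W"
 proof
  fix z assume "z : K"
  then obtain x y where "z = x + y" "x : cbox a b" "norm y <= d" unfolding K_def by auto
  then have "z : ball x d0" using d0(1) by (auto simp: d_def dist_norm)
  then show "z : W" using d0(2) \<open>x : cbox a b\<close> by (meson UN_I subsetD)
 qed
 have KI: "w : K" if "y : cbox a b" "cmod (w - y) <= d" for y w unfolding K_def using that by (intro CollectI exI[of _ y] exI[of _ "w - y"]) auto
 have sub: "cball y e \<subseteq> W" if "y : cbox a b" "e <= d" for y e using KI[OF that(1)] KW that(2) by (force simp: dist_norm norm_minus_commute)
 have rc: "continuous_on (cbox a b) rep" using continuous_on_subset[OF holomorphic_on_imp_continuous_on[OF rep_holomorphic] W'] .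
 then have "integrable lborel (%w. indicator (cbox a b) w *\<^sub>R rep w)" by (intro borel_integrable_compact) auto
 then show ri: "integrable lborel (%w. rep w * indicator (cbox a b) w)" by (simp add: scaleR_conv_of_real mult.commute of_real_indicator)
 define e where "e n = d / real (Suc n)" for n
 have e: "e n > 0" "e n <= d" for n using d0(1) by (auto simp: e_def d_def divide_le_eq mult_le_cancel_left1 simp del: of_nat_Suc)
 have elim: "e \<longlonglongrightarrow> 0" using tendsto_mult[OF tendsto_const[of d] LIMSEQ_Suc[OF lim_1_over_n]] by (simp add: e_def[abs_def])
 define I where "I n w = (LINT y|lborel. bump (e n) (w - y) * indicator ?Q y)" for n w
 have Im [measurable]: "I n : borel_measurable borel" for n unfolding I_def by measurable
 have box_sub: "?Q \<subseteq> cbox a b" using Q box_subset_cbox by blast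
 have step: "(LINT w|lborel. u w * I n w) = bump_mass (e n) * (LINT w|lborel. rep w * indicator ?Q w)" "integrable lborel (%w. u w * I n w)" for n
 proof -
  have K': "bump (e n) (w - y) = 0" if "y : cbox a b" "w ~: K" for w y
  proof -
   have "\<not> cmod (w - y) <= d" using KI[OF that(1), of w] that(2) by blast
   then have "cmod (w - y) >= e n" using e(2)[of n] by linarith
   then show ?thesis using e(1) by (rule bump_zero)
  qed
  have g: "cmod (indicator ?Q y) <= 1" for y :: complex by (simp add: indicator_def)
  note fb = fubini_bump[OF e(1) K KW _ g compact_cbox _ K']
  have 0: "indicator ?Q y = (0::complex)" if "y ~: cbox a b" for y by (rule indicator_simps(2)) (use that box_sub in blast)
  have "(LINT y|lborel. av (e n) y * indicator ?Q y) = (LINT w|lborel. u w * I n w)" unfolding I_def by (rule fb(1)) (use 0 in auto)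
  moreover have "av (e n) y * indicator ?Q y = bump_mass (e n) * (rep y * indicator ?Q y)" for y
   using rep_eq[OF e(1) sub[OF _ e(2)], of y n] bump_mass_nonzero[OF e(1), of n] box_sub by (auto simp: indicator_def)
  ultimately show "(LINT w|lborel. u w * I n w) = bump_mass (e n) * (LINT w|lborel. rep w * indicator ?Q w)" by simp
  show "integrable lborel (%w. u w * I n w)" unfolding I_def by (rule fb(2)) (use 0 in auto)
 qed
 have I0: "I n w = 0" if "w ~: K" for n w
 proof -
  have z: "bump (e n) (w - y) * indicator ?Q y = 0" for y
  proof (cases "y : ?Q")
   case True
   then have "\<not> cmod (w - y) <= d" using KI[of y w] that box_sub by blast
   then have "cmod (w - y) >= e n" using e(2)[of n] by linarith
   from bump_zero[OF this e(1)] show ?thesis by simp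
  qed simp
  show ?thesis unfolding I_def z by simp
 qed
 have "(%n. LINT w|lborel. u w * (I n w / bump_mass (e n))) \<longlonglongrightarrow> (LINT w|lborel. u w * indicator ?Q w)"
 proof (rule integral_dominated_convergence[where w = "%w. norm (indicator K w *\<^sub>R u w)"])
  show "integrable lborel (%w. norm (indicator K w *\<^sub>R u w))" by (intro integrable_norm ui K KW)
  show "AE w in lborel. norm (u w * (I n w / bump_mass (e n))) <= norm (indicator K w *\<^sub>R u w)" for n
  proof (rule AE_I2)
   fix w
   have "cmod (I n w / bump_mass (e n)) <= 1" using bump_average_bound[OF e(1), of ?Q n w] bump_mass_nonzero[OF e(1), of n] by (simp add: I_def norm_divide divide_le_eq)
   then have "cmod (u w) * cmod (I n w / bump_mass (e n)) <= cmod (u w)" by (rule mult_left_le) simp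
   then show "norm (u w * (I n w / bump_mass (e n))) <= norm (indicator K w *\<^sub>R u w)" unfolding norm_mult[of "u w"] using I0[of w n] by (cases "w : K") simp_all
  qed
  have "AE w in lborel. w ~: cbox l r - ?Q" by (rule AE_not_in[OF null_sets_cbox_Diff_box])
  then show "AE w in lborel. (%n. u w * (I n w / bump_mass (e n))) \<longlonglongrightarrow> u w * indicator ?Q w"
  proof eventually_elim
   case (elim w)
   have "(%n. I n w / bump_mass (e n)) \<longlonglongrightarrow> indicator ?Q w"
   proof (cases "w : ?Q")
    case True
    then obtain er where er: "er > 0" "ball w er \<subseteq> ?Q" using open_box openE by blast
    have "\<forall>\<^sub>F n in sequentially. e n < er" using order_tendstoD(2)[OF \<open>e \<longlonglongrightarrow> 0\<close> er(1)] .
    then have "\<forall>\<^sub>F n in sequentially. I n w / bump_mass (e n) = indicator ?Q w"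
    proof eventually_elim
     case (elim n)
     have z: "bump (e n) (w - y) * indicator ?Q y = bump (e n) (w - y)" for y
     proof (cases "y : ?Q")
      case False
      then have "y ~: ball w er" using er(2) by blast
      then have "cmod (w - y) >= e n" using elim by (simp add: dist_norm)
      from bump_zero[OF this e(1)] show ?thesis by simp
     qed simp
     have "I n w = bump_mass (e n)" unfolding I_def z using bump_mass_translate[of "e n" w] by (simp add: bump_even(2)[of "e n" _ w])
     then show ?case using True bump_mass_nonzero[OF e(1), of n] by simp
    qed
    then show ?thesis by (rule tendsto_eventually)
   next
    case False
    then have "w : - cbox l r" using elim by auto
    then obtain er where er: "er > 0" "ball w er \<subseteq> - cbox l r" using openE[of "- cbox l r"] by (metis closed_cbox open_Compl)
    have "\<forall>\<^sub>F n in sequentially. e n < er" using order_tendstoD(2)[OF \<open>e \<longlonglongrightarrow> 0\<close> er(1)] .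
    then have "\<forall>\<^sub>F n in sequentially. I n w / bump_mass (e n) = indicator ?Q w"
    proof eventually_elim
     case (elim n)
     have z: "bump (e n) (w - y) * indicator ?Q y = 0" for y
     proof (cases "y : ?Q")
      case True
      then have "y ~: ball w er" using er(2) box_subset_cbox by blast
      then show ?thesis using elim e(1)[of n] bump_zero[of "e n" "w - y"] by (simp add: dist_norm)
     qed simp
     show ?case unfolding I_def z using False by simp
    qed
    then show ?thesis by (rule tendsto_eventually)
   qed
   then show ?case by (rule tendsto_mult_left)
  qed
 qed measurable
 moreover have "(LINT w|lborel. u w * (I n w / bump_mass (e n))) = (LINT w|lborel. rep w * indicator ?Q w)" for n using step[of n] bump_mass_nonzero[OF e(1), of n] by simp
 ultimately show "(LINT w|lborel. u w * indicator ?Q w) = (LINT w|lborel. rep w * indicator ?Q w)" by (simp add: LIMSEQ_const_iff)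
qed

text \<open>Integrals over boxes determine an integrable function almost everywhere.\<close>
lemma AE_rep_box: assumes W': "cbox a b \<subseteq> W" shows "AE w in lborel. w : box a b --> u w = rep w"
proof -
 define f where "f w = (u w * indicator (cbox a b) w - rep w * indicator (cbox a b) w) * indicator (box a b) w" for w
 have i1: "integrable lborel (%w. u w * indicator (cbox a b) w)" using ui[OF compact_cbox W'] by (simp add: scaleR_conv_of_real mult.commute of_real_indicator)
 have i2: "integrable lborel (%w. rep w * indicator (cbox a b) w)" by (rule box_average(2)[OF subset_refl W'])
 have ind: "integrable lborel (%w. g w * indicator A w)" if "integrable lborel g" "A : sets borel" for g :: "complex => complex" and A
  using integrable_mult_indicator[of A lborel g] that by (simp add: scaleR_conv_of_real mult.commute of_real_indicator)
 have fi: "integrable lborel f" unfolding f_def by (intro ind Bochner_Integration.integrable_diff i1 i2) auto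
 have box: "set_lebesgue_integral lborel (box l r) f = 0" for l r
 proof -
  obtain l' r' where Q: "box l r Int box a b = box l' r'" using box_Int_box by blast
  have sub0: "box l' r' \<subseteq> box a b" unfolding Q[symmetric] by (rule Int_lower2)
  note sub = sub0 subset_trans[OF sub0 box_subset_cbox]
  have "set_lebesgue_integral lborel (box l r) f = (LINT w|lborel. u w * indicator (box l' r') w - rep w * indicator (box l' r') w)" unfolding set_lebesgue_integral_def
  proof (intro Bochner_Integration.integral_cong refl)
   fix w
   have "w : box l r & w : box a b \<longleftrightarrow> w : box l' r'" unfolding Q[symmetric] by (rule Int_iff[symmetric])
   moreover have "w : box a b ==> w : cbox a b" by (rule subsetD[OF box_subset_cbox])
   ultimately show "indicator (box l r) w *\<^sub>R f w = u w * indicator (box l' r') w - rep w * indicator (box l' r') w"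
    unfolding f_def by (cases "w : box l r"; cases "w : box a b"; cases "w : box l' r'") simp_all
  qed
  also have "... = (LINT w|lborel. u w * indicator (box l' r') w) - (LINT w|lborel. rep w * indicator (box l' r') w)"
  proof (rule Bochner_Integration.integral_diff)
   have "(%w. u w * indicator (box l' r') w) = (%w. u w * indicator (cbox a b) w * indicator (box l' r') w)"
    "(%w. rep w * indicator (box l' r') w) = (%w. rep w * indicator (cbox a b) w * indicator (box l' r') w)" using sub by (auto simp: fun_eq_iff indicator_def)
   then show "integrable lborel (%w. u w * indicator (box l' r') w)" "integrable lborel (%w. rep w * indicator (box l' r') w)"
    using ind[OF i1, of "box l' r'"] ind[OF i2, of "box l' r'"] by simp_all
  qed
  also have "... = 0" using box_average(1)[OF sub(1) W'] by simp
  finally show ?thesis .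
 qed
 have si: "set_integrable lborel A f" if "A : sets borel" for A unfolding set_integrable_def using integrable_mult_indicator[OF _ fi, of A] that by simp
 have all: "set_lebesgue_integral lborel A f = 0" if "A : sigma_sets UNIV (range (%(a, b). box a b))" for A
 proof -
  have st: "Int_stable (range (%(a, b). box a b :: complex set))" by (auto simp: Int_stable_def box_Int_box)
  have pw: "range (%(a, b). box a b :: complex set) \<subseteq> Pow UNIV" by simp
  show ?thesis using st pw that
 proof (induction A rule: sigma_sets_induct_disjoint)
  case (compl A)
  have A: "A : sets borel" using compl by (simp add: borel_eq_box)
  have "set_lebesgue_integral lborel UNIV f = set_lebesgue_integral lborel (box a b) f"
   unfolding set_lebesgue_integral_def by (intro Bochner_Integration.integral_cong refl) (auto simp: f_def indicator_def)
  then have "set_lebesgue_integral lborel UNIV f = 0" using box by simp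
  moreover have "set_lebesgue_integral lborel (A \<union> (UNIV - A)) f = set_lebesgue_integral lborel A f + set_lebesgue_integral lborel (UNIV - A) f"
   by (rule set_integral_Un) (use A si in auto)
  ultimately show ?case using compl by simp
 next
  case (union A)
  have A: "A i : sets borel" for i using union by (auto simp: borel_eq_box)
  have "set_lebesgue_integral lborel (\<Union>i. A i) f = (\<Sum>i. set_lebesgue_integral lborel (A i) f)"
   by (rule lebesgue_integral_countable_add) (use A union in \<open>auto intro!: si simp: disjoint_family_on_def\<close>)
  then show ?case using union by simp
 qed (use box in \<open>auto simp: set_lebesgue_integral_def\<close>)
 qed
 have "AE w in lborel. f w = 0" by (rule sigma_finite_measure.density_zero[OF sigma_finite_lborel fi]) (use all in \<open>auto simp: borel_eq_box\<close>)
 then show ?thesis by eventually_elim (use box_subset_cbox in \<open>auto simp: f_def indicator_def split: if_splits\<close>)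
qed

lemma AE_rep: "AE w in lborel. w : W --> u w = rep w"
proof -
 obtain D where D: "countable D" "D \<subseteq> Pow W" "!!X. X : D ==> \<exists>a b. X = cbox a b" "\<Union>D = W"
  using open_countable_Union_open_cbox[OF W] by metis
 have "\<forall>X\<in>D. AE w in lborel. w : X --> u w = rep w"
 proof
  fix X assume X: "X : D"
  then obtain a b where ab: "X = cbox a b" using D(3) by blast
  have "AE w in lborel. w ~: cbox a b - box a b" by (rule AE_not_in[OF null_sets_cbox_Diff_box])
  moreover have "AE w in lborel. w : box a b --> u w = rep w" using X D(2) ab by (intro AE_rep_box) auto
  ultimately show "AE w in lborel. w : X --> u w = rep w" unfolding ab by eventually_elim auto
 qed
 then have "AE w in lborel. \<forall>X\<in>D. w : X --> u w = rep w" by (intro AE_ball_countable[THEN iffD2] D(1))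
 then show ?thesis by eventually_elim (use D(4) in auto)
qed

end

section \<open>Square-integrable functions\<close>

text \<open>Square-integrable functions themselves, without passing to classes modulo null sets, because sections are compared pointwise later.\<close>
definition L2 :: "'a measure => ('a => complex) set" where "L2 M = {f : borel_measurable M. integrable M (%x. sq (f x))}"

definition ip :: "'a measure => ('a => complex) => ('a => complex) => complex" where
 "ip M f g = (LINT x|M. f x * cnj (g x))"

definition nsq :: "'a measure => ('a => complex) => real" where "nsq M f = (LINT x|M. sq (f x))"

lemma cnj_measurable [measurable (raw)]: "f : borel_measurable M ==> (%x. cnj (f x)) : borel_measurable M"
 by (rule borel_measurable_continuous_on[of cnj, OF _ _]) (auto intro: continuous_intros)

lemma L2_measurable: "f : L2 M ==> f : borel_measurable M" by (simp add: L2_def)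

lemma cmod_mult_le_sq: "cmod (a * cnj b) <= sq a + sq b"
proof -
 have "0 <= (cmod a - cmod b)^2" "0 <= cmod a * cmod b" by auto
 moreover have "(cmod a - cmod b)^2 = sq a + sq b - 2 * (cmod a * cmod b)" by (simp add: power2_diff)
 ultimately show ?thesis unfolding norm_mult complex_mod_cnj by linarith
qed

lemma of_real_cmod_sq: "(complex_of_real (cmod z))^2 = z * cnj z" using complex_norm_square[of z] by simp

lemma cmod_add_sq: "sq (a + b) = sq a + sq b + 2 * Re (a * cnj b)" by (simp add: cmod_power2) (simp add: power2_eq_square algebra_simps)

lemma L2_integrable_prod: assumes "f : L2 M" "g : L2 M" shows "integrable M (%x. f x * cnj (g x))"
proof (rule Bochner_Integration.integrable_bound[of _ "%x. sq (f x) + sq (g x)"])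
 show "(%x. f x * cnj (g x)) : borel_measurable M" using assms[THEN L2_measurable] by measurable
qed (use assms cmod_mult_le_sq in \<open>auto simp: L2_def\<close>)

lemma L2_scale: "f : L2 M ==> (%x. c * f x) : L2 M" by (auto simp: L2_def norm_mult power_mult_distrib)

lemma L2_add: assumes "f : L2 M" "g : L2 M" shows "(%x. f x + g x) : L2 M"
proof -
 have "integrable M (%x. sq (f x) + sq (g x) + 2 * Re (f x * cnj (g x)))" by (intro Bochner_Integration.integrable_add integrable_mult_right
    integrable_bounded_linear[OF bounded_linear_Re L2_integrable_prod[OF assms]]) (use assms in \<open>auto simp: L2_def\<close>)
 then show ?thesis using assms by (auto simp: L2_def cmod_add_sq)
qed

lemma L2_lincomb: "f : L2 M ==> g : L2 M ==> (%x. f x + c * g x) : L2 M" by (intro L2_add L2_scale)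

lemma L2_diff: "f : L2 M ==> g : L2 M ==> (%x. f x - g x) : L2 M" using L2_lincomb[of f M g "-1"] by simp

lemma L2_zero: "(%_. 0) : L2 M" by (auto simp: L2_def)

lemma L2_sum: "(!!i. i : I ==> f i : L2 M) ==> (%x. \<Sum>i\<in>I. a i * f i x) : L2 M"
proof (induction I rule: infinite_finite_induct)
 case (insert i I)
 then show ?case using L2_add[OF L2_scale[of "f i" M "a i"], of "%x. \<Sum>i\<in>I. a i * f i x"] by simp
qed (auto intro: L2_zero)

lemma ip_self: "f : L2 M ==> ip M f f = of_real (nsq M f)" unfolding ip_def nsq_def complex_norm_square[symmetric] by (rule integral_complex_of_real)

lemma ip_cnj: "cnj (ip M f g) = ip M g f"
proof -
 have "cnj (ip M f g) = (LINT x|M. cnj (f x * cnj (g x)))" unfolding ip_def by (rule Bochner_Integration.integral_cnj[symmetric])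
 then show ?thesis by (simp add: ip_def mult.commute)
qed

lemma ip_add_left: "f : L2 M ==> g : L2 M ==> h : L2 M ==> ip M (%x. f x + g x) h = ip M f h + ip M g h"
 by (simp add: ip_def distrib_right L2_integrable_prod)

lemma ip_scale_left: "ip M (%x. c * f x) h = c * ip M f h" by (simp add: ip_def mult.assoc)

lemma ip_scale_right: "ip M h (%x. c * f x) = cnj c * ip M h f" by (simp add: ip_def mult.left_commute)

lemma ip_diff_left: "f : L2 M ==> g : L2 M ==> h : L2 M ==> ip M (%x. f x - g x) h = ip M f h - ip M g h"
 using ip_add_left[of f M "%x. (-1) * g x" h] L2_scale[of g M "-1"] ip_scale_left[of M "-1" g h] by simp

lemma ip_add_right: "f : L2 M ==> g : L2 M ==> h : L2 M ==> ip M h (%x. f x + g x) = ip M h f + ip M h g"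
 by (simp add: ip_def distrib_left L2_integrable_prod)

lemma ip_sum_left: "(!!i. i : I ==> f i : L2 M) ==> h : L2 M ==>
  ip M (%x. \<Sum>i\<in>I. a i * f i x) h = (\<Sum>i\<in>I. a i * ip M (f i) h)"
proof (induction I rule: infinite_finite_induct)
 case (insert i I)
 then show ?case using ip_add_left[of "%x. a i * f i x" M "%x. \<Sum>i\<in>I. a i * f i x" h] by (simp add: L2_sum L2_scale ip_scale_left)
qed (auto simp: ip_def)

lemma ip_cong_AE: assumes "AE x in M. f x = f' x" "f : borel_measurable M" "f' : borel_measurable M" "g : borel_measurable M" shows "ip M f g = ip M f' g"
proof -
 have "(%x. f x * cnj (g x)) : borel_measurable M" "(%x. f' x * cnj (g x)) : borel_measurable M" using assms(2-) by measurable
 then show ?thesis unfolding ip_def using assms(1) by (intro integral_cong_AE) auto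
qed

lemma nsq_cong_AE: assumes "AE x in M. f x = f' x" "f : borel_measurable M" "f' : borel_measurable M" shows "nsq M f = nsq M f'"
 unfolding nsq_def using assms by (intro integral_cong_AE) auto

lemma nsq_nonneg [simp]: "nsq M f >= 0" by (simp add: nsq_def)

lemma nsq_scale: "nsq M (%x. c * f x) = sq c * nsq M f" by (simp add: nsq_def norm_mult power_mult_distrib)

lemma nsq_add: assumes "f : L2 M" "g : L2 M" shows "nsq M (%x. f x + g x) = nsq M f + nsq M g + 2 * Re (ip M f g)"
proof -
 define R where "R x = Re (f x * cnj (g x))" for x
 have R: "integrable M R" "(LINT x|M. R x) = Re (ip M f g)" unfolding R_def[abs_def] ip_def
  by (rule integrable_bounded_linear[OF bounded_linear_Re L2_integrable_prod[OF assms]],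
    rule integral_bounded_linear[OF bounded_linear_Re L2_integrable_prod[OF assms]])
 have "nsq M (%x. f x + g x) = (LINT x|M. sq (f x) + sq (g x) + 2 * R x)" unfolding nsq_def cmod_add_sq R_def ..
 also have "... = nsq M f + nsq M g + 2 * Re (ip M f g)" using assms R unfolding nsq_def by (simp add: L2_def)
 finally show ?thesis .
qed

lemma nsq_lincomb: assumes "f : L2 M" "g : L2 M" shows "nsq M (%x. f x + c * g x) = nsq M f + sq c * nsq M g + 2 * Re (cnj c * ip M f g)"
 using nsq_add[OF assms(1) L2_scale[OF assms(2)], of c] by (simp only: nsq_scale ip_scale_right)

lemma nsq_parallelogram: assumes "f : L2 M" "g : L2 M" shows "nsq M (%x. f x - g x) + nsq M (%x. f x + g x) = 2 * nsq M f + 2 * nsq M g"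
 using nsq_lincomb[OF assms, of "-1"] nsq_lincomb[OF assms, of 1] by simp

lemma ip_Cauchy_Schwarz: assumes "f : L2 M" "g : L2 M" shows "sq (ip M f g) <= nsq M f * nsq M g"
proof (cases "nsq M g = 0")
 case True
 define a where "a = sq (ip M f g)"
 have "0 <= nsq M f - 2 * t * a" for t :: real
 proof -
  have "0 <= nsq M (%x. f x + (- of_real t * ip M f g) * g x)" by simp
  also have "... = nsq M f + 2 * Re (cnj (- of_real t * ip M f g) * ip M f g)" unfolding nsq_lincomb[OF assms] True by simp
  also have "cnj (- of_real t * ip M f g) * ip M f g = of_real (- t * a)" unfolding a_def by (simp add: of_real_cmod_sq mult.commute)
  finally show ?thesis by simp
 qed
 from this[of "(nsq M f + 1) / (2 * a)"] have "a = 0" by (cases "a = 0") auto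
 then show ?thesis using True by (simp add: a_def)
next
 case False
 then have n: "nsq M g > 0" by (simp add: less_le)
 define c where "c = - ip M f g / of_real (nsq M g)"
 have "cnj c * ip M f g = of_real (- (sq (ip M f g) / nsq M g))" by (simp add: c_def of_real_cmod_sq mult.commute)
 moreover have "sq c * nsq M g = sq (ip M f g) / nsq M g" using n by (simp add: c_def norm_divide power_divide power2_eq_square)
 ultimately have "nsq M (%x. f x + c * g x) = nsq M f - sq (ip M f g) / nsq M g" unfolding nsq_lincomb[OF assms] by simp
 then have "sq (ip M f g) / nsq M g <= nsq M f" using nsq_nonneg[of M "%x. f x + c * g x"] by linarith
 then show ?thesis using n by (simp add: divide_le_eq)
qed

lemma nsq_triangle: assumes "f : L2 M" "g : L2 M" shows "sqrt (nsq M (%x. f x + g x)) <= sqrt (nsq M f) + sqrt (nsq M g)"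
proof (rule real_le_lsqrt)
 have "Re (ip M f g) <= cmod (ip M f g)" by (rule complex_Re_le_cmod)
 also have "... <= sqrt (nsq M f * nsq M g)" using ip_Cauchy_Schwarz[OF assms] by (rule real_le_rsqrt)
 finally show "nsq M (%x. f x + g x) <= (sqrt (nsq M f) + sqrt (nsq M g))^2" unfolding nsq_add[OF assms] by (simp add: power2_sum real_sqrt_mult)
qed auto

lemma nsq_diff_commute: "nsq M (%x. f x - g x) = nsq M (%x. g x - f x)" by (simp add: nsq_def norm_minus_commute)

lemma L2_iff_nn_integral: assumes [measurable]: "f : borel_measurable M"
 shows "f : L2 M \<longleftrightarrow> (\<integral>\<^sup>+x. ennreal (sq (f x)) \<partial>M) < \<infinity>"
 unfolding L2_def by (auto simp: integrable_iff_bounded)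

lemma nn_integral_nsq: "f : L2 M ==> (\<integral>\<^sup>+x. ennreal (sq (f x)) \<partial>M) = ennreal (nsq M f)"
 unfolding nsq_def L2_def by (intro nn_integral_eq_integral) auto

text \<open>Riesz-Fischer: a subsequence with geometrically decreasing steps converges almost everywhere, and Fatou's lemma identifies its limit.\<close>
theorem L2_complete: assumes s: "!!n. s n : L2 M"
  and cauchy: "!!e. e > 0 ==> \<exists>N. \<forall>m\<ge>N. \<forall>n\<ge>N. nsq M (%x. s m x - s n x) < e"
 obtains l where "l : L2 M" "(%n. nsq M (%x. s n x - l x)) \<longlonglongrightarrow> 0"
proof -
 have sm [measurable]: "s n : borel_measurable M" for n using s L2_measurable by blast
 define P where "P j N \<longleftrightarrow> (\<forall>m\<ge>N. \<forall>n\<ge>N. nsq M (%x. s m x - s n x) < (1/4) ^ j)" for j N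
 have "\<exists>N. P j N" for j unfolding P_def by (rule cauchy) simp
 then obtain K where K: "!!j. P j (K j)" by metis
 define k where "k j = j + (\<Sum>i\<le>j. K i)" for j
 have kK: "k j >= K j" for j unfolding k_def by (rule trans_le_add2, rule member_le_sum) auto
 have kmono: "k i <= k j" if "i <= j" for i j unfolding k_def using that by (intro add_mono sum_mono2) auto
 define g where "g j x = s (k (Suc j)) x - s (k j) x" for j x
 have g2: "g j : L2 M" for j unfolding g_def by (intro L2_diff s)
 have gm [measurable]: "g j : borel_measurable M" for j using g2 L2_measurable by blast
 have gn: "nsq M (g j) <= (1/4) ^ j" for j
 proof -
  have "K j <= k (Suc j)" "K j <= k j" using kK[of j] kmono[of j "Suc j"] by auto
  then show ?thesis using K[of j] unfolding P_def g_def[abs_def] by (blast intro: less_imp_le)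
 qed
 have "(\<integral>\<^sup>+x. (\<Sum>j. ennreal (2 ^ j * sq (g j x))) \<partial>M) = (\<Sum>j. \<integral>\<^sup>+x. ennreal (2 ^ j * sq (g j x)) \<partial>M)"
  by (rule nn_integral_suminf) measurable
 also have "... = (\<Sum>j. ennreal (2 ^ j * nsq M (g j)))"
 proof (rule suminf_cong)
  fix j
  have "(\<integral>\<^sup>+x. ennreal (2 ^ j * sq (g j x)) \<partial>M) = ennreal (2 ^ j) * (\<integral>\<^sup>+x. ennreal (sq (g j x)) \<partial>M)"
   by (subst nn_integral_cmult[symmetric]) (auto simp: ennreal_mult)
  then show "(\<integral>\<^sup>+x. ennreal (2 ^ j * sq (g j x)) \<partial>M) = ennreal (2 ^ j * nsq M (g j))" by (simp add: nn_integral_nsq[OF g2] ennreal_mult)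
 qed
 also have "... <= (\<Sum>j. ennreal ((1/2) ^ j))"
 proof (intro suminf_le ennreal_leI summableI)
  fix j
  have "2 ^ j * nsq M (g j) <= 2 ^ j * (1/4) ^ j" using gn[of j] by (intro mult_left_mono) auto
  also have "... = (1/2) ^ j" by (simp flip: power_mult_distrib)
  finally show "2 ^ j * nsq M (g j) <= (1/2) ^ j" .
 qed
 also have "... = ennreal (\<Sum>j. (1/2) ^ j)" by (rule suminf_ennreal2) (auto intro: summable_geometric)
 finally have "(\<integral>\<^sup>+x. (\<Sum>j. ennreal (2 ^ j * sq (g j x))) \<partial>M) ~= \<infinity>"
  by (metis ennreal_less_top infinity_ennreal_def leD)
 then have "AE x in M. (\<Sum>j. ennreal (2 ^ j * sq (g j x))) ~= \<infinity>" by (rule nn_integral_noteq_infinite[rotated]) measurable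
 then have conv: "AE x in M. convergent (%j. s (k j) x)"
 proof eventually_elim
  case (elim x)
  define C where "C = enn2real (\<Sum>j. ennreal (2 ^ j * sq (g j x)))"
  have C: "C >= 0" "(\<Sum>j. ennreal (2 ^ j * sq (g j x))) = ennreal C"
  proof -
   show "C >= 0" unfolding C_def by (rule enn2real_nonneg)
   have "(\<Sum>j. ennreal (2 ^ j * sq (g j x))) < top" using elim unfolding infinity_ennreal_def less_top .
   then show "(\<Sum>j. ennreal (2 ^ j * sq (g j x))) = ennreal C" unfolding C_def by (rule ennreal_enn2real[symmetric])
  qed
  have "cmod (g j x) <= sqrt C * sqrt (1/2) ^ j" for j
  proof -
   have "ennreal (2 ^ j * sq (g j x)) <= ennreal C"
    unfolding C(2)[symmetric] using sum_le_suminf[OF summableI, of "{j}" "%j. ennreal (2 ^ j * sq (g j x))"]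
    by (simp only: sum.insert sum.empty finite.intros empty_iff not_False_eq_True add_0_right simp_thms zero_le)
   then have "2 ^ j * sq (g j x) <= C" using C(1) by (simp only: ennreal_le_iff)
   then have "sq (g j x) <= C / 2 ^ j" by (simp only: pos_le_divide_eq[OF zero_less_power[OF zero_less_numeral]] mult.commute)
   then have "sq (g j x) <= C * (1/2) ^ j" by (simp add: power_divide)
   then have "cmod (g j x) <= sqrt (C * (1/2) ^ j)" by (rule real_le_rsqrt)
   then show ?thesis by (simp add: real_sqrt_mult real_sqrt_power)
  qed
  moreover have "summable (%j. sqrt C * sqrt (1/2) ^ j)" by (intro summable_mult summable_geometric) (simp add: real_sqrt_lt_1_iff)
  ultimately have "summable (%j. g j x)" by (rule summable_comparison_test'[where N = 0, rotated])
  then have "convergent (%n. \<Sum>j<n. g j x)" by (simp add: summable_iff_convergent)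
  then have "convergent (%n. s (k 0) x + (\<Sum>j<n. g j x))" by (simp add: convergent_add_const_iff)
  moreover have "s (k 0) x + (\<Sum>j<n. g j x) = s (k n) x" for n
  proof (induction n)
   case (Suc n)
   have "s (k 0) x + (\<Sum>j<Suc n. g j x) = (s (k 0) x + (\<Sum>j<n. g j x)) + g n x" by simp
   then show ?case unfolding Suc by (simp add: g_def)
  qed simp
  ultimately show ?case by simp
 qed
 define l where "l x = lim (%j. s (k j) x)" for x
 have lm [measurable]: "l : borel_measurable M" unfolding l_def by (rule borel_measurable_lim_metric) measurable
 have lim: "AE x in M. (%j. s (k j) x) \<longlonglongrightarrow> l x" using conv by eventually_elim (simp add: l_def convergent_LIMSEQ_iff)
 have fatou: "(\<integral>\<^sup>+x. ennreal (sq (s n x - l x)) \<partial>M) <= ennreal e"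
  if n: "\<forall>m\<ge>N. nsq M (%x. s n x - s m x) <= e" for n N e
 proof -
  have "(\<integral>\<^sup>+x. ennreal (sq (s n x - l x)) \<partial>M) = (\<integral>\<^sup>+x. liminf (%j. ennreal (sq (s n x - s (k j) x))) \<partial>M)"
  proof (rule nn_integral_cong_AE)
   show "AE x in M. ennreal (sq (s n x - l x)) = liminf (%j. ennreal (sq (s n x - s (k j) x)))" using lim
   proof eventually_elim
    case (elim x)
    have "(%j. ennreal (sq (s n x - s (k j) x))) \<longlonglongrightarrow> ennreal (sq (s n x - l x))"
     by (intro tendsto_intros elim tendsto_ennrealI)
    from lim_imp_Liminf[OF _ this] show ?case by simp
   qed
  qed
  also have "... <= liminf (%j. \<integral>\<^sup>+x. ennreal (sq (s n x - s (k j) x)) \<partial>M)" by (rule nn_integral_liminf) measurable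
  also have "... = liminf (%j. ennreal (nsq M (%x. s n x - s (k j) x)))" by (simp add: nn_integral_nsq L2_diff s)
  also have "... <= liminf (%j. ennreal e)"
  proof (rule Liminf_mono)
   have "\<forall>\<^sub>F j in sequentially. k j >= N" by (rule eventually_sequentiallyI[of N]) (simp add: k_def)
   then show "\<forall>\<^sub>F j in sequentially. ennreal (nsq M (%x. s n x - s (k j) x)) <= ennreal e"
    by eventually_elim (use n in \<open>auto intro: ennreal_leI\<close>)
  qed
  finally show ?thesis by (simp add: Liminf_const)
 qed
 have "l : L2 M" and lim0: "(%n. nsq M (%x. s n x - l x)) \<longlonglongrightarrow> 0"
 proof -
  obtain N where N: "\<forall>m\<ge>N. \<forall>n\<ge>N. nsq M (%x. s m x - s n x) < 1" using cauchy[of 1] by auto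
  have d: "(%x. s N x - l x) : L2 M"
  proof -
   have "(\<integral>\<^sup>+x. ennreal (sq (s N x - l x)) \<partial>M) <= ennreal 1" by (rule fatou[of N]) (use N in \<open>auto intro: less_imp_le\<close>)
   then have "(\<integral>\<^sup>+x. ennreal (sq (s N x - l x)) \<partial>M) < \<infinity>" by (rule le_less_trans) simp
   then show ?thesis by (subst L2_iff_nn_integral) auto
  qed
  have "(%x. s N x - (s N x - l x)) : L2 M" by (rule L2_diff[OF s d])
  then show l2: "l : L2 M" by simp
  show "(%n. nsq M (%x. s n x - l x)) \<longlonglongrightarrow> 0"
  proof (rule LIMSEQ_I)
   fix e :: real assume "e > 0"
   then obtain N where N: "\<forall>m\<ge>N. \<forall>n\<ge>N. nsq M (%x. s m x - s n x) < e/2" using cauchy[of "e/2"] by auto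
   have "nsq M (%x. s n x - l x) < e" if "n >= N" for n
   proof -
    have "ennreal (nsq M (%x. s n x - l x)) <= ennreal (e/2)"
     using fatou[of N n "e/2"] N that nn_integral_nsq[OF L2_diff[OF s[of n] l2]] by (auto intro: less_imp_le)
    then have "nsq M (%x. s n x - l x) <= e/2" using \<open>e > 0\<close> by (simp add: ennreal_le_iff)
    then show ?thesis using \<open>e > 0\<close> by simp
   qed
   then show "\<exists>no. \<forall>n\<ge>no. norm (nsq M (%x. s n x - l x) - 0) < e" by auto
  qed
 qed
 then show ?thesis using that by blast
qed

lemma ip_tendsto: assumes "!!n. s n : L2 M" "l : L2 M" "f : L2 M" "(%n. nsq M (%x. s n x - l x)) \<longlonglongrightarrow> 0"
 shows "(%n. ip M (s n) f) \<longlonglongrightarrow> ip M l f"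
proof (rule LIM_zero_cancel, rule Lim_null_comparison)
 have "cmod (ip M (s n) f - ip M l f) <= sqrt (nsq M (%x. s n x - l x) * nsq M f)" for n using ip_Cauchy_Schwarz[OF L2_diff[OF assms(1)[of n] assms(2)] assms(3)]
  by (simp add: ip_diff_left assms real_le_rsqrt)
 then show "\<forall>\<^sub>F n in sequentially. norm (ip M (s n) f - ip M l f) <= sqrt (nsq M (%x. s n x - l x) * nsq M f)" by simp
 have "(%n. sqrt (nsq M (%x. s n x - l x) * nsq M f)) \<longlonglongrightarrow> sqrt (0 * nsq M f)" by (intro tendsto_intros assms)
 then show "(%n. sqrt (nsq M (%x. s n x - l x) * nsq M f)) \<longlonglongrightarrow> 0" by simp
qed

text \<open>A minimising sequence for the distance to V is Cauchy by the parallelogram law. V need not be closed, so its part of the decomposition is only a limit.\<close>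
theorem L2_projection:
 assumes V: "V \<subseteq> L2 M" "(%_. 0) : V" "!!f g c. f : V ==> g : V ==> (%x. f x + c * g x) : V"
  and v: "v : L2 M"
 obtains s f where "s : L2 M" "!!g. g : V ==> ip M s g = 0" "!!n::nat. f n : V"
  "(%n. nsq M (%x. (v x - f n x) - s x)) \<longlonglongrightarrow> 0"
proof -
 define d where "d = (INF f\<in>V. nsq M (%x. v x - f x))"
 have bb: "bdd_below ((%f. nsq M (%x. v x - f x)) ` V)" by (rule bdd_belowI2[of _ 0]) simp
 have dle: "d <= nsq M (%x. v x - f x)" if "f : V" for f unfolding d_def by (rule cINF_lower[OF bb that])
 have "\<exists>f\<in>V. nsq M (%x. v x - f x) < d + 1 / real (Suc n)" for n unfolding d_def using V(2) bb by (subst cINF_less_iff[symmetric]) auto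
 then obtain f where f: "!!n. f n : V" "!!n. nsq M (%x. v x - f n x) < d + 1 / real (Suc n)" by metis
 define s where "s n x = v x - f n x" for n x
 have s2: "s n : L2 M" for n unfolding s_def using V(1) f(1) v by (intro L2_diff) auto
 have sd: "nsq M (s n) < d + 1 / real (Suc n)" for n using f(2)[of n] by (simp add: s_def[abs_def])
 have near: "nsq M (%x. s m x - s n x) <= 2 * (1 / real (Suc m)) + 2 * (1 / real (Suc n))" for m n
 proof -
  define h where "h = (%x. (0 + (1/2) * f m x) + (1/2) * f n x)"
  have "(%x. 0 + (1/2) * f m x) : V" by (rule V(3)[OF V(2) f(1)])
  from V(3)[OF this f(1)[of n], of "1/2"] have h: "h : V" unfolding h_def .
  have "4 * d <= 4 * nsq M (%x. v x - h x)" using dle[OF h] by simp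
  also have "... = nsq M (%x. 2 * (v x - h x))" by (subst nsq_scale) simp
  also have "(%x. 2 * (v x - h x)) = (%x. s m x + s n x)" by (auto simp: s_def h_def field_simps)
  finally show ?thesis using nsq_parallelogram[OF s2[of m] s2[of n]] sd[of m] sd[of n] by simp
 qed
 have "\<exists>N. \<forall>m\<ge>N. \<forall>n\<ge>N. nsq M (%x. s m x - s n x) < e" if "e > 0" for e
 proof -
  have "e / 4 > 0" using that by simp
  then obtain N where "inverse (real (Suc N)) < e / 4" using reals_Archimedean by blast
  then have N: "1 / real (Suc N) < e / 4" by (simp only: inverse_eq_divide)
  have "nsq M (%x. s m x - s n x) < e" if "m >= N" "n >= N" for m n
  proof -
   have "1 / real (Suc m) <= 1 / real (Suc N)" "1 / real (Suc n) <= 1 / real (Suc N)" using that by (auto intro!: divide_left_mono simp del: of_nat_Suc)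
   then show ?thesis using near[of m n] N by linarith
  qed
  then show ?thesis by blast
 qed
 from L2_complete[OF s2 this] obtain l where l: "l : L2 M" "(%n. nsq M (%x. s n x - l x)) \<longlonglongrightarrow> 0" by blast
 have orth: "ip M l g = 0" if g: "g : V" for g
 proof -
  have g2: "g : L2 M" using g V(1) by auto
  have small: "sq (ip M (s n) g) <= nsq M g / real (Suc n)" for n
  proof (cases "nsq M g = 0")
   case True
   then show ?thesis using ip_Cauchy_Schwarz[OF s2[of n] g2] by simp
  next
   case False
   then have G: "nsq M g > 0" by (simp add: less_le)
   define c where "c = - ip M (s n) g / of_real (nsq M g)"
   have "(%x. f n x + (- c) * g x) : V" by (rule V(3)[OF f(1) g])
   from dle[OF this] have "d <= nsq M (%x. s n x + c * g x)" by (simp add: s_def algebra_simps)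
   also have "... = nsq M (s n) - sq (ip M (s n) g) / nsq M g"
   proof -
    have "cnj c * ip M (s n) g = of_real (- (sq (ip M (s n) g) / nsq M g))" by (simp add: c_def of_real_cmod_sq mult.commute)
    moreover have "sq c * nsq M g = sq (ip M (s n) g) / nsq M g" using G by (simp add: c_def norm_divide power_divide power2_eq_square)
    ultimately show ?thesis unfolding nsq_lincomb[OF s2 g2] by simp
   qed
   finally have "sq (ip M (s n) g) / nsq M g <= 1 / real (Suc n)" using sd[of n] by linarith
   then show ?thesis using G by (simp add: field_simps)
  qed
  have "(%n. sq (ip M (s n) g)) \<longlonglongrightarrow> 0"
  proof (rule Lim_null_comparison)
   show "\<forall>\<^sub>F n in sequentially. norm (sq (ip M (s n) g)) <= nsq M g * (1 / real (Suc n))" using small by simp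
   show "(%n. nsq M g * (1 / real (Suc n))) \<longlonglongrightarrow> 0" using tendsto_mult[OF tendsto_const[of "nsq M g"] LIMSEQ_Suc[OF lim_1_over_n]] by simp
  qed
  moreover have "(%n. sq (ip M (s n) g)) \<longlonglongrightarrow> sq (ip M l g)" by (intro tendsto_intros ip_tendsto s2 l g2)
  ultimately have "sq (ip M l g) = 0" using LIMSEQ_unique by blast
  then show ?thesis by simp
 qed
 have "(%n. nsq M (%x. (v x - f n x) - l x)) \<longlonglongrightarrow> 0" using l(2) by (simp add: s_def)
 then show ?thesis using that[of l f] l(1) orth f(1) by blast
qed

section \<open>Orthonormal bases and evaluation\<close>

text \<open>An abstract form of the space of holomorphic sections: H is a set of objects with square-integrable realisations F, and every function orthogonal to \<open>V\<^sub>0\<close> is realised, almost everywhere, in H.\<close>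
locale hilbert_sections = fixes M :: "'a measure" and H :: "'s set" and F :: "'s => 'a => complex" and V0 :: "('a => complex) set"
 assumes F2: "!!S. S : H ==> F S : L2 M" and V02: "V0 \<subseteq> L2 M"
  and Horth: "!!S v. S : H ==> v : V0 ==> ip M (F S) v = 0"
  and Hclosed: "!!s. s : L2 M ==> (!!v. v : V0 ==> ip M s v = 0) ==> \<exists>S\<in>H. AE x in M. F S x = s x"
begin

definition onb :: "'s set => bool" where
 "onb B \<longleftrightarrow> B \<subseteq> H & (\<forall>S\<in>B. \<forall>T\<in>B. ip M (F S) (F T) = (if S = T then 1 else 0)) \<and>
   (\<forall>S\<in>H. \<forall>e>0. \<exists>A a. finite A & A \<subseteq> B & nsq M (%x. F S x - (\<Sum>T\<in>A. a T * F T x)) < e)"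

text \<open>Zorn's lemma. If a maximal orthonormal set were not dense, the normalised remainder of a projection would be orthogonal to \<open>V\<^sub>0\<close>, hence realised in H, and could be added.\<close>
lemma onb_exists: "\<exists>B. onb B"
proof -
 define \<O> where "\<O> = {B. B \<subseteq> H & (\<forall>S\<in>B. \<forall>T\<in>B. ip M (F S) (F T) = (if S = T then 1 else 0))}"
 have "\<exists>B\<in>\<O>. \<forall>X\<in>\<O>. B \<subseteq> X --> X = B"
 proof (rule subset_Zorn')
  fix C assume "subset.chain \<O> C"
  then have C: "C \<subseteq> \<O>" "!!X Y. X : C ==> Y : C ==> X \<subseteq> Y \<or> Y \<subseteq> X" by (auto simp: subset.chain_def)
  show "\<Union>C : \<O>" unfolding \<O>_def
  proof (intro CollectI conjI ballI)
   show "\<Union>C \<subseteq> H" using C(1) unfolding \<O>_def by auto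
   fix S T assume "S : \<Union>C" "T : \<Union>C"
   then obtain X Y where "X : C" "Y : C" "S : X" "T : Y" by auto
   then obtain Z where "Z : C" "S : Z" "T : Z" using C(2) by blast
   then show "ip M (F S) (F T) = (if S = T then 1 else 0)" using C(1) unfolding \<O>_def by blast
  qed
 qed
 then obtain B where B: "B : \<O>" and max: "!!X. X : \<O> ==> B \<subseteq> X ==> X = B" by blast
 have BH: "B \<subseteq> H" and orth: "!!S T. S : B ==> T : B ==> ip M (F S) (F T) = (if S = T then 1 else 0)"
  using B by (auto simp: \<O>_def)
 define V where "V = {f. \<exists>A a. finite A & A \<subseteq> B & f = (%x. \<Sum>T\<in>A. a T * F T x)}"
 have V2: "V \<subseteq> L2 M" unfolding V_def using BH F2 by (auto intro!: L2_sum)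
 have V0: "(%_. 0) : V" unfolding V_def by (intro CollectI exI[of _ "{}"]) auto
 have Vadd: "(%x. f x + c * g x) : V" if fg: "f : V" "g : V" for f g c
 proof -
  obtain A a where A: "finite A" "A \<subseteq> B" "f = (%x. \<Sum>T\<in>A. a T * F T x)" using fg(1) unfolding V_def by blast
  obtain A' a' where A': "finite A'" "A' \<subseteq> B" "g = (%x. \<Sum>T\<in>A'. a' T * F T x)" using fg(2) unfolding V_def by blast
  define b where "b T = (if T : A then a T else 0) + c * (if T : A' then a' T else 0)" for T
  have "(\<Sum>T\<in>A. a T * F T x) + c * (\<Sum>T\<in>A'. a' T * F T x) = (\<Sum>T\<in>A \<union> A'. b T * F T x)" for x
  proof -
   have 1: "(\<Sum>T\<in>A. a T * F T x) = (\<Sum>T\<in>A \<union> A'. (if T : A then a T else 0) * F T x)" using A(1) A'(1) by (intro sum.mono_neutral_cong_left) auto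
   have 2: "(\<Sum>T\<in>A'. a' T * F T x) = (\<Sum>T\<in>A \<union> A'. (if T : A' then a' T else 0) * F T x)" using A(1) A'(1) by (intro sum.mono_neutral_cong_left) auto
   show ?thesis unfolding 1 2 b_def by (simp add: sum_distrib_left sum.distrib distrib_right mult.assoc)
  qed
  then show ?thesis unfolding V_def using A A' by (intro CollectI exI[of _ "A \<union> A'"] exI[of _ b]) auto
 qed
 have dense: "\<exists>A a. finite A & A \<subseteq> B & nsq M (%x. F S x - (\<Sum>T\<in>A. a T * F T x)) < e" if S: "S : H" and e: "e > 0" for S e
 proof -
  obtain s f where s: "s : L2 M" "!!g. g : V ==> ip M s g = 0" "!!n::nat. f n : V"
   "(%n. nsq M (%x. (F S x - f n x) - s x)) \<longlonglongrightarrow> 0" using L2_projection[OF V2 V0 Vadd F2[OF S]] by blast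
  have f2: "f n : L2 M" for n using s(3) V2 by blast
  have sv: "ip M s v = 0" if v: "v : V0" for v
  proof -
   have v2: "v : L2 M" using v V02 by auto
   have "ip M (f n) v = 0" for n
   proof -
    obtain A a where A: "finite A" "A \<subseteq> B" "f n = (%x. \<Sum>T\<in>A. a T * F T x)" using s(3)[of n] unfolding V_def by blast
    have "ip M (f n) v = (\<Sum>T\<in>A. a T * ip M (F T) v)" unfolding A(3) by (rule ip_sum_left) (use A BH F2 v2 in auto)
    then show ?thesis using A(2) BH Horth[OF _ v] by (simp add: subset_iff)
   qed
   then have "ip M (%x. F S x - f n x) v = 0" for n using ip_diff_left[OF F2[OF S] f2 v2] Horth[OF S v] by simp
   moreover have "(%n. ip M (%x. F S x - f n x) v) \<longlonglongrightarrow> ip M s v" by (rule ip_tendsto[OF _ s(1) v2 s(4)]) (intro L2_diff F2 S f2)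
   ultimately show ?thesis by (simp add: LIMSEQ_const_iff)
  qed
  have "nsq M s = 0"
  proof (rule ccontr)
   assume "nsq M s ~= 0"
   then have n: "nsq M s > 0" by (simp add: less_le)
   define c where "c = complex_of_real (1 / sqrt (nsq M s))"
   have cs: "(%x. c * s x) : L2 M" by (rule L2_scale[OF s(1)])
   obtain T where T: "T : H" "AE x in M. F T x = c * s x" using Hclosed[OF cs] sv by (auto simp: ip_scale_left)
   have m: "F T : borel_measurable M" "(%x. c * s x) : borel_measurable M" using F2[OF T(1)] cs by (auto simp: L2_measurable)
   have "nsq M (F T) = nsq M (%x. c * s x)" by (rule nsq_cong_AE[OF T(2) m])
   also have "... = 1" by (subst nsq_scale) (use n in \<open>simp add: c_def norm_divide power_divide\<close>)
   finally have T1: "ip M (F T) (F T) = 1" using ip_self[OF F2[OF T(1)]] by simp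
   have TB: "ip M (F T) (F S) = 0" "ip M (F S) (F T) = 0" if "S : B" for S
   proof -
    have FS: "F S : V" unfolding V_def using that by (intro CollectI exI[of _ "{S}"] exI[of _ "%_. 1"]) auto
    have "ip M (F T) (F S) = ip M (%x. c * s x) (F S)" by (rule ip_cong_AE[OF T(2) m]) (use FS V2 L2_measurable in blast)
    then show "ip M (F T) (F S) = 0" using s(2)[OF FS] by (simp add: ip_scale_left)
    then show "ip M (F S) (F T) = 0" using ip_cnj[of M "F T" "F S"] by simp
   qed
   have TnB: "T ~: B" using TB(1)[of T] T1 by force
   have "insert T B : \<O>" unfolding \<O>_def
   proof (intro CollectI conjI ballI)
    show "insert T B \<subseteq> H" using T(1) BH by simp
    fix S S' assume "S : insert T B" "S' : insert T B"
    then consider "S = T" "S' = T" | "S = T" "S' : B" | "S : B" "S' = T" | "S : B" "S' : B" by blast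
    then show "ip M (F S) (F S') = (if S = S' then 1 else 0)"
    proof cases
     case 1 then show ?thesis using T1 by simp
    next
     case 2
     then have "S ~= S'" using TnB by blast
     then show ?thesis using TB(1)[OF 2(2)] 2(1) by simp
    next
     case 3
     then have "S ~= S'" using TnB by blast
     then show ?thesis using TB(2)[OF 3(1)] 3(2) by simp
    next
     case 4 then show ?thesis by (rule orth)
    qed
   qed
   then have "T : B" using max[of "insert T B"] by auto
   then show False using TnB by simp
  qed
  then have z: "nsq M (%x. F S x - f n x) <= nsq M (%x. (F S x - f n x) - s x) + 2 * cmod (ip M (%x. (F S x - f n x) - s x) s)" for n
   using nsq_add[OF L2_diff[OF L2_diff[OF F2[OF S] f2[of n]] s(1)] s(1)]
    complex_Re_le_cmod[of "ip M (%x. (F S x - f n x) - s x) s"] by simp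
  have "ip M (%x. (F S x - f n x) - s x) s = 0" for n
   using ip_Cauchy_Schwarz[OF L2_diff[OF L2_diff[OF F2[OF S] f2[of n]] s(1)] s(1)] \<open>nsq M s = 0\<close> by simp
  then have z': "nsq M (%x. F S x - f n x) <= nsq M (%x. (F S x - f n x) - s x)" for n using z[of n] by simp
  obtain n where "nsq M (%x. (F S x - f n x) - s x) < e" using order_tendstoD(2)[OF s(4) e] by (auto simp: eventually_sequentially)
  then have "nsq M (%x. F S x - f n x) < e" using z'[of n] by simp
  moreover obtain A a where A: "finite A" "A \<subseteq> B" "f n = (%x. \<Sum>T\<in>A. a T * F T x)" using s(3)[of n] unfolding V_def by blast
  ultimately show ?thesis by auto
 qed
 show ?thesis unfolding onb_def by (rule exI[of _ B], intro conjI ballI allI impI) (use BH orth dense in \<open>simp_all\<close>)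
qed

lemma onb_nsq_sum: assumes B: "onb B" and A: "finite A" "A \<subseteq> B" shows "nsq M (%x. \<Sum>T\<in>A. a T * F T x) = (\<Sum>T\<in>A. sq (a T))"
proof -
 let ?f = "%x. \<Sum>T\<in>A. a T * F T x"
 have F2': "F T : L2 M" if "T : A" for T using that A(2) B F2 by (auto simp: onb_def)
 have f2: "?f : L2 M" by (rule L2_sum[OF F2'])
 have "ip M (F T) ?f = cnj (a T)" if T: "T : A" for T
 proof -
  have "ip M ?f (F T) = (\<Sum>S\<in>A. a S * ip M (F S) (F T))" by (rule ip_sum_left[OF F2' F2'[OF T]])
  also have "... = (\<Sum>S\<in>A. if S = T then a S else 0)"
  proof (rule sum.cong[OF refl])
   fix S assume "S : A"
   then have "ip M (F S) (F T) = (if S = T then 1 else 0)" using B A(2) T unfolding onb_def by blast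
   then show "a S * ip M (F S) (F T) = (if S = T then a S else 0)" by simp
  qed
  also have "... = a T" using A(1) T by simp
  finally show ?thesis using ip_cnj[of M ?f "F T"] by simp
 qed
 then have "ip M ?f ?f = (\<Sum>T\<in>A. a T * cnj (a T))" using ip_sum_left[OF F2' f2, where a = a] by (simp cong: sum.cong)
 also have "... = of_real (\<Sum>T\<in>A. sq (a T))" by (simp only: complex_norm_square of_real_sum)
 finally show ?thesis using ip_self[OF f2] by (simp only: of_real_eq_iff)
qed

text \<open>The sum over a basis is the squared norm of the evaluation. One bound uses the section \<open>\<Sum> cnj (ev T) T\<close> over a finite part of the basis, the other density of the basis and the Cauchy-Schwarz inequality.\<close>
lemma kernel_bounds: fixes ev :: "'s => complex" assumes B: "onb B"
  and lin: "!!S A a c. S : H ==> finite A ==> A \<subseteq> H ==> \<exists>T\<in>H. F T = (%x. c * F S x + (\<Sum>T\<in>A. a T * F T x)) & ev T = c * ev S + (\<Sum>T\<in>A. a T * ev T)"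
  and C: "!!S. S : H ==> sq (ev S) <= C * nsq M (F S)" "C >= 0"
 shows "(\<Sum>\<^sub>\<infinity>S\<in>B. sq (ev S)) <= C"
  and "!!S. S : H ==> sq (ev S) <= (\<Sum>\<^sub>\<infinity>S\<in>B. sq (ev S)) * nsq M (F S)"
proof -
 have BH: "B \<subseteq> H" using B by (auto simp: onb_def)
 have fin: "(\<Sum>S\<in>A. sq (ev S)) <= C" if A: "finite A" "A \<subseteq> B" for A
 proof (cases "A = {}")
  case False
  then obtain S0 where S0: "S0 : A" by auto
  define q where "q = (\<Sum>S\<in>A. sq (ev S))"
  have q0: "q >= 0" unfolding q_def by (intro sum_nonneg) auto
  obtain T where T: "T : H" "F T = (%x. 0 * F S0 x + (\<Sum>T\<in>A. cnj (ev T) * F T x))" "ev T = 0 * ev S0 + (\<Sum>T\<in>A. cnj (ev T) * ev T)"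
   using lin[of S0 A 0 "%T. cnj (ev T)"] S0 A BH by blast
  have "ev T = of_real q" unfolding T(3) q_def by (simp only: complex_norm_square of_real_sum mult.commute[of "cnj _"]) simp
  moreover have "nsq M (F T) = q" unfolding T(2) q_def using onb_nsq_sum[OF B A, of "%T. cnj (ev T)"] by simp
  ultimately have "q^2 <= C * q" using C(1)[OF T(1)] by simp
  then show ?thesis unfolding q_def[symmetric] using q0 C(2) by (cases "q = 0") (auto simp: power2_eq_square)
 qed (use C in simp)
 have sm: "(%S. sq (ev S)) summable_on B" by (rule nonneg_bdd_above_summable_on) (use fin in \<open>auto intro!: bdd_aboveI2[of _ _ C]\<close>)
 show "(\<Sum>\<^sub>\<infinity>S\<in>B. sq (ev S)) <= C" by (rule infsum_le_finite_sums[OF sm fin]) auto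
 define P where "P = (\<Sum>\<^sub>\<infinity>S\<in>B. sq (ev S))"
 have P0: "P >= 0" unfolding P_def by (rule infsum_nonneg) auto
 fix S assume S: "S : H"
 define n where "n = nsq M (F S)"
 have main: "cmod (ev S) <= sqrt P * (sqrt n + t) + sqrt C * t" if t: "t > 0" for t
 proof -
  obtain A a where A: "finite A" "A \<subseteq> B" "nsq M (%x. F S x - (\<Sum>T\<in>A. a T * F T x)) < t^2"
   using B S t unfolding onb_def by (meson zero_less_power)
  have AH: "A \<subseteq> H" using A BH by auto
  define G where "G = (%x. \<Sum>T\<in>A. a T * F T x)"
  have G2: "G : L2 M" unfolding G_def by (rule L2_sum) (use AH F2 in auto)
  obtain T where T: "T : H" "F T = (%x. 1 * F S x + (\<Sum>T\<in>A. (- a T) * F T x))" "ev T = 1 * ev S + (\<Sum>T\<in>A. (- a T) * ev T)"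
   using lin[OF S A(1) AH, of 1 "%T. - a T"] by blast
  have FT: "F T = (%x. F S x - G x)" unfolding T(2) G_def by (simp add: sum_negf)
  have dt: "sqrt (nsq M (%x. F S x - G x)) <= t" using A(3) t by (intro real_le_lsqrt) (auto simp: G_def)
  have "cmod (ev T) <= sqrt (C * nsq M (F T))" using C(1)[OF T(1)] by (rule real_le_rsqrt)
  also have "... <= sqrt C * t" using dt C(2) unfolding FT by (simp add: real_sqrt_mult mult_left_mono)
  finally have 1: "cmod (ev T) <= sqrt C * t" .
  have "cmod (\<Sum>T\<in>A. a T * ev T) <= (\<Sum>T\<in>A. cmod (a T) * cmod (ev T))" by (rule order_trans[OF norm_sum]) (simp add: norm_mult)
  also have "... <= sqrt (\<Sum>T\<in>A. sq (a T)) * sqrt (\<Sum>T\<in>A. sq (ev T))"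
   using L2_set_mult_ineq[of "%T. cmod (a T)" "%T. cmod (ev T)" A] by (simp add: L2_set_def)
  also have "(\<Sum>T\<in>A. sq (a T)) = nsq M G" unfolding G_def using onb_nsq_sum[OF B A(1,2)] by simp
  also have "sqrt (nsq M G) * sqrt (\<Sum>T\<in>A. sq (ev T)) <= (sqrt n + t) * sqrt P"
  proof (intro mult_mono)
   have "sqrt (nsq M (%x. F S x + (G x - F S x))) <= sqrt (nsq M (F S)) + sqrt (nsq M (%x. G x - F S x))"
    by (rule nsq_triangle[OF F2[OF S] L2_diff[OF G2 F2[OF S]]])
   then show "sqrt (nsq M G) <= sqrt n + t" using dt by (simp add: n_def nsq_diff_commute[of M G])
   have "(\<Sum>T\<in>A. sq (ev T)) <= P" unfolding P_def by (rule finite_sum_le_infsum[OF sm A(1,2)]) auto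
   then show "sqrt (\<Sum>T\<in>A. sq (ev T)) <= sqrt P" by simp
  qed (use t n_def in \<open>auto intro!: sum_nonneg add_nonneg_nonneg\<close>)
  finally have 2: "cmod (\<Sum>T\<in>A. a T * ev T) <= sqrt P * (sqrt n + t)" by (simp add: mult.commute)
  have "ev S = ev T + (\<Sum>T\<in>A. a T * ev T)" using T(3) by (simp add: sum_negf)
  then have "cmod (ev S) <= cmod (ev T) + cmod (\<Sum>T\<in>A. a T * ev T)" by (metis norm_triangle_ineq)
  then show ?thesis using 1 2 by linarith
 qed
 have "cmod (ev S) <= sqrt P * sqrt n"
 proof (rule field_le_epsilon)
  fix e :: real assume e: "e > 0"
  define t where "t = e / (sqrt P + sqrt C + 1)"
  have den: "sqrt P + sqrt C + 1 > 0" using P0 C(2) by (intro add_nonneg_pos add_nonneg_nonneg) auto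
  then have t: "t > 0" using e by (simp add: t_def)
  have "(sqrt P + sqrt C) * t <= (sqrt P + sqrt C + 1) * t" using t by simp
  also have "... = e" using den by (simp add: t_def)
  finally show "cmod (ev S) <= sqrt P * sqrt n + e" using main[OF t] by (simp add: algebra_simps)
 qed
 then have "sq (ev S) <= (sqrt P * sqrt n)^2" by (intro power_mono) auto
 also have "... = P * n" using P0 by (simp add: power_mult_distrib n_def)
 finally show "sq (ev S) <= (\<Sum>\<^sub>\<infinity>S\<in>B. sq (ev S)) * nsq M (F S)" by (simp add: P_def n_def)
qed

end

abbreviation cinv :: "'a chart => complex => 'a" where "cinv k \<equiv> inv_into (fst k) (snd k)"

section \<open>Charts and the area measure\<close>

text \<open>A Riemann surface with a Hermitian metric on an open part Y.\<close>
locale surf = fixes A :: "('a::{t2_space,second_countable_topology}) chart set" and Y :: "'a set" and \<omega> :: "'a form11"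
 assumes RS: "riemann_surface A" and opY: "open Y" and neY: "Y ~= {}" and herm: "hermitian_metric_on A Y \<omega>"
begin

lemma chart_charts: "k : A ==> k : charts A" using RS by (auto simp: riemann_surface_def charts_def)

lemma chart_cover: "\<exists>k\<in>A. x : fst k"
proof -
 have "x : (\<Union>k\<in>A. fst k)" using RS by (simp add: riemann_surface_def)
 then show ?thesis by blast
qed

lemma chart_at: "chart_at A x : charts A" "x : fst (chart_at A x)"
proof -
 have "\<exists>k. k : charts A & x : fst k" using chart_cover[of x] chart_charts by blast
 from someI_ex[OF this] show "chart_at A x : charts A" "x : fst (chart_at A x)" by (auto simp: chart_at_def)
qed

lemma chartD: assumes "k : charts A" shows "open (fst k)" "open (snd k ` fst k)" "inj_on (snd k) (fst k)"
  "continuous_on (fst k) (snd k)" "continuous_on (snd k ` fst k) (cinv k)" using assms by (auto simp: charts_def is_chart_def homeomorphism_def split: prod.splits)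

lemma cinv_snd [simp]: "k : charts A ==> x : fst k ==> cinv k (snd k x) = x" using chartD(3) inv_into_f_f by metis

lemma open_chart_image: assumes "k : charts A" "open S" shows "open (snd k ` (fst k Int S))"
proof -
 have "open (snd k ` fst k Int cinv k -` S)" by (rule continuous_open_preimage[OF chartD(5,2)[OF assms(1)] assms(2)])
 moreover have "snd k ` (fst k Int S) = snd k ` fst k Int cinv k -` S" using assms(1) by (auto simp: image_iff)
 ultimately show ?thesis by simp
qed

lemma transition_snd: "k : charts A ==> x : fst k ==> transition k l (snd k x) = snd l x" by (simp add: transition_def split_beta)

lemma compatible_A: "k : charts A ==> m : A ==> transition k m holomorphic_on snd k ` (fst k Int fst m)
  & transition m k holomorphic_on snd m ` (fst k Int fst m)" by (auto simp: charts_def compatible_def)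

lemma transition_holomorphic: assumes k: "k : charts A" and l: "l : charts A" shows "transition k l holomorphic_on snd k ` (fst k Int fst l)"
proof -
 have "transition k l field_differentiable at w" if w: "w : snd k ` (fst k Int fst l)" for w
 proof -
  obtain x where x: "x : fst k" "x : fst l" "w = snd k x" using w by auto
  obtain m where m: "m : A" "x : fst m" using chart_cover by blast
  have mc: "m : charts A" using chart_charts m by auto
  define O1 where "O1 = snd k ` (fst k Int (fst l Int fst m))"
  have O1: "open O1" unfolding O1_def using chartD(1)[OF l] chartD(1)[OF mc] by (intro open_chart_image[OF k]) auto
  have h1: "transition k m holomorphic_on O1" by (rule holomorphic_on_subset[OF compatible_A[OF k m(1), THEN conjunct1]]) (auto simp: O1_def)
  have h2: "transition m l holomorphic_on snd m ` (fst l Int fst m)" using compatible_A[OF l m(1)] by simp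
  have "(transition m l \<circ> transition k m) holomorphic_on O1" by (rule holomorphic_on_compose_gen[OF h1 h2]) (auto simp: O1_def transition_snd[OF k])
  then have "transition k l holomorphic_on O1" by (rule holomorphic_transform) (auto simp: O1_def transition_snd[OF k] transition_snd[OF mc])
  moreover have "w : O1" using x m by (auto simp: O1_def)
  ultimately show ?thesis using O1 holomorphic_on_imp_differentiable_at by blast
 qed
 then show ?thesis by (auto simp: holomorphic_on_def field_differentiable_at_within)
qed

lemma open_overlap: "k : charts A ==> l : charts A ==> open (snd k ` (fst k Int fst l))"
 by (rule open_chart_image) (auto dest: chartD)

lemma transition_inj: "k : charts A ==> l : charts A ==> inj_on (transition k l) (snd k ` (fst k Int fst l))"
 by (auto intro!: inj_onI simp: transition_snd dest: inj_onD[OF chartD(3)[of l]])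

lemma jac_chain: assumes "k : charts A" "l : charts A" "m : charts A" "x : fst k" "x : fst l" "x : fst m" shows "jac k m x = jac k l x * jac l m x"
proof -
 define O1 where "O1 = snd k ` (fst k Int (fst l Int fst m))"
 have O1: "open O1" unfolding O1_def using chartD(1)[OF assms(2)] chartD(1)[OF assms(3)] by (intro open_chart_image[OF assms(1)]) auto
 have x: "snd k x : O1" using assms by (auto simp: O1_def)
 have d1: "(transition k l has_field_derivative jac k l x) (at (snd k x))"
  unfolding jac_def by (rule holomorphic_derivI[OF transition_holomorphic[OF assms(1,2)] open_overlap[OF assms(1,2)]]) (use assms(4-6) in blast)
 have d2: "(transition l m has_field_derivative jac l m x) (at (transition k l (snd k x)))" unfolding jac_def transition_snd[OF assms(1,4)]
  by (rule holomorphic_derivI[OF transition_holomorphic[OF assms(2,3)] open_overlap[OF assms(2,3)]]) (use assms(4-6) in blast)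
 have "(transition l m \<circ> transition k l has_field_derivative jac l m x * jac k l x) (at (snd k x))" by (rule DERIV_chain[OF d2 d1])
 then have "(transition k m has_field_derivative jac l m x * jac k l x) (at (snd k x))" by (rule has_field_derivative_transform_within_open[OF _ O1 x])
   (auto simp: O1_def transition_snd assms)
 then show ?thesis by (simp add: jac_def[of k m] DERIV_imp_deriv mult.commute)
qed

lemma jac_self: "k : charts A ==> x : fst k ==> jac k k x = 1"
proof -
 assume k: "k : charts A" "x : fst k"
 have "((%w. w) has_field_derivative 1) (at (snd k x))" by (rule DERIV_ident)
 then have "(transition k k has_field_derivative 1) (at (snd k x))" by (rule has_field_derivative_transform_within_open[OF _ chartD(2)[OF k(1)]])
   (use k in \<open>auto simp: transition_snd\<close>)
 then show ?thesis by (simp add: jac_def DERIV_imp_deriv)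
qed

lemma jac_inverse: assumes "k : charts A" "l : charts A" "x : fst k" "x : fst l" shows "jac k l x * jac l k x = 1" "jac k l x ~= 0"
 using jac_chain[OF assms(1,2,1,3,4,3)] jac_self[OF assms(1,3)] by auto

text \<open>The image of Y in the coordinate k.\<close>
definition W :: "'a chart => complex set" where "W k = snd k ` (fst k Int Y)"

definition rho :: "'a chart => complex => real" where "rho k = in_coord k (\<omega> k)"

lemma open_W: "k : charts A ==> open (W k)" unfolding W_def by (rule open_chart_image[OF _ opY])

lemma rho_snd: "k : charts A ==> x : fst k ==> rho k (snd k x) = \<omega> k x" by (simp add: rho_def in_coord_def)

lemma omega_pos: "k : charts A ==> x : fst k ==> x : Y ==> \<omega> k x > 0"
 using herm unfolding hermitian_metric_on_def by blast

lemma omega_law: "k : charts A ==> l : charts A ==> x : fst k ==> x : fst l ==> x : Y ==>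
  \<omega> k x = \<omega> l x * sq (jac k l x)" using herm unfolding hermitian_metric_on_def by blast

lemma rho_pos: "k : charts A ==> w : W k ==> rho k w > 0" by (auto simp: W_def rho_snd omega_pos)

lemma rho_smooth: "k : charts A ==> Ck_on n (rho k) (W k)" using herm unfolding hermitian_metric_on_def smooth_on_def rho_def W_def by blast

lemma rho_continuous: "k : charts A ==> continuous_on (W k) (rho k)" using rho_smooth[of k 0] by simp

lemma WE: "k : charts A ==> w : W k ==> (!!x. x : fst k ==> x : Y ==> w = snd k x ==> cinv k w = x ==> P) ==> P"
 by (auto simp: W_def)

lemma borel_chart_image: assumes "k : charts A" "E : sets borel" "E \<subseteq> fst k" shows "snd k ` E : sets borel"
proof -
 have "cinv k : borel_measurable (restrict_space borel (snd k ` fst k))" by (intro borel_measurable_continuous_on_restrict chartD assms)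
 then have "cinv k -` E Int space (restrict_space borel (snd k ` fst k)) : sets (restrict_space borel (snd k ` fst k))" using assms(2) by (rule measurable_sets)
 moreover have "cinv k -` E Int space (restrict_space borel (snd k ` fst k)) = snd k ` E" using assms by (auto simp: space_restrict_space image_iff)
 ultimately show ?thesis using chartD(2)[OF assms(1)] by (simp add: sets_restrict_space_iff)
qed

definition rhoW :: "'a chart => complex => ennreal" where "rhoW k w = ennreal (indicator (W k) w *\<^sub>R rho k w)"

lemma rhoW_measurable [measurable]: "k : charts A ==> rhoW k : borel_measurable borel" unfolding rhoW_def
 by (intro measurable_compose[OF _ measurable_ennreal] borel_measurable_continuous_on_indicator rho_continuous) (use open_W in auto)

definition cm :: "'a chart => 'a set => ennreal" where "cm k E = (\<integral>\<^sup>+w\<in>snd k ` E. ennreal (rho k w) \<partial>lborel)"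

lemma cm_rhoW: "E \<subseteq> fst k Int Y ==> cm k E = (\<integral>\<^sup>+w\<in>snd k ` E. rhoW k w \<partial>lborel)"
 unfolding cm_def rhoW_def by (intro nn_integral_cong) (auto simp: W_def indicator_def)

text \<open>Under a change of coordinates \<open>\<rho>\<close> is multiplied by the Jacobian determinant.\<close>
lemma cm_invariant: assumes k: "k : charts A" and l: "l : charts A" and E: "E : sets borel" "E \<subseteq> fst k" "E \<subseteq> fst l" "E \<subseteq> Y"
 shows "cm k E = cm l E"
proof -
 let ?t = "transition k l"
 let ?U = "snd k ` (fst k Int fst l)"
 have im: "?t ` (snd k ` E) = snd l ` E" using E by (force simp: image_image transition_snd[OF k] subset_iff)
 have "cm l E = (\<integral>\<^sup>+y\<in>?t ` (snd k ` E). rhoW l y \<partial>lborel)" unfolding im using E by (intro cm_rhoW) auto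
 also have "... = (\<integral>\<^sup>+w\<in>snd k ` E. rhoW l (?t w) * ennreal (sq (deriv ?t w)) \<partial>lborel)"
  by (rule nn_integral_holomorphic_image[OF open_overlap[OF k l] transition_holomorphic[OF k l] transition_inj[OF k l]
    borel_chart_image[OF k E(1,2)]]) (use E l in auto)
 also have "... = cm k E" unfolding cm_def
 proof (rule nn_integral_cong)
  fix w
  show "rhoW l (?t w) * ennreal (sq (deriv ?t w)) * indicator (snd k ` E) w = ennreal (rho k w) * indicator (snd k ` E) w"
  proof (cases "w : snd k ` E")
   case True
   then obtain x where x: "x : E" "w = snd k x" by auto
   then have xs: "x : fst k" "x : fst l" "x : Y" using E by auto
   have "rhoW l (?t w) = ennreal (\<omega> l x)" using xs by (simp add: x(2) transition_snd[OF k] rhoW_def W_def rho_snd[OF l])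
   moreover have "rho k w = \<omega> l x * sq (deriv ?t w)" using omega_law[OF k l xs] by (simp add: x(2) rho_snd[OF k xs(1)] jac_def)
   ultimately show ?thesis using omega_pos[OF l xs(2,3)] by (simp add: ennreal_mult)
  qed simp
 qed
 finally show ?thesis by simp
qed

lemma countable_charts: "\<exists>K::nat => 'a chart. (\<forall>n. K n : charts A) & (\<Union>n. fst (K n)) = UNIV"
proof -
 obtain F where F: "F \<subseteq> fst ` charts A" "countable F" "\<Union>F = \<Union>(fst ` charts A)"
  using Lindelof[of "fst ` charts A"] chartD(1) by (metis (no_types, lifting) imageE)
 have U: "\<Union>F = UNIV" using F(3) chart_at by blast
 have ne: "F ~= {}" using U by auto
 define f where "f = from_nat_into F"
 have f: "range f = F" unfolding f_def by (rule range_from_nat_into[OF ne F(2)])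
 have "\<exists>k\<in>charts A. fst k = f n" for n using f F(1) by (metis (no_types, lifting) imageE rangeI subsetD)
 then obtain K where K: "!!n. K n : charts A & fst (K n) = f n" by metis
 then show ?thesis using f U by (intro exI[of _ K]) auto
qed

definition CK0 :: "nat => 'a chart" where "CK0 = (SOME K. (\<forall>n. K n : charts A) & (\<Union>n. fst (K n)) = UNIV)"

lemma CK0: "CK0 n : charts A" "(\<Union>n. fst (CK0 n)) = UNIV" using someI_ex[OF countable_charts] by (auto simp: CK0_def)

text \<open>A countable measurable partition of Y into pieces of charts, on which the area measure is assembled.\<close>
definition DD :: "nat => 'a set" where "DD n = (fst (CK0 n) Int Y) - (\<Union>m<n. fst (CK0 m))"

lemma DD_borel: "DD n : sets borel" unfolding DD_def using chartD(1)[OF CK0(1)] opY by (intro sets.Diff borel_open open_UN) auto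

lemma DD_sub: "DD n \<subseteq> fst (CK0 n)" "DD n \<subseteq> Y" by (auto simp: DD_def)

lemma DD_disjoint: "disjoint_family DD" unfolding disjoint_family_on_def DD_def by (auto simp: linorder_neq_iff)

lemma DD_union: "(\<Union>n. DD n) = Y"
proof -
 have "\<exists>n. x : DD n" if "x : Y" for x
 proof -
  have "\<exists>n. x : fst (CK0 n)" using CK0(2) by blast
  then have "x : fst (CK0 (LEAST n. x : fst (CK0 n)))" by (rule LeastI_ex)
  moreover have "\<forall>m<(LEAST n. x : fst (CK0 n)). x ~: fst (CK0 m)" using not_less_Least by blast
  ultimately show ?thesis using that unfolding DD_def by blast
 qed
 then show ?thesis using DD_sub(2) by blast
qed

abbreviation BY :: "'a measure" where "BY \<equiv> restrict_space borel Y"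

lemma sets_BY: "E : sets BY \<longleftrightarrow> E : sets borel & E \<subseteq> Y" using opY by (auto simp: sets_restrict_space_iff)

lemma space_BY [simp]: "space BY = Y" by (simp add: space_restrict_space)

definition y0 :: 'a where "y0 = (SOME y. y : Y)"

lemma y0: "y0 : Y" unfolding y0_def using neY by (rule some_in_eq[THEN iffD2])

definition tot :: "'a chart => complex => 'a" where "tot k w = (if w : W k then cinv k w else y0)"

lemma tot_measurable [measurable]: assumes k: "k : charts A" shows "tot k : measurable borel BY"
proof (rule measurable_restrict_space2)
 show "tot k : space borel \<rightarrow> Y" using y0 k by (auto simp: tot_def elim!: WE[OF k])
 have "continuous_on (W k) (cinv k)" by (rule continuous_on_subset[OF chartD(5)[OF k]]) (auto simp: W_def)
 then have "cinv k : borel_measurable (restrict_space borel (W k))" by (rule borel_measurable_continuous_on_restrict)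
 then show "tot k : borel_measurable borel" unfolding tot_def using open_W[OF k] by (intro measurable_If_restrict_space_iff[THEN iffD2]) auto
qed

definition Nk :: "'a chart => 'a measure" where "Nk k = distr (density lborel (rhoW k)) BY (tot k)"

lemma emeasure_Nk: assumes k: "k : charts A" and E: "E : sets BY" shows "emeasure (Nk k) E = cm k (E Int fst k)"
proof -
 have [measurable]: "k : charts A" by fact
 have "emeasure (Nk k) E = emeasure (density lborel (rhoW k)) (tot k -` E)" unfolding Nk_def using E k by (subst emeasure_distr) auto
 also have "... = (\<integral>\<^sup>+w. rhoW k w * indicator (tot k -` E) w \<partial>lborel)"
  using measurable_sets[OF tot_measurable[OF k] E] k by (subst emeasure_density) auto
 also have "... = cm k (E Int fst k)"
  unfolding cm_rhoW[of "E Int fst k" k, OF le_infI1[OF sets_BY[THEN iffD1, OF E, THEN conjunct2], THEN Int_greatest[OF Int_lower2]]]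
 proof (rule nn_integral_cong)
  fix w
  show "rhoW k w * indicator (tot k -` E) w = rhoW k w * indicator (snd k ` (E Int fst k)) w"
  proof (cases "w : W k")
   case True
   then obtain x where x: "x : fst k" "x : Y" "w = snd k x" "cinv k w = x" by (rule WE[OF k])
   have "w : snd k ` (E Int fst k) \<longleftrightarrow> x : E" using x k by (auto simp: image_iff) (metis cinv_snd)
   then show ?thesis using True x by (simp add: tot_def indicator_def)
  qed (simp add: rhoW_def)
 qed
 finally show ?thesis .
qed

definition M0 :: "'a measure" where "M0 = measure_of Y (sets BY) (%E. \<integral>\<^sup>+n. emeasure (Nk (CK0 n)) (E Int DD n) \<partial>count_space UNIV)"

lemma sets_Nk: "sets (Nk k) = sets BY" by (simp add: Nk_def)

lemma DD_BY: "E : sets BY ==> E Int DD n : sets BY" unfolding sets_BY using DD_borel by auto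

lemma sets_M0 [simp]: "sets M0 = sets BY" unfolding M0_def using sets.space_closed[of BY] sets.sigma_sets_eq[of BY] by simp

lemma emeasure_M0: assumes E: "E : sets BY" shows "emeasure M0 E = (\<integral>\<^sup>+n. emeasure (Nk (CK0 n)) (E Int DD n) \<partial>count_space UNIV)"
proof (rule emeasure_measure_of[OF M0_def])
 show "sets BY \<subseteq> Pow Y" using sets.space_closed[of BY] by simp
 show "positive (sets M0) (%E. \<integral>\<^sup>+n. emeasure (Nk (CK0 n)) (E Int DD n) \<partial>count_space UNIV)" by (simp add: positive_def)
 show "countably_additive (sets M0) (%E. \<integral>\<^sup>+n. emeasure (Nk (CK0 n)) (E Int DD n) \<partial>count_space UNIV)"
 proof (rule countably_additiveI)
  fix F :: "nat => 'a set"
  assume F: "range F \<subseteq> sets M0" "disjoint_family F"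
  have "(\<Sum>i. \<integral>\<^sup>+n. emeasure (Nk (CK0 n)) (F i Int DD n) \<partial>count_space UNIV) =
    (\<integral>\<^sup>+n. (\<Sum>i. emeasure (Nk (CK0 n)) (F i Int DD n)) \<partial>count_space UNIV)" by (rule nn_integral_suminf[symmetric]) simp
  also have "... = (\<integral>\<^sup>+n. emeasure (Nk (CK0 n)) (\<Union>i. F i Int DD n) \<partial>count_space UNIV)"
  proof (rule nn_integral_cong, rule suminf_emeasure)
   fix n show "range (%i. F i Int DD n) \<subseteq> sets (Nk (CK0 n))" unfolding sets_Nk using F(1) DD_BY by auto
   show "disjoint_family (%i. F i Int DD n)" using F(2) by (auto simp: disjoint_family_on_def)
  qed
  finally show "(\<Sum>i. \<integral>\<^sup>+n. emeasure (Nk (CK0 n)) (F i Int DD n) \<partial>count_space UNIV) =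
    (\<integral>\<^sup>+n. emeasure (Nk (CK0 n)) ((\<Union>i. F i) Int DD n) \<partial>count_space UNIV)" by simp
 qed
qed (use E in simp)

lemma M0_chart: assumes k: "k : charts A" and E: "E : sets BY" "E \<subseteq> fst k" shows "emeasure M0 E = cm k E"
proof -
 have "emeasure (Nk (CK0 n)) (E Int DD n) = emeasure (Nk k) (E Int DD n)" for n
 proof -
  have "emeasure (Nk (CK0 n)) (E Int DD n) = cm (CK0 n) (E Int DD n)"
   using emeasure_Nk[OF CK0(1) DD_BY[OF E(1)], of n n] DD_sub(1)[of n] by (simp add: Int_absorb2 inf.coboundedI2)
  also have "... = cm k (E Int DD n)" using DD_BY[OF E(1), of n] E(2) DD_sub[of n] by (intro cm_invariant CK0 k) (auto simp: sets_BY)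
  also have "... = emeasure (Nk k) (E Int DD n)" using emeasure_Nk[OF k DD_BY[OF E(1)], of n] E(2) by (simp add: Int_absorb2 le_infI1)
  finally show ?thesis .
 qed
 then have "emeasure M0 E = (\<Sum>n. emeasure (Nk k) (E Int DD n))" by (simp add: emeasure_M0[OF E(1)] nn_integral_count_space_nat)
 also have "... = emeasure (Nk k) (\<Union>n. E Int DD n)" using DD_disjoint by (intro suminf_emeasure) (auto simp: sets_Nk DD_BY[OF E(1)] disjoint_family_on_def)
 also have "(\<Union>n. E Int DD n) = E" using DD_union E(1) by (auto simp: sets_BY)
 also have "emeasure (Nk k) E = cm k E" using emeasure_Nk[OF k E(1)] E(2) by (simp add: Int_absorb2)
 finally show ?thesis .
qed

abbreviation AM :: "'a measure" where "AM \<equiv> area_measure A Y \<omega>"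

text \<open>Two measures with the defining property agree on each piece of the countable partition, hence everywhere.\<close>
lemma AM_eq: "AM = M0" unfolding area_measure_def
proof (rule the_equality)
 show "sets M0 = sets BY & (\<forall>k\<in>charts A. \<forall>E\<in>sets M0. E \<subseteq> fst k -->
   emeasure M0 E = (\<integral>\<^sup>+w\<in>snd k ` E. ennreal (in_coord k (\<omega> k) w) \<partial>lborel))" using M0_chart by (simp add: cm_def rho_def)
 fix M assume M: "sets M = sets BY & (\<forall>k\<in>charts A. \<forall>E\<in>sets M. E \<subseteq> fst k -->
   emeasure M E = (\<integral>\<^sup>+w\<in>snd k ` E. ennreal (in_coord k (\<omega> k) w) \<partial>lborel))"
 show "M = M0"
 proof (rule measure_eqI)
  show "sets M = sets M0" using M by simp
  fix E assume "E : sets M"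
  then have E: "E : sets BY" using M by simp
  have u: "(\<Union>n. E Int DD n) = E" using DD_union E by (auto simp: sets_BY)
  have "emeasure M (E Int DD n) = emeasure M0 (E Int DD n)" for n
  proof -
   have "E Int DD n \<subseteq> fst (CK0 n)" using DD_sub(1) by auto
   then show ?thesis using M CK0(1)[of n] DD_BY[OF E, of n] M0_chart[OF CK0(1) DD_BY[OF E], of n n] by (simp add: cm_def rho_def)
  qed
  moreover have "(\<Sum>n. emeasure M (E Int DD n)) = emeasure M (\<Union>n. E Int DD n)"
   using DD_disjoint M by (intro suminf_emeasure) (auto simp: DD_BY[OF E] disjoint_family_on_def)
  moreover have "(\<Sum>n. emeasure M0 (E Int DD n)) = emeasure M0 (\<Union>n. E Int DD n)"
   using DD_disjoint by (intro suminf_emeasure) (auto simp: DD_BY[OF E] disjoint_family_on_def)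
  ultimately have "emeasure M (\<Union>n. E Int DD n) = emeasure M0 (\<Union>n. E Int DD n)" by (simp only:)
  then show "emeasure M E = emeasure M0 E" by (simp only: u)
 qed
qed

lemma sets_AM [measurable_cong]: "sets AM = sets BY" by (simp add: AM_eq)

lemma space_AM [simp]: "space AM = Y" using sets_eq_imp_space_eq[OF sets_AM] by simp

lemma chart_sets_AM: "k : charts A ==> fst k Int Y : sets AM" unfolding sets_AM sets_BY using chartD(1) opY by auto

lemma density_chart: assumes k: "k : charts A" shows "density AM (indicator (fst k Int Y)) = Nk k"
proof (rule measure_eqI)
 show "sets (density AM (indicator (fst k Int Y))) = sets (Nk k)" by (simp add: sets_AM sets_Nk)
 fix E assume "E : sets (density AM (indicator (fst k Int Y)))"
 then have E: "E : sets BY" by (simp add: sets_AM)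
 have s: "fst k Int Y : sets BY" using chart_sets_AM[OF k] by (simp add: sets_AM)
 have EY: "E \<subseteq> Y" using E by (simp add: sets_BY)
 have "emeasure (density AM (indicator (fst k Int Y))) E = emeasure AM ((fst k Int Y) Int E)"
  using E s by (subst emeasure_density) (auto simp: sets_AM simp flip: indicator_inter_arith)
 also have "(fst k Int Y) Int E = E Int fst k" using EY by auto
 also have "emeasure AM (E Int fst k) = cm k (E Int fst k)"
 proof -
  have "E Int fst k = E Int (fst k Int Y)" using EY by auto
  then have "E Int fst k : sets BY" using sets.Int[OF E s] by simp
  then show ?thesis unfolding AM_eq by (intro M0_chart[OF k]) auto
 qed
 also have "... = emeasure (Nk k) E" by (rule emeasure_Nk[OF k E, symmetric])
 finally show "emeasure (density AM (indicator (fst k Int Y))) E = emeasure (Nk k) E" .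
qed

lemma nn_integral_chart: assumes k: "k : charts A" and f [measurable]: "f : borel_measurable AM"
 shows "(\<integral>\<^sup>+x\<in>fst k. f x \<partial>AM) = (\<integral>\<^sup>+w\<in>W k. f (cinv k w) * ennreal (rho k w) \<partial>lborel)"
proof -
 have [measurable]: "k : charts A" by fact
 have fB: "f : borel_measurable BY" using f measurable_cong_sets[OF sets_AM] by blast
 have "(\<integral>\<^sup>+x\<in>fst k. f x \<partial>AM) = (\<integral>\<^sup>+x. indicator (fst k Int Y) x * f x \<partial>AM)"
  by (intro nn_integral_cong) (auto simp: indicator_def)
 also have "... = (\<integral>\<^sup>+x. f x \<partial>density AM (indicator (fst k Int Y)))"
  by (rule nn_integral_density[symmetric]) (use chart_sets_AM[OF k] in auto)
 also have "... = (\<integral>\<^sup>+x. f x \<partial>Nk k)" by (simp only: density_chart[OF k])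
 also have "... = (\<integral>\<^sup>+w. f (tot k w) \<partial>density lborel (rhoW k))" unfolding Nk_def using fB k by (intro nn_integral_distr) auto
 also have "... = (\<integral>\<^sup>+w. rhoW k w * f (tot k w) \<partial>lborel)"
  using fB k by (intro nn_integral_density) (auto intro: measurable_compose[OF tot_measurable])
 also have "... = (\<integral>\<^sup>+w\<in>W k. f (cinv k w) * ennreal (rho k w) \<partial>lborel)"
  by (intro nn_integral_cong) (auto simp: rhoW_def tot_def indicator_def mult.commute)
 finally show ?thesis .
qed

lemma integral_chart: fixes f :: "'a => complex"
 assumes k: "k : charts A" and f [measurable]: "f : borel_measurable AM" and z: "!!x. x : Y ==> x ~: fst k ==> f x = 0"
 shows "integrable AM f \<longleftrightarrow> integrable lborel (%w. indicator (W k) w *\<^sub>R (of_real (rho k w) * f (cinv k w)))"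
  "(LINT x|AM. f x) = (LINT w|lborel. indicator (W k) w *\<^sub>R (of_real (rho k w) * f (cinv k w)))"
proof -
 have [measurable]: "k : charts A" by fact
 have fB: "f : borel_measurable BY" using f measurable_cong_sets[OF sets_AM] by blast
 have tm: "(%w. f (tot k w)) : borel_measurable borel" by (rule measurable_compose[OF tot_measurable[OF k] fB])
 define r where "r w = indicator (W k) w *\<^sub>R rho k w" for w
 have r: "rhoW k = (%w. ennreal (r w))" "r : borel_measurable borel" "!!w. r w >= 0"
 proof -
  show "rhoW k = (%w. ennreal (r w))" by (simp add: rhoW_def r_def fun_eq_iff)
  show "r : borel_measurable borel" unfolding r_def using open_W[OF k] by (intro borel_measurable_continuous_on_indicator rho_continuous k) auto
  show "r w >= 0" for w using rho_pos[OF k, of w] by (auto simp: r_def indicator_def intro: less_imp_le)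
 qed
 have e1: "(%w. r w *\<^sub>R f (tot k w)) = (%w. indicator (W k) w *\<^sub>R (of_real (rho k w) * f (cinv k w)))"
  by (auto simp: fun_eq_iff r_def tot_def indicator_def scaleR_conv_of_real)
 have ind: "indicator (fst k Int Y) = (%x. ennreal (indicator (fst k Int Y) x))" by (auto simp: indicator_def)
 have im: "indicator (fst k Int Y) : borel_measurable AM" for r using chart_sets_AM[OF k] by (rule borel_measurable_indicator)
 have e2: "integrable AM f \<longleftrightarrow> integrable AM (%x. indicator (fst k Int Y) x *\<^sub>R f x)"
  "(LINT x|AM. f x) = (LINT x|AM. indicator (fst k Int Y) x *\<^sub>R f x)"
  by (rule Bochner_Integration.integrable_cong Bochner_Integration.integral_cong, simp, use z in \<open>auto simp: indicator_def\<close>)+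
 have ir: "(indicator (fst k Int Y) :: 'a => real) : borel_measurable AM" using chart_sets_AM[OF k] by (rule borel_measurable_indicator)
 have "integrable AM (%x. indicator (fst k Int Y) x *\<^sub>R f x) \<longleftrightarrow> integrable (density AM (indicator (fst k Int Y))) f"
  unfolding ind using f ir by (subst integrable_density) auto
 also have "... \<longleftrightarrow> integrable (density lborel (%w. ennreal (r w))) (%w. f (tot k w))"
  unfolding density_chart[OF k] Nk_def r(1) using fB k by (intro integrable_distr_eq) auto
 also have "... \<longleftrightarrow> integrable lborel (%w. r w *\<^sub>R f (tot k w))" using tm r by (intro integrable_density) auto
 finally show "integrable AM f \<longleftrightarrow> integrable lborel (%w. indicator (W k) w *\<^sub>R (of_real (rho k w) * f (cinv k w)))"
  unfolding e1 using e2(1) by simp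
 have "(LINT x|AM. indicator (fst k Int Y) x *\<^sub>R f x) = (LINT x|density AM (indicator (fst k Int Y)). f x)"
  unfolding ind using f ir by (subst integral_density) auto
 also have "... = (LINT w|density lborel (%w. ennreal (r w)). f (tot k w))" unfolding density_chart[OF k] Nk_def r(1) using fB k by (intro integral_distr) auto
 also have "... = (LINT w|lborel. r w *\<^sub>R f (tot k w))" using tm r by (intro integral_density) auto
 finally show "(LINT x|AM. f x) = (LINT w|lborel. indicator (W k) w *\<^sub>R (of_real (rho k w) * f (cinv k w)))" unfolding e1 using e2(2) by simp
qed

lemma chart_null: assumes k: "k : charts A" and P: "AE w in lborel. w : W k --> P (cinv k w)" shows "AE x in AM. x : fst k --> P x"
proof -
 obtain N where N: "{w : space lborel. \<not> (w : W k --> P (cinv k w))} \<subseteq> N" "N : sets lborel" "emeasure lborel N = 0"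
  using P by (rule AE_E)
 define B where "B = {x : Y. x : fst k & snd k x : N}"
 have im: "snd k ` B = N Int W k" by (auto simp: B_def W_def)
 have "B = (%x. x) -` B" by simp
 have Bs: "B : sets BY"
 proof -
  have m: "snd k : borel_measurable (restrict_space borel (fst k))" by (rule borel_measurable_continuous_on_restrict[OF chartD(4)[OF k]])
  have "snd k -` N Int space (restrict_space borel (fst k)) : sets (restrict_space borel (fst k))" by (rule measurable_sets[OF m]) (use N(2) in simp)
  then have "snd k -` N Int fst k : sets borel" using chartD(1)[OF k] by (simp add: sets_restrict_space_iff space_restrict_space)
  then have "(snd k -` N Int fst k) Int Y : sets borel" using opY by auto
  moreover have "(snd k -` N Int fst k) Int Y = B" by (auto simp: B_def)
  ultimately show ?thesis unfolding sets_BY by (auto simp: B_def)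
 qed
 have "emeasure AM B = cm k B" unfolding AM_eq by (rule M0_chart[OF k Bs]) (auto simp: B_def)
 also have "... = (\<integral>\<^sup>+w. 0 \<partial>(lborel :: complex measure))" unfolding cm_def im
 proof (rule nn_integral_cong_AE)
  have "AE w in lborel. w ~: N" using N by (intro AE_not_in null_setsI) auto
  then show "AE w in lborel. ennreal (rho k w) * indicator (N Int W k) w = 0" by eventually_elim auto
 qed
 finally have "B : null_sets AM" using Bs by (intro null_setsI) (auto simp: sets_AM)
 from AE_not_in[OF this] AE_space show ?thesis
 proof eventually_elim
  case (elim x)
  show ?case
  proof
   assume x: "x : fst k"
   have "snd k x : W k" "cinv k (snd k x) = x" using x elim k by (auto simp: W_def)
   moreover have "snd k x ~: N" using elim x by (auto simp: B_def)
   ultimately show "P x" using N(1) by force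
  qed
 qed
qed

lemma null_chart: assumes k: "k : charts A" and P: "AE x in AM. P x" shows "AE w in lborel. w : W k --> P (cinv k w)"
proof -
 obtain N where N: "{x : space AM. \<not> P x} \<subseteq> N" "N : sets AM" "emeasure AM N = 0" using P by (rule AE_E)
 define B where "B = N Int (fst k Int Y)"
 have Bs: "B : sets AM" unfolding B_def using N(2) chart_sets_AM[OF k] by (rule sets.Int)
 then have Bs': "B : sets BY" "B : sets borel" "B \<subseteq> fst k" by (auto simp: sets_AM sets_BY B_def)
 have "emeasure AM B <= emeasure AM N" by (rule emeasure_mono) (auto simp: B_def N)
 then have "cm k B = 0" using N(3) M0_chart[OF k Bs'(1,3)] by (simp add: AM_eq)
 then have z: "(\<integral>\<^sup>+w\<in>snd k ` B. rhoW k w \<partial>lborel) = 0" by (subst cm_rhoW[symmetric]) (auto simp: B_def)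
 have [measurable]: "snd k ` B : sets borel" by (rule borel_chart_image[OF k Bs'(2,3)])
 have m: "(%w. rhoW k w * indicator (snd k ` B) w) : borel_measurable lborel" using rhoW_measurable[OF k] by measurable
 have "AE w in lborel. rhoW k w * indicator (snd k ` B) w = 0" using z nn_integral_0_iff_AE[OF m] by blast
 then show ?thesis
 proof eventually_elim
  case (elim w)
  show ?case
  proof
   assume w: "w : W k"
   then obtain x where x: "x : fst k" "x : Y" "w = snd k x" "cinv k w = x" by (rule WE[OF k])
   have "rhoW k w > 0" using rho_pos[OF k w] w by (simp add: rhoW_def)
   then have "w ~: snd k ` B" using elim by (auto simp: indicator_def split: if_splits)
   then have "x ~: N" using x by (auto simp: B_def)
   then show "P (cinv k w)" using N(1) x by auto
  qed
 qed
qed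

end

context surf
begin

section \<open>Sections and their norms\<close>

text \<open>A measurable choice of charts; it makes global functions out of sections.\<close>
definition sel :: "'a => 'a chart" where "sel x = CK0 (LEAST n. x : fst (CK0 n))"

lemma sel: "sel x : charts A" "x : fst (sel x)"
proof -
 show "sel x : charts A" unfolding sel_def by (rule CK0)
 have "\<exists>n. x : fst (CK0 n)" using CK0(2) by blast
 then show "x : fst (sel x)" unfolding sel_def by (rule LeastI_ex)
qed

lemma sel_DD: "x : DD n ==> sel x = CK0 n" unfolding sel_def DD_def by (auto intro!: arg_cong[of _ _ CK0] Least_equality simp: not_less[symmetric])

lemma snd_measurable: assumes k: "k : charts A" and S: "S \<subseteq> fst k" "S \<subseteq> Y" "S : sets borel"
 shows "snd k : borel_measurable (restrict_space AM S)"
proof -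
 have "snd k : borel_measurable (restrict_space borel (fst k))" by (rule borel_measurable_continuous_on_restrict[OF chartD(4)[OF k]])
 then have "snd k : borel_measurable (restrict_space borel S)" using S(1) by (rule measurable_restrict_mono)
 moreover have "sets (restrict_space AM S) = sets (restrict_space borel S)"
 proof -
  have "sets (restrict_space AM S) = sets (restrict_space BY S)" by (rule sets_restrict_space_cong[OF sets_AM])
  also have "restrict_space BY S = restrict_space borel S" using S(2,3) opY by (subst restrict_restrict_space) (auto simp: Int_absorb1)
  finally show ?thesis .
 qed
 ultimately show ?thesis using measurable_cong_sets by blast
qed

lemma glob_measurable: fixes h :: "'a chart => 'a => complex"
 assumes h: "!!k. k : charts A ==> (%w. indicator (W k) w *\<^sub>R h k (cinv k w)) : borel_measurable borel"
 shows "(%x. h (sel x) x) : borel_measurable AM"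
proof (rule measurable_piecewise_restrict[of "range DD"])
 show "countable (range DD)" by simp
 show "\<Omega> Int space AM : sets AM" if "\<Omega> \<in> range DD" for \<Omega>
  using that sets.Int[OF DD_borel borel_open[OF opY]] unfolding sets_AM sets_BY by auto
 show "space AM \<subseteq> \<Union>(range DD)" using DD_union by simp
 fix \<Omega> assume "\<Omega> \<in> range DD"
 then obtain n where n: "\<Omega> = DD n" by auto
 let ?k = "CK0 n"
 have 1: "(%x. indicator (W ?k) (snd ?k x) *\<^sub>R h ?k (cinv ?k (snd ?k x))) : borel_measurable (restrict_space AM \<Omega>)"
  by (rule measurable_compose[OF snd_measurable h[OF CK0(1)]]) (use n DD_sub CK0 DD_borel in auto)
 show "(%x. h (sel x) x) : borel_measurable (restrict_space AM \<Omega>)"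
 proof (rule measurable_cong[THEN iffD1, OF _ 1])
  fix x assume "x : space (restrict_space AM \<Omega>)"
  then have x: "x : DD n" using n by (simp add: space_restrict_space)
  then have "x : fst ?k" "x : Y" using DD_sub by auto
  then show "indicator (W ?k) (snd ?k x) *\<^sub>R h ?k (cinv ?k (snd ?k x)) = h (sel x) x" using sel_DD[OF x] CK0(1) by (simp add: W_def)
 qed
qed

definition law :: "nat => 'a sect => bool" where
 "law p S \<longleftrightarrow> (\<forall>k\<in>charts A. \<forall>l\<in>charts A. \<forall>x\<in>fst k Int fst l Int Y. S k x = S l x * jac k l x ^ p)"

lemma lawD: "law p S ==> k : charts A ==> l : charts A ==> x : fst k ==> x : fst l ==> x : Y ==>
  S k x = S l x * jac k l x ^ p" unfolding law_def by blast

lemma law_pair: assumes "law p S" "law p T" and kl: "k : charts A" "l : charts A" "x : fst k" "x : fst l" "x : Y"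
 shows "S k x * cnj (T k x) * of_real ((2 / \<omega> k x) ^ p) = S l x * cnj (T l x) * of_real ((2 / \<omega> l x) ^ p)"
proof -
 let ?J = "jac k l x"
 have J: "?J ~= 0" using jac_inverse(2)[OF kl(1-4)] .
 have o: "complex_of_real (\<omega> k x) = of_real (\<omega> l x) * (?J * cnj ?J)" using omega_law[OF kl] by (simp add: of_real_cmod_sq)
 have "of_real ((2 / \<omega> k x) ^ p) = (of_real (2 / \<omega> l x) ^ p / (?J ^ p * cnj ?J ^ p) :: complex)" by (simp add: o power_divide power_mult_distrib)
 then show ?thesis using J lawD[OF assms(1) kl] lawD[OF assms(2) kl] by simp
qed

text \<open>The coefficient in the chosen chart, scaled so that its modulus is the pointwise norm. All \<open>L\<^sup>2\<close> theory of sections is done for this function.\<close>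
definition scal :: "nat => 'a sect => 'a => complex" where "scal p S x = S (sel x) x * of_real (sqrt ((2 / \<omega> (sel x) x) ^ p))"

lemma scal_pair: assumes "law p S" "law p T" "k : charts A" "x : fst k" "x : Y"
 shows "scal p S x * cnj (scal p T x) = S k x * cnj (T k x) * of_real ((2 / \<omega> k x) ^ p)"
proof -
 have "(2 / \<omega> (sel x) x) ^ p >= 0" using omega_pos[OF sel assms(5)] by simp
 then have "complex_of_real (sqrt ((2 / \<omega> (sel x) x) ^ p)) * of_real (sqrt ((2 / \<omega> (sel x) x) ^ p)) = of_real ((2 / \<omega> (sel x) x) ^ p)"
  by (simp flip: of_real_mult)
 then have "scal p S x * cnj (scal p T x) = S (sel x) x * cnj (T (sel x) x) * of_real ((2 / \<omega> (sel x) x) ^ p)"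
  unfolding scal_def by (simp add: algebra_simps del: of_real_power)
 also have "... = S k x * cnj (T k x) * of_real ((2 / \<omega> k x) ^ p)" by (rule law_pair) (use assms sel in auto)
 finally show ?thesis .
qed

lemma scal_sq: assumes "law p S" "k : charts A" "x : fst k" "x : Y" shows "sq (scal p S x) = sq (S k x) * (2 / \<omega> k x) ^ p"
proof -
 have "complex_of_real (sq (scal p S x)) = of_real (sq (S k x) * (2 / \<omega> k x) ^ p)"
  using scal_pair[OF assms(1,1,2-4)] by (simp add: of_real_cmod_sq)
 then show ?thesis by (simp only: of_real_eq_iff)
qed

lemma hprod_scal: "law p S ==> law p T ==> x : Y ==> hprod A \<omega> p S T x = scal p S x * cnj (scal p T x)"
 unfolding hprod_def Let_def by (rule scal_pair[symmetric]) (auto intro: chart_at)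

lemma hnorm_scal: "law p S ==> x : Y ==> hnorm_sq A \<omega> p S x = sq (scal p S x)"
 unfolding hnorm_sq_def Let_def by (rule scal_sq[symmetric]) (auto intro: chart_at)

definition co :: "'a chart => 'a sect => complex => complex" where "co k S w = S k (cinv k w)"

lemma co_snd: "k : charts A ==> x : fst k ==> co k S (snd k x) = S k x" by (simp add: co_def)

definition cmeas :: "'a sect => bool" where
 "cmeas S \<longleftrightarrow> (\<forall>k\<in>charts A. (%w. indicator (W k) w *\<^sub>R co k S w) : borel_measurable borel)"

lemma cmeas_continuous: "(!!k. k : charts A ==> continuous_on (W k) (co k S)) ==> cmeas S"
 unfolding cmeas_def by (auto intro!: borel_measurable_continuous_on_indicator simp: open_W)

lemma omega_chart_measurable: assumes "k : charts A" shows "(%w. indicator (W k) w *\<^sub>R rho k w) : borel_measurable borel"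
 using open_W[OF assms] by (intro borel_measurable_continuous_on_indicator rho_continuous assms) auto

lemma scal_measurable: assumes "cmeas S" shows "scal p S : borel_measurable AM"
proof -
 have "(%x. (%k x. S k x * of_real (sqrt ((2 / \<omega> k x) ^ p))) (sel x) x) : borel_measurable AM"
 proof (rule glob_measurable)
  fix k assume k: "k : charts A"
  have [measurable]: "(%w. indicator (W k) w *\<^sub>R co k S w) : borel_measurable borel" using assms k by (auto simp: cmeas_def)
  note [measurable] = omega_chart_measurable[OF k]
  have "(%w. (indicator (W k) w *\<^sub>R co k S w) * of_real (sqrt ((2 / (indicator (W k) w *\<^sub>R rho k w)) ^ p))) : borel_measurable borel" by measurable
  also have "(%w. (indicator (W k) w *\<^sub>R co k S w) * of_real (sqrt ((2 / (indicator (W k) w *\<^sub>R rho k w)) ^ p))) =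
    (%w. indicator (W k) w *\<^sub>R (S k (cinv k w) * of_real (sqrt ((2 / \<omega> k (cinv k w)) ^ p))))"
   by (auto simp: fun_eq_iff indicator_def co_def rho_def in_coord_def)
  finally show "(%w. indicator (W k) w *\<^sub>R (S k (cinv k w) * of_real (sqrt ((2 / \<omega> k (cinv k w)) ^ p)))) : borel_measurable borel" .
 qed
 then show ?thesis by (simp add: scal_def[abs_def])
qed

text \<open>The section with prescribed scalar function.\<close>
definition unscal :: "nat => ('a => complex) => 'a sect" where
 "unscal p s k x = s x / of_real (sqrt ((2 / \<omega> (sel x) x) ^ p)) * jac k (sel x) x ^ p"

lemma law_unscal: "law p (unscal p s)" unfolding law_def
proof (intro ballI)
 fix k l x assume "k : charts A" "l : charts A" "x : fst k Int fst l Int Y"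
 then have "jac k (sel x) x = jac k l x * jac l (sel x) x" using jac_chain[OF _ _ sel(1), of k l x x] sel by auto
 then show "unscal p s k x = unscal p s l x * jac k l x ^ p" unfolding unscal_def by (simp add: power_mult_distrib)
qed

lemma scal_unscal: "x : Y ==> scal p (unscal p s) x = s x" using omega_pos[OF sel, of x] jac_self[OF sel, of x] unfolding scal_def unscal_def by simp

lemma jac_continuous: assumes "k : charts A" "l : charts A" shows "continuous_on (snd k ` (fst k Int fst l)) (%w. jac k l (cinv k w))"
proof -
 have "continuous_on (snd k ` (fst k Int fst l)) (deriv (transition k l))"
  by (intro holomorphic_on_imp_continuous_on holomorphic_deriv transition_holomorphic open_overlap assms)
 then show ?thesis by (rule continuous_on_cong[THEN iffD1, rotated -1]) (use assms in \<open>auto simp: jac_def\<close>)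
qed

lemma cmeas_unscal: assumes s: "s : borel_measurable AM" shows "cmeas (unscal p s)" unfolding cmeas_def
proof
 fix k assume k: "k : charts A"
 have sB: "s : borel_measurable BY" using s measurable_cong_sets[OF sets_AM] by blast
 have st: "(%w. s (tot k w)) : borel_measurable borel" by (rule measurable_compose[OF tot_measurable[OF k] sB])
 define P where "P n = snd k ` (fst k Int DD n)" for n
 have Pb: "P n : sets borel" for n unfolding P_def using chartD(1)[OF k] DD_borel by (intro borel_chart_image k) auto
 have PW: "(\<Union>n. P n) = W k"
 proof -
  have "(\<Union>n. P n) = snd k ` (fst k Int (\<Union>n. DD n))" unfolding P_def by blast
  then show ?thesis by (simp only: DD_union W_def)
 qed
 show "(%w. indicator (W k) w *\<^sub>R co k (unscal p s) w) : borel_measurable borel"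
 proof (rule measurable_piecewise_restrict[of "insert (- W k) (range P)"])
  show "countable (insert (- W k) (range P))" by simp
  show "space borel \<subseteq> \<Union> (insert (- W k) (range P))" using PW by auto
  show "\<Omega> Int space borel : sets borel" if "\<Omega> \<in> insert (- W k) (range P)" for \<Omega> using that Pb open_W[OF k] by auto
  fix \<Omega> assume "\<Omega> \<in> insert (- W k) (range P)"
  then consider "\<Omega> = - W k" | n where "\<Omega> = P n" by auto
  then show "(%w. indicator (W k) w *\<^sub>R co k (unscal p s) w) : borel_measurable (restrict_space borel \<Omega>)"
  proof cases
   case 1
   have "(%w. 0 :: complex) : borel_measurable (restrict_space borel \<Omega>)" by simp
   then show ?thesis by (rule measurable_cong[THEN iffD1, rotated]) (use 1 in \<open>auto simp: space_restrict_space\<close>)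
  next
   case (2 n)
   let ?l = "CK0 n"
   let ?V = "snd k ` (fst k Int fst ?l)"
   have PV: "P n \<subseteq> ?V" unfolding P_def using DD_sub(1) by auto
   have oV: "open ?V" by (rule open_overlap[OF k CK0(1)])
   have [measurable]: "(%w. indicator ?V w *\<^sub>R jac k ?l (cinv k w)) : borel_measurable borel"
    using oV by (intro borel_measurable_continuous_on_indicator jac_continuous k CK0(1)) auto
   have jd: "jac k ?l (cinv k w) ~= 0" if "w : ?V" for w using that jac_inverse(2)[OF k CK0(1)] k by auto
   note [measurable] = st omega_chart_measurable[OF k]
   have "(%w. s (tot k w) / of_real (sqrt ((2 / ((indicator (W k) w *\<^sub>R rho k w) / sq (indicator ?V w *\<^sub>R jac k ?l (cinv k w)))) ^ p))
     * (indicator ?V w *\<^sub>R jac k ?l (cinv k w)) ^ p) : borel_measurable borel" by measurable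
   then have "(%w. s (tot k w) / of_real (sqrt ((2 / ((indicator (W k) w *\<^sub>R rho k w) / sq (indicator ?V w *\<^sub>R jac k ?l (cinv k w)))) ^ p))
     * (indicator ?V w *\<^sub>R jac k ?l (cinv k w)) ^ p) : borel_measurable (restrict_space borel \<Omega>)" by (rule measurable_restrict_space1)
   then show ?thesis
   proof (rule measurable_cong[THEN iffD1, rotated])
    fix w assume "w : space (restrict_space borel \<Omega>)"
    then have "w : P n" using 2 by (simp add: space_restrict_space)
    then obtain x where x: "x : fst k" "x : DD n" "w = snd k x" unfolding P_def by auto
    have xs: "x : Y" "x : fst ?l" using x(2) DD_sub by auto
    have w: "w : W k" "w : ?V" "cinv k w = x" "tot k w = x" using x xs k by (auto simp: W_def tot_def)
    have "\<omega> k x / sq (jac k ?l x) = \<omega> ?l x" using omega_law[OF k CK0(1) x(1) xs(2,1)] jd[OF w(2)] w(3) by simp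
    then show "s (tot k w) / of_real (sqrt ((2 / ((indicator (W k) w *\<^sub>R rho k w) / sq (indicator ?V w *\<^sub>R jac k ?l (cinv k w)))) ^ p))
     * (indicator ?V w *\<^sub>R jac k ?l (cinv k w)) ^ p = indicator (W k) w *\<^sub>R co k (unscal p s) w"
     using w sel_DD[OF x(2)] rho_snd[OF k x(1)] x(3) by (simp add: co_def unscal_def)
   qed
  qed
 qed
qed

section \<open>Sections given by their coefficient in one chart\<close>

text \<open>The section with coefficient f in the coordinate k, extended by zero.\<close>
definition secof :: "nat => 'a chart => (complex => complex) => 'a sect" where
 "secof p k f l x = (if l : charts A & x : fst l Int fst k Int Y then f (snd k x) * jac l k x ^ p else 0)"

lemma law_secof: "k : charts A ==> law p (secof p k f)" unfolding law_def
proof (intro ballI)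
 fix m l x assume a: "k : charts A" "m : charts A" "l : charts A" "x : fst m Int fst l Int Y"
 show "secof p k f m x = secof p k f l x * jac m l x ^ p"
 proof (cases "x : fst k")
  case True
  then have "jac m k x = jac m l x * jac l k x" using jac_chain[of m l k x] a by auto
  then show ?thesis using a True by (simp add: secof_def power_mult_distrib)
 qed (simp add: secof_def)
qed

lemma co_secof_self: "k : charts A ==> w : W k ==> co k (secof p k f) w = f w"
proof -
 assume k: "k : charts A" and "w : W k"
 from this(2) obtain x where x: "x : fst k" "x : Y" "w = snd k x" "cinv k w = x" by (rule WE[OF k])
 show ?thesis unfolding co_def x(4) using x k by (simp add: secof_def jac_self)
qed

lemma open_W_overlap: "k : charts A ==> l : charts A ==> open (snd k ` (fst k Int (fst l Int Y)))"
 by (intro open_chart_image open_Int chartD(1) opY)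

lemma CK_secof: assumes k: "k : charts A" and l: "l : charts A" and f: "CK n f (W k)"
  and K: "compact K" "K \<subseteq> W k" "!!w. w ~: K ==> f w = 0" shows "CK n (co l (secof p k f)) (W l)"
proof -
 define C where "C = cinv k ` K"
 have "compact C" unfolding C_def by (intro compact_continuous_image continuous_on_subset[OF chartD(5)[OF k]] K(1)) (use K(2) in \<open>auto simp: W_def\<close>)
 then have oC: "open (- C)" using compact_imp_closed by auto
 define U1 where "U1 = snd l ` (fst l Int (fst k Int Y))"
 define U2 where "U2 = snd l ` (fst l Int (- C Int Y))"
 have o: "open U1" "open U2" unfolding U1_def U2_def using open_W_overlap[OF l k] open_chart_image[OF l, of "- C Int Y"] oC opY by auto
 have CY: "C \<subseteq> fst k" "C \<subseteq> Y" using K(2) k unfolding C_def by (auto simp: W_def subset_iff)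
 have U: "W l = U1 \<union> U2" unfolding U1_def U2_def W_def using CY by blast
 have t: "transition l k holomorphic_on U1" by (rule holomorphic_on_subset[OF transition_holomorphic[OF l k]]) (auto simp: U1_def)
 have "CK n (%w. f (transition l k w) * deriv (transition l k) w ^ p) U1" by (intro CK_mult CK_power CK_compose[OF _ t _ f] CK_holomorphic holomorphic_deriv o t)
   (auto simp: U1_def W_def transition_snd[OF l])
 then have 1: "CK n (co l (secof p k f)) U1" by (rule CK_cong[THEN iffD1, OF o(1), rotated]) (auto simp: U1_def co_def secof_def transition_snd l jac_def)
 have "f (snd k x) = 0" if "x : fst k" "x ~: C" for x
 proof -
  have "snd k x ~: K" using that k by (force simp: C_def image_iff)
  then show ?thesis by (rule K(3))
 qed
 then have 2: "CK n (co l (secof p k f)) U2" by (intro CK_cong[THEN iffD2, OF o(2) _ CK_const[of n 0]]) (auto simp: U2_def co_def secof_def l)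
 show ?thesis unfolding U by (rule CK_Un[OF o 1 2])
qed

section \<open>Integrals in a chart\<close>

definition supp_in :: "'a chart => complex set => 'a sect => bool" where
 "supp_in k K S \<longleftrightarrow> k : charts A & compact K & K \<subseteq> W k & (\<forall>l\<in>charts A. \<forall>x\<in>fst l Int Y. S l x ~= 0 --> x : fst k & snd k x : K)"

lemma supp_in_secof: "k : charts A ==> compact K ==> K \<subseteq> W k ==> (!!w. w ~: K ==> f w = 0) ==> supp_in k K (secof p k f)"
 by (auto simp: supp_in_def secof_def split: if_splits)

lemma supp_co: "supp_in k K S ==> w : W k ==> w ~: K ==> co k S w = 0"
proof -
 assume s: "supp_in k K S" and w: "w : W k" "w ~: K"
 have k: "k : charts A" using s by (simp add: supp_in_def)
 from w(1) obtain x where x: "x : fst k" "x : Y" "w = snd k x" "cinv k w = x" by (rule WE[OF k])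
 have "S k x ~= 0 ==> snd k x : K" using s k x(1,2) unfolding supp_in_def by blast
 then show ?thesis using w(2) x by (auto simp: co_def)
qed

lemma supp_scal: "supp_in k K S ==> x : Y ==> x ~: fst k ==> scal p S x = 0"
 using sel[of x] by (auto simp: supp_in_def scal_def)

lemma nn_integral_scal_chart: assumes S: "law p S" "cmeas S" and k: "k : charts A"
 shows "(\<integral>\<^sup>+x\<in>fst k. ennreal (sq (scal p S x)) \<partial>AM) =
   (\<integral>\<^sup>+w\<in>W k. ennreal (sq (co k S w) * ((2 / rho k w) ^ p * rho k w)) \<partial>lborel)"
proof -
 have [measurable]: "scal p S : borel_measurable AM" by (rule scal_measurable[OF S(2)])
 have "(\<integral>\<^sup>+x\<in>fst k. ennreal (sq (scal p S x)) \<partial>AM) =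
   (\<integral>\<^sup>+w\<in>W k. ennreal (sq (scal p S (cinv k w))) * ennreal (rho k w) \<partial>lborel)" by (rule nn_integral_chart[OF k]) measurable
 also have "... = (\<integral>\<^sup>+w\<in>W k. ennreal (sq (co k S w) * ((2 / rho k w) ^ p * rho k w)) \<partial>lborel)"
 proof (rule nn_integral_cong)
  fix w
  show "ennreal (sq (scal p S (cinv k w))) * ennreal (rho k w) * indicator (W k) w =
   ennreal (sq (co k S w) * ((2 / rho k w) ^ p * rho k w)) * indicator (W k) w"
  proof (cases "w : W k")
   case True
   then obtain x where x: "x : fst k" "x : Y" "w = snd k x" "cinv k w = x" by (rule WE[OF k])
   have "sq (scal p S x) * rho k w = sq (co k S w) * ((2 / rho k w) ^ p * rho k w)" using scal_sq[OF S(1) k x(1,2)] x k by (simp add: co_def rho_snd)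
   moreover have "ennreal (sq (scal p S x)) * ennreal (rho k w) = ennreal (sq (scal p S x) * rho k w)"
    using rho_pos[OF k True] by (intro ennreal_mult[symmetric]) auto
   ultimately show ?thesis unfolding x(4) by (simp only:)
  qed simp
 qed
 finally show ?thesis .
qed

lemma weight_continuous: "k : charts A ==> continuous_on (W k) (%w. (2 / rho k w) ^ p)"
 using rho_pos[of k] by (intro continuous_intros rho_continuous) force+

lemma scal_L2: assumes S: "law p S" "!!l. l : charts A ==> continuous_on (W l) (co l S)" "supp_in k K S" shows "scal p S : L2 AM"
proof -
 have k: "k : charts A" "compact K" "K \<subseteq> W k" using S(3) by (auto simp: supp_in_def)
 have cm: "cmeas S" by (rule cmeas_continuous[OF S(2)])
 define g where "g w = sq (co k S w) * ((2 / rho k w) ^ p * rho k w)" for w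
 have gc: "continuous_on K g" unfolding g_def by (rule continuous_on_subset[OF _ k(3)]) (intro continuous_intros S(2) k(1) weight_continuous rho_continuous)
 have gi: "integrable lborel (%w. indicator K w *\<^sub>R g w)" using gc k by (intro borel_integrable_compact) auto
 have g0: "g w >= 0" if "w : W k" for w using rho_pos[OF k(1) that] by (simp add: g_def)
 have "(\<integral>\<^sup>+x. ennreal (sq (scal p S x)) \<partial>AM) = (\<integral>\<^sup>+x\<in>fst k. ennreal (sq (scal p S x)) \<partial>AM)"
  by (intro nn_integral_cong) (use supp_scal[OF S(3)] in \<open>auto simp: indicator_def\<close>)
 also have "... = (\<integral>\<^sup>+w\<in>W k. ennreal (g w) \<partial>lborel)" unfolding g_def by (rule nn_integral_scal_chart[OF S(1) cm k(1)])
 also have "... = (\<integral>\<^sup>+w. ennreal (indicator K w *\<^sub>R g w) \<partial>lborel)"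
  by (intro nn_integral_cong) (use k(3) supp_co[OF S(3)] in \<open>auto simp: indicator_def g_def\<close>)
 also have "... < \<infinity>" using gi g0 k(3) by (simp add: integrable_iff_bounded indicator_def subset_iff cong: nn_integral_cong if_cong)
 finally show ?thesis using L2_iff_nn_integral[OF scal_measurable[OF cm]] by blast
qed

lemma ip_chart: assumes S: "law (Suc q) S" "cmeas S" and T: "law (Suc q) T" "cmeas T" and k: "k : charts A"
  and z: "!!x. x : Y ==> x ~: fst k ==> scal (Suc q) S x * cnj (scal (Suc q) T x) = 0"
 shows "ip AM (scal (Suc q) S) (scal (Suc q) T) =
   2 * (LINT w|lborel. indicator (W k) w *\<^sub>R (co k S w * cnj (co k T w) * of_real ((2 / rho k w) ^ q)))"
  "integrable AM (%x. scal (Suc q) S x * cnj (scal (Suc q) T x)) ==>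
   integrable lborel (%w. indicator (W k) w *\<^sub>R (co k S w * cnj (co k T w) * of_real ((2 / rho k w) ^ q)))"
proof -
 define f where "f x = scal (Suc q) S x * cnj (scal (Suc q) T x)" for x
 have fm: "f : borel_measurable AM" using scal_measurable[OF S(2), of "Suc q"] scal_measurable[OF T(2), of "Suc q"] unfolding f_def by measurable
 have e: "(%w. indicator (W k) w *\<^sub>R (of_real (rho k w) * f (cinv k w))) =
   (%w. 2 * (indicator (W k) w *\<^sub>R (co k S w * cnj (co k T w) * of_real ((2 / rho k w) ^ q))))"
 proof
  fix w
  show "indicator (W k) w *\<^sub>R (of_real (rho k w) * f (cinv k w)) =
   2 * (indicator (W k) w *\<^sub>R (co k S w * cnj (co k T w) * of_real ((2 / rho k w) ^ q)))"
  proof (cases "w : W k")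
   case True
   then obtain x where x: "x : fst k" "x : Y" "w = snd k x" "cinv k w = x" by (rule WE[OF k])
   have r: "rho k w = \<omega> k x" "\<omega> k x > 0" using rho_snd[OF k x(1)] omega_pos[OF k x(1,2)] x(3) by auto
   have "f x = S k x * cnj (T k x) * of_real ((2 / \<omega> k x) ^ Suc q)" unfolding f_def by (rule scal_pair[OF S(1) T(1) k x(1,2)])
   also have "complex_of_real ((2 / \<omega> k x) ^ Suc q) = of_real ((2 / \<omega> k x) ^ q) * (2 / of_real (\<omega> k x))" by simp
   finally show ?thesis using True r x(4) by (simp add: co_def)
  qed simp
 qed
 have z': "!!x. x : Y ==> x ~: fst k ==> f x = 0" using z unfolding f_def .
 show "ip AM (scal (Suc q) S) (scal (Suc q) T) =
   2 * (LINT w|lborel. indicator (W k) w *\<^sub>R (co k S w * cnj (co k T w) * of_real ((2 / rho k w) ^ q)))"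
 proof -
  have "(LINT x|AM. f x) = (LINT w|lborel. indicator (W k) w *\<^sub>R (of_real (rho k w) * f (cinv k w)))" by (rule integral_chart(2)[OF k fm]) (rule z')
  then show ?thesis unfolding e unfolding ip_def f_def[symmetric] by (simp only: integral_mult_right_zero)
 qed
 assume "integrable AM (%x. scal (Suc q) S x * cnj (scal (Suc q) T x))"
 then have "integrable lborel (%w. 2 * (indicator (W k) w *\<^sub>R (co k S w * cnj (co k T w) * of_real ((2 / rho k w) ^ q))))"
 proof -
  have "integrable AM f \<longleftrightarrow> integrable lborel (%w. indicator (W k) w *\<^sub>R (of_real (rho k w) * f (cinv k w)))"
   by (rule integral_chart(1)[OF k fm]) (rule z')
  then show ?thesis using \<open>integrable AM (%x. scal (Suc q) S x * cnj (scal (Suc q) T x))\<close> unfolding e unfolding f_def by blast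
 qed
 then show "integrable lborel (%w. indicator (W k) w *\<^sub>R (co k S w * cnj (co k T w) * of_real ((2 / rho k w) ^ q)))"
 proof -
  define X where "X w = indicator (W k) w *\<^sub>R (co k S w * cnj (co k T w) * of_real ((2 / rho k w) ^ q))" for w
  assume "integrable lborel (%w. 2 * (indicator (W k) w *\<^sub>R (co k S w * cnj (co k T w) * of_real ((2 / rho k w) ^ q))))"
  then have "integrable lborel (%w. 2 * X w)" unfolding X_def .
  from integrable_mult_right[OF this, of "1/2"] have "integrable lborel X" by simp
  then show ?thesis unfolding X_def .
 qed
qed

end

section \<open>Logarithmic derivatives of the density\<close>

lemma dzb_dz_of_real: assumes "open S" "Ck_on 2 f S" "w : S" shows "dzb (dz (%x. complex_of_real (f x))) w = of_real (d_dbar f w)"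
proof -
 have d: "f differentiable (at x)" "pdx f differentiable (at x)" "pdy f differentiable (at x)" if "x : S" for x using assms(2) that by (auto simp: numeral_2_eq_2)
 have e: "dz (%x. complex_of_real (f x)) x = (1/2) * (of_real (pdx f x) - \<i> * of_real (pdy f x))" if "x : S" for x
  using wirtinger_of_real(1)[OF d(1)[OF that]] by simp
 have c: "dzb (%x. c) w = 0" "(%x. c) differentiable (at w)" for c :: complex using wirtinger_holomorphic(2,3)[of "%_. c" UNIV w] by auto
 note x = wirtinger_of_real[OF d(2)[OF assms(3)]] and y = wirtinger_of_real[OF d(3)[OF assms(3)]]
 have 1: "dzb (%x. \<i> * complex_of_real (pdy f x)) w = \<i> * dzb (%x. of_real (pdy f x)) w"
   "(%x. \<i> * complex_of_real (pdy f x)) differentiable (at w)" using wirtinger_mult(2,3)[OF c(2)[of \<i>] y(3)] by (auto simp: c(1))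
 have 2: "(%x. of_real (pdx f x) - \<i> * of_real (pdy f x)) differentiable (at w)" by (rule differentiable_diff[OF x(3) 1(2)])
 have "dzb (dz (%x. complex_of_real (f x))) w = dzb (%x. (1/2) * (of_real (pdx f x) - \<i> * of_real (pdy f x))) w"
  by (rule wirtinger_cong[OF assms(1,3)]) (rule e)
 also have "... = (1/2) * (dzb (%x. of_real (pdx f x)) w - \<i> * dzb (%x. of_real (pdy f x)) w)"
  using wirtinger_mult(2)[OF c(2)[of "1/2"] 2] wirtinger_diff(2)[OF x(3) 1(2)] 1(1) by (simp add: c(1))
 also have "... = of_real (d_dbar f w)" unfolding x(2) y(2) using pd_comm[OF assms] by (simp add: d_dbar_def partial_def numeral_2_eq_2 complex_eq_iff)
 finally show ?thesis .
qed

lemma CK_ln: assumes "open S" "Ck_on n r S" "!!w. w : S ==> r w > (0::real)" shows "CK n (%w. complex_of_real (ln (r w))) S"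
proof (cases n)
 case 0
 then show ?thesis using assms by (auto intro!: continuous_intros) (use assms(3) in force)
next
 case (Suc m)
 have R: "CK n (%w. complex_of_real (r w)) S" by (rule CK_of_real[OF assms(1,2)])
 have i: "CK m (%w. inverse (complex_of_real (r w))) S" by (rule CK_inverse[OF assms(1) CK_le[OF R]]) (use Suc assms(3) in force)+
 have "CK (Suc m) (%w. complex_of_real (ln (r w))) S"
 proof (rule CK_Suc_cong[OF assms(1), where p = "%w. dz (%w. complex_of_real (r w)) w * inverse (of_real (r w))"
   and q = "%w. dzb (%w. complex_of_real (r w)) w * inverse (of_real (r w))"])
  fix w assume w: "w : S"
  have d: "r differentiable (at w)" using assms(2) w Suc by auto
  have "((%w. ln (r w)) has_derivative (%h. (pdx r w * Re h + pdy r w * Im h) / r w)) (at w)"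
   using has_derivative_ln[OF assms(3)[OF w] has_real_wirtinger_derivative[OF d]] by (simp add: divide_inverse mult.commute)
  from has_derivative_of_real[OF this]
  have "((%w. complex_of_real (ln (r w))) has_derivative (%h. complex_of_real ((pdx r w * Re h + pdy r w * Im h) / r w))) (at w)" .
  also have "(%h. complex_of_real ((pdx r w * Re h + pdy r w * Im h) / r w)) =
   (%h. dz (%w. complex_of_real (r w)) w * inverse (of_real (r w)) * h + dzb (%w. complex_of_real (r w)) w * inverse (of_real (r w)) * cnj h)"
   unfolding wirtinger_of_real(1,2)[OF d] using assms(3)[OF w] by (auto simp: fun_eq_iff complex_eq_iff field_simps)
  finally show "((%w. complex_of_real (ln (r w))) has_derivative
   (%h. dz (%w. complex_of_real (r w)) w * inverse (of_real (r w)) * h + dzb (%w. complex_of_real (r w)) w * inverse (of_real (r w)) * cnj h)) (at w)" .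
 qed (use R Suc i in \<open>auto intro!: CK_mult assms(1)\<close>)
 then show ?thesis using Suc by simp
qed

lemma dz_ln: assumes "open S" "Ck_on 1 r S" "!!w. w : S ==> r w > (0::real)" "w : S"
 shows "dz (%w. complex_of_real (ln (r w))) w = dz (%w. complex_of_real (r w)) w / of_real (r w)"
proof -
 have d: "r differentiable (at w)" using assms(2,4) by auto
 have "((%w. ln (r w)) has_derivative (%h. (pdx r w / r w) * Re h + (pdy r w / r w) * Im h)) (at w)"
  using has_derivative_ln[OF assms(3)[OF assms(4)] has_real_wirtinger_derivative[OF d]] by (simp add: divide_inverse algebra_simps)
 note l = pd_unique[OF this]
 show ?thesis unfolding wirtinger_of_real(1)[OF d] wirtinger_of_real(1)[OF l(1)] l(2,3) by (simp add: diff_divide_distrib mult.commute)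
qed

section \<open>The planar integration by parts\<close>

text \<open>The weight of \<open>K\<^sup>q\<close>.\<close>
definition wE :: "(complex => real) => nat => complex => complex" where "wE r q w = of_real ((2 / r w) ^ q)"
text \<open>The derivative of \<open>log \<rho>\<close>; its z-bar derivative is the curvature.\<close>
definition wG :: "(complex => real) => complex => complex" where "wG r w = dz (%w. of_real (r w)) w / of_real (r w)"
text \<open>Minus the covariant derivative of \<open>K\<^sup>q\<close>; it is the formal adjoint of \<open>\<partial>\<close>-bar.\<close>
definition wD :: "(complex => real) => nat => (complex => complex) => complex => complex" where
 "wD r q a w = - (dz a w - of_nat q * wG r w * a w)"

locale weighted_plane = fixes U :: "complex set" and r :: "complex => real" and q :: nat
 assumes U: "open U" and r: "Ck_on 3 r U" and rpos: "!!w. w : U ==> r w > 0"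
begin

abbreviation "E \<equiv> wE r q"
abbreviation "G \<equiv> wG r"
abbreviation "D \<equiv> wD r q"
lemmas E_def = wE_def[of r q] and G_def = wG_def[of r] and D_def = wD_def[of r q]

lemma r_CK: "CK 3 (%w. of_real (r w)) U" by (rule CK_of_real[OF U r])

lemma r_differentiable: "w : U ==> (%w. complex_of_real (r w)) differentiable (at w)" using r_CK by (auto simp: eval_nat_numeral)

lemma rinv_CK: "CK 3 (%w. inverse (complex_of_real (r w))) U" by (rule CK_inverse[OF U r_CK]) (use rpos in force)

lemma E_eq: "E = (%w. (2 * inverse (complex_of_real (r w))) ^ q)" by (auto simp: E_def fun_eq_iff divide_inverse)

lemma E_CK: "CK 3 E U" unfolding E_eq by (intro CK_power CK_mult U rinv_CK CK_const)

lemma G_CK: "CK 2 G U"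
proof -
 have "CK 2 (%w. dz (%w. of_real (r w)) w * inverse (of_real (r w))) U"
 proof (intro CK_mult U)
  show "CK 2 (dz (%w. complex_of_real (r w))) U" using r_CK by (auto simp: eval_nat_numeral)
  show "CK 2 (%w. inverse (complex_of_real (r w))) U" by (rule CK_le[OF rinv_CK]) simp
 qed
 then show ?thesis by (simp add: G_def[abs_def] divide_inverse)
qed

lemma dzb_r: "w : U ==> dzb (%w. complex_of_real (r w)) w = cnj (dz (%w. of_real (r w)) w)"
proof -
 assume "w : U"
 then have "r differentiable (at w)" using r by (auto simp: eval_nat_numeral)
 then show ?thesis by (simp add: wirtinger_of_real)
qed

lemma power_wirtinger: assumes "f differentiable (at w)"
 shows "dz (%x. f x ^ n) w = of_nat n * f w ^ (n - 1) * dz f w" "dzb (%x. f x ^ n) w = of_nat n * f w ^ (n - 1) * dzb f w"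
  "(%x. f x ^ n) differentiable (at w)"
proof -
 have "dz (%x. f x ^ n) w = of_nat n * f w ^ (n - 1) * dz f w & dzb (%x. f x ^ n) w = of_nat n * f w ^ (n - 1) * dzb f w \<and>
  (%x. f x ^ n) differentiable (at w)"
 proof (induction n)
  case 0
  then show ?case using wirtinger_holomorphic[of "%_. 1" UNIV w] by auto
 next
  case (Suc n)
  then show ?case using wirtinger_mult[OF assms, of "%x. f x ^ n"] by (cases n) (auto simp: algebra_simps)
 qed
 then show "dz (%x. f x ^ n) w = of_nat n * f w ^ (n - 1) * dz f w" "dzb (%x. f x ^ n) w = of_nat n * f w ^ (n - 1) * dzb f w"
  "(%x. f x ^ n) differentiable (at w)" by auto
qed

lemma E_wirtinger: assumes w: "w : U" shows "dz E w = - of_nat q * G w * E w" "dzb E w = - of_nat q * cnj (G w) * E w" "E differentiable (at w)"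
proof -
 let ?r = "%w. complex_of_real (r w)"
 let ?f = "%w. 2 * inverse (?r w)"
 have r0: "?r w ~= 0" using rpos[OF w] by simp
 have rd: "?r differentiable (at w)" by (rule r_differentiable[OF w])
 have id: "(%w. inverse (?r w)) differentiable (at w)" using rinv_CK w by (auto simp: eval_nat_numeral)
 have c: "dz (%x. 2) w = 0" "dzb (%x. 2) w = 0" "(%x. 2::complex) differentiable (at w)" using wirtinger_holomorphic[of "%_. 2" UNIV w] by auto
 have f: "dz ?f w = - (2 / ?r w) * G w" "dzb ?f w = - (2 / ?r w) * cnj (G w)" "?f differentiable (at w)"
  using wirtinger_mult[OF c(3) id] wirtinger_inverse[OF rd r0] dzb_r[OF w] r0 by (auto simp: c(1,2) G_def power2_eq_square)
 have s: "of_nat q * ?f w ^ (q - 1) * (- (2 / ?r w) * g) = - of_nat q * g * E w" for g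
 proof (cases q)
  case (Suc m)
  have x: "2 / ?r w = ?f w" by (rule divide_inverse)
  have Ew: "E w = ?f w ^ q" by (rule fun_cong[OF E_eq])
  show ?thesis unfolding Ew x unfolding Suc diff_Suc_1 power_Suc by (simp only: mult_minus_left mult_minus_right mult_ac)
 qed simp
 show "dz E w = - of_nat q * G w * E w" "dzb E w = - of_nat q * cnj (G w) * E w" "E differentiable (at w)"
 proof -
  note pw = power_wirtinger[OF f(3), of q, folded E_eq]
  show "dz E w = - of_nat q * G w * E w" unfolding pw(1) f(1) by (rule s)
  show "dzb E w = - of_nat q * cnj (G w) * E w" unfolding pw(2) f(2) by (rule s)
  show "E differentiable (at w)" by (rule pw(3))
 qed
qed

lemma D_CK: "CK (Suc n) a U ==> n <= 2 ==> CK n (D a) U"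
 unfolding D_def by (intro CK_uminus CK_diff CK_mult CK_const U CK_le[OF G_CK] CK_Suc[of n a]) auto

lemma E_cnj: "cnj (E w) = E w" by (simp add: E_def)

lemma integral_dzb_compact: assumes P: "CK 1 P U" and K: "compact K" "K \<subseteq> U" "!!w. w : U ==> w ~: K ==> P w = 0"
 shows "integrable lborel (%w. indicator U w *\<^sub>R dzb P w)" "(LINT w|lborel. indicator U w *\<^sub>R dzb P w) = 0"
  "integrable lborel (%w. indicator U w *\<^sub>R dz P w)" "(LINT w|lborel. indicator U w *\<^sub>R dz P w) = 0"
proof -
 define P' where "P' w = (if w : U then P w else 0)" for w
 have 1: "CK 1 P' U" by (rule CK_cong[THEN iffD1, OF U _ P]) (simp add: P'_def)
 have 2: "!!w. w ~: K ==> P' w = 0" using K by (auto simp: P'_def)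
 have CK: "CK 1 P' UNIV" by (rule CK_zero_off_compact[OF U 1 K(1,2) 2])
 have z: "dz P' w = 0" "dzb P' w = 0" if "w ~: U" for w
 proof -
  have "open (- K)" "w : - K" using compact_imp_closed[OF K(1)] that K(2) by auto
  then show "dz P' w = 0" "dzb P' w = 0" using wirtinger_cong(1,2)[of "- K" w P' "%_. 0"] 2 wirtinger_holomorphic(1,2)[of "%_. 0" UNIV w] by auto
 qed
 have "dz P' w = dz P w" "dzb P' w = dzb P w" if "w : U" for w using wirtinger_cong(1,2)[OF U that, of P' P] by (auto simp: P'_def)
 then have e: "(%w. indicator U w *\<^sub>R dz P w) = dz P'" "(%w. indicator U w *\<^sub>R dzb P w) = dzb P'" using z by (auto simp: fun_eq_iff indicator_def)
 show "integrable lborel (%w. indicator U w *\<^sub>R dzb P w)" "(LINT w|lborel. indicator U w *\<^sub>R dzb P w) = 0"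
  "integrable lborel (%w. indicator U w *\<^sub>R dz P w)" "(LINT w|lborel. indicator U w *\<^sub>R dz P w) = 0"
  unfolding e using integral_wirtinger_zero[OF CK K(1) 2] by auto
qed

text \<open>The formal adjoint of \<open>\<partial>/\<partial>z\<bar>\<close> in the weighted space is \<open>D\<close>.\<close>

lemma adjoint: assumes u: "CK 1 u U" and b: "CK 1 b U" and K: "compact K" "K \<subseteq> U" "!!w. w : U ==> w ~: K ==> u w * b w = 0"
  and i: "integrable lborel (%w. indicator U w *\<^sub>R (u w * cnj (D b w) * E w))"
 shows "(LINT w|lborel. indicator U w *\<^sub>R (u w * cnj (D b w) * E w)) = (LINT w|lborel. indicator U w *\<^sub>R (dzb u w * cnj (b w) * E w))"
  "integrable lborel (%w. indicator U w *\<^sub>R (dzb u w * cnj (b w) * E w))"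
proof -
 define P where "P w = u w * (cnj (b w) * E w)" for w
 have P: "CK 1 P U" unfolding P_def by (intro CK_mult CK_cnj U u b CK_le[OF E_CK]) simp
 have d: "u differentiable (at w)" "b differentiable (at w)" if "w : U" for w using u b that by auto
 have e: "dzb P w = dzb u w * cnj (b w) * E w - u w * cnj (D b w) * E w" if w: "w : U" for w
 proof -
  note c = wirtinger_cnj[OF d(2)[OF w]]
  note m = wirtinger_mult[OF c(3) E_wirtinger(3)[OF w]]
  show ?thesis unfolding P_def wirtinger_mult(2)[OF d(1)[OF w] m(3)] m(2) c(2) E_wirtinger(2)[OF w] by (simp add: D_def algebra_simps)
 qed
 have z: "P w = 0" if "w : U" "w ~: K" for w using K(3)[OF that] by (auto simp: P_def)
 note I = integral_dzb_compact(1,2)[OF P K(1,2) z]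
 have eq: "(%w. indicator U w *\<^sub>R dzb P w) = (%w. indicator U w *\<^sub>R (dzb u w * cnj (b w) * E w) - indicator U w *\<^sub>R (u w * cnj (D b w) * E w))"
  using e by (auto simp: fun_eq_iff indicator_def)
 have s: "(%w. indicator U w *\<^sub>R (dzb u w * cnj (b w) * E w)) = (%w. indicator U w *\<^sub>R dzb P w + indicator U w *\<^sub>R (u w * cnj (D b w) * E w))"
  by (rule ext) (use fun_cong[OF eq] in simp)
 show "integrable lborel (%w. indicator U w *\<^sub>R (dzb u w * cnj (b w) * E w))" unfolding s using I(1) i by simp
 show "(LINT w|lborel. indicator U w *\<^sub>R (u w * cnj (D b w) * E w)) = (LINT w|lborel. indicator U w *\<^sub>R (dzb u w * cnj (b w) * E w))" unfolding s using I i by simp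
qed

text \<open>Integrate by parts twice; commuting the two operators leaves the curvature term.\<close>
lemma bochner_kodaira:
 assumes a: "CK 2 a U" and b: "CK 2 b U" and K: "compact K" "K \<subseteq> U" "!!w. w : U ==> w ~: K ==> b w = 0"
  and i: "integrable lborel (%w. indicator U w *\<^sub>R (D a w * cnj (D b w) * E w))" shows "(LINT w|lborel. indicator U w *\<^sub>R (D a w * cnj (D b w) * E w)) =
   (LINT w|lborel. indicator U w *\<^sub>R ((dzb a w * cnj (dzb b w) + of_nat q * dzb G w * a w * cnj (b w)) * E w))"
  "integrable lborel (%w. indicator U w *\<^sub>R ((dzb a w * cnj (dzb b w) + of_nat q * dzb G w * a w * cnj (b w)) * E w))"
proof -
 define Q where "Q w = dzb a w * (cnj (b w) * E w)" for w
 have b1: "CK 1 b U" and a1: "CK 1 a U" by (rule CK_le[OF b] CK_le[OF a], simp)+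
 have daz: "CK 1 (dz a) U" "CK 1 (dzb a) U" using a by (auto simp: numeral_2_eq_2)
 have Da: "CK 1 (D a) U" by (rule D_CK) (use a in \<open>simp_all add: numeral_2_eq_2\<close>)
 have Q: "CK 1 Q U" unfolding Q_def by (intro CK_mult CK_cnj U daz b1 CK_le[OF E_CK]) simp
 have d: "a differentiable (at w)" "b differentiable (at w)" "dz a differentiable (at w)" "dzb a differentiable (at w)" "G differentiable (at w)"
  if "w : U" for w using a1 b1 daz G_CK that by (auto simp: numeral_2_eq_2)
 have eQ: "dz Q w = dz (dzb a) w * cnj (b w) * E w + dzb a w * cnj (dzb b w) * E w - of_nat q * dzb a w * cnj (b w) * G w * E w" if w: "w : U" for w
 proof -
  note c = wirtinger_cnj[OF d(2)[OF w]]
  note m = wirtinger_mult[OF c(3) E_wirtinger(3)[OF w]]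
  show ?thesis unfolding Q_def wirtinger_mult(1)[OF d(4)[OF w] m(3)] m(1) c(1) E_wirtinger(1)[OF w] by (simp add: algebra_simps)
 qed
 have eD: "dzb (D a) w = - dzb (dz a) w + of_nat q * dzb G w * a w + of_nat q * G w * dzb a w" if w: "w : U" for w
 proof -
  have k: "dzb (%x. c) w = 0" "(%x. c) differentiable (at w)" for c :: complex using wirtinger_holomorphic(2,3)[of "%_. c" UNIV w] by auto
  note m = wirtinger_mult[OF k(2)[of "of_nat q"] d(5)[OF w]]
  note m2 = wirtinger_mult[OF m(3) d(1)[OF w]]
  note m3 = wirtinger_mult[OF k(2)[of "-1"] d(3)[OF w]]
  have "D a = (%w. (-1) * dz a w + of_nat q * G w * a w)" by (auto simp: D_def fun_eq_iff)
  then show ?thesis using wirtinger_add(2)[OF m3(3) m2(3)] m(2) m2(2) m3(2) by (simp add: k(1))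
 qed
 have z: "Q w = 0" if "w : U" "w ~: K" for w using K(3)[OF that] by (auto simp: Q_def)
 note I = integral_dzb_compact(3,4)[OF Q K(1,2) z]
 note J = adjoint[OF Da b1 K(1,2) _ i]
 have z': "D a w * b w = 0" if "w : U" "w ~: K" for w using K(3)[OF that] by simp
 have eq: "(%w. indicator U w *\<^sub>R ((dzb a w * cnj (dzb b w) + of_nat q * dzb G w * a w * cnj (b w)) * E w)) =
   (%w. indicator U w *\<^sub>R dz Q w + indicator U w *\<^sub>R (dzb (D a) w * cnj (b w) * E w))"
 proof (rule ext)
  fix w
  show "indicator U w *\<^sub>R ((dzb a w * cnj (dzb b w) + of_nat q * dzb G w * a w * cnj (b w)) * E w) =
   indicator U w *\<^sub>R dz Q w + indicator U w *\<^sub>R (dzb (D a) w * cnj (b w) * E w)"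
  proof (cases "w : U")
   case True
   have "(dzb a w * cnj (dzb b w) + of_nat q * dzb G w * a w * cnj (b w)) * E w = dz Q w + dzb (D a) w * cnj (b w) * E w"
    unfolding eQ[OF True] eD[OF True] dz_dzb_comm[OF U a True] by (simp add: algebra_simps)
   then show ?thesis using True by simp
  qed simp
 qed
 show "integrable lborel (%w. indicator U w *\<^sub>R ((dzb a w * cnj (dzb b w) + of_nat q * dzb G w * a w * cnj (b w)) * E w))"
  unfolding eq using I(1) J(2)[OF z'] by simp
 show "(LINT w|lborel. indicator U w *\<^sub>R (D a w * cnj (D b w) * E w)) =
   (LINT w|lborel. indicator U w *\<^sub>R ((dzb a w * cnj (dzb b w) + of_nat q * dzb G w * a w * cnj (b w)) * E w))" unfolding eq using I J[OF z'] by simp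
qed

end

section \<open>Change of coordinates\<close>

locale coordinate_change = fixes U V :: "complex set" and t :: "complex => complex" and r1 r2 :: "complex => real"
 assumes U: "open U" and V: "open V" and t: "t holomorphic_on U" "t ` U \<subseteq> V" "!!w. w : U ==> deriv t w ~= 0"
  and r2: "Ck_on 3 r2 V" "!!w. w : V ==> r2 w > 0" and r12: "!!w. w : U ==> r1 w = r2 (t w) * sq (deriv t w)"
begin

lemma t': "deriv t holomorphic_on U" by (rule holomorphic_deriv[OF t(1) U])

lemma weight2: "weighted_plane V r2" by (standard; fact V r2)

text \<open>The logarithmic derivative of a density changes like a connection; the additional term is holomorphic, so the curvature is a form.\<close>
lemma G_change: assumes w: "w : U" shows "wG r1 w = wG r2 (t w) * deriv t w + deriv (deriv t) w / deriv t w"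
proof -
 let ?R1 = "%w. complex_of_real (r1 w)" and ?R2 = "%w. complex_of_real (r2 w)"
 have tw: "t w : V" using w t by auto
 have e: "?R1 x = ?R2 (t x) * (deriv t x * cnj (deriv t x))" if "x : U" for x using r12[OF that] by (simp add: of_real_cmod_sq)
 have d2: "?R2 differentiable (at (t w))" by (rule weighted_plane.r_differentiable[OF weight2 tw])
 note c = wirtinger_compose[OF t(1) U w d2]
 note h = wirtinger_holomorphic[OF t' U w]
 note hc = wirtinger_cnj[OF h(3)]
 note m = wirtinger_mult[OF h(3) hc(3)]
 have "dz ?R1 w = dz (%x. ?R2 (t x) * (deriv t x * cnj (deriv t x))) w" by (rule wirtinger_cong[OF U w e])
 also have "... = dz ?R2 (t w) * deriv t w * (deriv t w * cnj (deriv t w)) + ?R2 (t w) * (deriv (deriv t) w * cnj (deriv t w))"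
  unfolding wirtinger_mult(1)[OF c(3) m(3)] c(1) m(1) hc(1) h(1,2) by simp
 finally have 1: "dz ?R1 w = ..." .
 have nz: "?R2 (t w) ~= 0" "deriv t w ~= 0" "cnj (deriv t w) ~= 0" using r2(2)[OF tw] t(3)[OF w] by auto
 have alg: "(A * d * (d * d') + R * (D * d')) / (R * (d * d')) = A / R * d + D / d" if "R ~= 0" "d ~= 0" "d' ~= 0" for A R D d d' :: complex
  using that by (simp add: field_simps)
 show ?thesis unfolding wG_def 1 e[OF w] by (rule alg[OF nz])
qed

lemma curvature_change: assumes w: "w : U" shows "dzb (wG r1) w = dzb (wG r2) (t w) * cnj (deriv t w) * deriv t w"
proof -
 have tw: "t w : V" using w t by auto
 have d2: "wG r2 differentiable (at (t w))" using weighted_plane.G_CK[OF weight2] tw by (auto simp: numeral_2_eq_2)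
 note c = wirtinger_compose[OF t(1) U w d2]
 note h = wirtinger_holomorphic[OF t' U w]
 have q: "(%x. deriv (deriv t) x / deriv t x) holomorphic_on U" by (intro holomorphic_intros holomorphic_deriv t' U t(3))
 note hq = wirtinger_holomorphic[OF q U w]
 note m = wirtinger_mult[OF c(3) h(3)]
 have "dzb (wG r1) w = dzb (%x. wG r2 (t x) * deriv t x + deriv (deriv t) x / deriv t x) w" by (rule wirtinger_cong[OF U w]) (rule G_change)
 also have "... = dzb (wG r2) (t w) * cnj (deriv t w) * deriv t w" unfolding wirtinger_add(2)[OF m(3) hq(3)] m(2) c(2) h(2) hq(2) by simp
 finally show ?thesis .
qed

lemma section_change: assumes w: "w : U" and a2: "CK 1 a2 V" and a12: "!!w. w : U ==> a1 w = a2 (t w) * deriv t w ^ q"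
 shows "wD r1 q a1 w = wD r2 q a2 (t w) * deriv t w ^ Suc q" "dzb a1 w = dzb a2 (t w) * cnj (deriv t w) * deriv t w ^ q"
proof -
 have tw: "t w : V" using w t by auto
 have d2: "a2 differentiable (at (t w))" using a2 tw by auto
 note c = wirtinger_compose[OF t(1) U w d2]
 note h = wirtinger_holomorphic[OF t' U w]
 note p = weighted_plane.power_wirtinger[OF weight2 h(3), of q]
 have e: "dz a1 w = dz (%x. a2 (t x) * deriv t x ^ q) w" "dzb a1 w = dzb (%x. a2 (t x) * deriv t x ^ q) w" by (rule wirtinger_cong[OF U w a12], assumption)+
 show "dzb a1 w = dzb a2 (t w) * cnj (deriv t w) * deriv t w ^ q" unfolding e(2) wirtinger_mult(2)[OF c(3) p(3)] c(2) p(2) h(2) by simp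
 have nz: "deriv t w ~= 0" by (rule t(3)[OF w])
 have alg: "- (A * d * d ^ q + a * (of_nat q * d ^ (q - 1) * dd) - of_nat q * (g * d + dd / d) * (a * d ^ q)) =
   - (A - of_nat q * g * a) * d ^ Suc q" if "d ~= 0" for A a d dd g :: complex using that by (cases q) (auto simp: field_simps)
 show "wD r1 q a1 w = wD r2 q a2 (t w) * deriv t w ^ Suc q" unfolding wD_def e(1) wirtinger_mult(1)[OF c(3) p(3)] c(1) p(1) h(1) G_change[OF w] a12[OF w] by (rule alg[OF nz])
qed

end

context surf
begin

lemma weighted_plane: "k : charts A ==> weighted_plane (W k) (rho k)" by standard (auto intro: open_W rho_smooth rho_pos)

lemma coordinate_change: assumes k: "k : charts A" and l: "l : charts A"
 shows "coordinate_change (snd k ` (fst k Int (fst l Int Y))) (W l) (transition k l) (rho k) (rho l)"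
proof
 show "open (snd k ` (fst k Int (fst l Int Y)))" by (rule open_W_overlap[OF k l])
 show "open (W l)" by (rule open_W[OF l])
 show "transition k l holomorphic_on snd k ` (fst k Int (fst l Int Y))" by (rule holomorphic_on_subset[OF transition_holomorphic[OF k l]]) auto
 show "transition k l ` snd k ` (fst k Int (fst l Int Y)) \<subseteq> W l" by (auto simp: W_def transition_snd[OF k])
 show "Ck_on 3 (rho l) (W l)" by (rule rho_smooth[OF l])
 show "!!w. w : W l ==> 0 < rho l w" by (rule rho_pos[OF l])
 fix w assume "w : snd k ` (fst k Int (fst l Int Y))"
 then obtain x where x: "x : fst k" "x : fst l" "x : Y" "w = snd k x" by auto
 show "deriv (transition k l) w ~= 0" using jac_inverse(2)[OF k l x(1,2)] by (simp add: jac_def x(4))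
 show "rho k w = rho l (transition k l w) * sq (deriv (transition k l) w)"
  using omega_law[OF k l x(1-3)] by (simp add: x(4) transition_snd[OF k x(1)] rho_snd[OF k x(1)] rho_snd[OF l x(2)] jac_def)
qed

section \<open>Test sections and the adjoint of \<open>\<partial>\<close>-bar\<close>

definition csec :: "nat => 'a sect => bool" where "csec q a \<longleftrightarrow> law q a & (\<forall>k\<in>charts A. CK 2 (co k a) (W k))"

lemma csecD: "csec q a ==> law q a" "csec q a ==> k : charts A ==> CK 2 (co k a) (W k)"
 "csec q a ==> k : charts A ==> CK 1 (co k a) (W k)" unfolding csec_def by (blast, blast, metis CK_le one_le_numeral)

lemma csec_continuous: "csec q a ==> k : charts A ==> continuous_on (W k) (co k a)" by (rule CK_continuous[OF csecD(2)])

lemma csec_cmeas: "csec q a ==> cmeas a" by (rule cmeas_continuous) (rule csec_continuous)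

text \<open>The operator D maps sections of \<open>K\<^sup>q\<close> to sections of \<open>K\<^sup>q\<^sup>+\<^sup>1\<close>.\<close>
definition dsec :: "nat => 'a sect => 'a sect" where
 "dsec q a k x = (if k : charts A & x : fst k Int Y then wD (rho k) q (co k a) (snd k x) else 0)"

lemma co_law: assumes "law q a" and k: "k : charts A" and l: "l : charts A" and w: "w : snd k ` (fst k Int (fst l Int Y))"
 shows "co k a w = co l a (transition k l w) * deriv (transition k l) w ^ q"
proof -
 obtain x where x: "x : fst k" "x : fst l" "x : Y" "w = snd k x" using w by auto
 show ?thesis using lawD[OF assms(1) k l x(1-3)] by (simp add: x(4) transition_snd[OF k x(1)] co_snd[OF k x(1)] co_snd[OF l x(2)] jac_def)
qed

lemma law_dsec: assumes a: "csec q a" shows "law (Suc q) (dsec q a)" unfolding law_def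
proof (intro ballI)
 fix k l x assume k: "k : charts A" and l: "l : charts A" and x: "x : fst k Int fst l Int Y"
 have w: "snd k x : snd k ` (fst k Int (fst l Int Y))" using x by auto
 show "dsec q a k x = dsec q a l x * jac k l x ^ Suc q"
  using coordinate_change.section_change(1)[OF coordinate_change[OF k l] w csecD(3)[OF a l] co_law[OF csecD(1)[OF a] k l]] x k l
  by (simp add: dsec_def transition_snd jac_def del: power_Suc)
qed

lemma co_dsec: "k : charts A ==> w : W k ==> co k (dsec q a) w = wD (rho k) q (co k a) w"
proof -
 assume k: "k : charts A" and "w : W k"
 from this(2) obtain x where x: "x : fst k" "x : Y" "w = snd k x" "cinv k w = x" by (rule WE[OF k])
 show ?thesis unfolding co_def x(4) using x k by (simp add: dsec_def co_def[abs_def])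
qed

lemma CK_dsec: "csec q a ==> k : charts A ==> CK 1 (co k (dsec q a)) (W k)"
proof -
 assume a: "csec q a" and k: "k : charts A"
 have "CK 1 (wD (rho k) q (co k a)) (W k)" by (rule weighted_plane.D_CK[OF weighted_plane[OF k]]) (use csecD(2)[OF a k] in \<open>simp_all add: numeral_2_eq_2\<close>)
 then show ?thesis by (rule CK_cong[THEN iffD2, OF open_W[OF k], rotated]) (rule co_dsec[OF k])
qed

lemma dsec_continuous: "csec q a ==> k : charts A ==> continuous_on (W k) (co k (dsec q a))" by (rule CK_continuous[OF CK_dsec])

lemma dsec_cmeas: "csec q a ==> cmeas (dsec q a)" by (rule cmeas_continuous) (rule dsec_continuous)

lemma supp_in_dsec: assumes b: "supp_in k K b" shows "supp_in k K (dsec q b)"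
proof -
 have k: "k : charts A" and K: "compact K" "K \<subseteq> W k"
  and s: "!!l x. l : charts A ==> x : fst l ==> x : Y ==> b l x ~= 0 ==> x : fst k & snd k x : K"
  using b unfolding supp_in_def by blast+
 define C where "C = cinv k ` K"
 have "compact C" unfolding C_def by (intro compact_continuous_image continuous_on_subset[OF chartD(5)[OF k]] K(1)) (use K(2) in \<open>auto simp: W_def\<close>)
 then have oC: "open (- C)" using compact_imp_closed by auto
 have "dsec q b l x = 0" if l: "l : charts A" and x: "x : fst l" "x : Y" and nC: "x ~: C" for l x
 proof -
  let ?O = "snd l ` (fst l Int (- C Int Y))"
  have o: "open ?O" "snd l x : ?O" using open_chart_image[OF l, of "- C Int Y"] oC opY x nC by auto
  have z: "co l b w = 0" if "w : ?O" for w
  proof -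
   obtain y where y: "y : fst l" "y ~: C" "y : Y" "w = snd l y" using \<open>w : ?O\<close> by auto
   have "b l y = 0"
   proof (rule ccontr)
    assume "b l y ~= 0"
    from s[OF l y(1,3) this] have "y : C" using k by (auto simp: C_def image_iff) (metis cinv_snd)
    then show False using y(2) by simp
   qed
   then show ?thesis using y l by (simp add: co_snd)
  qed
  have "dz (co l b) (snd l x) = 0" using wirtinger_cong(1)[OF o z] wirtinger_holomorphic(1)[of "%_. 0" UNIV "snd l x"] by simp
  then show ?thesis using z[OF o(2)] by (simp add: dsec_def wD_def)
 qed
 then have "x : C" if "l : charts A" "x : fst l" "x : Y" "dsec q b l x ~= 0" for l x using that by blast
 moreover have "x : fst k & snd k x : K" if "x : C" for x using that K(2) k by (auto simp: C_def W_def)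
 ultimately show ?thesis unfolding supp_in_def using k K by blast
qed

text \<open>The pointwise Bochner-Kodaira density of two sections, a function on Y.\<close>
definition nn :: "nat => 'a sect => 'a sect => 'a chart => 'a => complex" where
 "nn q a b k x = (dzb (co k a) (snd k x) * cnj (dzb (co k b) (snd k x)) + of_nat q * dzb (wG (rho k)) (snd k x) * co k a (snd k x) * cnj (co k b (snd k x)))
   * of_real ((2 / \<omega> k x) ^ q / \<omega> k x)"

lemma nn_invariant: assumes a: "csec q a" and b: "csec q b" and k: "k : charts A" and l: "l : charts A" and x: "x : fst k" "x : fst l" "x : Y"
 shows "nn q a b k x = nn q a b l x"
proof -
 have w: "snd k x : snd k ` (fst k Int (fst l Int Y))" using x by auto
 note cc = coordinate_change[OF k l]
 define d where "d = jac k l x"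
 have d: "d ~= 0" "cnj d ~= 0" using jac_inverse(2)[OF k l x(1,2)] by (auto simp: d_def)
 note ds = d_def[unfolded jac_def, symmetric] and ts = transition_snd[OF k x(1), of l]
 have sec: "dzb (co k c) (snd k x) = dzb (co l c) (snd l x) * cnj d * d ^ q" if c: "csec q c" for c unfolding d_def jac_def ts[symmetric]
  by (rule coordinate_change.section_change(2)[OF cc w csecD(3)[OF c l]]) (rule co_law[OF csecD(1)[OF c] k l])
 note sa = sec[OF a] and sb = sec[OF b]
 note sG = coordinate_change.curvature_change[OF cc w, unfolded ds ts]
 note la = co_law[OF csecD(1)[OF a] k l w, unfolded ds ts] and lb = co_law[OF csecD(1)[OF b] k l w, unfolded ds ts]
 have o: "complex_of_real (\<omega> k x) = of_real (\<omega> l x) * (d * cnj d)" using omega_law[OF k l x] by (simp add: of_real_cmod_sq d_def)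
 have wt: "complex_of_real ((2 / \<omega> k x) ^ q / \<omega> k x) = of_real ((2 / \<omega> l x) ^ q / \<omega> l x) / (d ^ q * cnj d ^ q * (d * cnj d))"
  by (simp add: o power_divide power_mult_distrib)
 have alg: "((za * d' * p) * cnj (zb * d' * p) + n * (c * d' * d) * (aa * p) * cnj (bb * p)) * (E / (p * cnj p * (d * d'))) =
   (za * cnj zb + n * c * aa * cnj bb) * E" if "p ~= 0" "d' = cnj d" for za zb d' p n c aa bb E using that d by (simp add: field_simps)
 show ?thesis unfolding nn_def sa sb sG la lb wt unfolding complex_cnj_power[symmetric] by (rule alg) (use d in auto)
qed

lemma nn_continuous: assumes a: "csec q a" and b: "csec q b" and k: "k : charts A" shows "continuous_on (W k) (%w. nn q a b k (cinv k w))"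
proof -
 interpret weighted_plane "W k" "rho k" q by (rule weighted_plane[OF k])
 have ca: "continuous_on (W k) (dzb (co k a))" "continuous_on (W k) (dzb (co k b))" "continuous_on (W k) (dzb (wG (rho k)))"
  using csecD(2)[OF a k] csecD(2)[OF b k] G_CK by (auto simp: numeral_2_eq_2 intro!: CK_continuous[of "Suc 0"])
 have "continuous_on (W k) (%w. (dzb (co k a) w * cnj (dzb (co k b) w) + of_nat q * dzb (wG (rho k)) w * co k a w * cnj (co k b w))
   * of_real ((2 / rho k w) ^ q / rho k w))"
  using rho_pos[OF k] by (intro continuous_intros ca csec_continuous[OF a k] csec_continuous[OF b k] weight_continuous k rho_continuous) force
 then show ?thesis by (rule continuous_on_cong[THEN iffD1, OF refl, rotated]) (auto simp: nn_def W_def rho_snd[OF k] k)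
qed

lemma nn_measurable: assumes "csec q a" "csec q b" shows "(%x. nn q a b (sel x) x) : borel_measurable AM"
 by (rule glob_measurable) (intro borel_measurable_continuous_on_indicator nn_continuous assms, use open_W in auto)

lemma ip_dsec_local: assumes a: "csec q a" "scal (Suc q) (dsec q a) : L2 AM" and b: "csec q b" "supp_in k K b"
 shows "ip AM (scal (Suc q) (dsec q a)) (scal (Suc q) (dsec q b)) = 2 * (LINT x|AM. nn q a b (sel x) x)" "integrable AM (%x. nn q a b (sel x) x)"
proof -
 have k: "k : charts A" "compact K" "K \<subseteq> W k" using b(2) by (auto simp: supp_in_def)
 interpret weighted_plane "W k" "rho k" q by (rule weighted_plane[OF k(1)])
 have sb: "supp_in k K (dsec q b)" by (rule supp_in_dsec[OF b(2)])
 have b2: "scal (Suc q) (dsec q b) : L2 AM" by (rule scal_L2[OF law_dsec[OF b(1)] dsec_continuous[OF b(1)] sb])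
 have z: "scal (Suc q) (dsec q a) x * cnj (scal (Suc q) (dsec q b) x) = 0" if "x : Y" "x ~: fst k" for x using supp_scal[OF sb that] by simp
 note ic = ip_chart[OF law_dsec[OF a(1)] dsec_cmeas[OF a(1)] law_dsec[OF b(1)] dsec_cmeas[OF b(1)] k(1)]
 let ?X = "%w. indicator (W k) w *\<^sub>R (D (co k a) w * cnj (D (co k b) w) * E w)"
 let ?N = "%w. indicator (W k) w *\<^sub>R ((dzb (co k a) w * cnj (dzb (co k b) w) + of_nat q * dzb G w * co k a w * cnj (co k b w)) * E w)"
 have eX: "(%w. indicator (W k) w *\<^sub>R (co k (dsec q a) w * cnj (co k (dsec q b) w) * of_real ((2 / rho k w) ^ q))) = ?X"
  using co_dsec[OF k(1)] by (auto simp: fun_eq_iff indicator_def wE_def)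
 have ic1: "ip AM (scal (Suc q) (dsec q a)) (scal (Suc q) (dsec q b)) = 2 * (LINT w|lborel. ?X w)" unfolding eX[symmetric] by (rule ic(1)) (rule z)
 have iX: "integrable lborel ?X" unfolding eX[symmetric] by (rule ic(2)[OF _ L2_integrable_prod[OF a(2) b2]]) (rule z)
 have bk1: "(LINT w|lborel. ?X w) = (LINT w|lborel. ?N w)" by (rule bochner_kodaira(1)[OF csecD(2)[OF a(1) k(1)] csecD(2)[OF b(1) k(1)] k(2,3) _ iX]) (rule supp_co[OF b(2)])
 have bk2: "integrable lborel ?N" by (rule bochner_kodaira(2)[OF csecD(2)[OF a(1) k(1)] csecD(2)[OF b(1) k(1)] k(2,3) _ iX]) (rule supp_co[OF b(2)])
 define f where "f x = nn q a b (sel x) x" for x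
 have fm: "f : borel_measurable AM" unfolding f_def by (rule nn_measurable[OF a(1) b(1)])
 have fk: "f x = nn q a b k x" if "x : fst k" "x : Y" for x unfolding f_def by (rule nn_invariant[OF a(1) b(1) sel(1) k(1) sel(2) that])
 have f0: "f x = 0" if x: "x : Y" "x ~: fst k" for x
 proof -
  define C where "C = cinv k ` K"
  have "compact C" unfolding C_def by (intro compact_continuous_image continuous_on_subset[OF chartD(5)[OF k(1)]] k(2)) (use k(3) in \<open>auto simp: W_def\<close>)
  then have oC: "open (- C)" using compact_imp_closed by auto
  let ?l = "sel x"
  let ?O = "snd ?l ` (fst ?l Int (- C Int Y))"
  have "x ~: C" using x k by (auto simp: C_def W_def)
  then have o: "open ?O" "snd ?l x : ?O" using open_chart_image[OF sel(1), of "- C Int Y"] oC opY x(1) sel(2) by auto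
  have zz: "co ?l b w = 0" if "w : ?O" for w
  proof -
   obtain y where y: "y : fst ?l" "y ~: C" "y : Y" "w = snd ?l y" using \<open>w : ?O\<close> by auto
   have "b ?l y = 0"
   proof (rule ccontr)
    assume "b ?l y ~= 0"
    then have "y : fst k & snd k y : K" using b(2) sel(1) y(1,3) unfolding supp_in_def by blast
    then have "y : C" using k(1) by (auto simp: C_def image_iff) (metis cinv_snd)
    then show False using y(2) by simp
   qed
   then show ?thesis using y sel by (simp add: co_snd)
  qed
  have "dzb (co ?l b) (snd ?l x) = 0" using wirtinger_cong(2)[OF o zz] wirtinger_holomorphic(2)[of "%_. 0" UNIV "snd ?l x"] by simp
  then show ?thesis using zz[OF o(2)] by (simp add: f_def nn_def)
 qed
 have eN: "(%w. indicator (W k) w *\<^sub>R (of_real (rho k w) * f (cinv k w))) = ?N"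
 proof
  fix w show "indicator (W k) w *\<^sub>R (of_real (rho k w) * f (cinv k w)) = ?N w"
  proof (cases "w : W k")
   case True
   then obtain x where x: "x : fst k" "x : Y" "w = snd k x" "cinv k w = x" by (rule WE[OF k(1)])
   have r: "rho k w = \<omega> k x" "\<omega> k x > 0" using rho_snd[OF k(1) x(1)] omega_pos[OF k(1) x(1,2)] x(3) by auto
   have "of_real (\<omega> k x) * nn q a b k x = (dzb (co k a) w * cnj (dzb (co k b) w) + of_nat q * dzb G w * co k a w * cnj (co k b w)) * E w"
    using r unfolding nn_def x(3)[symmetric] wE_def by simp
   then show ?thesis using True fk[OF x(1,2)] r(1) x(4) by simp
  qed simp
 qed
 have I: "integrable AM f \<longleftrightarrow> integrable lborel ?N" "(LINT x|AM. f x) = (LINT w|lborel. ?N w)"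
  unfolding eN[symmetric] by (rule integral_chart[OF k(1) fm f0], assumption+)+
 show "integrable AM (%x. nn q a b (sel x) x)" using I(1) bk2 unfolding f_def by blast
 show "ip AM (scal (Suc q) (dsec q a)) (scal (Suc q) (dsec q b)) = 2 * (LINT x|AM. nn q a b (sel x) x)" unfolding ic1 bk1 I(2)[symmetric] f_def ..
qed

end

context surf
begin

inductive tsec :: "nat => 'a sect => bool" for q where
 zero: "tsec q (%_ _. 0)"
| add: "tsec q a ==> csec q b ==> supp_in k K b ==> tsec q (%k x. a k x + c * b k x)"

lemma co_lin: "co k (%k x. S k x + c * T k x) = (%w. co k S w + c * co k T w)" by (simp add: co_def fun_eq_iff)

lemma csec_lin: "csec q a ==> csec q b ==> csec q (%k x. a k x + c * b k x)"
proof -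
 assume a: "csec q a" and b: "csec q b"
 have "law q (%k x. a k x + c * b k x)" unfolding law_def
 proof (intro ballI)
  fix k l x assume "k : charts A" "l : charts A" "x : fst k Int fst l Int Y"
  then show "a k x + c * b k x = (a l x + c * b l x) * jac k l x ^ q" using lawD[OF csecD(1)[OF a], of k l x] lawD[OF csecD(1)[OF b], of k l x] by (simp add: algebra_simps)
 qed
 moreover have "CK 2 (co k (%k x. a k x + c * b k x)) (W k)" if k: "k : charts A" for k
  unfolding co_lin by (intro CK_add CK_mult CK_const open_W k csecD(2)[OF a k] csecD(2)[OF b k])
 ultimately show ?thesis by (simp add: csec_def)
qed

lemma csec_zero: "csec q (%_ _. 0)" by (simp add: csec_def law_def co_def[abs_def])

lemma wirtinger_lin: assumes "f differentiable (at w)" "g differentiable (at w)"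
 shows "dz (%x. f x + c * g x) w = dz f w + c * dz g w" "dzb (%x. f x + c * g x) w = dzb f w + c * dzb g w"
proof -
 have c: "dz (%x. c) w = 0" "dzb (%x. c) w = 0" "(%x. c) differentiable (at w)" using wirtinger_holomorphic[of "%_. c" UNIV w] by auto
 note m = wirtinger_mult[OF c(3) assms(2)]
 show "dz (%x. f x + c * g x) w = dz f w + c * dz g w" "dzb (%x. f x + c * g x) w = dzb f w + c * dzb g w"
  unfolding wirtinger_add[OF assms(1) m(3)] m(1,2) c(1,2) by simp_all
qed

lemma csec_differentiable: "csec q a ==> k : charts A ==> x : fst k ==> x : Y ==> co k a differentiable (at (snd k x))"
 using csecD(3)[of q a k] by (auto simp: W_def)

lemma dsec_lin: assumes a: "csec q a" and b: "csec q b" shows "dsec q (%k x. a k x + c * b k x) = (%k x. dsec q a k x + c * dsec q b k x)"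
proof (intro ext)
 fix k x
 show "dsec q (%k x. a k x + c * b k x) k x = dsec q a k x + c * dsec q b k x"
 proof (cases "k : charts A & x : fst k Int Y")
  case True
  then have d: "co k a differentiable (at (snd k x))" "co k b differentiable (at (snd k x))" using csec_differentiable[OF a] csec_differentiable[OF b] by auto
  show ?thesis using True by (simp add: dsec_def wD_def co_lin wirtinger_lin[OF d] algebra_simps)
 next
  case False
  show ?thesis unfolding dsec_def if_not_P[OF False] by simp
 qed
qed

lemma dsec_zero: "dsec q (%_ _. 0) = (%_ _. 0)"
proof -
 have "dz (co k (%_ _. 0)) w = 0" for k w using wirtinger_holomorphic(1)[of "%_. 0" UNIV w] by (simp add: co_def[abs_def])
 then show ?thesis by (simp add: fun_eq_iff dsec_def wD_def) (simp add: co_def)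
qed

lemma scal_lin: "scal p (%k x. S k x + c * T k x) = (%x. scal p S x + c * scal p T x)" by (simp add: scal_def fun_eq_iff algebra_simps)

lemma scal_zero: "scal p (%_ _. 0) = (%_. 0)" by (simp add: scal_def fun_eq_iff)

lemma tsec_csec: "tsec q a ==> csec q a" by (induction rule: tsec.induct) (auto intro: csec_zero csec_lin)

lemma local_L2: assumes "csec q b" "supp_in k K b" shows "scal q b : L2 AM" "scal (Suc q) (dsec q b) : L2 AM"
 by (rule scal_L2[OF csecD(1) csec_continuous]; use assms in blast) (rule scal_L2[OF law_dsec dsec_continuous supp_in_dsec]; use assms in blast)

lemma tsec_L2: "tsec q a ==> scal q a : L2 AM & scal (Suc q) (dsec q a) : L2 AM"
proof (induction rule: tsec.induct)
 case zero
 show ?case unfolding dsec_zero scal_zero by (simp add: L2_zero)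
next
 case (add a b k K c)
 then show ?case unfolding dsec_lin[OF tsec_csec[OF add(1)] add(2)] scal_lin using local_L2[OF add(2,3)] by (auto intro: L2_lincomb)
qed

lemma tsec_local: "csec q b ==> supp_in k K b ==> tsec q b" using tsec.add[OF tsec.zero, of q b k K 1] by simp

lemma tsec_lincomb: "tsec q b ==> tsec q a ==> tsec q (%k x. a k x + c * b k x)"
proof (induction rule: tsec.induct)
 case (add b b' k K c')
 have "tsec q (%k x. (a k x + c * b k x) + (c * c') * b' k x)" by (rule tsec.add[OF add(4)[OF add(5)] add(2,3)])
 then show ?case by (simp add: algebra_simps)
qed simp

lemma nn_lin: assumes b: "csec q b" and b': "csec q b'" and k: "k : charts A" "x : fst k" "x : Y"
 shows "nn q a (%k x. b k x + c * b' k x) k x = nn q a b k x + cnj c * nn q a b' k x"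
proof -
 have d: "co k b differentiable (at (snd k x))" "co k b' differentiable (at (snd k x))" using csec_differentiable[OF b k] csec_differentiable[OF b' k] by auto
 show ?thesis unfolding nn_def co_lin wirtinger_lin(2)[OF d] by (simp add: algebra_simps)
qed

lemma ip_dsec: assumes a: "tsec q a" and b: "tsec q b" shows "ip AM (scal (Suc q) (dsec q a)) (scal (Suc q) (dsec q b)) = 2 * (LINT x|AM. nn q a b (sel x) x) \<and>
  integrable AM (%x. nn q a b (sel x) x)" using b
proof (induction rule: tsec.induct)
 case zero
 have "nn q a (%_ _. 0) k x = 0" for k x using wirtinger_holomorphic(2)[of "%_. 0" UNIV "snd k x"] by (simp add: nn_def co_def[abs_def])
 then show ?case by (simp add: dsec_zero scal_zero ip_def)
next
 case (add b b' k K c)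
 have cb: "csec q b" by (rule tsec_csec[OF add(1)])
 have a2: "scal (Suc q) (dsec q a) : L2 AM" using tsec_L2[OF a] by blast
 have b2: "scal (Suc q) (dsec q b) : L2 AM" using tsec_L2[OF add(1)] by blast
 note l2 = local_L2(2)[OF add(2,3)]
 note loc = ip_dsec_local[OF tsec_csec[OF a] a2 add(2,3)]
 have e: "nn q a (%k x. b k x + c * b' k x) (sel x) x = nn q a b (sel x) x + cnj c * nn q a b' (sel x) x" if "x : Y" for x by (rule nn_lin[OF cb add(2) sel that])
 have "integrable AM (%x. nn q a b (sel x) x + cnj c * nn q a b' (sel x) x)"
  using add(4) loc(2) by (intro Bochner_Integration.integrable_add integrable_mult_right) auto
 then have 1: "integrable AM (%x. nn q a (%k x. b k x + c * b' k x) (sel x) x)"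
  by (rule Bochner_Integration.integrable_cong[THEN iffD2, rotated -1]) (auto simp: e)
 have "(LINT x|AM. nn q a (%k x. b k x + c * b' k x) (sel x) x) = (LINT x|AM. nn q a b (sel x) x + cnj c * nn q a b' (sel x) x)"
  by (rule Bochner_Integration.integral_cong) (auto simp: e)
 also have "... = (LINT x|AM. nn q a b (sel x) x) + cnj c * (LINT x|AM. nn q a b' (sel x) x)" using add(4) loc(2) by simp
 finally have 2: "(LINT x|AM. nn q a (%k x. b k x + c * b' k x) (sel x) x) = ..." .
 have "ip AM (scal (Suc q) (dsec q a)) (%x. scal (Suc q) (dsec q b) x + c * scal (Suc q) (dsec q b') x)
   = ip AM (scal (Suc q) (dsec q a)) (scal (Suc q) (dsec q b)) + cnj c * ip AM (scal (Suc q) (dsec q a)) (scal (Suc q) (dsec q b'))"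
  using ip_add_right[OF b2 L2_scale[OF l2] a2] by (simp add: ip_scale_right)
 then show ?case unfolding dsec_lin[OF cb add(2)] scal_lin using 1 2 add(4) loc(1) by (simp add: algebra_simps)
qed

definition VV :: "nat => ('a => complex) set" where "VV q = {scal (Suc q) (dsec q a) | a. tsec q a}"

lemma VV_L2: "VV q \<subseteq> L2 AM" using tsec_L2 by (auto simp: VV_def)

lemma VV_zero: "(%_. 0) : VV q" unfolding VV_def by (intro CollectI exI[of _ "%_ _. 0"]) (simp add: dsec_zero scal_zero tsec.zero)

lemma VV_lincomb: "f : VV q ==> g : VV q ==> (%x. f x + c * g x) : VV q"
proof -
 assume "f : VV q" "g : VV q"
 then obtain a b where ab: "tsec q a" "tsec q b" "f = scal (Suc q) (dsec q a)" "g = scal (Suc q) (dsec q b)" by (auto simp: VV_def)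
 show ?thesis unfolding VV_def by (intro CollectI exI[of _ "%k x. a k x + c * b k x"] conjI tsec_lincomb ab)
   (simp add: dsec_lin[OF tsec_csec[OF ab(1)] tsec_csec[OF ab(2)]] scal_lin ab)
qed

text \<open>On the diagonal the density is at least the curvature term, which the Ricci bound controls from below. The factor in \<open>ip_dsec\<close> makes the constant \<open>q\<kappa>\<close>.\<close>
lemma energy:
 assumes curv: "!!k w. k : charts A ==> w : W k ==> \<exists>c. dzb (wG (rho k)) w = of_real c & c >= \<kappa> / 2 * rho k w"
  and a: "tsec q a" shows "real q * \<kappa> * nsq AM (scal q a) <= nsq AM (scal (Suc q) (dsec q a))"
proof -
 have a2: "scal q a : L2 AM" "scal (Suc q) (dsec q a) : L2 AM" using tsec_L2[OF a] by auto
 note I = ip_dsec[OF a a]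
 have pt: "real q * \<kappa> / 2 * sq (scal q a x) <= Re (nn q a a (sel x) x)" if x: "x : Y" for x
 proof -
  let ?k = "sel x" and ?w = "snd (sel x) x"
  have k: "?k : charts A" "x : fst ?k" by (rule sel)+
  have w: "?w : W ?k" using k x by (auto simp: W_def)
  obtain c where c: "dzb (wG (rho ?k)) ?w = of_real c" "c >= \<kappa> / 2 * rho ?k ?w" using curv[OF k(1) w] by blast
  have o: "\<omega> ?k x > 0" by (rule omega_pos[OF k x])
  have r: "rho ?k ?w = \<omega> ?k x" by (rule rho_snd[OF k])
  let ?z = "dzb (co ?k a) ?w" and ?s = "co ?k a ?w"
  have "nn q a a ?k x = of_real (((cmod ?z)^2 + real q * c * (cmod ?s)^2) * ((2 / \<omega> ?k x) ^ q / \<omega> ?k x))"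
   unfolding nn_def c(1) by (simp add: complex_norm_square[symmetric] mult.assoc flip: of_real_power)
  then have e1: "Re (nn q a a ?k x) = ((cmod ?z)^2 + real q * c * (cmod ?s)^2) * ((2 / \<omega> ?k x) ^ q / \<omega> ?k x)" by (simp only: Re_complex_of_real)
  have le: "(real q * (\<kappa> / 2 * \<omega> ?k x) * (cmod ?s)^2) * ((2 / \<omega> ?k x) ^ q / \<omega> ?k x) \<le>
   ((cmod ?z)^2 + real q * c * (cmod ?s)^2) * ((2 / \<omega> ?k x) ^ q / \<omega> ?k x)"
  proof (rule mult_right_mono)
   have "real q * (\<kappa> / 2 * \<omega> ?k x) * (cmod ?s)^2 <= real q * c * (cmod ?s)^2" using c(2) r by (intro mult_right_mono mult_left_mono) auto
   then show "real q * (\<kappa> / 2 * \<omega> ?k x) * (cmod ?s)^2 <= (cmod ?z)^2 + real q * c * (cmod ?s)^2" by (simp add: add_increasing)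
  qed (use o in simp)
  have e2: "(real q * (\<kappa> / 2 * \<omega> ?k x) * (cmod ?s)^2) * ((2 / \<omega> ?k x) ^ q / \<omega> ?k x) = real q * \<kappa> / 2 * ((cmod ?s)^2 * (2 / \<omega> ?k x) ^ q)"
   using o by simp
  have e3: "sq (scal q a x) = (cmod ?s)^2 * (2 / \<omega> ?k x) ^ q" using scal_sq[OF csecD(1)[OF tsec_csec[OF a]] k x] k by (simp add: co_snd)
  show ?thesis unfolding e1 e3 using le unfolding e2 .
 qed
 have Ri: "integrable AM (%x. Re (nn q a a (sel x) x))" by (rule integrable_bounded_linear[OF bounded_linear_Re]) (use I in blast)
 have "real q * \<kappa> / 2 * nsq AM (scal q a) = (LINT x|AM. real q * \<kappa> / 2 * sq (scal q a x))" by (simp add: nsq_def)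
 also have "... <= (LINT x|AM. Re (nn q a a (sel x) x))" by (rule integral_mono[OF _ Ri]) (use a2(1) pt in \<open>auto simp: L2_def\<close>)
 also have "... = Re (LINT x|AM. nn q a a (sel x) x)" by (rule integral_bounded_linear[OF bounded_linear_Re]) (use I in blast)
 also have "2 * ... = Re (ip AM (scal (Suc q) (dsec q a)) (scal (Suc q) (dsec q a)))" using I by simp
 also have "... = nsq AM (scal (Suc q) (dsec q a))" by (simp add: ip_self[OF a2(2)])
 finally show ?thesis by simp
qed

section \<open>Pairing with test sections\<close>

lemma pairing: assumes S: "law (Suc q) S" "!!l. l : charts A ==> CK 1 (co l S) (W l)" "scal (Suc q) S : L2 AM"
  and a: "csec q a" "scal (Suc q) (dsec q a) : L2 AM" and s: "supp_in k K a \<or> supp_in k K S" shows "ip AM (scal (Suc q) S) (scal (Suc q) (dsec q a)) =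
  2 * (LINT w|lborel. indicator (W k) w *\<^sub>R (dzb (co k S) w * cnj (co k a w) * of_real ((2 / rho k w) ^ q)))"
proof -
 have k: "k : charts A" "compact K" "K \<subseteq> W k" using s by (auto simp: supp_in_def)
 interpret weighted_plane "W k" "rho k" q by (rule weighted_plane[OF k(1)])
 have Sm: "cmeas S" by (rule cmeas_continuous[OF CK_continuous[OF S(2)]])
 have z: "scal (Suc q) S x * cnj (scal (Suc q) (dsec q a) x) = 0" if "x : Y" "x ~: fst k" for x using s supp_scal[OF _ that] supp_in_dsec[of k K a q] by auto
 note ic = ip_chart[OF S(1) Sm law_dsec[OF a(1)] dsec_cmeas[OF a(1)] k(1)]
 let ?X = "%w. indicator (W k) w *\<^sub>R (co k S w * cnj (D (co k a) w) * E w)"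
 have eX: "(%w. indicator (W k) w *\<^sub>R (co k S w * cnj (co k (dsec q a) w) * of_real ((2 / rho k w) ^ q))) = ?X"
  using co_dsec[OF k(1)] by (auto simp: fun_eq_iff indicator_def wE_def)
 have ic1: "ip AM (scal (Suc q) S) (scal (Suc q) (dsec q a)) = 2 * (LINT w|lborel. ?X w)" unfolding eX[symmetric] by (rule ic(1)) (rule z)
 have iX: "integrable lborel ?X" unfolding eX[symmetric] by (rule ic(2)[OF _ L2_integrable_prod[OF S(3) a(2)]]) (rule z)
 have zz: "co k S w * co k a w = 0" if "w : W k" "w ~: K" for w using s supp_co[OF _ that] by auto
 have "(LINT w|lborel. ?X w) = (LINT w|lborel. indicator (W k) w *\<^sub>R (dzb (co k S) w * cnj (co k a w) * E w))"
  by (rule adjoint(1)[OF S(2)[OF k(1)] csecD(3)[OF a(1) k(1)] k(2,3) _ iX]) (rule zz)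
 then show ?thesis unfolding ic1 by (simp add: wE_def del: of_real_power)
qed

lemma holomorphic_orthogonal: assumes S: "law (Suc q) S" "!!l. l : charts A ==> co l S holomorphic_on W l" "scal (Suc q) S : L2 AM"
  and v: "v : VV q" shows "ip AM (scal (Suc q) S) v = 0"
proof -
 have CK: "CK 1 (co l S) (W l)" if "l : charts A" for l by (rule CK_holomorphic[OF open_W[OF that] S(2)[OF that]])
 have "ip AM (scal (Suc q) S) (scal (Suc q) (dsec q a)) = 0" if "tsec q a" for a using that
 proof (induction rule: tsec.induct)
  case zero
  show ?case by (simp add: dsec_zero scal_zero ip_def)
 next
  case (add a b k K c)
  have k: "k : charts A" using add(3) by (simp add: supp_in_def)
  have "indicator (W k) w *\<^sub>R (dzb (co k S) w * cnj (co k b w) * of_real ((2 / rho k w) ^ q)) = 0" for w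
   using wirtinger_holomorphic(2)[OF S(2)[OF k] open_W[OF k], of w] by (simp add: indicator_def)
  note z = this
  have "ip AM (scal (Suc q) S) (scal (Suc q) (dsec q b)) =
   2 * (LINT w|lborel. indicator (W k) w *\<^sub>R (dzb (co k S) w * cnj (co k b w) * of_real ((2 / rho k w) ^ q)))"
   by (rule pairing[OF S(1) CK S(3) add(2) local_L2(2)[OF add(2,3)]]) (use add(3) in blast)+
  then have "ip AM (scal (Suc q) S) (scal (Suc q) (dsec q b)) = 0" unfolding z by simp
  moreover have "scal (Suc q) (dsec q a) : L2 AM" using tsec_L2[OF add(1)] by blast
  ultimately show ?case unfolding dsec_lin[OF tsec_csec[OF add(1)] add(2)] scal_lin
   using ip_add_right[OF _ L2_scale[OF local_L2(2)[OF add(2,3)]] S(3)] add(4) by (simp add: ip_scale_right)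
 qed
 then show ?thesis using v by (auto simp: VV_def)
qed

end

section \<open>Holomorphic sections as an orthogonal complement\<close>

lemma continuous_AE_eq: fixes f g :: "complex => complex"
 assumes "open U" "continuous_on U f" "continuous_on U g" "AE w in lborel. w : U --> f w = g w" "w : U" shows "f w = g w"
proof (rule ccontr)
 assume ne: "f w ~= g w"
 define V where "V = U Int (%x. f x - g x) -` (- {0})"
 have "open V" unfolding V_def by (rule continuous_open_preimage[OF continuous_on_diff[OF assms(2,3)] assms(1)]) auto
 moreover have "w : V" using ne assms(5) by (simp add: V_def)
 ultimately obtain r where r: "r > 0" "ball w r \<subseteq> V" using openE by blast
 have "AE x in lborel. x ~: ball w r" using assms(4) by eventually_elim (use r in \<open>auto simp: V_def\<close>)
 then have "emeasure lborel (ball w r) = 0" by (subst (asm) AE_iff_measurable[OF _ refl]) (auto simp: ball_def)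
 then show False using r(1) by (simp add: emeasure_ball unit_ball_vol_2)
qed

context surf
begin

text \<open>Dividing a bump by the weight gives a test section, and orthogonality to its image under D is the weak Cauchy-Riemann equation in the chart.\<close>
lemma weakly_holomorphic_chart: assumes s: "s : L2 AM" and orth: "!!v. v : VV q ==> ip AM s v = 0" and k: "k : charts A"
 shows "weakly_holomorphic (W k) (%w. indicator (W k) w *\<^sub>R co k (unscal (Suc q) s) w)"
proof
 let ?T = "unscal (Suc q) s"
 interpret wp: weighted_plane "W k" "rho k" q by (rule weighted_plane[OF k])
 have sm: "s : borel_measurable AM" by (rule L2_measurable[OF s])
 have cm: "cmeas ?T" by (rule cmeas_unscal[OF sm])
 have sT: "scal (Suc q) ?T x = s x" if "x : Y" for x by (rule scal_unscal[OF that])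
 have T2: "scal (Suc q) ?T : L2 AM"
 proof -
  have "integrable AM (%x. sq (scal (Suc q) ?T x)) \<longleftrightarrow> integrable AM (%x. sq (s x))"
   by (rule Bochner_Integration.integrable_cong) (auto simp: sT)
  then show ?thesis using s scal_measurable[OF cm] by (simp add: L2_def)
 qed
 show "open (W k)" by (rule open_W[OF k])
 let ?u = "%w. indicator (W k) w *\<^sub>R co k ?T w"
 show um: "?u : borel_measurable borel" using cm k by (simp add: cmeas_def)
 show "integrable lborel (%w. indicator K w *\<^sub>R ?u w)" if K: "compact K" "K \<subseteq> W k" for K
 proof (cases "K = {}")
  case False
  define g where "g w = (2 / rho k w) ^ Suc q * rho k w" for w
  have gc: "continuous_on K g" unfolding g_def by (rule continuous_on_subset[OF _ K(2)]) (intro continuous_intros weight_continuous rho_continuous k)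
  obtain w0 where w0: "w0 : K" "!!w. w : K ==> g w0 <= g w" using continuous_attains_inf[OF K(1) False gc] by blast
  define m where "m = g w0"
  have m: "m > 0" using w0(1) K(2) rho_pos[OF k, of w0] by (auto simp: m_def g_def)
  have Kb [measurable]: "K : sets borel" using K(1) by (simp add: compact_imp_closed)
  have fin: "(\<integral>\<^sup>+w\<in>W k. ennreal (sq (co k ?T w) * g w) \<partial>lborel) < \<infinity>"
  proof -
   have "(\<integral>\<^sup>+x\<in>fst k. ennreal (sq (scal (Suc q) ?T x)) \<partial>AM) <= (\<integral>\<^sup>+x. ennreal (sq (scal (Suc q) ?T x)) \<partial>AM)"
    by (intro nn_integral_mono) (auto simp: indicator_def)
   also have "... < \<infinity>" using nn_integral_nsq[OF T2] by simp
   finally show ?thesis using nn_integral_scal_chart[OF law_unscal cm k] unfolding g_def by simp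
  qed
  have "(\<integral>\<^sup>+w. ennreal (norm (indicator K w *\<^sub>R ?u w)) \<partial>lborel) \<le>
    (\<integral>\<^sup>+w. indicator K w + ennreal (1/m) * (ennreal (sq (co k ?T w) * g w) * indicator (W k) w) \<partial>lborel)"
  proof (rule nn_integral_mono)
   fix w
   show "ennreal (norm (indicator K w *\<^sub>R ?u w)) <= indicator K w + ennreal (1/m) * (ennreal (sq (co k ?T w) * g w) * indicator (W k) w)"
   proof (cases "w : K")
    case True
    define c where "c = cmod (co k ?T w)"
    have "c <= 1 + c^2" using zero_le_power2[of "c - 1"] by (simp add: power2_diff c_def) (smt (verit) zero_le_power2)
    also have "c^2 <= (1/m) * (c^2 * g w)" using mult_right_mono[OF w0(2)[OF True], of "c^2"] m by (simp add: m_def[symmetric] field_simps)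
    finally have "c <= 1 + (1/m) * (c^2 * g w)" by simp
    moreover have "g w >= 0" using w0(2)[OF True] m by (simp add: m_def)
    ultimately have "ennreal c <= 1 + ennreal (1/m) * ennreal (c^2 * g w)"
     using m by (subst ennreal_mult[symmetric]) (auto simp: ennreal_plus[symmetric] ennreal_1[symmetric] simp del: ennreal_plus ennreal_1 intro!: ennreal_leI)
    then show ?thesis using True K(2) by (auto simp: c_def)
   qed simp
  qed
  also have "... = emeasure lborel K + ennreal (1/m) * (\<integral>\<^sup>+w\<in>W k. ennreal (sq (co k ?T w) * g w) \<partial>lborel)"
  proof -
   have gm: "(%w. ennreal (sq (co k ?T w) * g w) * indicator (W k) w) : borel_measurable lborel"
   proof -
    note [measurable] = um omega_chart_measurable[OF k]
    have "(%w. ennreal (sq (?u w) * ((2 / (indicator (W k) w *\<^sub>R rho k w)) ^ Suc q * (indicator (W k) w *\<^sub>R rho k w)))) : borel_measurable lborel"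
     by measurable
    then show ?thesis by (rule measurable_cong[THEN iffD1, rotated]) (auto simp: g_def indicator_def)
   qed
   show ?thesis using gm by (subst nn_integral_add) (auto simp: nn_integral_cmult)
  qed
  also have "... < \<infinity>" using fin emeasure_compact_finite[OF K(1)] by (simp add: ennreal_mult_less_top)
  finally have f0: "(\<integral>\<^sup>+w. ennreal (norm (indicator K w *\<^sub>R ?u w)) \<partial>lborel) < \<infinity>" .
  have "(%w. indicator K w *\<^sub>R ?u w) : borel_measurable lborel"       by (rule borel_measurable_scaleR) (use um in simp_all)
  then show ?thesis using f0 by (rule integrableI_bounded)
 qed simp
 show "(LINT w|lborel. ?u w * dzb (%w. bump e (w - c)) w) = 0" if e: "e > 0" "cball c e \<subseteq> W k" for c e
 proof -
  let ?b = "%w. bump e (w - c)"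
  define f where "f w = ?b w * inverse (wE (rho k) q w)" for w
  have E0: "wE (rho k) q w ~= 0" if "w : W k" for w using rho_pos[OF k that] by (simp add: wE_def)
  have fCK: "CK 2 f (W k)" unfolding f_def by (intro CK_mult CK_inverse open_W k E0 CK_le[OF wp.E_CK] CK_subset[OF CK_bump]) auto
  have bz: "?b w = 0" if "w ~: cball c e" for w by (rule bump_zero) (use that e in \<open>auto simp: dist_norm norm_minus_commute\<close>)
  then have fz: "f w = 0" if "w ~: cball c e" for w using that by (simp add: f_def)
  define a where "a = secof q k f"
  have a: "csec q a" unfolding csec_def a_def using law_secof[OF k] CK_secof[OF k _ fCK compact_cball e(2) fz] by blast
  have sa: "supp_in k (cball c e) a" unfolding a_def by (rule supp_in_secof[OF k compact_cball e(2) fz])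
  have "scal (Suc q) (dsec q a) : VV q" unfolding VV_def using tsec_local[OF a sa] by blast
  then have "ip AM s (scal (Suc q) (dsec q a)) = 0" by (rule orth)
  moreover have "ip AM (scal (Suc q) ?T) (scal (Suc q) (dsec q a)) = ip AM s (scal (Suc q) (dsec q a))"
   unfolding ip_def by (rule Bochner_Integration.integral_cong) (auto simp: sT)
  moreover have "ip AM (scal (Suc q) ?T) (scal (Suc q) (dsec q a)) =
    2 * (LINT w|lborel. indicator (W k) w *\<^sub>R (co k ?T w * cnj (co k (dsec q a) w) * of_real ((2 / rho k w) ^ q)))"
   by (rule ip_chart(1)[OF law_unscal cm law_dsec[OF a] dsec_cmeas[OF a] k]) (use supp_scal[OF supp_in_dsec[OF sa]] in simp)
  ultimately have "(LINT w|lborel. indicator (W k) w *\<^sub>R (co k ?T w * cnj (co k (dsec q a) w) * of_real ((2 / rho k w) ^ q))) = 0" by simp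
  also have "(%w. indicator (W k) w *\<^sub>R (co k ?T w * cnj (co k (dsec q a) w) * of_real ((2 / rho k w) ^ q))) = (%w. - (?u w * dzb ?b w))"
  proof
   fix w
   show "indicator (W k) w *\<^sub>R (co k ?T w * cnj (co k (dsec q a) w) * of_real ((2 / rho k w) ^ q)) = - (?u w * dzb ?b w)"
   proof (cases "w : W k")
    case w: True
    have cf: "co k a x = f x" if "x : W k" for x unfolding a_def by (rule co_secof_self[OF k that])
    have fd: "f differentiable (at w)" using fCK w by (auto simp: numeral_2_eq_2)
    have dc: "wD (rho k) q (co k a) w = wD (rho k) q f w" unfolding wD_def using wirtinger_cong(1)[OF open_W[OF k] w cf] cf[OF w] by simp
    have be: "?b x = f x * wE (rho k) q x" if "x : W k" for x using E0[OF that] by (simp add: f_def)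
    have "dz ?b w = dz (%x. f x * wE (rho k) q x) w" by (rule wirtinger_cong(1)[OF open_W[OF k] w be])
    also have "... = - (wE (rho k) q w * wD (rho k) q f w)"
     unfolding wirtinger_mult(1)[OF fd wp.E_wirtinger(3)[OF w]] wp.E_wirtinger(1)[OF w] by (simp add: wD_def algebra_simps)
    finally have "cnj (dz ?b w) = - (wE (rho k) q w * cnj (wD (rho k) q f w))" by (simp add: wp.E_cnj)
    moreover have "cnj (dz ?b w) = dzb ?b w" by (rule cnj_dz_bump)
    ultimately have "cnj (wD (rho k) q f w) * wE (rho k) q w = - dzb ?b w" by (simp add: mult.commute)
    then have "co k ?T w * cnj (co k (dsec q a) w) * of_real ((2 / rho k w) ^ q) = - (co k ?T w * dzb ?b w)" unfolding co_dsec[OF k w] dc wE_def[symmetric] mult.assoc by simp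
    then show ?thesis using w by simp
   qed simp
  qed
  finally show ?thesis by simp
 qed
qed

abbreviation HH :: "nat => 'a sect set" where "HH p \<equiv> L2_sections A Y \<omega> p"

lemma holomorphic_section_law: "holomorphic_section A Y p S ==> law p S" unfolding holomorphic_section_def law_def by blast

lemma holomorphic_section_co: "holomorphic_section A Y p S ==> k : charts A ==> co k S holomorphic_on W k"
 unfolding holomorphic_section_def W_def by (simp add: co_def[abs_def] in_coord_def comp_def)

lemma L2_norm_sq_scal: "law p S ==> L2_norm_sq A Y \<omega> p S = (\<integral>\<^sup>+x. ennreal (sq (scal p S x)) \<partial>AM)"
 unfolding L2_norm_sq_def by (rule nn_integral_cong) (simp add: hnorm_scal)

lemma HH_iff: "S : HH p \<longleftrightarrow> holomorphic_section A Y p S & scal p S : L2 AM"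
proof (cases "holomorphic_section A Y p S")
 case True
 have m: "scal p S : borel_measurable AM" by (rule scal_measurable[OF cmeas_continuous[OF holomorphic_on_imp_continuous_on[OF holomorphic_section_co[OF True]]]])
 show ?thesis using L2_iff_nn_integral[OF m] True by (simp add: L2_sections_def L2_norm_sq_scal[OF holomorphic_section_law[OF True]])
qed (simp add: L2_sections_def)

text \<open>The holomorphic representatives in different charts satisfy the transformation law almost everywhere, hence everywhere by continuity.\<close>
lemma weyl_section: assumes s: "s : L2 AM" and orth: "!!v. v : VV q ==> ip AM s v = 0"
 shows "\<exists>S\<in>HH (Suc q). AE x in AM. scal (Suc q) S x = s x"
proof -
 let ?T = "unscal (Suc q) s"
 define u where "u k w = indicator (W k) w *\<^sub>R co k ?T w" for k w
 have wh: "weakly_holomorphic (W k) (u k)" if "k : charts A" for k unfolding u_def by (rule weakly_holomorphic_chart[OF s orth that])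
 define h where "h k = weakly_holomorphic.rep (W k) (u k)" for k
 have hol: "h k holomorphic_on W k" if "k : charts A" for k unfolding h_def by (rule weakly_holomorphic.rep_holomorphic[OF wh[OF that]])
 have ae: "AE w in lborel. w : W k --> co k ?T w = h k w" if "k : charts A" for k
  using weakly_holomorphic.AE_rep[OF wh[OF that]] by eventually_elim (simp add: h_def u_def)
 define S where "S k x = (if k : charts A & x : fst k Int Y then h k (snd k x) else 0)" for k x
 have coS: "co k S w = h k w" if k: "k : charts A" and w: "w : W k" for k w
 proof -
  obtain x where x: "x : fst k" "x : Y" "w = snd k x" "cinv k w = x" using w by (rule WE[OF k])
  show ?thesis unfolding co_def x(4) using x k by (simp add: S_def)
 qed
 have aeM: "AE x in AM. x : fst k --> ?T k x = S k x" if k: "k : charts A" for k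
 proof (rule chart_null[OF k])
  show "AE w in lborel. w : W k --> ?T k (cinv k w) = S k (cinv k w)" using ae[OF k] by eventually_elim (use coS[OF k] in \<open>auto simp: co_def\<close>)
 qed
 have law: "law (Suc q) S" unfolding law_def
 proof (intro ballI)
  fix k l x assume k: "k : charts A" and l: "l : charts A" and x: "x : fst k Int fst l Int Y"
  let ?O = "snd k ` (fst k Int (fst l Int Y))"
  have o: "open ?O" by (rule open_W_overlap[OF k l])
  have sub: "?O \<subseteq> W k" by (auto simp: W_def)
  have t: "transition k l holomorphic_on ?O" by (rule holomorphic_on_subset[OF transition_holomorphic[OF k l]]) auto
  have tW: "transition k l ` ?O \<subseteq> W l" by (auto simp: W_def transition_snd[OF k])
  have c1: "continuous_on ?O (h k)" by (rule continuous_on_subset[OF holomorphic_on_imp_continuous_on[OF hol[OF k]] sub])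
  have c2: "continuous_on ?O (%w. h l (transition k l w) * deriv (transition k l) w ^ Suc q)"
   by (intro continuous_intros continuous_on_compose2[OF holomorphic_on_imp_continuous_on[OF hol[OF l]] _ tW]
    holomorphic_on_imp_continuous_on holomorphic_deriv t o)
  have "AE x in AM. (x : fst k --> ?T k x = S k x) & (x : fst l --> ?T l x = S l x)"
   using aeM[OF k] aeM[OF l] by eventually_elim blast
  from null_chart[OF k this]
  have "AE w in lborel. w : ?O --> h k w = h l (transition k l w) * deriv (transition k l) w ^ Suc q"
  proof eventually_elim
   case (elim w)
   show ?case
   proof
    assume "w : ?O"
    then obtain y where y: "y : fst k" "y : fst l" "y : Y" "w = snd k y" by auto
    have e: "?T k y = S k y" "?T l y = S l y" using elim y k by (auto simp: W_def)
    have "h k w = S k y" "S l y = h l (transition k l w)" using y k l by (auto simp: S_def transition_snd)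
    moreover have "?T k y = ?T l y * jac k l y ^ Suc q" by (rule lawD[OF law_unscal k l y(1-3)])
    ultimately show "h k w = h l (transition k l w) * deriv (transition k l) w ^ Suc q" using e by (simp add: jac_def y(4) del: power_Suc)
   qed
  qed
  from continuous_AE_eq[OF o c1 c2 this, of "snd k x"]
  show "S k x = S l x * jac k l x ^ Suc q" using x k l by (simp add: S_def jac_def transition_snd del: power_Suc)
 qed
 have hs: "holomorphic_section A Y (Suc q) S" unfolding holomorphic_section_def
 proof (intro conjI ballI allI impI)
  fix k assume k: "k : charts A"
  have "co k S holomorphic_on W k" using hol[OF k] by (rule holomorphic_transform) (simp add: coS[OF k])
  then show "in_coord k (S k) holomorphic_on snd k ` (fst k Int Y)" by (simp add: W_def co_def[abs_def] in_coord_def comp_def)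
 next
  fix k l x assume "k : charts A" "l : charts A" "x : fst k Int fst l Int Y"
  then show "S k x = S l x * jac k l x ^ Suc q" using law unfolding law_def by blast
 next
  fix k x assume "k ~: charts A \<or> x ~: fst k Int Y"
  then show "S k x = 0" by (auto simp: S_def)
 qed
 have "AE x in AM. \<forall>n. x : fst (CK0 n) --> ?T (CK0 n) x = S (CK0 n) x" unfolding AE_all_countable using aeM[OF CK0(1)] by blast
 then have eq: "AE x in AM. scal (Suc q) S x = s x" using AE_space
 proof eventually_elim
  case (elim x)
  have "?T (sel x) x = S (sel x) x" using elim(1) sel(2)[of x] unfolding sel_def by blast
  then have "scal (Suc q) S x = scal (Suc q) ?T x" by (simp add: scal_def)
  then show ?case using scal_unscal[of x "Suc q" s] elim(2) by simp
 qed
 have m: "scal (Suc q) S : borel_measurable AM" by (rule scal_measurable[OF cmeas_continuous[OF holomorphic_on_imp_continuous_on[OF holomorphic_section_co[OF hs]]]])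
 have "(\<integral>\<^sup>+x. ennreal (sq (scal (Suc q) S x)) \<partial>AM) = (\<integral>\<^sup>+x. ennreal (sq (s x)) \<partial>AM)"
  by (rule nn_integral_cong_AE) (use eq in \<open>eventually_elim; simp\<close>)
 then have "scal (Suc q) S : L2 AM" using L2_iff_nn_integral[OF m] L2_iff_nn_integral[OF L2_measurable[OF s]] s by simp
 then show ?thesis using hs eq HH_iff by blast
qed

lemma hilbert: "hilbert_sections AM (HH (Suc q)) (scal (Suc q)) (VV q)"
proof
 show "scal (Suc q) S : L2 AM" if "S : HH (Suc q)" for S using that HH_iff by blast
 show "VV q \<subseteq> L2 AM" by (rule VV_L2)
 show "ip AM (scal (Suc q) S) v = 0" if "S : HH (Suc q)" "v : VV q" for S v
  using that holomorphic_orthogonal[of q S v] holomorphic_section_law holomorphic_section_co unfolding HH_iff by blast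
 show "\<exists>S\<in>HH (Suc q). AE x in AM. scal (Suc q) S x = s x" if "s : L2 AM" "!!v. v : VV q ==> ip AM s v = 0" for s
  by (rule weyl_section[OF that])
qed

end

section \<open>Bounds for values of sections\<close>

lemma submean_gaussian: assumes H: "H holomorphic_on ball c R" and s: "0 < s" "s < R" and k: "k > 0"
 shows "ennreal (sq (H c) * (pi / k * (1 - exp (- k * s^2)))) \<le>
  (\<integral>\<^sup>+z\<in>ball 0 s. ennreal (sq (H (c + z)) * exp (- k * sq z)) \<partial>lborel)"
proof -
 define g where "g t = (if t < s then exp (- k * t^2) else 0)" for t :: real
 have gm [measurable]: "g : borel_measurable borel" unfolding g_def by measurable
 have g0: "g t >= 0" for t by (simp add: g_def)
 have gb: "\<bar>g t\<bar> <= 1" for t using k by (simp add: g_def)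
 have h: "(%z. H z ^ 2) holomorphic_on ball c R" by (intro holomorphic_intros H)
 note mv = mean_value_radial[OF h s gm gb]
 have i: "integrable lborel (%z. (H (c + z))^2 * of_real (g (cmod z)))" by (rule mv(1)) (simp add: g_def)
 have e: "(LINT z|lborel. (H (c + z))^2 * of_real (g (cmod z))) = (H c)^2 * (LINT z::complex|lborel. of_real (g (cmod z)))" by (rule mv(2)) (simp add: g_def)
 have I: "(\<integral>\<^sup>+z. ennreal (g (cmod z)) \<partial>(lborel :: complex measure)) = ennreal (pi / k * (1 - exp (- k * s^2)))"
  unfolding nn_integral_gaussian_disc[OF s(1) k, symmetric] by (intro nn_integral_cong) (auto simp: g_def indicator_def)
 have pos: "pi / k * (1 - exp (- k * s^2)) >= 0" using k by simp
 have gi: "integrable lborel (%z::complex. g (cmod z))" by (rule integrableI_nonneg) (use g0 I in auto)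
 have gI: "(LINT z::complex|lborel. g (cmod z)) = pi / k * (1 - exp (- k * s^2))" using nn_integral_eq_integral[OF gi] g0 I pos by (simp add: integral_nonneg)
 have "sq (H c) * (pi / k * (1 - exp (- k * s^2))) = cmod ((H c)^2 * of_real (LINT z::complex|lborel. g (cmod z)))"
  unfolding gI norm_mult norm_power norm_of_real abs_of_nonneg[OF pos] ..
 also have "... = cmod (LINT z|lborel. (H (c + z))^2 * of_real (g (cmod z)))" unfolding e by simp
 finally have "ennreal (sq (H c) * (pi / k * (1 - exp (- k * s^2)))) = ennreal (cmod (LINT z|lborel. (H (c + z))^2 * of_real (g (cmod z))))" by simp
 also have "... <= (\<integral>\<^sup>+z. ennreal (cmod ((H (c + z))^2 * of_real (g (cmod z)))) \<partial>lborel)" by (rule integral_norm_bound_ennreal[OF i])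
 also have "... = (\<integral>\<^sup>+z\<in>ball 0 s. ennreal (sq (H (c + z)) * exp (- k * sq z)) \<partial>lborel)"
  by (intro nn_integral_cong) (auto simp: g_def indicator_def norm_mult norm_power)
 finally show ?thesis .
qed

context surf
begin

text \<open>The mean value property for \<open>S exp (-pG)\<close> against the Gaussian part of the weight. Holomorphy near the centre suffices, so the bound also applies to the remainder of the projection.\<close>
lemma co_section_bound: assumes law: "law p S" and cm: "cmeas S" and S2: "scal p S : L2 AM" and hol: "co k S holomorphic_on ball w0 R"
  and k: "k : charts A" and s: "s > 0" and G: "G holomorphic_on ball w0 R" "s < R" "ball w0 R \<subseteq> W k" and K: "K > 0" and p: "p > 0" and c0: "c0 > 0"
  and wt: "!!z. cmod z < s ==> (2 / rho k (w0 + z)) ^ p * rho k (w0 + z) >= c0 * exp (- 2 * real p * Re (G (w0 + z))) * exp (- 2 * real p * K * sq z)"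
 shows "sq (co k S w0) * exp (- 2 * real p * Re (G w0)) * (c0 * (pi / (2 * real p * K) * (1 - exp (- 2 * real p * K * s^2)))) <= nsq AM (scal p S)"
proof -
 define H where "H z = co k S z * exp (- of_nat p * G z)" for z
 have H: "H holomorphic_on ball w0 R" unfolding H_def by (intro holomorphic_intros G hol)
 have Hn: "sq (H z) = sq (co k S z) * exp (- 2 * real p * Re (G z))" for z by (simp add: H_def norm_mult power_mult_distrib exp_double[symmetric])
 let ?k = "2 * real p * K"
 have kk: "?k > 0" using p K by simp
 define f where "f w = ennreal (sq (co k S w) * ((2 / rho k w) ^ p * rho k w)) * indicator (W k) w" for w
 have fm: "f : borel_measurable borel"
 proof -
  have um: "(%w. indicator (W k) w *\<^sub>R co k S w) : borel_measurable borel" using cm k by (simp add: cmeas_def)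
  note [measurable] = um omega_chart_measurable[OF k]
  have "(%w. ennreal (sq (indicator (W k) w *\<^sub>R co k S w) * ((2 / (indicator (W k) w *\<^sub>R rho k w)) ^ p * (indicator (W k) w *\<^sub>R rho k w)))) : borel_measurable borel"
   by measurable
  then show ?thesis by (rule measurable_cong[THEN iffD1, rotated]) (auto simp: f_def indicator_def)
 qed
 have "ennreal (c0 * (sq (H w0) * (pi / ?k * (1 - exp (- ?k * s^2))))) = ennreal c0 * ennreal (sq (H w0) * (pi / ?k * (1 - exp (- ?k * s^2))))"
  by (rule ennreal_mult') (use c0 in simp)
 also have "... <= ennreal c0 * (\<integral>\<^sup>+z\<in>ball 0 s. ennreal (sq (H (w0 + z)) * exp (- ?k * sq z)) \<partial>lborel)"
  by (intro mult_left_mono submean_gaussian[OF H s G(2) kk]) simp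
 also have "... = (\<integral>\<^sup>+z. ennreal c0 * (ennreal (sq (H (w0 + z)) * exp (- ?k * sq z)) * indicator (ball 0 s) z) \<partial>lborel)"
 proof (rule nn_integral_cmult[symmetric])
  have "(%z. indicator (ball 0 s) z *\<^sub>R H (w0 + z)) : borel_measurable borel"
   by (intro borel_measurable_continuous_on_indicator continuous_on_compose2[OF holomorphic_on_imp_continuous_on[OF H]] continuous_intros)
    (use G(2) in \<open>auto simp: dist_norm\<close>)
  then have [measurable]: "(%z. indicator (ball 0 s) z *\<^sub>R H (w0 + z)) : borel_measurable borel" .
  have "(%z. ennreal (sq (indicator (ball 0 s) z *\<^sub>R H (w0 + z)) * exp (- ?k * sq z))) : borel_measurable lborel" by measurable
  then show "(%z. ennreal (sq (H (w0 + z)) * exp (- ?k * sq z)) * indicator (ball 0 s) z) : borel_measurable lborel"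
   by (rule measurable_cong[THEN iffD1, rotated]) (auto simp: indicator_def)
 qed
 also have "... <= (\<integral>\<^sup>+z. f (w0 + z) \<partial>lborel)"
 proof (rule nn_integral_mono)
  fix z
  show "ennreal c0 * (ennreal (sq (H (w0 + z)) * exp (- ?k * sq z)) * indicator (ball 0 s) z) <= f (w0 + z)"
  proof (cases "cmod z < s")
   case True
   have "w0 + z : ball w0 R" using G(2) True by (simp add: dist_norm)
   then have inW: "w0 + z : W k" using G(3) by blast
   have "c0 * (sq (H (w0 + z)) * exp (- ?k * sq z)) = sq (co k S (w0 + z)) * (c0 * exp (- 2 * real p * Re (G (w0 + z))) * exp (- 2 * real p * K * sq z))"
    unfolding Hn by simp
   also have "... <= sq (co k S (w0 + z)) * ((2 / rho k (w0 + z)) ^ p * rho k (w0 + z))" by (rule mult_left_mono[OF wt[OF True]]) simp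
   finally have "ennreal (c0 * (sq (H (w0 + z)) * exp (- ?k * sq z))) <= ennreal (sq (co k S (w0 + z)) * ((2 / rho k (w0 + z)) ^ p * rho k (w0 + z)))"
    by (rule ennreal_leI)
   then show ?thesis using True inW c0 by (simp add: f_def ennreal_mult')
  qed simp
 qed
 also have "... = (\<integral>\<^sup>+w. f w \<partial>lborel)" by (rule nn_integral_translation[OF fm])
 also have "... = (\<integral>\<^sup>+x\<in>fst k. ennreal (sq (scal p S x)) \<partial>AM)"
  unfolding f_def by (rule nn_integral_scal_chart[OF law cm k, symmetric])
 also have "... <= (\<integral>\<^sup>+x. ennreal (sq (scal p S x)) \<partial>AM)" by (intro nn_integral_mono) (auto simp: indicator_def)
 also have "... = ennreal (nsq AM (scal p S))" by (rule nn_integral_nsq[OF S2])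
 finally have "c0 * (sq (H w0) * (pi / ?k * (1 - exp (- ?k * s^2)))) <= nsq AM (scal p S)" by (simp add: ennreal_le_iff)
 then show ?thesis unfolding Hn by (simp add: mult_ac)
qed

section \<open>Solving the \<open>\<partial>\<close>-bar equation\<close>

definition dbar_norm :: "nat => 'a chart => (complex => complex) => real" where
 "dbar_norm q k f = (LINT w|lborel. indicator (W k) w * (sq (dzb f w) * ((2 / rho k w) ^ q / rho k w)))"

context fixes k :: "'a chart" and K f and q :: nat
 assumes k: "k : charts A" and f: "CK 1 f (W k)" and K: "compact K" "K \<subseteq> W k" and fz: "!!w. w ~: K ==> f w = 0"
begin

lemma dbar_data: shows "(%w. indicator (W k) w *\<^sub>R (dzb f w * of_real (sqrt ((2 / rho k w) ^ q / rho k w)))) : L2 lborel"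
  "nsq lborel (%w. indicator (W k) w *\<^sub>R (dzb f w * of_real (sqrt ((2 / rho k w) ^ q / rho k w)))) = dbar_norm q k f"
proof -
 let ?F = "%w. indicator (W k) w *\<^sub>R (dzb f w * of_real (sqrt ((2 / rho k w) ^ q / rho k w)))"
 have c: "continuous_on (W k) (%w. dzb f w * of_real (sqrt ((2 / rho k w) ^ q / rho k w)))"
  using f rho_pos[OF k] by (intro continuous_intros weight_continuous k rho_continuous) (auto simp: less_le)
 have dz0: "dzb f w = 0" if "w : W k" "w ~: K" for w
 proof -
  have "open (- K)" "w : - K" using compact_imp_closed[OF K(1)] that by auto
  then show ?thesis using wirtinger_cong(2)[of "- K" w f "%_. 0"] fz wirtinger_holomorphic(2)[of "%_. 0" UNIV w] by auto
 qed
 have m: "?F : borel_measurable lborel" using borel_measurable_continuous_on_indicator[OF _ c] open_W[OF k] by simp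
 have sq: "sq (?F w) = indicator (W k) w * (sq (dzb f w) * ((2 / rho k w) ^ q / rho k w))" for w
 proof (cases "w : W k")
  case True
  then have "(2 / rho k w) ^ q / rho k w >= 0" using rho_pos[OF k True] by simp
  then show ?thesis using True by (simp add: norm_mult power_mult_distrib)
 qed simp
 have cont: "continuous_on K (%w. sq (dzb f w) * ((2 / rho k w) ^ q / rho k w))" by (rule continuous_on_subset[OF _ K(2)])
   (use f rho_pos[OF k] in \<open>intro continuous_intros weight_continuous k rho_continuous; auto simp: less_le\<close>)
 have "integrable lborel (%w. indicator K w *\<^sub>R (sq (dzb f w) * ((2 / rho k w) ^ q / rho k w)))" by (rule borel_integrable_compact[OF K(1) cont])
 also have "(%w. indicator K w *\<^sub>R (sq (dzb f w) * ((2 / rho k w) ^ q / rho k w))) = (%w. sq (?F w))"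
  unfolding sq using K(2) dz0 by (auto simp: fun_eq_iff indicator_def)
 finally show "?F : L2 lborel" using m by (simp add: L2_def)
 show "nsq lborel ?F = dbar_norm q k f" unfolding nsq_def sq dbar_norm_def ..
qed

lemma peak_supp: "supp_in k K (secof (Suc q) k f)" by (rule supp_in_secof[OF k K fz])

lemma peak_CK: "l : charts A ==> CK 1 (co l (secof (Suc q) k f)) (W l)" by (rule CK_secof[OF k _ f K fz])

lemma peak_L2: "scal (Suc q) (secof (Suc q) k f) : L2 AM" by (rule scal_L2[OF law_secof[OF k] CK_continuous[OF peak_CK] peak_supp])

lemma peak_pairing: assumes a: "tsec q a"
 shows "sq (ip AM (scal (Suc q) (secof (Suc q) k f)) (scal (Suc q) (dsec q a))) <= 4 * dbar_norm q k f * nsq AM (scal q a)"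
proof -
 let ?v = "secof (Suc q) k f"
 have ca: "csec q a" and a2: "scal q a : L2 AM" "scal (Suc q) (dsec q a) : L2 AM" using tsec_csec[OF a] tsec_L2[OF a] by auto
 define F where "F w = indicator (W k) w *\<^sub>R (dzb f w * of_real (sqrt ((2 / rho k w) ^ q / rho k w)))" for w
 define g where "g w = indicator (W k) w *\<^sub>R (co k a w * of_real (sqrt ((2 / rho k w) ^ q * rho k w)))" for w
 have F: "F : L2 lborel" "nsq lborel F = dbar_norm q k f" using dbar_data unfolding F_def[abs_def] by auto
 have gm: "g : borel_measurable lborel"
 proof -
  have "continuous_on (W k) (%w. co k a w * of_real (sqrt ((2 / rho k w) ^ q * rho k w)))"
   by (intro continuous_intros csec_continuous[OF ca k] weight_continuous k rho_continuous)
  then show ?thesis unfolding g_def using borel_measurable_continuous_on_indicator[of "W k"] open_W[OF k] by simp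
 qed
 have "(\<integral>\<^sup>+w. ennreal (sq (g w)) \<partial>lborel) = (\<integral>\<^sup>+w\<in>W k. ennreal (sq (co k a w) * ((2 / rho k w) ^ q * rho k w)) \<partial>lborel)"
  using rho_pos[OF k] by (intro nn_integral_cong) (auto simp: g_def indicator_def norm_mult power_mult_distrib less_imp_le)
 also have "... = (\<integral>\<^sup>+x\<in>fst k. ennreal (sq (scal q a x)) \<partial>AM)"
  by (rule nn_integral_scal_chart[OF csecD(1)[OF ca] csec_cmeas[OF ca] k, symmetric])
 also have "... <= (\<integral>\<^sup>+x. ennreal (sq (scal q a x)) \<partial>AM)" by (intro nn_integral_mono) (auto simp: indicator_def)
 also have "... = ennreal (nsq AM (scal q a))" by (rule nn_integral_nsq[OF a2(1)])
 finally have gle: "(\<integral>\<^sup>+w. ennreal (sq (g w)) \<partial>lborel) <= ennreal (nsq AM (scal q a))" .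
 then have g2: "g : L2 lborel" using L2_iff_nn_integral[OF gm] by (simp add: le_less_trans)
 have gn: "nsq lborel g <= nsq AM (scal q a)" using gle nn_integral_nsq[OF g2] by (simp add: ennreal_le_iff)
 have "ip AM (scal (Suc q) ?v) (scal (Suc q) (dsec q a)) =
  2 * (LINT w|lborel. indicator (W k) w *\<^sub>R (dzb (co k ?v) w * cnj (co k a w) * of_real ((2 / rho k w) ^ q)))"
  by (rule pairing[OF law_secof[OF k] peak_CK peak_L2 ca a2(2)]) (use peak_supp in blast)+
 also have "(%w. indicator (W k) w *\<^sub>R (dzb (co k ?v) w * cnj (co k a w) * of_real ((2 / rho k w) ^ q))) = (%w. F w * cnj (g w))"
 proof
  fix w
  show "indicator (W k) w *\<^sub>R (dzb (co k ?v) w * cnj (co k a w) * of_real ((2 / rho k w) ^ q)) = F w * cnj (g w)"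
  proof (cases "w : W k")
   case w: True
   have r: "rho k w > 0" by (rule rho_pos[OF k w])
   have "dzb (co k ?v) w = dzb f w" by (rule wirtinger_cong(2)[OF open_W[OF k] w]) (rule co_secof_self[OF k])
   moreover have "sqrt ((2 / rho k w) ^ q / rho k w) * sqrt ((2 / rho k w) ^ q * rho k w) = (2 / rho k w) ^ q" using r by (simp flip: real_sqrt_mult add: real_sqrt_mult_self)
   then have "complex_of_real (sqrt ((2 / rho k w) ^ q / rho k w)) * of_real (sqrt ((2 / rho k w) ^ q * rho k w)) = of_real ((2 / rho k w) ^ q)"
    by (simp only: of_real_mult[symmetric])
   then have "dzb f w * of_real (sqrt ((2 / rho k w) ^ q / rho k w)) * (cnj (co k a w) * of_real (sqrt ((2 / rho k w) ^ q * rho k w))) =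
     dzb f w * cnj (co k a w) * of_real ((2 / rho k w) ^ q)" by (simp only: mult_ac)
   ultimately show ?thesis using w unfolding F_def g_def by (simp only: indicator_simps scaleR_one complex_cnj_mult complex_cnj_complex_of_real)
  qed (simp add: F_def)
 qed
 finally have "ip AM (scal (Suc q) ?v) (scal (Suc q) (dsec q a)) = 2 * ip lborel F g" by (simp add: ip_def)
 then have "sq (ip AM (scal (Suc q) ?v) (scal (Suc q) (dsec q a))) = 4 * sq (ip lborel F g)" by (simp add: norm_mult power_mult_distrib)
 also have "... <= 4 * (nsq lborel F * nsq lborel g)" using ip_Cauchy_Schwarz[OF F(1) g2] by simp
 also have "... <= 4 * (dbar_norm q k f * nsq AM (scal q a))" unfolding F(2) using gn F(2) nsq_nonneg[of lborel F] by (simp add: mult_left_mono)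
 finally show ?thesis by simp
qed

text \<open>Hoermander's duality argument. The remainder u is a limit of elements D a, and \<open>peak_pairing\<close> with \<open>energy\<close> bounds its products with such elements.\<close>
theorem peak_projection:
 assumes curv: "!!k w. k : charts A ==> w : W k ==> \<exists>c. dzb (wG (rho k)) w = of_real c & c >= \<kappa> / 2 * rho k w"
  and \<kappa>: "\<kappa> > 0" and q: "q > 0"
 obtains S where "S : HH (Suc q)" "nsq AM (scal (Suc q) S) <= nsq AM (scal (Suc q) (secof (Suc q) k f))"
  "nsq AM (%x. scal (Suc q) (secof (Suc q) k f) x - scal (Suc q) S x) <= 4 * dbar_norm q k f / (real q * \<kappa>)"
proof -
 define v where "v = scal (Suc q) (secof (Suc q) k f)"
 have v2: "v : L2 AM" unfolding v_def by (rule peak_L2)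
 obtain s t where s: "s : L2 AM" "!!g. g : VV q ==> ip AM s g = 0" "!!n::nat. t n : VV q"
  "(%n. nsq AM (%x. (v x - t n x) - s x)) \<longlonglongrightarrow> 0" using L2_projection[OF VV_L2 VV_zero VV_lincomb v2] by blast
 obtain S where S: "S : HH (Suc q)" "AE x in AM. scal (Suc q) S x = s x" using weyl_section[OF s(1,2)] by blast
 have Sm: "scal (Suc q) S : borel_measurable AM" using S(1) HH_iff L2_measurable by blast
 define u where "u x = v x - s x" for x
 have u2: "u : L2 AM" unfolding u_def by (rule L2_diff[OF v2 s(1)])
 have t2: "t n : L2 AM" for n using s(3) VV_L2 by blast
 have tu: "(%n. nsq AM (%x. t n x - u x)) \<longlonglongrightarrow> 0" using s(4) by (subst nsq_diff_commute) (simp add: u_def algebra_simps)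
 \<comment> \<open>the remainder is orthogonal to the projection\<close>
 have "(%n. ip AM (t n) s) \<longlonglongrightarrow> ip AM u s" by (rule ip_tendsto[OF t2 u2 s(1) tu])
 moreover have "ip AM (t n) s = 0" for n using s(2)[OF s(3)[of n]] ip_cnj[of AM s "t n"] by simp
 ultimately have us: "ip AM u s = 0" by (simp add: LIMSEQ_const_iff)
 have vus: "nsq AM v = nsq AM u + nsq AM s" using nsq_add[OF u2 s(1)] us by (simp add: u_def)
 let ?N = "4 * dbar_norm q k f / (real q * \<kappa>)"
 have N0: "dbar_norm q k f >= 0" using dbar_data(2) nsq_nonneg by metis
 have tn: "sq (ip AM u (t n)) <= ?N * nsq AM (t n)" for n
 proof -
  obtain a where a: "tsec q a" "t n = scal (Suc q) (dsec q a)" using s(3)[of n] by (auto simp: VV_def)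
  have "ip AM u (t n) = ip AM v (t n)" unfolding u_def using ip_diff_left[OF v2 s(1) t2] s(2)[OF s(3)] by simp
  then have "sq (ip AM u (t n)) <= 4 * dbar_norm q k f * nsq AM (scal q a)" using peak_pairing[OF a(1)] by (simp add: a(2) v_def)
  also have "... = ?N * (real q * \<kappa> * nsq AM (scal q a))" using q \<kappa> by simp
  also have "... <= ?N * nsq AM (t n)" unfolding a(2) by (intro mult_left_mono energy[OF curv a(1)]) (use N0 q \<kappa> in auto)
  finally show ?thesis .
 qed
 have l1: "(%n. sq (ip AM u (t n))) \<longlonglongrightarrow> (nsq AM u)^2"
 proof -
  have "(%n. cnj (ip AM (t n) u)) \<longlonglongrightarrow> cnj (ip AM u u)" by (intro tendsto_intros ip_tendsto[OF t2 u2 u2 tu])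
  then have "(%n. ip AM u (t n)) \<longlonglongrightarrow> of_real (nsq AM u)" by (simp add: ip_cnj ip_self[OF u2])
  then have "(%n. sq (ip AM u (t n))) \<longlonglongrightarrow> sq (of_real (nsq AM u))" by (intro tendsto_intros)
  then show ?thesis by simp
 qed
 have l2: "(%n. ?N * nsq AM (t n)) \<longlonglongrightarrow> ?N * nsq AM u"
 proof (intro tendsto_mult tendsto_const)
  have e: "nsq AM (t n) = nsq AM (%x. t n x - u x) + nsq AM u + 2 * Re (ip AM (%x. t n x - u x) u)" for n using nsq_add[OF L2_diff[OF t2[of n] u2] u2] by simp
  have "(%n. ip AM (%x. t n x - u x) u) \<longlonglongrightarrow> ip AM u u - ip AM u u"
   unfolding ip_diff_left[OF t2 u2 u2] by (intro tendsto_intros ip_tendsto[OF t2 u2 u2 tu])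
  then have "(%n. nsq AM (%x. t n x - u x) + nsq AM u + 2 * Re (ip AM (%x. t n x - u x) u)) \<longlonglongrightarrow> 0 + nsq AM u + 2 * Re (ip AM u u - ip AM u u)"
   by (intro tendsto_intros tu)
  then show "(%n. nsq AM (t n)) \<longlonglongrightarrow> nsq AM u" unfolding e[symmetric] by simp
 qed
 have "(nsq AM u)^2 <= ?N * nsq AM u" by (rule LIMSEQ_le[OF l1 l2]) (use tn in blast)
 moreover have "?N >= 0" using N0 \<kappa> by simp
 ultimately have uN: "nsq AM u <= ?N" using nsq_nonneg[of AM u] mult_right_le_imp_le[of "nsq AM u" "nsq AM u" ?N] unfolding power2_eq_square by (metis less_eq_real_def)
 have "nsq AM (%x. v x - scal (Suc q) S x) = nsq AM u"
 proof (rule nsq_cong_AE)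
  show "AE x in AM. v x - scal (Suc q) S x = u x" using S(2) by eventually_elim (simp add: u_def)
 qed (use Sm L2_measurable[OF v2] L2_measurable[OF u2] in auto)
 moreover have "nsq AM (scal (Suc q) S) = nsq AM s" by (rule nsq_cong_AE[OF S(2) Sm L2_measurable[OF s(1)]])
 ultimately show ?thesis using that[OF S(1)] vus uN nsq_nonneg[of AM u] unfolding v_def by simp
qed

end

section \<open>The Bergman kernel\<close>

lemma HH_lin: assumes S: "S : HH p" and T: "T : HH p" shows "(%k x. S k x + c * T k x) : HH p"
proof -
 have hs: "holomorphic_section A Y p S" "holomorphic_section A Y p T" using S T HH_iff by auto
 have "holomorphic_section A Y p (%k x. S k x + c * T k x)" unfolding holomorphic_section_def
 proof (intro conjI ballI allI impI)
  fix k assume "k : charts A"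
  then have "in_coord k (S k) holomorphic_on snd k ` (fst k Int Y)" "in_coord k (T k) holomorphic_on snd k ` (fst k Int Y)"
   using hs unfolding holomorphic_section_def by blast+
  then have "(%w. in_coord k (S k) w + c * in_coord k (T k) w) holomorphic_on snd k ` (fst k Int Y)" by (intro holomorphic_intros)
  then show "in_coord k (%x. S k x + c * T k x) holomorphic_on snd k ` (fst k Int Y)" by (simp add: in_coord_def comp_def)
 next
  fix k l x assume "k : charts A" "l : charts A" "x : fst k Int fst l Int Y"
  then have "S k x = S l x * jac k l x ^ p" "T k x = T l x * jac k l x ^ p" using hs unfolding holomorphic_section_def by blast+
  then show "S k x + c * T k x = (S l x + c * T l x) * jac k l x ^ p" by (simp add: algebra_simps)
 next
  fix k x assume "k ~: charts A \<or> x ~: fst k Int Y"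
  then have "S k x = 0" "T k x = 0" using hs unfolding holomorphic_section_def by blast+
  then show "S k x + c * T k x = 0" by simp
 qed
 then show ?thesis using S T unfolding HH_iff scal_lin by (blast intro: L2_lincomb)
qed

lemma HH_sum: assumes S: "S : HH p" and F: "finite F" "F \<subseteq> HH p" shows "(%k x. c * S k x + (\<Sum>T\<in>F. a T * T k x)) : HH p" using F
proof (induction F)
 case empty
 have "(%k x. S k x + (c - 1) * S k x) : HH p" by (rule HH_lin[OF S S])
 then show ?case by (simp add: algebra_simps)
next
 case (insert T F)
 have "(%k x. (c * S k x + (\<Sum>T\<in>F. a T * T k x)) + a T * T k x) : HH p" by (rule HH_lin) (use insert in auto)
 then show ?case using insert by (simp add: algebra_simps)
qed

lemma scal_sum: "scal p (%k x. c * S k x + (\<Sum>T\<in>F. a T * T k x)) = (%x. c * scal p S x + (\<Sum>T\<in>F. a T * scal p T x))"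
 by (simp add: scal_def fun_eq_iff distrib_left distrib_right sum_distrib_left sum_distrib_right mult.assoc)

lemma onb_iff: "orthonormal_basis A Y \<omega> (Suc q) B \<longleftrightarrow> hilbert_sections.onb AM (HH (Suc q)) (scal (Suc q)) B"
proof (cases "B \<subseteq> HH (Suc q)")
 case True
 have inner: "L2_inner A Y \<omega> (Suc q) S T = ip AM (scal (Suc q) S) (scal (Suc q) T)" if "S : HH (Suc q)" "T : HH (Suc q)" for S T unfolding L2_inner_def ip_def
  by (rule Bochner_Integration.integral_cong[OF refl]) (use that in \<open>auto intro!: hprod_scal holomorphic_section_law simp: HH_iff\<close>)
 have norm: "L2_norm_sq A Y \<omega> (Suc q) (%k x. S k x - (\<Sum>T\<in>F. a T * T k x)) < ennreal e \<longleftrightarrow>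
   nsq AM (%x. scal (Suc q) S x - (\<Sum>T\<in>F. a T * scal (Suc q) T x)) < e" if "S : HH (Suc q)" "finite F" "F \<subseteq> HH (Suc q)" "e > 0" for S F a e
 proof -
  have e1: "(%k x. S k x - (\<Sum>T\<in>F. a T * T k x)) = (%k x. 1 * S k x + (\<Sum>T\<in>F. (- a T) * T k x))" by (simp add: sum_negf)
  have H: "(%k x. S k x - (\<Sum>T\<in>F. a T * T k x)) : HH (Suc q)" unfolding e1 by (rule HH_sum[OF that(1-3)])
  have e2: "scal (Suc q) (%k x. S k x - (\<Sum>T\<in>F. a T * T k x)) = (%x. scal (Suc q) S x - (\<Sum>T\<in>F. a T * scal (Suc q) T x))"
   unfolding e1 scal_sum by (simp add: sum_negf)
  have "L2_norm_sq A Y \<omega> (Suc q) (%k x. S k x - (\<Sum>T\<in>F. a T * T k x)) = ennreal (nsq AM (scal (Suc q) (%k x. S k x - (\<Sum>T\<in>F. a T * T k x))))"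
   using H by (simp only: L2_norm_sq_scal[OF holomorphic_section_law] nn_integral_nsq HH_iff)
  then show ?thesis unfolding e2 using that(4) by (simp add: ennreal_less_iff)
 qed
 show ?thesis unfolding orthonormal_basis_def hilbert_sections.onb_def[OF hilbert]
 proof (intro conj_cong refl ball_cong)
  fix S T assume "S : B" "T : B"
  then show "(L2_inner A Y \<omega> (Suc q) S T = (if S = T then 1 else 0)) = (ip AM (scal (Suc q) S) (scal (Suc q) T) = (if S = T then 1 else 0))"
   using inner True by (simp add: subset_iff)
 next
  fix S assume S: "S : HH (Suc q)"
  show "(\<forall>e>0. \<exists>F a. finite F & F \<subseteq> B & L2_norm_sq A Y \<omega> (Suc q) (%k x. S k x - (\<Sum>T\<in>F. a T * T k x)) < ennreal e) =
   (\<forall>e>0. \<exists>F a. finite F & F \<subseteq> B & nsq AM (%x. scal (Suc q) S x - (\<Sum>T\<in>F. a T * scal (Suc q) T x)) < e)"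
   using norm[OF S] True by (meson subset_trans)
 qed
qed (simp add: orthonormal_basis_def hilbert_sections.onb_def[OF hilbert])

theorem bergman_bounds: assumes k: "k : charts A" and x: "x : fst k" "x : Y"
  and C: "C >= 0" "!!S. S : HH (Suc q) ==> sq (S k x) <= C * nsq AM (scal (Suc q) S)"
 shows "bergman_kernel A Y \<omega> (Suc q) x <= C * (2 / \<omega> k x) ^ Suc q"
  "S : HH (Suc q) ==> sq (S k x) * (2 / \<omega> k x) ^ Suc q <= bergman_kernel A Y \<omega> (Suc q) x * nsq AM (scal (Suc q) S)"
proof -
 interpret H: hilbert_sections AM "HH (Suc q)" "scal (Suc q)" "VV q" by (rule hilbert)
 define B where "B = (SOME B. orthonormal_basis A Y \<omega> (Suc q) B)"
 have "\<exists>B. orthonormal_basis A Y \<omega> (Suc q) B" unfolding onb_iff by (rule H.onb_exists)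
 from someI_ex[OF this] have "orthonormal_basis A Y \<omega> (Suc q) B" unfolding B_def[symmetric] .
 then have B: "H.onb B" by (simp only: onb_iff)
 have BH: "B \<subseteq> HH (Suc q)" using B by (simp add: H.onb_def)
 have lin: "\<exists>T\<in>HH (Suc q). scal (Suc q) T = (%x. c * scal (Suc q) S x + (\<Sum>T\<in>F. a T * scal (Suc q) T x)) & T k x = c * S k x + (\<Sum>T\<in>F. a T * T k x)"
  if "S : HH (Suc q)" "finite F" "F \<subseteq> HH (Suc q)" for S F a c by (rule bexI[OF _ HH_sum[OF that, of c a]]) (simp add: scal_sum)
 note kb = H.kernel_bounds[OF B lin C(2,1)]
 let ?m = "(2 / \<omega> k x) ^ Suc q"
 have m: "?m >= 0" using omega_pos[OF k x] by simp
 have hn: "hnorm_sq A \<omega> (Suc q) S x = sq (S k x) * ?m" if "S : HH (Suc q)" for S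
 proof -
  have l: "law (Suc q) S" using that holomorphic_section_law HH_iff by blast
  show ?thesis unfolding hnorm_scal[OF l x(2)] by (rule scal_sq[OF l k x])
 qed
 have "bergman_kernel A Y \<omega> (Suc q) x = (\<Sum>\<^sub>\<infinity>S\<in>B. sq (S k x) * ?m)"
  unfolding bergman_kernel_def B_def[symmetric] by (rule infsum_cong) (use hn BH in blast)
 also have "... = (\<Sum>\<^sub>\<infinity>S\<in>B. sq (S k x)) * ?m" by (rule infsum_cmult_left')
 finally have bk: "bergman_kernel A Y \<omega> (Suc q) x = (\<Sum>\<^sub>\<infinity>S\<in>B. sq (S k x)) * ?m" .
 show "bergman_kernel A Y \<omega> (Suc q) x <= C * ?m" unfolding bk using kb(1) m by (rule mult_right_mono)
 assume "S : HH (Suc q)"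
 then have "sq (S k x) <= (\<Sum>\<^sub>\<infinity>S\<in>B. sq (S k x)) * nsq AM (scal (Suc q) S)" by (intro kb(2))
 from mult_right_mono[OF this m]
 show "sq (S k x) * ?m <= bergman_kernel A Y \<omega> (Suc q) x * nsq AM (scal (Suc q) S)" unfolding bk by (simp only: mult_ac)
qed

end

section \<open>Local expansion of the weight\<close>

lemma taylor_first_order: fixes f :: "complex => real"
 assumes S: "Ck_on 1 f S" and seg: "!!t. 0 <= t ==> t <= 1 ==> w + of_real t * v : S"
  and M: "!!t m n. 0 <= t ==> t <= 1 ==> m + n = 1 ==> \<bar>partial m n f (w + of_real t * v)\<bar> <= M"
 shows "\<bar>f (w + v) - f w\<bar> <= 2 * M * cmod v"
proof -
 have d: "f differentiable (at x)" if "x : S" for x using S that by simp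
 have "\<exists>t>0. t < 1 & f (w + of_real 1 * v) - f (w + of_real 0 * v) = (1 - 0) * (pdx f (w + of_real t * v) * Re v + pdy f (w + of_real t * v) * Im v)"
  by (rule MVT2) (use line_derivative d seg in auto)
 then obtain t where t: "0 < t" "t < 1" "f (w + v) - f w = pdx f (w + of_real t * v) * Re v + pdy f (w + of_real t * v) * Im v" by auto
 have b: "\<bar>pdx f (w + of_real t * v)\<bar> <= M" "\<bar>pdy f (w + of_real t * v)\<bar> <= M" using M[of t 1 0] M[of t 0 1] t by (auto simp: partial_def)
 have "\<bar>f (w + v) - f w\<bar> <= \<bar>pdx f (w + of_real t * v)\<bar> * \<bar>Re v\<bar> + \<bar>pdy f (w + of_real t * v)\<bar> * \<bar>Im v\<bar>"
  unfolding t(3) by (metis abs_mult abs_triangle_ineq)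
 also have "... <= M * cmod v + M * cmod v" using b abs_Re_le_cmod[of v] abs_Im_le_cmod[of v] by (intro add_mono mult_mono) auto
 finally show ?thesis by simp
qed

lemma taylor_third_order: fixes f :: "complex => real"
 assumes S: "open S" "Ck_on 3 f S" and seg: "!!t. 0 <= t ==> t <= 1 ==> w + of_real t * v : S"
  and M: "!!t m n. 0 <= t ==> t <= 1 ==> m + n = 3 ==> \<bar>partial m n f (w + of_real t * v)\<bar> <= M"
 shows "\<bar>f (w + v) - (f w + (pdx f w * Re v + pdy f w * Im v) +
  (pdx (pdx f) w * (Re v)^2 + 2 * pdx (pdy f) w * (Re v * Im v) + pdy (pdy f) w * (Im v)^2) / 2)\<bar> <= 2 * M * cmod v ^ 3"
proof -
 define a b where "a = Re v" and "b = Im v"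
 define P where "P t = w + of_real t * v" for t :: real
 have P01: "P 0 = w" "P 1 = w + v" by (simp_all add: P_def)
 have seg': "P t : S" if "0 <= t" "t <= 1" for t using seg[OF that] by (simp add: P_def)
 have c2: "Ck_on 2 f S" using S(2) by (auto simp: eval_nat_numeral intro: differentiable_imp_continuous_on
   intro!: continuous_at_imp_continuous_on differentiable_imp_continuous_within)
 have c2': "Ck_on 2 (pdx f) S" "Ck_on 2 (pdy f) S" using S(2) by (auto simp: eval_nat_numeral)
 have d: "f differentiable (at x)" "pdx f differentiable (at x)" "pdy f differentiable (at x)"
   "pdx (pdx f) differentiable (at x)" "pdx (pdy f) differentiable (at x)" "pdy (pdy f) differentiable (at x)"
  if "x : S" for x using S(2) that by (auto simp: eval_nat_numeral)
 have comm: "pdy (pdx f) x = pdx (pdy f) x" if "x : S" for x using pd_comm[OF S(1) c2 that] by simp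
 have yxx: "pdy (pdx (pdx f)) x = pdx (pdx (pdy f)) x" if "x : S" for x using pd_comm[OF S(1) c2'(1) that] pd_cong(1)[OF S(1) that comm] by simp
 have yxy: "pdy (pdx (pdy f)) x = pdx (pdy (pdy f)) x" if "x : S" for x using pd_comm[OF S(1) c2'(2) that] by simp
 note line = line_derivative[folded P_def a_def b_def]
 define g1 where "g1 t = pdx f (P t) * a + pdy f (P t) * b" for t
 define g2 where "g2 t = pdx (pdx f) (P t) * a^2 + 2 * pdx (pdy f) (P t) * (a * b) + pdy (pdy f) (P t) * b^2" for t
 define g3 where "g3 t = pdx (pdx (pdx f)) (P t) * a^3 + 3 * pdx (pdx (pdy f)) (P t) * (a^2 * b)
   + 3 * pdx (pdy (pdy f)) (P t) * (a * b^2) + pdy (pdy (pdy f)) (P t) * b^3" for t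
 have D1: "((%t. f (P t)) has_real_derivative g1 t) (at t)" if t: "0 <= t" "t <= 1" for t
  unfolding g1_def P_def a_def b_def by (rule line_derivative) (use d(1) seg[OF t] in blast)
 have D2: "(g1 has_real_derivative g2 t) (at t)" if t: "0 <= t" "t <= 1" for t
 proof -
  have s: "P t : S" by (rule seg'[OF t])
  have "((%t. pdx f (P t) * a + pdy f (P t) * b) has_real_derivative
    (pdx (pdx f) (P t) * a + pdy (pdx f) (P t) * b) * a + (pdx (pdy f) (P t) * a + pdy (pdy f) (P t) * b) * b) (at t)" unfolding P_def a_def b_def
   by (intro DERIV_add DERIV_cmult_right line_derivative) (use d s in \<open>auto simp: P_def\<close>)
  then show ?thesis by (simp add: g1_def[abs_def] g2_def comm[OF s] power2_eq_square algebra_simps)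
 qed
 have D3: "(g2 has_real_derivative g3 t) (at t)" if t: "0 <= t" "t <= 1" for t
 proof -
  have s: "P t : S" by (rule seg'[OF t])
  have "((%t. pdx (pdx f) (P t) * a^2 + 2 * pdx (pdy f) (P t) * (a * b) + pdy (pdy f) (P t) * b^2) has_real_derivative
    (pdx (pdx (pdx f)) (P t) * a + pdy (pdx (pdx f)) (P t) * b) * a^2 + 2 * (pdx (pdx (pdy f)) (P t) * a + pdy (pdx (pdy f)) (P t) * b) * (a * b)
    + (pdx (pdy (pdy f)) (P t) * a + pdy (pdy (pdy f)) (P t) * b) * b^2) (at t)" unfolding P_def a_def b_def
   by (intro DERIV_add DERIV_cmult_right DERIV_cmult line_derivative) (use d s in \<open>auto simp: P_def\<close>)
  then show ?thesis by (simp add: g2_def[abs_def] g3_def yxx[OF s] yxy[OF s] power2_eq_square power3_eq_cube algebra_simps)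
 qed
 define df where "df m = (if m = 0 then (%t. f (P t)) else if m = 1 then g1 else if m = 2 then g2 else g3)" for m :: nat
 have "\<exists>t>0. t <= 1 & f (P 1) = (\<Sum>m<3. df m 0 / fact m * 1 ^ m) + df 3 t / fact 3 * 1 ^ 3"
 proof (rule Maclaurin2)
  show "\<forall>m t. m < 3 & 0 <= t & t <= 1 --> (df m has_real_derivative df (Suc m) t) (at t)"
   using D1 D2 D3 by (auto simp: df_def less_Suc_eq numeral_3_eq_3 numeral_2_eq_2)
 qed (simp_all add: df_def)
 then obtain t where t: "0 < t" "t <= 1" "f (P 1) = f (P 0) + g1 0 + g2 0 / 2 + g3 t / 6" by (auto simp: df_def numeral_3_eq_3 fact_numeral)
 let ?z = "cmod v"
 have ab: "\<bar>a\<bar> <= ?z" "\<bar>b\<bar> <= ?z" unfolding a_def b_def by (rule abs_Re_le_cmod abs_Im_le_cmod)+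
 have M': "\<bar>pdx (pdx (pdx f)) (P t)\<bar> <= M" "\<bar>pdx (pdx (pdy f)) (P t)\<bar> <= M" "\<bar>pdx (pdy (pdy f)) (P t)\<bar> <= M" "\<bar>pdy (pdy (pdy f)) (P t)\<bar> <= M"
  using M[of t 3 0] M[of t 2 1] M[of t 1 2] M[of t 0 3] t by (auto simp: partial_def P_def eval_nat_numeral)
 have M0: "M >= 0" using M'(1) by linarith
 have "\<bar>x * (y * z)\<bar> <= ?z * (?z * ?z)" if "\<bar>x\<bar> <= ?z" "\<bar>y\<bar> <= ?z" "\<bar>z\<bar> <= ?z" for x y z
  unfolding abs_mult by (intro mult_mono that) auto
 then have m: "\<bar>a^3\<bar> <= ?z^3" "\<bar>a^2 * b\<bar> <= ?z^3" "\<bar>a * b^2\<bar> <= ?z^3" "\<bar>b^3\<bar> <= ?z^3"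
  unfolding power2_eq_square power3_eq_cube mult.assoc using ab by blast+
 have "\<bar>g3 t\<bar> <= \<bar>pdx (pdx (pdx f)) (P t) * a^3\<bar> + \<bar>3 * pdx (pdx (pdy f)) (P t) * (a^2 * b)\<bar>
   + \<bar>3 * pdx (pdy (pdy f)) (P t) * (a * b^2)\<bar> + \<bar>pdy (pdy (pdy f)) (P t) * b^3\<bar>" unfolding g3_def by linarith
 also have "... <= M * ?z^3 + 3 * M * ?z^3 + 3 * M * ?z^3 + M * ?z^3"
  unfolding abs_mult[of _ "a^3"] abs_mult[of _ "b^3"] abs_mult[of _ "a^2 * b"] abs_mult[of _ "a * b^2"]
  by (intro add_mono mult_mono M' m) (use M' M0 in \<open>auto simp: abs_mult\<close>)
 finally have "\<bar>g3 t\<bar> <= 8 * (M * ?z^3)" by simp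
 moreover have "M * ?z^3 >= 0" using M0 by simp
 ultimately have "\<bar>g3 t / 6\<bar> <= 2 * (M * ?z^3)" by simp
 moreover have "f (w + v) - (f w + (pdx f w * a + pdy f w * b) + (pdx (pdx f) w * a^2 + 2 * pdx (pdy f) w * (a * b) + pdy (pdy f) w * b^2) / 2) = g3 t / 6"
  using t(3) unfolding P01 g1_def g2_def by simp
 ultimately show ?thesis unfolding a_def b_def mult.assoc by (simp only:)
qed

lemma d_dbar_add_harmonic: assumes S: "open S" "Ck_on 2 f S" "w : S" and h: "h holomorphic_on S" shows "d_dbar (%w. f w + Re (h w)) w = d_dbar f w"
proof -
 let ?f = "%w. complex_of_real (f w)"
 have fc: "CK 2 ?f S" by (rule CK_of_real[OF S(1,2)])
 have hc: "CK 2 h S" "CK 2 (%w. cnj (h w)) S" by (intro CK_cnj CK_holomorphic S h)+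
 have e: "complex_of_real (f w + Re (h w)) = ?f w + (1/2) * (h w + cnj (h w))" for w by (simp add: complex_add_cnj)
 have c: "CK 2 (%w. complex_of_real (f w + Re (h w))) S" unfolding e by (intro CK_add CK_mult CK_const S fc hc)
 have "Ck_on 2 (%w. Re (complex_of_real (f w + Re (h w)))) S" by (rule Ck_on_Re[OF S(1) c])
 then have ck: "Ck_on 2 (%w. f w + Re (h w)) S" by simp
 have d: "?f differentiable at x" "h differentiable at x" "(%w. cnj (h w)) differentiable at x" "(%w. h w + cnj (h w)) differentiable at x"
  "(%w. (1/2) * (h w + cnj (h w))) differentiable at x" "dz ?f differentiable at x" if "x : S" for x
  using fc hc that CK_add[OF S(1) hc] CK_mult[OF S(1) CK_const[of 2 "1/2"] CK_add[OF S(1) hc]] by (auto simp: numeral_2_eq_2)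
 have z: "dz (%w. complex_of_real (f w + Re (h w))) x = dz ?f x + (1/2) * deriv h x" if x: "x : S" for x
 proof -
  have c: "dz (%_. 1/2) x = 0" using wirtinger_holomorphic(1)[of "%_. 1/2" UNIV x] by simp
  show ?thesis unfolding e wirtinger_add(1)[OF d(1,5)[OF x]] wirtinger_mult(1)[OF differentiable_const d(4)[OF x]]
    wirtinger_add(1)[OF d(2,3)[OF x]] wirtinger_cnj(1)[OF d(2)[OF x]] wirtinger_holomorphic(1,2)[OF h S(1) x] c by simp
 qed
 have dh: "(%w. (1/2) * deriv h w) holomorphic_on S" by (intro holomorphic_intros holomorphic_deriv h S)
 have "complex_of_real (d_dbar (%w. f w + Re (h w)) w) = dzb (dz (%w. complex_of_real (f w + Re (h w)))) w"
  by (rule dzb_dz_of_real[OF S(1) ck S(3), symmetric])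
 also have "... = dzb (%x. dz ?f x + (1/2) * deriv h x) w" by (rule wirtinger_cong(2)[OF S(1,3) z])
 also have "... = dzb (dz ?f) w" using wirtinger_add(2)[OF d(6)[OF S(3)] wirtinger_holomorphic(3)[OF dh S(1,3)]] wirtinger_holomorphic(2)[OF dh S(1,3)] by simp
 also have "... = of_real (d_dbar f w)" by (rule dzb_dz_of_real[OF S])
 finally show ?thesis by (simp only: of_real_eq_iff)
qed

text \<open>The quadratic part of the Taylor polynomial is \<open>K |v|\<^sup>2\<close> plus the real part of a holomorphic quadratic.\<close>
lemma local_expansion: fixes \<phi> \<psi> :: "complex => real" assumes w: "w ~= 0" and S: "open S" "ball w (cmod w) \<subseteq> S" "Ck_on 3 \<psi> S"
  and \<phi>: "!!x. x : S ==> \<phi> x = \<nu> * ln (cmod x) + \<psi> x"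
  and M: "!!x m n. x : ball w (cmod w) ==> cmod x >= cmod w / 2 ==> m + n = 3 ==> \<bar>partial m n \<psi> x\<bar> <= M"
 obtains G where "G holomorphic_on ball w (cmod w)"
  "!!v. cmod v <= cmod w / 2 ==> \<bar>\<phi> (w + v) - Re (G (w + v)) - d_dbar \<phi> w * sq v\<bar> <= 2 * M * cmod v ^ 3"
proof -
 let ?B = "ball w (cmod w)"
 define h where "h x = of_real \<nu> * (Ln (x / w) + of_real (ln (cmod w)))" for x
 have xw: "Re (x / w) > 0" if "x : ?B" for x
 proof -
  have "cmod (1 - x / w) = cmod (w - x) / cmod w" using w by (simp add: norm_divide[symmetric] diff_divide_distrib)
  also have "... < 1" using that w by (simp add: dist_norm)
  finally show ?thesis using abs_Re_le_cmod[of "1 - x / w"] by simp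
 qed
 have xn: "x / w ~: \<real>\<^sub>\<le>\<^sub>0" if "x : ?B" for x using xw[OF that] by (simp add: complex_nonpos_Reals_iff)
 have hh: "h holomorphic_on ?B" unfolding h_def by (intro holomorphic_intros) (use xn w in blast)+
 have hR: "\<nu> * ln (cmod x) = Re (h x)" if x: "x : ?B" for x
 proof -
  have x0: "x ~= 0" using x by (auto simp: dist_norm)
  have "Re (Ln (x / w)) = ln (cmod x) - ln (cmod w)" using x0 w by (simp add: norm_divide ln_div)
  then show ?thesis by (simp add: h_def)
 qed
 have ph: "\<phi> x = \<psi> x + Re (h x)" if "x : ?B" for x using \<phi>[of x] hR[OF that] S(2) that by auto
 have cB: "Ck_on 3 \<psi> ?B" using S(2,3) by (auto simp: eval_nat_numeral intro: continuous_on_subset)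
 have c2: "Ck_on 2 \<psi> ?B" using cB by (auto simp: eval_nat_numeral
   intro!: continuous_at_imp_continuous_on differentiable_imp_continuous_within)
 have wB: "w : ?B" using w by simp
 have op: "open ?B" by simp
 have e1: "pdx \<phi> x = pdx (%x. \<psi> x + Re (h x)) x" "pdy \<phi> x = pdy (%x. \<psi> x + Re (h x)) x" if "x : ?B" for x
  by (rule pd_cong(1)[OF op that]; erule ph) (rule pd_cong(2)[OF op that]; erule ph)
 have "d_dbar \<phi> w = d_dbar (%x. \<psi> x + Re (h x)) w"
  using pd_cong(1)[OF op wB e1(1)] pd_cong(2)[OF op wB e1(2)] by (simp add: d_dbar_def partial_def numeral_2_eq_2)
 also have "... = d_dbar \<psi> w" by (rule d_dbar_add_harmonic[OF op c2 wB hh])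
 finally have K: "d_dbar \<phi> w = (pdx (pdx \<psi>) w + pdy (pdy \<psi>) w) / 4" by (simp add: d_dbar_def partial_def numeral_2_eq_2)
 define b where "b = Complex ((pdx (pdx \<psi>) w - pdy (pdy \<psi>) w) / 4) (- pdx (pdy \<psi>) w / 2)"
 define G where "G x = h x + (of_real (\<psi> w) + Complex (pdx \<psi> w) (- pdy \<psi> w) * (x - w) + b * (x - w)^2)" for x
 show ?thesis
 proof (rule that)
  show "G holomorphic_on ?B" unfolding G_def by (intro holomorphic_intros hh)
  fix v assume v: "cmod v <= cmod w / 2"
  have cw: "cmod w > 0" using w by simp
  have seg: "cmod (of_real t * v) <= cmod w / 2" if "0 <= t" "t <= 1" for t using mult_left_le_one_le[of "cmod v" t] that v by (simp add: norm_mult)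
  have segB: "w + of_real t * v : ?B" "cmod (w + of_real t * v) >= cmod w / 2" if "0 <= t" "t <= 1" for t
  proof -
   have "cmod (of_real t * v) < cmod w" using seg[OF that] cw by linarith
   then show "w + of_real t * v : ?B" by (simp add: dist_norm)
   show "cmod (w + of_real t * v) >= cmod w / 2" using seg[OF that] norm_diff_ineq[of w "of_real t * v"] by simp
  qed
  have vB: "w + v : ?B" using segB(1)[of 1] by simp
  have "Re (G (w + v)) + d_dbar \<phi> w * sq v = Re (h (w + v)) + (\<psi> w + (pdx \<psi> w * Re v + pdy \<psi> w * Im v) +
   (pdx (pdx \<psi>) w * (Re v)^2 + 2 * pdx (pdy \<psi>) w * (Re v * Im v) + pdy (pdy \<psi>) w * (Im v)^2) / 2)"
   unfolding G_def b_def K cmod_power2 by (simp add: power2_eq_square field_simps)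
  moreover have "\<bar>\<psi> (w + v) - (\<psi> w + (pdx \<psi> w * Re v + pdy \<psi> w * Im v) +
   (pdx (pdx \<psi>) w * (Re v)^2 + 2 * pdx (pdy \<psi>) w * (Re v * Im v) + pdy (pdy \<psi>) w * (Im v)^2) / 2)\<bar> <= 2 * M * cmod v ^ 3"
   by (rule taylor_third_order[OF op cB segB(1) M[OF segB]])
  ultimately show "\<bar>\<phi> (w + v) - Re (G (w + v)) - d_dbar \<phi> w * sq v\<bar> <= 2 * M * cmod v ^ 3" using ph[OF vB] by simp
 qed
qed

text \<open>It is 1 for |v| at most s/2, 0 for |v| at least s, and of class \<open>C\<^sup>1\<close>.\<close>
definition cutoff :: "real => complex => complex" where
 "cutoff s v = 1 - of_real (max 0 (1 - (max 0 (4 / (3 * s^2) * (s^2 - sq v)))^2)) ^ 2"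

lemma cutoff_data: assumes s: "s > 0"
 shows "CK 1 (%w. cutoff s (w - c)) UNIV" "cmod v <= s / 2 ==> cutoff s v = 1" "cmod v >= s ==> cutoff s v = 0"
  "cmod (cutoff s v) <= 1" "cmod (w - c) <= s ==> cmod (dzb (%w. cutoff s (w - c)) w) <= 8 / s"
proof -
 define t where "t w = 4 / (3 * s^2) * (s^2 - sq (w - c))" for w
 define u where "u w = 1 - (max 0 (t w))^2" for w
 have tc: "CK 1 (%w. complex_of_real (t w)) UNIV" unfolding t_def of_real_mult by (intro CK_mult CK_const CK_sq_diff open_UNIV)
 have uc: "CK 1 (%w. complex_of_real (u w)) UNIV" unfolding u_def of_real_diff of_real_power
  using CK_max_power[OF open_UNIV tc] by (intro CK_diff CK_const open_UNIV) (simp add: numeral_2_eq_2 del: CK.simps)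
 have xe: "cutoff s (w - c) = 1 - of_real (max 0 (u w)) ^ 2" for w by (simp add: cutoff_def u_def t_def)
 show "CK 1 (%w. cutoff s (w - c)) UNIV"
  unfolding xe using CK_max_power[OF open_UNIV uc] by (intro CK_diff CK_const open_UNIV) (simp add: numeral_2_eq_2 del: CK.simps)
 show "cutoff s v = 1" if v: "cmod v <= s / 2"
 proof -
  have "sq v <= (s/2)^2" using v by (intro power_mono) auto
  then have "s^2 - sq v >= 3/4 * s^2" by (simp add: power_divide)
  then have "4 / (3 * s^2) * (s^2 - sq v) >= 4 / (3 * s^2) * (3/4 * s^2)" by (intro mult_left_mono) auto
  then have "4 / (3 * s^2) * (s^2 - sq v) >= 1" using s by simp
  then have "(max 0 (4 / (3 * s^2) * (s^2 - sq v)))^2 >= 1" by (intro one_le_power) (simp add: max_def)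
  then have "max 0 (1 - (max 0 (4 / (3 * s^2) * (s^2 - sq v)))^2) = 0" by simp
  then show ?thesis unfolding cutoff_def by simp
 qed
 show "cutoff s v = 0" if v: "cmod v >= s"
 proof -
  have "s^2 <= sq v" using v s by (intro power_mono) auto
  then have "4 / (3 * s^2) * (s^2 - sq v) <= 0" by (intro mult_nonneg_nonpos) auto
  then have "max 0 (4 / (3 * s^2) * (s^2 - sq v)) = 0" by (rule max_absorb1)
  then show ?thesis unfolding cutoff_def by simp
 qed
 have m01: "0 <= max 0 (1 - y^2)" "max 0 (1 - y^2) <= 1" for y :: real by auto
 show "cmod (cutoff s v) <= 1"
 proof -
  let ?m = "max 0 (1 - (max 0 (4 / (3 * s^2) * (s^2 - sq v)))^2)"
  have "?m^2 <= 1" "?m^2 >= 0" using m01 by (auto intro!: power_le_one)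
  moreover have "cutoff s v = of_real (1 - ?m^2)" unfolding cutoff_def by simp
  ultimately show ?thesis by (simp only: norm_of_real abs_le_iff) linarith
 qed
 assume w: "cmod (w - c) <= s"
 have "4 / (3 * s^2) * (s^2 - sq (w - c)) <= 4 / (3 * s^2) * s^2" by (intro mult_left_mono) auto
 also have "... = 4/3" using s by simp
 finally have t43: "max 0 (t w) <= 4/3" by (auto simp only: t_def intro!: max.boundedI)
 have "((%w. of_real (s^2) - (w - c) * cnj (w - c)) has_derivative (%h. - cnj (w - c) * h + - (w - c) * cnj h)) (at w)"
  by (auto intro!: derivative_eq_intros simp: algebra_simps)
 note dsq = this[folded of_real_sq_diff]
 have "((%w. complex_of_real (4 / (3 * s^2)) * of_real (s^2 - sq (w - c))) has_derivative
   (%h. complex_of_real (4 / (3 * s^2)) * (- cnj (w - c) * h + - (w - c) * cnj h))) (at w)" by (rule has_derivative_mult_right[OF dsq])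
 then have "((%w. complex_of_real (t w)) has_derivative (%h. (complex_of_real (4 / (3 * s^2)) * (- cnj (w - c))) * h
   + (complex_of_real (4 / (3 * s^2)) * (- (w - c))) * cnj h)) (at w)" unfolding t_def of_real_mult by (simp only: distrib_left mult.assoc)
 note td = wirtinger_unique[OF this]
 have td': "cmod (dzb (%w. complex_of_real (t w)) w) <= 4 / (3 * s)"
 proof -
  have "cmod (dzb (%w. complex_of_real (t w)) w) = 4 / (3 * s^2) * cmod (w - c)" unfolding td(3) norm_mult norm_of_real norm_minus_cancel by simp
  also have "... <= 4 / (3 * s^2) * s" using w by (intro mult_left_mono) auto
  finally show ?thesis using s by (simp add: power2_eq_square)
 qed
 note md = wirtinger_unique[OF has_derivative_max_power[OF td(1), of 0]]
 have ue: "(%w. complex_of_real (u w)) = (%w. 1 - of_real (max 0 (t w)) ^ Suc (Suc 0))" unfolding u_def by (simp add: numeral_2_eq_2)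
 have cd: "(%_. 1) differentiable (at w)" "dzb (%_. 1) w = 0" using wirtinger_holomorphic[of "%_. 1" UNIV w] by auto
 have ud: "(%w. complex_of_real (u w)) differentiable (at w)" using uc by simp
 have "dzb (%w. complex_of_real (u w)) w = - (of_nat (Suc (Suc 0)) * of_real (max 0 (t w)) ^ Suc 0 * dzb (%w. of_real (t w)) w)"
  unfolding ue wirtinger_diff(2)[OF cd(1) md(1)] cd(2) md(3) by simp
 then have "cmod (dzb (%w. complex_of_real (u w)) w) = 2 * max 0 (t w) * cmod (dzb (%w. of_real (t w)) w)" by (simp add: norm_mult)
 also have "... <= 2 * (4/3) * (4 / (3 * s))" using t43 td' s by (intro mult_mono) auto
 finally have ud': "cmod (dzb (%w. complex_of_real (u w)) w) <= 32 / 9 / s" by simp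
 note xd = wirtinger_unique[OF has_derivative_max_power[OF ud, of 0]]
 have "dzb (%w. cutoff s (w - c)) w = - (of_nat (Suc (Suc 0)) * of_real (max 0 (u w)) ^ Suc 0 * dzb (%w. of_real (u w)) w)"
  unfolding xe numeral_2_eq_2 wirtinger_diff(2)[OF cd(1) xd(1)] cd(2) xd(3) by simp
 then have "cmod (dzb (%w. cutoff s (w - c)) w) = 2 * max 0 (u w) * cmod (dzb (%w. of_real (u w)) w)" by (simp add: norm_mult)
 also have "... <= 2 * 1 * (32 / 9 / s)" using m01 ud' s by (intro mult_mono) (auto simp: u_def)
 also have "... <= 8 / s" using s by (simp add: field_simps)
 finally show "cmod (dzb (%w. cutoff s (w - c)) w) <= 8 / s" .
qed

section \<open>The kernel at one point\<close>

lemma inverse_one_minus_exp: fixes y :: real assumes "y > 0" shows "1 / (1 - exp (- y)) <= 1 + 1 / y"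
proof -
 have e: "1 + y <= exp y" by (rule exp_ge_add_one_self)
 have n: "exp y ~= 0" by simp
 have "1 / (1 - exp (- y)) = 1 + 1 / (exp y - 1)" using assms e n by (simp add: exp_minus field_simps)
 also have "1 / (exp y - 1) <= 1 / y"
 proof (rule divide_left_mono)
  show "y <= exp y - 1" using e by linarith
 qed (use assms in auto)
 finally show ?thesis by simp
qed

context surf
begin

lemma curvature_form: assumes k: "k : charts A" and w: "w : W k" shows "dzb (wG (rho k)) w = of_real (d_dbar (%w. ln (rho k w)) w)"
proof -
 have o: "open (W k)" by (rule open_W[OF k])
 have c: "Ck_on 2 (%w. ln (rho k w)) (W k)" using Ck_on_Re[OF o CK_ln[OF o rho_smooth[OF k] rho_pos[OF k]], of 2] by simp
 have "dzb (wG (rho k)) w = dzb (dz (%w. complex_of_real (ln (rho k w)))) w"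
 proof (rule wirtinger_cong(2)[OF o w])
  fix x assume x: "x : W k"
  show "wG (rho k) x = dz (%w. complex_of_real (ln (rho k w))) x" unfolding wG_def by (rule dz_ln[OF o rho_smooth[OF k] rho_pos[OF k] x, symmetric])
 qed
 also have "... = of_real (d_dbar (%w. ln (rho k w)) w)" by (rule dzb_dz_of_real[OF o c w])
 finally show ?thesis .
qed

lemma curvature_lower_bound: assumes ric: "form_le_on A Y (ricci \<omega>) (%k x. - \<kappa> * \<omega> k x)" and k: "k : charts A" and w: "w : W k"
 shows "d_dbar (%w. ln (rho k w)) w >= \<kappa> / 2 * rho k w"
proof -
 obtain x where x: "x : fst k" "x : Y" "w = snd k x" using w by (rule WE[OF k])
 have "ricci \<omega> k x <= - \<kappa> * \<omega> k x" using ric k x(1,2) unfolding form_le_on_def by blast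
 then show ?thesis unfolding ricci_def x(3) rho_snd[OF k x(1)] by (simp add: rho_def)
qed

text \<open>The curvature form and \<open>\<rho>\<close> are multiplied by the same factor under a change of coordinates.\<close>
lemma gauss_curvature_chart: assumes k: "k : charts A" and x: "x : fst k" "x : Y"
 shows "gauss_curvature A \<omega> x = - (2 / \<omega> k x) * d_dbar (%w. ln (rho k w)) (snd k x)"
proof -
 define l where "l = chart_at A x"
 have l: "l : charts A" "x : fst l" unfolding l_def by (rule chart_at)+
 interpret cc: coordinate_change "snd k ` (fst k Int (fst l Int Y))" "W l" "transition k l" "rho k" "rho l" by (rule coordinate_change[OF k l(1)])
 let ?d = "deriv (transition k l) (snd k x)"
 have W: "snd k x : W k" "snd l x : W l" using x l by (auto simp: W_def)
 have t: "transition k l (snd k x) = snd l x" by (rule transition_snd[OF k x(1)])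
 have "dzb (wG (rho k)) (snd k x) = dzb (wG (rho l)) (transition k l (snd k x)) * cnj ?d * ?d" by (rule cc.curvature_change) (use x l in blast)
 then have "complex_of_real (d_dbar (%w. ln (rho k w)) (snd k x)) = of_real (d_dbar (%w. ln (rho l w)) (snd l x) * (cmod ?d)^2)"
  unfolding t curvature_form[OF k W(1)] curvature_form[OF l(1) W(2)] of_real_mult complex_norm_square by (simp add: mult_ac)
 then have "d_dbar (%w. ln (rho k w)) (snd k x) = d_dbar (%w. ln (rho l w)) (snd l x) * (cmod ?d)^2" by (simp only: of_real_eq_iff)
 moreover have "\<omega> k x = \<omega> l x * (cmod ?d)^2" using omega_law[OF k l(1) x(1) l(2) x(2)] by (simp add: jac_def)
 moreover have "\<omega> k x > 0" by (rule omega_pos[OF k x])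
 ultimately have "- (2 / \<omega> k x) * d_dbar (%w. ln (rho k w)) (snd k x) = - (2 / \<omega> l x) * d_dbar (%w. ln (rho l w)) (snd l x)" by auto
 then show ?thesis unfolding gauss_curvature_def Let_def l_def[symmetric] by (simp add: rho_def)
qed

lemma bergman_kernel_nonneg: "x : Y ==> bergman_kernel A Y \<omega> p x >= 0" unfolding bergman_kernel_def hnorm_sq_def Let_def
 using omega_pos[OF chart_at, of x] by (intro infsum_nonneg mult_nonneg_nonneg zero_le_power) auto

context fixes k :: "'a chart" and x :: 'a and w0 :: complex and r s K M er eta \<kappa> rh0 :: real and G :: "complex => complex" and q p :: nat
 assumes k: "k : charts A" and x: "x : fst k" "x : Y" and w0: "snd k x = w0" and rh0: "rho k w0 = rh0"
  and B: "ball w0 r \<subseteq> W k" and s: "0 < s" "s < r" and G: "G holomorphic_on ball w0 r" and K: "K > 0"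
  and expn: "!!v. cmod v <= s ==> \<bar>(ln (rho k (w0 + v)) - ln 2) / 2 - Re (G (w0 + v)) - K * sq v\<bar> <= M * cmod v ^ 3"
  and M: "M >= 0" "real p * (M * s ^ 3) <= er" "er <= 1"
  and lip: "!!v. cmod v <= s ==> \<bar>rho k (w0 + v) - rh0\<bar> <= eta * rh0" and eta: "eta <= 1/2"
  and p: "p = Suc q" and q: "q > 0"
begin

lemma disc_chart: "cmod v <= s ==> w0 + v : W k" using B s by (auto simp: subset_iff dist_norm)

lemma rh0_pos: "rh0 > 0" using rho_pos[OF k disc_chart[of 0]] s rh0 by simp

lemma er_nonneg: "er >= 0" using M s by (meson mult_nonneg_nonneg of_nat_0_le_iff order_trans zero_le_power less_imp_le)

lemma eta_nonneg: "eta >= 0"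
proof -
 have "0 <= eta * rh0" using lip[of 0] s by (simp add: rh0)
 then show ?thesis using rh0_pos by (simp add: zero_le_mult_iff)
qed

lemma p_pos: "real p > 0" using p by simp

lemma weight_exp: assumes v: "cmod v <= s"
 obtains t where "\<bar>t\<bar> <= er" "(2 / rho k (w0 + v)) ^ p = exp (- 2 * real p * Re (G (w0 + v))) * exp (- 2 * real p * K * sq v) * exp (2 * t)"
  "v = 0 ==> t = 0"
proof
 define e where "e = (ln (rho k (w0 + v)) - ln 2) / 2 - Re (G (w0 + v)) - K * sq v"
 have e: "\<bar>e\<bar> <= M * cmod v ^ 3" unfolding e_def by (rule expn[OF v])
 also have "... <= M * s ^ 3" using v M by (intro mult_left_mono power_mono) auto
 finally have "real p * \<bar>e\<bar> <= real p * (M * s ^ 3)" by (intro mult_left_mono) auto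
 then show "\<bar>- real p * e\<bar> <= er" using M(2) by (simp add: abs_mult)
 show "v = 0 ==> - real p * e = 0" using e by simp
 have r: "rho k (w0 + v) > 0" by (rule rho_pos[OF k disc_chart[OF v]])
 have "(2 / rho k (w0 + v)) = exp (ln 2 - ln (rho k (w0 + v)))" using r by (simp add: exp_diff)
 also have "... = exp (- 2 * (Re (G (w0 + v)) + K * sq v + e))" by (simp add: e_def algebra_simps)
 finally have "(2 / rho k (w0 + v)) ^ p = exp (real p * (- 2 * (Re (G (w0 + v)) + K * sq v + e)))" by (simp only: exp_of_nat_mult)
 then show "(2 / rho k (w0 + v)) ^ p = exp (- 2 * real p * Re (G (w0 + v))) * exp (- 2 * real p * K * sq v) * exp (2 * (- real p * e))"
  by (simp add: exp_add[symmetric] algebra_simps)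
qed

lemma weight_center: "(2 / rh0) ^ p = exp (- 2 * real p * Re (G w0))"
proof -
 have "cmod (0::complex) <= s" using s by simp
 from weight_exp[OF this] show ?thesis by (metis rh0 add.right_neutral exp_zero mult.right_neutral mult_zero_right norm_zero zero_power2)
qed

lemma weight_lower: assumes v: "cmod v <= s"
 shows "exp (- 2 * er) * ((1 - eta) * rh0) * exp (- 2 * real p * Re (G (w0 + v))) * exp (- 2 * real p * K * sq v)
   <= (2 / rho k (w0 + v)) ^ p * rho k (w0 + v)"
proof -
 obtain t where t: "\<bar>t\<bar> <= er" "(2 / rho k (w0 + v)) ^ p = exp (- 2 * real p * Re (G (w0 + v))) * exp (- 2 * real p * K * sq v) * exp (2 * t)"
  using weight_exp[OF v] by metis
 have "(1 - eta) * rh0 <= rho k (w0 + v)" using lip[OF v] by (simp add: algebra_simps)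
 moreover have "exp (- 2 * er) <= exp (2 * t)" using t(1) by simp
 moreover have "(1 - eta) * rh0 >= 0" using eta rh0_pos by simp
 ultimately have "exp (- 2 * er) * ((1 - eta) * rh0) <= exp (2 * t) * rho k (w0 + v)" by (intro mult_mono) auto
 from mult_right_mono[OF this, of "exp (- 2 * real p * Re (G (w0 + v))) * exp (- 2 * real p * K * sq v)"]
 show ?thesis unfolding t(2) by (simp only: mult_ac) simp
qed

lemma weight_upper: assumes v: "cmod v <= s"
 shows "sq (exp (of_nat p * G (w0 + v))) * (2 / rho k (w0 + v)) ^ p <= exp (2 * er) * exp (- 2 * real p * K * sq v)"
  "rho k (w0 + v) <= (1 + eta) * rh0"
proof -
 obtain t where t: "\<bar>t\<bar> <= er" "(2 / rho k (w0 + v)) ^ p = exp (- 2 * real p * Re (G (w0 + v))) * exp (- 2 * real p * K * sq v) * exp (2 * t)"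
  using weight_exp[OF v] by metis
 have "sq (exp (of_nat p * G (w0 + v))) = exp (2 * real p * Re (G (w0 + v)))" by (simp add: exp_double[symmetric])
 then have "sq (exp (of_nat p * G (w0 + v))) * (2 / rho k (w0 + v)) ^ p = exp (2 * t) * exp (- 2 * real p * K * sq v)"
  unfolding t(2) by (simp add: exp_add[symmetric])
 also have "... <= exp (2 * er) * exp (- 2 * real p * K * sq v)" using t(1) by (intro mult_right_mono) auto
 finally show "sq (exp (of_nat p * G (w0 + v))) * (2 / rho k (w0 + v)) ^ p <= exp (2 * er) * exp (- 2 * real p * K * sq v)" .
 show "rho k (w0 + v) <= (1 + eta) * rh0" using lip[OF v] by (simp add: algebra_simps)
qed

definition yy :: real where "yy = real p * K * s^2"

lemma yy_pos: "yy > 0" unfolding yy_def using p_pos K s by simp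

text \<open>The norm of the model peak section: the mass of \<open>\<rho>\<^sub>0 exp (-2pK |v|\<^sup>2)\<close> over the plane.\<close>
definition gm :: real where "gm = pi * rh0 / (2 * real p * K)"

lemma gm_pos: "gm > 0" unfolding gm_def using p_pos K rh0_pos by simp

lemma section_value_bound: assumes T: "law p T" "cmeas T" "scal p T : L2 AM" "co k T holomorphic_on ball w0 R" and a: "0 < a" "a < R" "R <= r" "a <= s"
 shows "sq (T k x) * (2 / rh0) ^ p * (exp (- 2 * er) * (1 - eta) * gm * (1 - exp (- 2 * real p * K * a^2))) <= nsq AM (scal p T)"
proof -
 have "co k T w0 = T k x" using co_snd[OF k x(1)] w0 by blast
 moreover have "sq (co k T w0) * exp (- 2 * real p * Re (G w0)) *
   (exp (- 2 * er) * ((1 - eta) * rh0) * (pi / (2 * real p * K) * (1 - exp (- 2 * real p * K * a^2)))) <= nsq AM (scal p T)"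
 proof (rule co_section_bound[OF T k a(1) _ a(2) _ K])
  show "G holomorphic_on ball w0 R" using a G by (meson holomorphic_on_subset subset_ball)
  show "ball w0 R \<subseteq> W k" using a B by (meson subset_ball subset_trans)
  show "p > 0" using p by simp
  show "exp (- 2 * er) * ((1 - eta) * rh0) > 0" using eta rh0_pos by simp
  fix v assume "cmod v < a"
  then show "exp (- 2 * er) * ((1 - eta) * rh0) * exp (- 2 * real p * Re (G (w0 + v))) * exp (- 2 * real p * K * sq v)
    <= (2 / rho k (w0 + v)) ^ p * rho k (w0 + v)" using a by (intro weight_lower) simp
 qed
 ultimately show ?thesis unfolding weight_center gm_def by (simp add: mult_ac)
qed

lemma HH_value_bound: assumes S: "S : HH p"
 shows "sq (S k x) * (2 / rh0) ^ p * (exp (- 2 * er) * (1 - eta) * gm * (1 - exp (- 2 * yy))) <= nsq AM (scal p S)"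
proof -
 have hs: "holomorphic_section A Y p S" and S2: "scal p S : L2 AM" using S HH_iff by auto
 have cm: "cmeas S" by (rule cmeas_continuous[OF holomorphic_on_imp_continuous_on[OF holomorphic_section_co[OF hs]]])
 show ?thesis using section_value_bound[OF holomorphic_section_law[OF hs] cm S2 holomorphic_on_subset[OF holomorphic_section_co[OF hs k] B] s order_refl order_refl]
  by (simp only: yy_def mult.assoc)
qed

lemma kernel_constant: "(2 / rh0) ^ p * (exp (- 2 * er) * (1 - eta) * gm * (1 - exp (- 2 * yy))) > 0"
 using rh0_pos eta gm_pos yy_pos by (intro mult_pos_pos zero_less_power) auto

definition CC :: real where "CC = 1 / ((2 / rh0) ^ p * (exp (- 2 * er) * (1 - eta) * gm * (1 - exp (- 2 * yy))))"

lemma CC_nonneg: "CC >= 0" unfolding CC_def using kernel_constant by (simp only: zero_le_divide_1_iff less_imp_le)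

lemma HH_value_bound': assumes S: "S : HH p" shows "sq (S k x) <= CC * nsq AM (scal p S)"
 using HH_value_bound[OF S] kernel_constant unfolding CC_def times_divide_eq_left mult_1_left by (subst pos_le_divide_eq) (simp_all only: mult.assoc)

lemma HH_value_bound'': "S : HH (Suc q) ==> sq (S k x) <= CC * nsq AM (scal (Suc q) S)"
 using HH_value_bound'[of S] by (simp only: p[symmetric])

lemma \<omega>_center: "\<omega> k x = rh0" using rho_snd[OF k x(1)] w0 rh0 by simp

lemma kernel_upper: "bergman_kernel A Y \<omega> p x * gm <= exp (2 * er) / (1 - eta) * (1 + 1 / (2 * yy))"
proof -
 let ?E = "(2 / rh0) ^ p" and ?D = "exp (- 2 * er) * (1 - eta) * gm * (1 - exp (- 2 * yy))"
 have E: "?E > 0" using rh0_pos by simp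
 have "bergman_kernel A Y \<omega> p x <= 1 / (?E * ?D) * ?E"
  using bergman_bounds(1)[OF k x CC_nonneg HH_value_bound''] unfolding \<omega>_center p[symmetric] CC_def by blast
 also have "... = 1 / ?D"
 proof -
  have "?E ~= 0" using E by linarith
  then show ?thesis unfolding times_divide_eq_left mult_1_left by (rule nonzero_divide_mult_cancel_left)
 qed
 finally have "bergman_kernel A Y \<omega> p x * gm <= 1 / ?D * gm" using gm_pos by (intro mult_right_mono) auto
 also have "... = exp (2 * er) / (1 - eta) * (1 / (1 - exp (- 2 * yy)))"
 proof -
  have "1 / (e * h * g * X) * g = 1 / e / h * (1 / X)" if "g ~= 0" for e h g X :: real using that by simp
  from this[of gm "exp (- 2 * er)" "1 - eta" "1 - exp (- 2 * yy)"]
  have "gm ~= 0 ==> 1 / (exp (- 2 * er) * (1 - eta) * gm * (1 - exp (- 2 * yy))) * gm = 1 / exp (- 2 * er) / (1 - eta) * (1 / (1 - exp (- 2 * yy)))" .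
  note this[OF gm_pos[THEN less_imp_neq, symmetric]]
  moreover have "1 / exp (- 2 * er) = exp (2 * er)" by (simp add: exp_minus divide_inverse)
  ultimately show ?thesis by (simp only:)
 qed
 also have "... <= exp (2 * er) / (1 - eta) * (1 + 1 / (2 * yy))"
 proof (intro mult_left_mono)
  show "1 / (1 - exp (- 2 * yy)) <= 1 + 1 / (2 * yy)" using inverse_one_minus_exp[of "2 * yy"] yy_pos by simp
  show "exp (2 * er) / (1 - eta) >= 0" using eta by simp
 qed
 finally show ?thesis .
qed

text \<open>The peak section.\<close>
definition ff :: "complex => complex" where "ff w = (if w : ball w0 r then cutoff s (w - w0) * exp (of_nat p * G w) else 0)"

lemma ff_zero: "w ~: cball w0 s ==> ff w = 0" using cutoff_data(3)[OF s(1), of "w - w0"] by (auto simp: ff_def dist_norm norm_minus_commute)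

lemma disc_subset: "cball w0 s \<subseteq> ball w0 r" "cball w0 s \<subseteq> W k" using s B by (auto simp: subset_iff)

lemma exp_holomorphic: "(%w. exp (of_nat p * G w)) holomorphic_on ball w0 r" by (intro holomorphic_intros G)

lemma ff_CK: "CK 1 ff (W k)"
proof -
 have "CK 1 (%w. cutoff s (w - w0) * exp (of_nat p * G w)) (ball w0 r)"
  by (intro CK_mult CK_holomorphic exp_holomorphic open_ball CK_subset[OF cutoff_data(1)[OF s(1)]]) auto
 then have "CK 1 ff (ball w0 r)" by (subst CK_cong[OF open_ball]) (auto simp: ff_def)
 from CK_zero_off_compact[OF open_ball this compact_cball disc_subset(1) ff_zero] show ?thesis by (rule CK_subset) auto
qed

lemma dzb_ff: "w : cball w0 s ==> cmod (dzb ff w) <= 8 / s * cmod (exp (of_nat p * G w))"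
 "w ~: cball w0 s ==> dzb ff w = 0" "cmod (w - w0) < s / 2 ==> dzb ff w = 0"
proof -
 show "cmod (dzb ff w) <= 8 / s * cmod (exp (of_nat p * G w))" if w: "w : cball w0 s"
 proof -
  have wb: "w : ball w0 r" using w disc_subset by blast
  have d: "(%w. cutoff s (w - w0)) differentiable (at w)" using cutoff_data(1)[OF s(1), of w0] by simp
  note h = wirtinger_holomorphic[OF exp_holomorphic open_ball wb]
  have "dzb ff w = dzb (%w. cutoff s (w - w0) * exp (of_nat p * G w)) w" by (rule wirtinger_cong(2)[OF open_ball wb]) (simp add: ff_def)
  also have "... = dzb (%w. cutoff s (w - w0)) w * exp (of_nat p * G w)" unfolding wirtinger_mult(2)[OF d h(3)] h(2) by simp
  finally have "cmod (dzb ff w) = cmod (dzb (%w. cutoff s (w - w0)) w) * cmod (exp (of_nat p * G w))" by (simp only: norm_mult)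
  moreover have "cmod (dzb (%w. cutoff s (w - w0)) w) <= 8 / s" using cutoff_data(5)[OF s(1), of w w0] w by (simp add: dist_norm norm_minus_commute)
  ultimately show ?thesis by (simp only: mult_right_mono norm_ge_zero)
 qed
 show "dzb ff w = 0" if w: "w ~: cball w0 s"
 proof -
  have "open (- cball w0 s)" "w : - cball w0 s" using w by (auto simp: open_Compl)
  then have "dzb ff w = dzb (%_. 0) w" by (rule wirtinger_cong(2)) (use ff_zero in blast)
  then show ?thesis using wirtinger_holomorphic(2)[of "%_. 0" UNIV w] by simp
 qed
 show "dzb ff w = 0" if w: "cmod (w - w0) < s / 2"
 proof -
  have wb: "w : ball w0 (s/2)" using w by (simp add: dist_norm norm_minus_commute)
  have h: "(%w. exp (of_nat p * G w)) holomorphic_on ball w0 (s/2)" by (rule holomorphic_on_subset[OF exp_holomorphic]) (use s in auto)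
  have "dzb ff w = dzb (%w. exp (of_nat p * G w)) w"
  proof (rule wirtinger_cong(2)[OF open_ball wb])
   fix u assume u: "u : ball w0 (s/2)"
   then have "u : ball w0 r" "cmod (u - w0) <= s / 2" using s by (auto simp: dist_norm norm_minus_commute)
   then show "ff u = exp (of_nat p * G u)" using cutoff_data(2)[OF s(1), of "u - w0"] by (simp add: ff_def)
  qed
  then show ?thesis using wirtinger_holomorphic(2)[OF h open_ball wb] by simp
 qed
qed

lemma ff_dbar_norm: "dbar_norm q k ff <= 32 * pi * exp (2 * er) * exp (- (yy / 2))"
proof -
 define b where "b = 32 / s^2 * (exp (2 * er) * exp (- (yy / 2)))"
 have b0: "b >= 0" using s by (simp add: b_def)
 have "dbar_norm q k ff <= (LINT w|lborel. indicator (cball w0 s) w *\<^sub>R b)" unfolding dbar_norm_def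
 proof (rule integral_mono')
  show "integrable lborel (%w::complex. indicator (cball w0 s) w *\<^sub>R b)" by (rule borel_integrable_compact) (auto simp: compact_cball)
  show "0 <= indicat_real (cball w0 s) w *\<^sub>R b" for w using b0 by simp
  fix w
  show "indicator (W k) w * (sq (dzb ff w) * ((2 / rho k w) ^ q / rho k w)) <= indicat_real (cball w0 s) w *\<^sub>R b"
  proof (cases "w : cball w0 s & cmod (w - w0) >= s / 2")
   case True
   define v where "v = w - w0"
   have v: "cmod v <= s" "cmod v >= s / 2" "w = w0 + v" using True by (auto simp: v_def dist_norm norm_minus_commute)
   have wW: "w : W k" using True disc_subset by blast
   have r: "rho k w > 0" by (rule rho_pos[OF k wW])
   have "sq (dzb ff w) <= (8 / s * cmod (exp (of_nat p * G w)))^2" using True dzb_ff(1) by (intro power_mono) auto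
   also have "... = 64 / s^2 * sq (exp (of_nat p * G w))" by (simp only: power_mult_distrib power_divide) simp
   finally have 1: "sq (dzb ff w) <= 64 / s^2 * sq (exp (of_nat p * G w))" .
   have 2: "(2 / rho k w) ^ q / rho k w = (2 / rho k w) ^ p / 2" using r by (simp add: p)
   have "sq (dzb ff w) * ((2 / rho k w) ^ q / rho k w) <= 64 / s^2 * sq (exp (of_nat p * G w)) * ((2 / rho k w) ^ p / 2)"
    unfolding 2 by (intro mult_right_mono 1) (use r in simp)
   also have "... = 32 / s^2 * (sq (exp (of_nat p * G w)) * (2 / rho k w) ^ p)" by simp
   also have "... <= 32 / s^2 * (exp (2 * er) * exp (- 2 * real p * K * sq v))"
    using weight_upper(1)[OF v(1)] unfolding v(3) by (intro mult_left_mono) auto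
   also have "... <= b"
   proof -
    have "(s/2)^2 <= sq v" using v s by (intro power_mono) auto
    then have "2 * real p * K * (s/2)^2 <= 2 * real p * K * sq v" using p_pos K by (intro mult_left_mono) auto
    moreover have "2 * real p * K * (s/2)^2 = yy / 2" by (simp add: yy_def power_divide)
    ultimately have "yy / 2 <= 2 * real p * K * sq v" by (simp only:)
    then show ?thesis unfolding b_def by (intro mult_left_mono) auto
   qed
   finally show ?thesis using True wW by simp
  next
   case False
   then have "dzb ff w = 0" using dzb_ff(2,3)[of w] by linarith
   then show ?thesis using b0 by simp
  qed
 qed
 also have "... = b * (pi * s^2)" using s by (simp add: content_cball unit_ball_vol_2)
 also have "... = 32 * pi * exp (2 * er) * exp (- (yy / 2))" using s by (simp add: b_def)
 finally show ?thesis .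
qed

lemma ff_section: shows "law p (secof p k ff)" "cmeas (secof p k ff)" "scal p (secof p k ff) : L2 AM"
  "nsq AM (scal p (secof p k ff)) <= exp (2 * er) * (1 + eta) * gm"
proof -
 let ?V = "secof p k ff"
 show l: "law p ?V" by (rule law_secof[OF k])
 have c: "CK 1 (co l ?V) (W l)" if "l : charts A" for l by (rule CK_secof[OF k that ff_CK compact_cball disc_subset(2) ff_zero])
 show m: "cmeas ?V" by (rule cmeas_continuous[OF CK_continuous[OF c]])
 have supp: "supp_in k (cball w0 s) ?V" by (rule supp_in_secof[OF k compact_cball disc_subset(2) ff_zero])
 show 2: "scal p ?V : L2 AM" by (rule scal_L2[OF l CK_continuous[OF c] supp])
 define b where "b = exp (2 * er) * ((1 + eta) * rh0)"
 have b0: "b >= 0" using rh0_pos eta_nonneg by (simp add: b_def)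
 have pw: "ennreal (sq (co k ?V w) * ((2 / rho k w) ^ p * rho k w)) * indicator (W k) w
   <= ennreal b * (ennreal (exp (- (2 * real p * K) * sq (w - w0))) * indicator (ball 0 s) (w - w0))" for w
 proof (cases "w : W k & cmod (w - w0) < s")
  case True
  define v where "v = w - w0"
  have v: "cmod v <= s" "w = w0 + v" using True by (auto simp: v_def)
  have wb: "w : ball w0 r" using True s by (simp add: dist_norm norm_minus_commute)
  have r: "rho k w > 0" using rho_pos[OF k] True by blast
  have e0: "cmod (co k ?V w) = cmod (cutoff s (w - w0)) * cmod (exp (of_nat p * G w))" using co_secof_self[OF k, of w p ff] True wb by (simp add: ff_def norm_mult)
  have "cmod (co k ?V w) <= cmod (exp (of_nat p * G w))" unfolding e0 by (rule mult_left_le_one_le) (auto simp: cutoff_data(4)[OF s(1)])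
  then have "sq (co k ?V w) * (2 / rho k w) ^ p <= sq (exp (of_nat p * G w)) * (2 / rho k w) ^ p" using r by (intro mult_right_mono power_mono) auto
  also have "... <= exp (2 * er) * exp (- 2 * real p * K * sq v)" using weight_upper(1)[OF v(1)] unfolding v(2) .
  finally have "sq (co k ?V w) * (2 / rho k w) ^ p * rho k w <= exp (2 * er) * exp (- 2 * real p * K * sq v) * ((1 + eta) * rh0)"
   by (rule mult_mono) (use weight_upper(2)[OF v(1)] r v(2) in auto)
  then have "sq (co k ?V w) * ((2 / rho k w) ^ p * rho k w) <= b * exp (- (2 * real p * K) * sq (w - w0))"
   unfolding b_def v_def by (simp add: mult_ac)
  then show ?thesis using True b0 by (simp add: ennreal_mult'[symmetric] ennreal_leI del: ennreal_le_iff)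
 next
  case False
  have "w : W k ==> co k ?V w = 0"
  proof -
   assume w: "w : W k"
   then have "cmod (w - w0) >= s" using False by auto
   then have "ff w = 0" using cutoff_data(3)[OF s(1), of "w - w0"] by (simp add: ff_def)
   then show "co k ?V w = 0" using co_secof_self[OF k w] by simp
  qed
  then show ?thesis by (cases "w : W k") auto
 qed
 have "ennreal (nsq AM (scal p ?V)) = (\<integral>\<^sup>+y. ennreal (sq (scal p ?V y)) \<partial>AM)" by (rule nn_integral_nsq[OF 2, symmetric])
 also have "... = (\<integral>\<^sup>+y\<in>fst k. ennreal (sq (scal p ?V y)) \<partial>AM)"
 proof (rule nn_integral_cong)
  fix y assume "y : space AM"
  then have y: "y : Y" by simp
  show "ennreal (sq (scal p ?V y)) = ennreal (sq (scal p ?V y)) * indicator (fst k) y"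
  proof (cases "y : fst k")
   case False
   then have "scal p ?V y = 0" by (intro supp_scal[OF supp y]) auto
   then show ?thesis by simp
  qed simp
 qed
 also have "... = (\<integral>\<^sup>+w\<in>W k. ennreal (sq (co k ?V w) * ((2 / rho k w) ^ p * rho k w)) \<partial>lborel)"
  by (rule nn_integral_scal_chart[OF l m k])
 also have "... <= (\<integral>\<^sup>+w. ennreal b * (ennreal (exp (- (2 * real p * K) * sq (w - w0))) * indicator (ball 0 s) (w - w0)) \<partial>lborel)"
  by (intro nn_integral_mono pw)
 also have "... = (\<integral>\<^sup>+v. ennreal b * (ennreal (exp (- (2 * real p * K) * sq v)) * indicator (ball 0 s) v) \<partial>(lborel :: complex measure))"
 proof -
  have "(%v::complex. ennreal b * (ennreal (exp (- (2 * real p * K) * sq v)) * indicator (ball 0 s) v)) : borel_measurable borel"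
  proof -
   have [measurable]: "ball (0::complex) s : sets borel" by simp
   show ?thesis by measurable
  qed
  from nn_integral_translation[OF this, of "- w0"] show ?thesis by (simp only: uminus_add_conv_diff)
 qed
 also have "... = ennreal b * ennreal (pi / (2 * real p * K) * (1 - exp (- (2 * real p * K) * s^2)))"

 proof -
  have [measurable]: "ball (0::complex) s : sets borel" by simp
  have "(%v::complex. ennreal (exp (- (2 * real p * K) * sq v)) * indicator (ball 0 s) v) : borel_measurable lborel" by measurable
  from nn_integral_cmult[OF this] show ?thesis using nn_integral_gaussian_disc[OF s(1), of "2 * real p * K"] p_pos K by simp
 qed
 also have "... = ennreal (b * (pi / (2 * real p * K) * (1 - exp (- (2 * real p * K) * s^2))))" using b0 by (rule ennreal_mult'[symmetric])
 finally have "nsq AM (scal p ?V) <= b * (pi / (2 * real p * K) * (1 - exp (- (2 * real p * K) * s^2)))" using b0 p_pos K by (simp add: ennreal_le_iff)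
 also have "... <= b * (pi / (2 * real p * K) * 1)" using b0 p_pos K by (intro mult_left_mono) auto
 also have "... = exp (2 * er) * (1 + eta) * gm" by (simp add: b_def gm_def)
 finally show "nsq AM (scal p ?V) <= exp (2 * er) * (1 + eta) * gm" .
qed

text \<open>Here \<open>\<tau>\<close> is the norm at x of the remainder of the projection. The remainder is holomorphic where the cutoff is 1, so its value is bounded by its norm, which decays like exp (-yy/4); the factor K in the bound is absorbed by this decay.\<close>
lemma kernel_lower:
 assumes curv: "!!k w. k : charts A ==> w : W k ==> \<exists>c. dzb (wG (rho k)) w = of_real c & c >= \<kappa> / 2 * rho k w" and \<kappa>: "\<kappa> > 0"
 obtains \<tau> where "\<tau> >= 0" "\<tau>\<^sup>2 <= 8192 * exp 4 / (\<kappa> * rh0 * (real p * s^2))"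
  "\<tau> <= 1 ==> (1 - \<tau>)^2 <= bergman_kernel A Y \<omega> p x * gm * (exp (2 * er) * (1 + eta))"
proof -
 let ?V = "secof p k ff" and ?E = "(2 / rh0) ^ p"
 obtain S where S: "S : HH p" "nsq AM (scal p S) <= nsq AM (scal p ?V)" "nsq AM (%y. scal p ?V y - scal p S y) <= 4 * dbar_norm q k ff / (real q * \<kappa>)"
  using peak_projection[OF k ff_CK compact_cball disc_subset(2) ff_zero curv \<kappa> q] unfolding p by blast
 have hs: "holomorphic_section A Y p S" and S2: "scal p S : L2 AM" using S(1) HH_iff by auto
 have Sl: "law p S" by (rule holomorphic_section_law[OF hs])
 have Sh: "co l S holomorphic_on W l" if "l : charts A" for l by (rule holomorphic_section_co[OF hs that])
 define T where "T = (%l y. ?V l y + (- 1) * S l y)"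
 have sT: "scal p T = (%y. scal p ?V y - scal p S y)" unfolding T_def scal_lin by simp
 have Tl: "law p T" unfolding law_def T_def
 proof (intro ballI)
  fix l m y assume "l : charts A" "m : charts A" "y : fst l Int fst m Int Y"
  then have "?V l y = ?V m y * jac l m y ^ p" "S l y = S m y * jac l m y ^ p" using lawD[OF ff_section(1), of l m y] lawD[OF Sl, of l m y] by blast+
  then show "?V l y + - 1 * S l y = (?V m y + - 1 * S m y) * jac l m y ^ p" by (simp add: algebra_simps)
 qed
 have coT: "co l T w = co l ?V w - co l S w" for l w by (simp add: co_def T_def)
 have Tm: "cmeas T"
 proof (rule cmeas_continuous)
  fix l assume l: "l : charts A"
  have "continuous_on (W l) (co l ?V)" by (rule CK_continuous[OF CK_secof[OF k l ff_CK compact_cball disc_subset(2) ff_zero]])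
  moreover have "continuous_on (W l) (co l S)" by (rule holomorphic_on_imp_continuous_on[OF Sh[OF l]])
  ultimately show "continuous_on (W l) (co l T)" unfolding coT[abs_def] by (rule continuous_on_diff)
 qed
 have T2: "scal p T : L2 AM" unfolding sT by (rule L2_diff[OF ff_section(3) S2])
 have Vco: "co k ?V w = exp (of_nat p * G w)" if "w : ball w0 (s/2)" for w
 proof -
  have w: "w : ball w0 r" "cmod (w - w0) <= s / 2" using that s by (auto simp: dist_norm norm_minus_commute)
  then have "w : W k" using B by blast
  then show ?thesis using co_secof_self[OF k, of w p ff] w cutoff_data(2)[OF s(1) w(2)] by (simp add: ff_def)
 qed
 have sub: "ball w0 (s/2) \<subseteq> ball w0 r" using s by auto
 have Th: "co k T holomorphic_on ball w0 (s/2)"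
 proof -
  have "(%w. exp (of_nat p * G w) - co k S w) holomorphic_on ball w0 (s/2)"
   by (intro holomorphic_on_diff holomorphic_on_subset[OF exp_holomorphic] holomorphic_on_subset[OF Sh[OF k]] order_trans[OF sub B] sub)
  then show ?thesis by (rule holomorphic_transform) (simp add: coT Vco)
 qed
 have E: "?E > 0" using rh0_pos by simp
 \<comment> \<open>the value of the remainder at the centre\<close>
 define X where "X = 1 - exp (- (yy / 8))"
 have Xl: "exp (- (yy / 2)) * (yy / 8) <= X"
 proof -
  have "yy / 8 <= exp (yy / 8) - 1" using exp_ge_add_one_self[of "yy / 8"] by linarith
  then have "exp (- (yy / 8)) * (yy / 8) <= exp (- (yy / 8)) * (exp (yy / 8) - 1)" by (rule mult_left_mono) simp
  also have "... = X" by (simp add: X_def exp_minus field_simps)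
  finally have "exp (- (yy / 8)) * (yy / 8) <= X" .
  moreover have "exp (- (yy / 2)) * (yy / 8) <= exp (- (yy / 8)) * (yy / 8)" using yy_pos by (intro mult_right_mono) auto
  ultimately show ?thesis by linarith
 qed
 have X: "X > 0" using yy_pos by (simp add: X_def)
 have "sq (T k x) * ?E * (exp (- 2 * er) * (1 - eta) * gm * (1 - exp (- 2 * real p * K * (s/4)^2))) <= nsq AM (scal p T)"
  by (rule section_value_bound[OF Tl Tm T2 Th]) (use s in auto)
 also have "1 - exp (- 2 * real p * K * (s/4)^2) = X" by (simp add: X_def yy_def power_divide)
 also have "nsq AM (scal p T) <= 4 * dbar_norm q k ff / (real q * \<kappa>)" unfolding sT by (rule S(3))
 also have "... <= 4 * (32 * pi * exp (2 * er) * exp (- (yy / 2))) / (real q * \<kappa>)"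
  by (intro divide_right_mono mult_left_mono ff_dbar_norm) (use q \<kappa> in auto)
 also have "... <= 4 * (32 * pi * exp (2 * er) * (8 / yy * X)) / (real q * \<kappa>)"
 proof (intro divide_right_mono mult_left_mono)
  show "exp (- (yy / 2)) <= 8 / yy * X" using Xl yy_pos by (simp add: field_simps)
 qed (use q \<kappa> in auto)
 finally have "(sq (T k x) * ?E) * (exp (- 2 * er) * (1 - eta) * gm) * X <= (1024 * pi * exp (2 * er) / (yy * real q * \<kappa>)) * X"
  by (simp add: mult_ac)
 then have tau1: "(sq (T k x) * ?E) * (exp (- 2 * er) * (1 - eta) * gm) <= 1024 * pi * exp (2 * er) / (yy * real q * \<kappa>)"
  using X by (rule mult_right_le_imp_le)
 define \<tau> where "\<tau> = cmod (T k x) * sqrt ?E"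
 have tau2: "\<tau>\<^sup>2 = sq (T k x) * ?E" using E by (simp add: \<tau>_def power_mult_distrib)
 have "\<tau>\<^sup>2 * (exp (- 2 * er) * (1/2) * gm) <= \<tau>\<^sup>2 * (exp (- 2 * er) * (1 - eta) * gm)"
  using eta gm_pos by (intro mult_left_mono mult_right_mono) auto
 also have "... <= 1024 * pi * exp (2 * er) / (yy * real q * \<kappa>)" using tau1 unfolding tau2 .
 finally have "\<tau>\<^sup>2 <= 1024 * pi * exp (2 * er) / (yy * real q * \<kappa>) / (exp (- 2 * er) * (1/2) * gm)"
  using gm_pos by (subst pos_le_divide_eq) auto
 also have "... = 4096 * (exp (2 * er) * exp (2 * er)) * (real p / real q) / (\<kappa> * rh0 * (real p * s^2))"
  using p_pos K s q \<kappa> rh0_pos by (simp add: gm_def yy_def exp_minus field_simps)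
 also have "... <= 4096 * exp 4 * 2 / (\<kappa> * rh0 * (real p * s^2))"
 proof (intro divide_right_mono mult_mono)
  show "exp (2 * er) * exp (2 * er) <= exp 4" unfolding exp_add[symmetric] using M(3) by simp
  show "real p / real q <= 2" using q p by (simp add: field_simps)
 qed (use \<kappa> rh0_pos in auto)
 finally have tau3: "\<tau>\<^sup>2 <= 8192 * exp 4 / (\<kappa> * rh0 * (real p * s^2))" by simp
 show ?thesis
 proof (rule that[OF _ tau3])
  show "\<tau> >= 0" using E by (simp add: \<tau>_def)
  assume t1: "\<tau> <= 1"
  have Vx: "cmod (?V k x) * sqrt ?E = 1"
  proof -
   have "?V k x = exp (of_nat p * G w0)" using Vco[of w0] co_snd[OF k x(1)] w0 s by simp
   then have "cmod (?V k x) = exp (real p * Re (G w0))" by simp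
   moreover have "sqrt ?E = exp (- (real p * Re (G w0)))" unfolding weight_center by (rule real_sqrt_unique) (auto simp: exp_double[symmetric])
   ultimately show ?thesis by (simp add: exp_minus)
  qed
  have "?V k x = S k x + T k x" by (simp add: T_def)
  then have "cmod (?V k x) <= cmod (S k x) + cmod (T k x)" by (simp add: norm_triangle_ineq)
  then have "cmod (?V k x) * sqrt ?E <= (cmod (S k x) + cmod (T k x)) * sqrt ?E" using E by (intro mult_right_mono) auto
  then have "1 - \<tau> <= cmod (S k x) * sqrt ?E" unfolding Vx \<tau>_def by (simp add: algebra_simps)
  then have "(1 - \<tau>)^2 <= (cmod (S k x) * sqrt ?E)^2" using t1 by (intro power_mono) auto
  also have "... = sq (S k x) * (2 / \<omega> k x) ^ p" using E by (simp add: power_mult_distrib \<omega>_center)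
  also have "... <= bergman_kernel A Y \<omega> p x * nsq AM (scal p S)" using bergman_bounds(2)[OF k x CC_nonneg HH_value_bound''] S(1) unfolding p[symmetric] by blast
  also have "... <= bergman_kernel A Y \<omega> p x * (exp (2 * er) * (1 + eta) * gm)"
   using S(2) ff_section(4) bergman_kernel_nonneg[OF x(2)] by (intro mult_left_mono) auto
  finally show "(1 - \<tau>)^2 <= bergman_kernel A Y \<omega> p x * gm * (exp (2 * er) * (1 + eta))" by (simp add: mult_ac)
 qed
qed

lemmas kernel_upper_explicit = kernel_upper[unfolded gm_def yy_def]
lemmas kernel_lower_explicit = kernel_lower[unfolded gm_def]

end

end

section \<open>The induced distance\<close>

lemma arc_length_lower_bound: fixes h :: "real => complex" assumes ab: "a < b" and F: "finite F" and h: "continuous_on {a..b} h"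
  and d: "!!t. t : {a<..<b} - F ==> (h has_vector_derivative D t) (at t)" and D: "continuous_on ({a<..<b} - F) D"
 shows "ennreal (cmod (h b - h a)) <= (\<integral>\<^sup>+t\<in>{a<..<b} - F. ennreal (cmod (D t)) \<partial>lborel)"
proof (cases "(\<integral>\<^sup>+t\<in>{a<..<b} - F. ennreal (cmod (D t)) \<partial>lborel) = \<infinity>")
 case False
 define E where "E t = indicator ({a<..<b} - F) t *\<^sub>R D t" for t
 have Em: "E : borel_measurable borel" unfolding E_def
  by (rule borel_measurable_continuous_on_indicator[OF _ D]) (intro sets.Diff borel_closed[OF finite_imp_closed[OF F]], simp)
 have n: "(\<integral>\<^sup>+t. ennreal (norm (E t)) \<partial>lborel) = (\<integral>\<^sup>+t\<in>{a<..<b} - F. ennreal (cmod (D t)) \<partial>lborel)"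
  by (intro nn_integral_cong) (auto simp: E_def indicator_def)
 have i: "integrable lborel E" by (rule integrableI_bounded) (use Em False in \<open>auto simp: n top.not_eq_extremum\<close>)
 have "(E has_integral (h b - h a)) {a..b}"
 proof (rule fundamental_theorem_of_calculus_interior_strong[OF F less_imp_le[OF ab] _ h])
  fix t assume "t : {a<..<b} - F"
  then show "(h has_vector_derivative E t) (at t)" using d by (simp add: E_def)
 qed
 moreover have "(E has_integral (LINT t|lborel. E t)) {a..b}"
 proof -
  have "(E has_integral (LINT t|lborel. E t)) UNIV" by (rule has_integral_integral_lborel[OF i])
  moreover have "(%t. if t : {a..b} then E t else 0) = E" by (auto simp: E_def fun_eq_iff)
  ultimately show ?thesis using has_integral_restrict_UNIV[of "{a..b}" E] by simp
 qed
 ultimately have "h b - h a = (LINT t|lborel. E t)" by (rule has_integral_unique)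
 then show ?thesis using integral_norm_bound_ennreal[OF i] by (simp add: n)
qed simp

text \<open>The image is open, and closed in the disc by compactness of the closure; the disc is connected.\<close>
lemma coordinate_disc_image: fixes k :: "('a::t2_space) chart" assumes k: "is_chart k" and x: "x : fst k" "snd k x = 0" and r: "r > 0"
  and c: "compact (closure (coord_disc k r))" "closure (coord_disc k r) \<subseteq> fst k" shows "snd k ` coord_disc k r = ball 0 r"
proof -
 obtain U z where kk: "k = (U, z)" by (cases k)
 have oz: "open (z ` U)" and hz: "homeomorphism U (z ` U) z (inv_into U z)" using k unfolding is_chart_def kk by auto
 have cz: "continuous_on U z" using hz by (simp add: homeomorphism_def)
 define V where "V = z ` coord_disc k r"
 define C where "C = z ` closure (coord_disc k r)"
 have V1: "V = z ` U Int ball 0 r" by (auto simp: V_def coord_disc_def kk)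
 have "compact C" unfolding C_def using c kk by (intro compact_continuous_image continuous_on_subset[OF cz]) auto
 then have "closed C" by (rule compact_imp_closed)
 have V2: "V = C Int ball 0 r"
 proof
  have "V \<subseteq> C" unfolding V_def C_def by (intro image_mono closure_subset)
  then show "V \<subseteq> C Int ball 0 r" using V1 by blast
  show "C Int ball 0 r \<subseteq> V" using c(2) by (auto simp: V1 C_def kk)
 qed
 have "openin (top_of_set (ball 0 r)) V" unfolding V1 using oz by (simp add: openin_open_Int Int_commute)
 moreover have "closedin (top_of_set (ball 0 r)) V" unfolding V2 using closedin_closed_Int[OF \<open>closed C\<close>, of "ball 0 r"] by (simp add: Int_commute)
 moreover have "V ~= {}" using x r by (auto simp: V_def coord_disc_def kk)
 ultimately have "V = ball 0 r" using connected_ball[of "0::complex" r] unfolding connected_clopen by blast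
 then show ?thesis by (simp add: V_def kk)
qed

context surf
begin

text \<open>The speed of a path is independent of the chart.\<close>
lemma speed_chart: assumes k: "k : charts A" "l : charts A" and t: "isCont gam t" "gam t : fst k" "gam t : fst l" "gam t : Y"
  and d: "((snd k \<circ> gam) has_vector_derivative v) (at t)" shows "((snd l \<circ> gam) has_vector_derivative (jac k l (gam t) * v)) (at t)"
  "sqrt (\<omega> l (gam t)) * cmod (vector_derivative (snd l \<circ> gam) (at t)) = sqrt (\<omega> k (gam t)) * cmod v"
proof -
 have "(transition k l has_field_derivative jac k l (gam t)) (at ((snd k \<circ> gam) t))" unfolding jac_def o_def
  by (rule holomorphic_derivI[OF transition_holomorphic[OF k] open_overlap[OF k]]) (use t in auto)
 from field_vector_diff_chain_at[OF d this]
 have 1: "((transition k l \<circ> (snd k \<circ> gam)) has_vector_derivative (v * jac k l (gam t))) (at t)" .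
 have "eventually (%u. gam u : fst k) (nhds t)"
  unfolding eventually_nhds_conv_at using topological_tendstoD[OF isContD[OF t(1)] chartD(1)[OF k(1)] t(2)] t(2) by blast
 then have "eventually (%u. (transition k l \<circ> (snd k \<circ> gam)) u = (snd l \<circ> gam) u) (nhds t)"
  by eventually_elim (simp add: transition_snd[OF k(1)])
 then obtain S where "open S" "t : S" "!!u. u : S ==> (transition k l \<circ> (snd k \<circ> gam)) u = (snd l \<circ> gam) u"
  unfolding eventually_nhds by blast
 from has_vector_derivative_transform_within_open[OF 1 this]
 show 2: "((snd l \<circ> gam) has_vector_derivative (jac k l (gam t) * v)) (at t)" by (simp only: mult.commute)
 have "\<omega> k (gam t) = \<omega> l (gam t) * sq (jac k l (gam t))" by (rule omega_law[OF k t(2-4)])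
 then show "sqrt (\<omega> l (gam t)) * cmod (vector_derivative (snd l \<circ> gam) (at t)) = sqrt (\<omega> k (gam t)) * cmod v"
  by (simp add: vector_derivative_at[OF 2] norm_mult real_sqrt_mult)
qed

context fixes k x0 r m m' assumes YU: "Y = UNIV" and k: "k : charts A" and x0: "x0 : fst k" "snd k x0 = 0" and r: "r > 0" and disc: "snd k ` coord_disc k r = ball 0 r"
  and m: "m > 0" "!!y. y : coord_disc k r ==> m <= \<omega> k y" "!!y. y : coord_disc k r ==> \<omega> k y <= m'"
begin

lemma radial_path: assumes x: "x : coord_disc k r"
 defines "gam \<equiv> %t::real. cinv k (of_real (1 - t) * snd k x)"
 shows "piecewise_C1_path A gam" "gam 0 = x" "gam 1 = x0" "path_length A \<omega> gam <= ennreal (sqrt m' * cmod (snd k x))"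
proof -
 have xk: "x : fst k" "cmod (snd k x) < r" using x by (auto simp: coord_disc_def)
 show "gam 0 = x" using k xk by (simp add: gam_def)
 show "gam 1 = x0" using k x0 cinv_snd[OF k x0(1)] by (simp add: gam_def)
 let ?l = "%t::real. of_real (1 - t) * snd k x"
 have lb: "?l t : ball 0 r" if "0 <= t" "t <= 1" for t
 proof -
  have "cmod (?l t) = (1 - t) * cmod (snd k x)" using that by (simp add: norm_mult del: of_real_diff)
  also have "... <= cmod (snd k x)" using that by (intro mult_left_le_one_le) auto
  finally show ?thesis using xk by simp
 qed
 have g: "gam t : coord_disc k r" "snd k (gam t) = ?l t" if t: "0 <= t" "t <= 1" for t
 proof -
  obtain y where y: "y : coord_disc k r" "?l t = snd k y" using lb[OF t] disc by (metis imageE)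
  have "gam t = y" unfolding gam_def y(2) using y(1) k by (simp add: coord_disc_def)
  then show "gam t : coord_disc k r" "snd k (gam t) = ?l t" using y by auto
 qed
 have im: "?l ` {0..1} \<subseteq> snd k ` fst k"
 proof -
  have "?l ` {0..1} \<subseteq> ball 0 r" using lb by auto
  also have "... \<subseteq> snd k ` fst k" unfolding disc[symmetric] by (intro image_mono) (auto simp: coord_disc_def)
  finally show ?thesis .
 qed
 have c: "continuous_on {0..1} gam" unfolding gam_def by (rule continuous_on_compose2[OF chartD(5)[OF k] _ im]) (intro continuous_intros)
 have ic: "isCont gam t" if "t : {0<..<1}" for t using continuous_on_interior[OF c, of t] that by simp
 have d: "((snd k \<circ> gam) has_vector_derivative (- snd k x)) (at t)" if t: "t : {0<..<1}" for t
 proof (rule has_vector_derivative_transform_within_open[where f = ?l and S = "{0<..<1}"])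
  show "(?l has_vector_derivative - snd k x) (at t)" by (auto intro!: derivative_eq_intros)
  show "?l u = (snd k \<circ> gam) u" if "u : {0<..<1}" for u using g(2)[of u] that by simp
 qed (use t in auto)
 have gk: "gam t : fst k" if "t : {0<..<1}" for t using g(1)[of t] that by (simp add: coord_disc_def)
 show "piecewise_C1_path A gam" unfolding piecewise_C1_path_def
 proof (intro conjI c exI[of _ "{}"] ballI)
  fix l assume l: "l : charts A"
  let ?T = "{t : {0<..<1} - {}. gam t : fst l}"
  have "continuous_on ?T (%t. jac k l (cinv k (?l t)))"
  proof (rule continuous_on_compose2[OF jac_continuous[OF k l]])
   show "?l ` ?T \<subseteq> snd k ` (fst k Int fst l)"
   proof
    fix w assume "w : ?l ` ?T"
    then obtain t where t: "t : ?T" "w = ?l t" by blast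
    then show "w : snd k ` (fst k Int fst l)" using g(2)[of t] gk[of t] by (intro image_eqI[of _ _ "gam t"]) auto
   qed
  qed (intro continuous_intros)
  then have "continuous_on ?T (%t. jac k l (gam t) * (- snd k x))" unfolding gam_def by (intro continuous_intros)
  moreover have "((snd l \<circ> gam) has_vector_derivative (jac k l (gam t) * (- snd k x))) (at t)" if "t : ?T" for t
  proof (rule speed_chart(1)[OF k l ic gk _ _ d])
   show "gam t : Y" unfolding YU by (rule UNIV_I)
  qed (use that in blast)+
  ultimately show "(snd l \<circ> gam) C1_differentiable_on ?T" unfolding C1_differentiable_on_def
   by (intro exI[of _ "%t. jac k l (gam t) * (- snd k x)"] conjI ballI)
 qed simp
 have "path_length A \<omega> gam <= (\<integral>\<^sup>+t. ennreal (sqrt m' * cmod (snd k x)) * indicator {0<..<1} t \<partial>(lborel :: real measure))"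
  unfolding path_length_def
 proof (rule nn_integral_mono)
  fix t :: real
  show "ennreal (let k = chart_at A (gam t) in sqrt (\<omega> k (gam t)) * cmod (vector_derivative (snd k \<circ> gam) (at t))) * indicator {0<..<1} t
   <= ennreal (sqrt m' * cmod (snd k x)) * indicator {0<..<1} t"
  proof (cases "t : {0<..<1}")
   case t: True
   have "sqrt (\<omega> k (gam t)) * cmod (- snd k x) <= sqrt m' * cmod (snd k x)" using m(3)[OF g(1)[of t]] t by (simp add: mult_right_mono)
   moreover have tY: "gam t : Y" unfolding YU by (rule UNIV_I)
   ultimately show ?thesis unfolding Let_def speed_chart(2)[OF k chart_at(1) ic[OF t] gk[OF t] chart_at(2) tY d[OF t]] by (intro mult_right_mono ennreal_leI) auto
  qed simp
 qed
 also have "... = ennreal (sqrt m' * cmod (snd k x))" by (simp add: nn_integral_cmult_indicator)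
 finally show "path_length A \<omega> gam <= ennreal (sqrt m' * cmod (snd k x))" .
qed

lemma rdist_upper: assumes x: "x : coord_disc k r" shows "rdist A \<omega> x x0 <= sqrt m' * cmod (snd k x)"
  "(INF gam\<in>{gam. piecewise_C1_path A gam & gam 0 = x & gam 1 = x0}. path_length A \<omega> gam) < \<infinity>"
proof -
 let ?I = "INF gam\<in>{gam. piecewise_C1_path A gam & gam 0 = x & gam 1 = x0}. path_length A \<omega> gam"
 have "?I <= path_length A \<omega> (%t. cinv k (of_real (1 - t) * snd k x))" by (rule INF_lower) (use radial_path(1-3)[OF x] in blast)
 also note radial_path(4)[OF x]
 finally have le: "?I <= ennreal (sqrt m' * cmod (snd k x))" .
 then show "?I < \<infinity>" by (simp add: le_less_trans)
 have "0 <= m'" using m(1) m(2,3)[OF x] by linarith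
 then show "rdist A \<omega> x x0 <= sqrt m' * cmod (snd k x)" unfolding rdist_def using enn2real_mono[OF le] by simp
qed

text \<open>After the last time at which the path is outside the disc of radius |z(x)| it stays in the coordinate disc and travels the coordinate distance |z(x)|.\<close>
lemma path_length_lower: assumes x: "x : coord_disc k r" and g: "piecewise_C1_path A gam" "gam 0 = x" "gam 1 = x0"
 shows "ennreal (sqrt m * cmod (snd k x)) <= path_length A \<omega> gam"
proof (cases "snd k x = 0")
 case False
 define R where "R = cmod (snd k x)"
 have R: "0 < R" "R < r" using False x by (auto simp: R_def coord_disc_def)
 have gc: "continuous_on {0..1} gam" using g(1) by (simp add: piecewise_C1_path_def)
 obtain F where F: "finite F" "(snd k \<circ> gam) C1_differentiable_on {t : {0<..<1} - F. gam t : fst k}"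
  using g(1) k unfolding piecewise_C1_path_def by blast
 define N where "N = cinv k ` cball 0 R"
 have ballsub: "cball 0 R \<subseteq> snd k ` fst k"
 proof -
  have "cball 0 R \<subseteq> ball (0::complex) r" using R by auto
  then show ?thesis unfolding disc[symmetric] by (auto simp: coord_disc_def)
 qed
 have "compact N" unfolding N_def by (intro compact_continuous_image continuous_on_subset[OF chartD(5)[OF k] ballsub] compact_cball)
 then have Nc: "closed N" by (rule compact_imp_closed)
 have Nm: "y : fst k & cmod (snd k y) <= R" if y: "y : N" for y
 proof -
  obtain w where w: "w : cball 0 R" "y = cinv k w" using y by (auto simp: N_def)
  obtain u where u: "u : fst k" "w = snd k u" using w(1) ballsub by blast
  have "y = u" using w(2) u k by simp
  then show ?thesis using u w by simp
 qed
 let ?D = "coord_disc k R"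
 have DN: "?D \<subseteq> N"
 proof
  fix y assume "y : ?D"
  then have "y : fst k" "snd k y : cball 0 R" by (auto simp: coord_disc_def)
  then show "y : N" unfolding N_def using k by (intro image_eqI[of _ _ "snd k y"]) auto
 qed
 have Do: "open ?D"
 proof -
  have "?D = fst k Int snd k -` ball 0 R" by (auto simp: coord_disc_def)
  then show ?thesis using continuous_open_preimage[OF chartD(4)[OF k] chartD(1)[OF k] open_ball] by simp
 qed
 \<comment> \<open>the last time at which the path is outside the disc\<close>
 define T where "T = {0..1} Int gam -` (- ?D)"
 have "closed T" unfolding T_def by (rule continuous_closed_preimage[OF gc]) (use Do in auto)
 then have Tc: "compact T" using compact_Int_closed[of "{0..1}" T] by (simp add: T_def Int_absorb1 flip: Int_assoc)
 have T0: "0 : T" using g(2) by (auto simp: T_def coord_disc_def R_def)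
 obtain a where a: "a : T" "!!t. t : T ==> t <= a" using compact_attains_sup[OF Tc] T0 by blast
 have x0D: "x0 : ?D" using x0 R by (simp add: coord_disc_def)
 have a01: "0 <= a" "a < 1" using a(1) g(3) x0D by (auto simp: T_def less_le)
 have inD: "gam t : ?D" if "a < t" "t <= 1" for t using a(2)[of t] that a01 by (force simp: T_def)
 have aN: "gam a : N"
 proof -
  have c: "continuous (at a within {a..1}) gam" using continuous_on_subset[OF gc, of "{a..1}"] a01 by (simp add: continuous_on_eq_continuous_within)
  have "(gam \<longlongrightarrow> gam a) (at a within {a..1})" using c by (simp add: continuous_within)
  moreover have "eventually (%t. gam t : N) (at a within {a..1})" unfolding eventually_at_topological using inD DN by (intro exI[of _ UNIV]) force
  moreover have "at a within {a..1} ~= bot" using a01 by (simp add: trivial_limit_within islimpt_Icc)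
  ultimately show ?thesis using Nc by (metis Lim_in_closed_set)
 qed
 have ak: "gam a : fst k" "cmod (snd k (gam a)) = R" using Nm[OF aN] a(1) by (auto simp: T_def coord_disc_def)
 have gk: "gam t : fst k" if "a <= t" "t <= 1" for t using that inD[of t] ak(1) by (cases "a = t") (auto simp: coord_disc_def)
 define h where "h = snd k \<circ> gam"
 obtain D where D: "!!t. t : {t : {0<..<1} - F. gam t : fst k} ==> (h has_vector_derivative D t) (at t)"
  "continuous_on {t : {0<..<1} - F. gam t : fst k} D" using F(2) unfolding C1_differentiable_on_def h_def by blast
 have sub: "{a<..<1} - F \<subseteq> {t : {0<..<1} - F. gam t : fst k}" using gk a01 by auto
 have hc: "continuous_on {a..1} h" unfolding h_def by (intro continuous_on_compose continuous_on_subset[OF gc] continuous_on_subset[OF chartD(4)[OF k]]) (use a01 gk in auto)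
 have "h a - h 1 = snd k (gam a)" using g(3) x0 by (simp add: h_def)
 then have "ennreal R <= (\<integral>\<^sup>+t\<in>{a<..<1} - F. ennreal (cmod (D t)) \<partial>lborel)"
  using arc_length_lower_bound[OF a01(2) F(1) hc _ continuous_on_subset[OF D(2) sub]] D(1) sub ak(2) by (metis (no_types, lifting) norm_minus_commute subsetD)
 then have "ennreal (sqrt m) * ennreal R <= ennreal (sqrt m) * (\<integral>\<^sup>+t\<in>{a<..<1} - F. ennreal (cmod (D t)) \<partial>lborel)" by (rule mult_left_mono) simp
 also have "... = (\<integral>\<^sup>+t. ennreal (sqrt m) * (ennreal (cmod (D t)) * indicator ({a<..<1} - F) t) \<partial>lborel)"
 proof (rule nn_integral_cmult[symmetric])
  have "(%t. indicator ({a<..<1} - F) t *\<^sub>R D t) : borel_measurable borel"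
   by (rule borel_measurable_continuous_on_indicator[OF _ continuous_on_subset[OF D(2) sub]]) (intro sets.Diff borel_closed[OF finite_imp_closed[OF F(1)]], simp)
  then have "(%t. ennreal (norm (indicator ({a<..<1} - F) t *\<^sub>R D t))) : borel_measurable lborel" by measurable
  then show "(%t. ennreal (cmod (D t)) * indicator ({a<..<1} - F) t) : borel_measurable lborel"
   by (rule measurable_cong[THEN iffD1, rotated]) (auto simp: indicator_def)
 qed
 also have "... <= path_length A \<omega> gam" unfolding path_length_def
 proof (rule nn_integral_mono)
  fix t :: real
  show "ennreal (sqrt m) * (ennreal (cmod (D t)) * indicator ({a<..<1} - F) t) \<le>
   ennreal (let k = chart_at A (gam t) in sqrt (\<omega> k (gam t)) * cmod (vector_derivative (snd k \<circ> gam) (at t))) * indicator {0<..<1} t"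
  proof (cases "t : {a<..<1} - F")
   case t: True
   have ic: "isCont gam t" using continuous_on_interior[OF gc, of t] t a01 by simp
   have td: "gam t : fst k" "t : {t : {0<..<1} - F. gam t : fst k}" using subsetD[OF sub t] by auto
   have tY: "gam t : Y" unfolding YU by (rule UNIV_I)
   note sp = speed_chart(2)[OF k chart_at(1) ic td(1) chart_at(2) tY D(1)[OF td(2), unfolded h_def]]
   have "gam t : coord_disc k r" using inD[of t] t R by (auto simp: coord_disc_def)
   then have "sqrt m * cmod (D t) <= sqrt (\<omega> k (gam t)) * cmod (D t)" using m(2) by (intro mult_right_mono) auto
   then have "ennreal (sqrt m) * ennreal (cmod (D t)) <= ennreal (sqrt (\<omega> k (gam t)) * cmod (D t))"
    using m(1) by (subst ennreal_mult[symmetric]) (auto intro: ennreal_leI)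
   then show ?thesis unfolding Let_def sp using t a01 by simp
  qed simp
 qed
 finally show ?thesis unfolding R_def using m(1) by (simp add: ennreal_mult)
qed simp

lemma rdist_pos: assumes x: "x : coord_disc k r" "x ~= x0" shows "rdist A \<omega> x x0 > 0"
proof -
 let ?I = "INF gam\<in>{gam. piecewise_C1_path A gam & gam 0 = x & gam 1 = x0}. path_length A \<omega> gam"
 have "snd k x ~= 0" using x x0 chartD(3)[OF k] by (metis (no_types, lifting) coord_disc_def inj_onD mem_Collect_eq)
 then have "0 < ennreal (sqrt m * cmod (snd k x))" using m(1) by (simp add: ennreal_zero_less_mult_iff)
 also have "... <= ?I" by (rule INF_greatest) (use path_length_lower[OF x(1)] in blast)
 finally show ?thesis unfolding rdist_def using rdist_upper(2)[OF x(1)] by (simp add: enn2real_positive_iff)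
qed

end

lemma rdist_refl: "rdist A \<omega> y y = 0"
proof -
 have p: "piecewise_C1_path A (%_. y)" unfolding piecewise_C1_path_def
  by (intro conjI exI[of _ "{}"]) (auto simp: C1_differentiable_on_def intro!: exI[of _ "%_. 0"])
 have 0: "path_length A \<omega> (%_. y) = 0" unfolding path_length_def by (simp add: Let_def o_def)
 have "(INF gam\<in>{gam. piecewise_C1_path A gam & gam 0 = y & gam 1 = y}. path_length A \<omega> gam) <= path_length A \<omega> (%_. y)"
  by (rule INF_lower) (use p in simp)
 then have "(INF gam\<in>{gam. piecewise_C1_path A gam & gam 0 = y & gam 1 = y}. path_length A \<omega> gam) = 0" using 0 by simp
 then show ?thesis unfolding rdist_def by simp
qed

end

section \<open>The estimate on the punctured disc\<close>

lemma d_dbar_affine: assumes S: "open S" "Ck_on 2 f S" "w : S" shows "d_dbar (%w. (f w - c) / 2) w = d_dbar f w / 2"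
proof -
 have one: "pdx (%w. (f w - c) / 2) x = pdx f x / 2" "pdy (%w. (f w - c) / 2) x = pdy f x / 2"
  if d: "f differentiable (at x)" for f :: "complex => real" and c x
 proof -
  have "((%w. (f w - c) / 2) has_derivative (%h. (pdx f x / 2) * Re h + (pdy f x / 2) * Im h)) (at x)"
   by (rule derivative_eq_intros has_real_wirtinger_derivative[OF d] refl)+ (auto simp: field_simps)
  from pd_unique(2,3)[OF this] show "pdx (%w. (f w - c) / 2) x = pdx f x / 2" "pdy (%w. (f w - c) / 2) x = pdy f x / 2" .
 qed
 have d: "f differentiable (at x)" "pdx f differentiable (at x)" "pdy f differentiable (at x)" if "x : S" for x using S(2) that by (auto simp: numeral_2_eq_2)
 have "pdx (pdx (%w. (f w - c) / 2)) w = pdx (%x. (pdx f x - 0) / 2) w" by (rule pd_cong(1)[OF S(1,3)]) (simp add: one(1)[OF d(1)])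
 moreover have "pdy (pdy (%w. (f w - c) / 2)) w = pdy (%x. (pdy f x - 0) / 2) w" by (rule pd_cong(2)[OF S(1,3)]) (simp add: one(2)[OF d(1)])
 ultimately show ?thesis using one(1)[OF d(2)[OF S(3)], of 0] one(2)[OF d(3)[OF S(3)], of 0] by (simp add: d_dbar_def partial_def numeral_2_eq_2 add_divide_distrib)
qed

text \<open>Since r is bounded, a larger exponent dominates up to a constant. This lets the one threshold with \<open>\<delta>\<close> control s/r and both error terms.\<close>
lemma powr_dominate: fixes \<xi> R e \<delta> :: real assumes "\<xi> > 0" "R > 0" "e <= \<delta>"
 shows "\<exists>C>1. \<forall>r p. 0 < r --> r < R --> p > C * r powr (- \<delta>) --> p > \<xi> * r powr (- e)"
proof (intro exI conjI allI impI)
 let ?C = "max 2 (\<xi> * R powr (\<delta> - e))"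
 show "?C > 1" by simp
 fix r p :: real assume r: "0 < r" "r < R" and p: "p > ?C * r powr (- \<delta>)"
 have "\<xi> * r powr (- e) = \<xi> * (r powr (\<delta> - e) * r powr (- \<delta>))" using r by (simp add: powr_add[symmetric])
 also have "... <= \<xi> * (R powr (\<delta> - e) * r powr (- \<delta>))" using r assms by (intro mult_left_mono mult_right_mono powr_mono2) auto
 also have "... = (\<xi> * R powr (\<delta> - e)) * r powr (- \<delta>)" by simp
 also have "... <= ?C * r powr (- \<delta>)" by (intro mult_right_mono) auto
 finally show "p > \<xi> * r powr (- e)" using p by simp
qed

lemma powr_small: fixes p r e h \<xi> :: real assumes "0 < r" "0 < h" "\<xi> > 0" "p > \<xi> powr (- 1 / h) * r powr (- (e / h))"
 shows "p powr (- h) * r powr (- e) <= \<xi>"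
proof -
 have q: "\<xi> powr (- 1 / h) * r powr (- (e / h)) > 0" using assms by simp
 have "p powr (- h) <= (\<xi> powr (- 1 / h) * r powr (- (e / h))) powr (- h)" using assms q by (intro powr_mono2') auto
 also have "... = \<xi> * r powr e" using assms by (simp add: powr_mult powr_powr)
 finally have "p powr (- h) * r powr (- e) <= \<xi> * r powr e * r powr (- e)" by (intro mult_right_mono) auto
 also have "... = \<xi>" using assms by (simp add: mult.assoc powr_add[symmetric])
 finally show ?thesis .
qed

lemma product_upper: fixes er eta tht :: real
 assumes "0 <= er" "er <= 1/4" "0 <= eta" "eta <= 1/2" "0 <= tht" "tht <= 1"
 shows "exp (2 * er) / (1 - eta) * (1 + tht) <= 1 + (12 * er + 6 * eta + 3 * tht)"
proof -
 have e: "exp (2 * er) <= 1 + 4 * er"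
 proof -
  have "exp (2 * er) <= 1 + 2 * er + (2 * er)^2" using assms by (intro exp_bound) auto
  also have "(2 * er)^2 <= 2 * er" unfolding power2_eq_square by (rule mult_left_le) (use assms in auto)
  finally show ?thesis by simp
 qed
 have n: "1 / (1 - eta) <= 1 + 2 * eta"
 proof -
  have "0 <= eta * (1 - 2 * eta)" using assms by simp
  then have "1 <= (1 + 2 * eta) * (1 - eta)" by (simp add: algebra_simps)
  then show ?thesis using assms by (simp add: divide_le_eq)
 qed
 have "exp (2 * er) / (1 - eta) * (1 + tht) = exp (2 * er) * (1 / (1 - eta)) * (1 + tht)" by simp
 also have "... <= (1 + 4 * er) * (1 + 2 * eta) * (1 + tht)" using assms e n by (intro mult_right_mono mult_mono) auto
 also have "... <= 1 + 3 * (4 * er + 2 * eta + tht)"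
 proof -
  have gen: "(1 + x) * (1 + y) * (1 + z) <= 1 + 3 * (x + y + z)" if "0 <= x" "x <= 1" "0 <= y" "y <= 1" "0 <= z" "z <= 1" for x y z :: real
  proof -
   have xy: "x * y <= x" "0 <= x * y" using that by (simp_all add: mult_left_le)
   have "y * z <= y" "x * z <= z" "x * y * z <= x * y" using that xy by (simp_all add: mult_left_le mult_left_le_one_le)
   then have "1 + x + y + z + x * y + y * z + x * z + x * y * z <= 1 + 3 * (x + y + z)" using xy that by argo
   also have "1 + x + y + z + x * y + y * z + x * z + x * y * z = (1 + x) * (1 + y) * (1 + z)" by (simp add: algebra_simps)
   finally show ?thesis .
  qed
  show ?thesis by (rule gen) (use assms in auto)
 qed
 finally show ?thesis by simp
qed

lemma product_lower: fixes er eta \<tau> Q :: real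
 assumes "0 <= er" "er <= 1/4" "0 <= eta" "eta <= 1/2" "0 <= \<tau>" "\<tau> <= 1/2"
  and Q: "(1 - \<tau>)^2 <= Q * (exp (2 * er) * (1 + eta))" shows "1 - (2 * \<tau> + 2 * er + eta) <= Q"
proof -
 have e: "1 - 2 * er <= exp (- (2 * er))" using exp_ge_add_one_self[of "- (2 * er)"] by simp
 have n: "1 - eta <= 1 / (1 + eta)"
 proof -
  have "(1 - eta) * (1 + eta) <= 1" by (simp add: algebra_simps)
  then show ?thesis using assms by (simp add: le_divide_eq)
 qed
 have t: "1 - 2 * \<tau> <= (1 - \<tau>)^2" by (simp add: power2_diff)
 have gen: "1 - (x + y + z) <= (1 - x) * (1 - y) * (1 - z)" if "0 <= x" "x <= 1" "0 <= y" "y <= 1" "0 <= z" "z <= 1" for x y z :: real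
 proof -
  have "x * y * z <= x * y" "0 <= x * y" "0 <= y * z" "0 <= x * z" using that by (simp_all add: mult_left_le)
  moreover have "(1 - x) * (1 - y) * (1 - z) = 1 - (x + y + z) + x * y + y * z + x * z - x * y * z" by (simp add: algebra_simps)
  ultimately show ?thesis by linarith
 qed
 have "1 - (2 * \<tau> + 2 * er + eta) <= (1 - 2 * \<tau>) * (1 - 2 * er) * (1 - eta)" by (rule gen) (use assms in auto)
 also have "... <= (1 - \<tau>)^2 * exp (- (2 * er)) * (1 / (1 + eta))" using assms e n t by (intro mult_mono mult_nonneg_nonneg) auto
 also have "... <= Q * (exp (2 * er) * (1 + eta)) * exp (- (2 * er)) * (1 / (1 + eta))" using assms by (intro mult_right_mono Q) auto
 also have "... = Q"
 proof -
  have "exp (2 * er) * exp (- (2 * er)) = 1" by (simp add: exp_minus)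
  moreover have "(1 + eta) * (1 / (1 + eta)) = 1" using assms by simp
  moreover have "Q * (exp (2 * er) * (1 + eta)) * exp (- (2 * er)) * (1 / (1 + eta)) =
    Q * (exp (2 * er) * exp (- (2 * er))) * ((1 + eta) * (1 / (1 + eta)))" by (simp only: mult_ac)
  ultimately show ?thesis by simp
 qed
 finally show ?thesis .
qed

lemma powr_eighth_powers: fixes p :: real assumes "p > 0" shows "p * (p powr (- 3/8)) ^ 3 = p powr (- 1/8)" "p * (p powr (- 3/8))^2 = p powr (1/4)"
proof -
 have 1: "p = p powr 1" using assms by simp
 have "(p powr (- 3/8)) ^ 3 = p powr (- 9/8)" "(p powr (- 3/8))^2 = p powr (- 3/4)" using assms by (simp_all add: powr_numeral[symmetric] powr_powr del: powr_numeral)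
 then show "p * (p powr (- 3/8)) ^ 3 = p powr (- 1/8)" "p * (p powr (- 3/8))^2 = p powr (1/4)" using powr_add[of p 1 "- 9/8"] powr_add[of p 1 "- 3/4"] assms by simp_all
qed

context surf
begin

text \<open>The constants A1, A2, A3, A4 bound in turn the deviation of the weight from the Gaussian, the oscillation of \<open>\<rho>\<close>, the remainder of the projection and the truncation of the Gaussian. The last two are powers of p alone and are absorbed in the first error term since r < R.\<close>
theorem punctured_disc_estimate: fixes \<phi> \<psi> :: "complex => real" and \<kappa> R R' \<nu> a a' \<alpha> \<beta> \<delta> m :: real
 assumes ric: "form_le_on A Y (ricci \<omega>) (%k x. - \<kappa> * \<omega> k x)" and \<kappa>: "\<kappa> > 0"
  and k: "k : charts A" and R: "R > 0" "2 * R <= R'" and D: "ball 0 R' - {0} \<subseteq> W k"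
  and m: "m > 0" "!!w. w : ball 0 R' - {0} ==> m <= rho k w"
  and \<phi>: "!!w. w : ball 0 R' - {0} ==> (ln (rho k w) - ln 2) / 2 = \<nu> * ln (cmod w) + \<psi> w" and \<psi>: "Ck_on 3 \<psi> (ball 0 R' - {0})"
  and a: "a > 0" "\<alpha> >= 0" "a' > 0" "\<beta> >= 0"
  and d3: "!!w m n. w : ball 0 R' - {0} ==> m + n = 3 ==> \<bar>partial m n \<psi> w\<bar> <= a * cmod w powr (- \<alpha>)"
  and d1: "!!w m n. w : ball 0 R' - {0} ==> m + n = 1 ==> \<bar>partial m n (rho k) w\<bar> <= a' * cmod w powr (- \<beta>)"
  and \<delta>: "8 / 3 <= \<delta>" "8 * \<beta> / 3 <= \<delta>" "8 * \<alpha> <= \<delta>"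
 shows "\<exists>C>1. \<forall>x\<in>fst k. \<forall>p::nat. 0 < cmod (snd k x) --> cmod (snd k x) < R --> real p > C * cmod (snd k x) powr (- \<delta>) -->
  \<bar>bergman_kernel A Y \<omega> p x / real p * (- (2 * pi / gauss_curvature A \<omega> x)) - 1\<bar>
   <= C * (real p powr (- 1 / 8) * cmod (snd k x) powr (- \<alpha>) + real p powr (- 3 / 8) * cmod (snd k x) powr (- \<beta>))"
proof -
 define A1 where "A1 = 2 * a * 2 powr \<alpha>"
 define A2 where "A2 = 2 * a' * 2 powr \<beta> / m"
 define A3 where "A3 = sqrt (8192 * exp 4 / (\<kappa> * m)) * R powr \<alpha>"
 define A4 where "A4 = 2 / (\<kappa> * m) * R powr \<alpha>"
 define L where "L = 4 * (A1 + A2 + A3 + A4)"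
 define C0 where "C0 = 12 * A1 + 6 * A2 + 3 * A4 + 2 * A3"
 have A_pos: "A1 > 0" "A2 > 0" "A3 > 0" "A4 > 0" using a m \<kappa> R by (simp_all add: A1_def A2_def A3_def A4_def)
 have L: "L > 0" using A_pos by (simp add: L_def)
 have C0: "C0 > 0" using A_pos by (simp add: C0_def)
 have iL: "1 / L > 0" using L by simp
 obtain B1 where B1: "B1 > 1" "!!r p. 0 < r ==> r < R ==> p > B1 * r powr (- \<delta>) ==> p > (1/L) powr (- 1 / (1/8)) * r powr (- (\<alpha> / (1/8)))"
  using powr_dominate[of "(1/L) powr (- 1 / (1/8))" R "\<alpha> / (1/8)" \<delta>] R L \<delta>(3) by auto
 obtain B2 where B2: "B2 > 1" "!!r p. 0 < r ==> r < R ==> p > B2 * r powr (- \<delta>) ==> p > (1/L) powr (- 1 / (3/8)) * r powr (- (\<beta> / (3/8)))"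
  using powr_dominate[of "(1/L) powr (- 1 / (3/8))" R "\<beta> / (3/8)" \<delta>] R L \<delta>(2) by (auto simp: mult.commute)
 obtain B3 where B3: "B3 > 1" "!!r p. 0 < r ==> r < R ==> p > B3 * r powr (- \<delta>) ==> p > (1/2) powr (- 1 / (3/8)) * r powr (- (1 / (3/8)))"
  using powr_dominate[of "(1/2) powr (- 1 / (3/8))" R "1 / (3/8)" \<delta>] R \<delta>(1) by auto
 obtain B4 where B4: "B4 > 1" "!!r p. 0 < r ==> r < R ==> p > B4 * r powr (- \<delta>) ==> p > 1 * r powr (- 0)"
  using powr_dominate[of 1 R 0 \<delta>] R \<delta>(1) by auto
 define C where "C = B1 + B2 + B3 + B4 + C0"
 have C: "C > 1" "C >= B1" "C >= B2" "C >= B3" "C >= B4" "C >= C0" using B1 B2 B3 B4 C0 by (auto simp: C_def)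
 show ?thesis
 proof (intro exI[of _ C] conjI C(1) ballI allI impI)
  fix x and p :: nat
  assume x: "x : fst k" and r0: "0 < cmod (snd k x)" and rR: "cmod (snd k x) < R" and pC: "real p > C * cmod (snd k x) powr (- \<delta>)"
  define w where "w = snd k x"
  define r where "r = cmod w"
  have r: "0 < r" "r < R" using r0 rR by (auto simp: r_def w_def)
  have pC': "real p > B * r powr (- \<delta>)" if "B <= C" for B using mult_right_mono[OF that, of "r powr (- \<delta>)"] pC by (simp add: r_def w_def)
  have p1: "real p > 1" using B4(2)[OF r pC'[OF C(5)]] r by simp
  define q where "q = p - 1"
  have q: "p = Suc q" "q > 0" using p1 by (auto simp: q_def)
  define s where "s = real p powr (- 3/8)"
  have s: "s > 0" "2 * s <= r"
  proof -
   show "s > 0" using p1 by (simp add: s_def)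
   have "real p powr (- (3/8)) * r powr (- 1) <= 1/2" by (rule powr_small[OF r(1)]) (use B3(2)[OF r pC'[OF C(4)]] in auto)
   then have "s * (1 / r) <= 1/2" using r by (simp add: s_def powr_minus_divide)
   then show "2 * s <= r" using r by (simp add: field_simps)
  qed
  define X1 where "X1 = real p powr (- 1/8) * r powr (- \<alpha>)"
  define X2 where "X2 = real p powr (- 3/8) * r powr (- \<beta>)"
  have X1: "0 <= X1" "X1 <= 1 / L" using powr_small[OF r(1) _ iL B1(2)[OF r pC'[OF C(2)]]] by (simp_all add: X1_def)
  have X2: "0 <= X2" "X2 <= 1 / L" using powr_small[OF r(1) _ iL B2(2)[OF r pC'[OF C(3)]]] by (simp_all add: X2_def)
  have small: "A * X <= 1/4" if "0 < A" "4 * A <= L" "0 <= X" "X <= 1 / L" for A X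
  proof -
   have "A * X <= A * (1 / L)" using that by (intro mult_left_mono) auto
   also have "... <= 1/4" using that L by (simp add: field_simps)
   finally show ?thesis .
  qed
  have AL: "4 * A1 <= L" "4 * A2 <= L" "4 * A3 <= L" "4 * A4 <= L" using A_pos by (auto simp: L_def)
  define er where "er = A1 * X1"
  define eta where "eta = A2 * X2"
  have er: "0 <= er" "er <= 1/4" unfolding er_def using small[OF A_pos(1) AL(1) X1] A_pos X1 by auto
  have eta: "0 <= eta" "eta <= 1/4" unfolding eta_def using small[OF A_pos(2) AL(2) X2] A_pos X2 by auto
  have w0: "w ~= 0" using r by (auto simp: r_def)
  \<comment> \<open>the disc of radius |w| around w avoids the puncture\<close>
  have Bsub: "ball w (cmod w) \<subseteq> ball 0 R' - {0}"
  proof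
   fix u assume "u : ball w (cmod w)"
   then have u: "cmod (w - u) < r" by (simp add: dist_norm r_def)
   have "u ~= 0" using u by (auto simp: r_def)
   moreover have "cmod u < R'" using norm_triangle_ineq4[of w "w - u"] u r R by (simp add: r_def)
   ultimately show "u : ball 0 R' - {0}" by simp
  qed
  have half: "cmod u powr (- e) <= 2 powr e * r powr (- e)" if "cmod u >= r / 2" "e >= 0" for u e
  proof -
   have "cmod u powr (- e) <= (r / 2) powr (- e)" using that r by (intro powr_mono2') auto
   also have "... = 2 powr e * r powr (- e)" using r by (simp add: powr_divide powr_minus_divide)
   finally show ?thesis .
  qed
  have wB: "w : ball w (cmod w)" using r by (simp add: r_def)
  then have wD: "w : ball 0 R' - {0}" using Bsub by blast
  have wW: "w : W k" using wD D by blast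
  have xY: "x : Y"
  proof -
   obtain y where "y : fst k" "y : Y" "w = snd k y" using wW by (rule WE[OF k])
   then show ?thesis using x k cinv_snd w_def by metis
  qed
  have oD: "open (ball 0 R' - {0::complex})" by (intro open_Diff) auto
  define K where "K = d_dbar (%w. (ln (rho k w) - ln 2) / 2) w"
  define rh0 where "rh0 = rho k w"
  have rh0: "rh0 >= m" "rh0 > 0" using m(2)[OF wD] m(1) by (auto simp: rh0_def)
  have lnC: "Ck_on 2 (%w. ln (rho k w)) (W k)" using Ck_on_Re[OF open_W[OF k] CK_ln[OF open_W[OF k] rho_smooth[OF k] rho_pos[OF k]], of 2] by simp
  have K2: "K = d_dbar (%w. ln (rho k w)) w / 2" unfolding K_def by (rule d_dbar_affine[OF open_W[OF k] lnC wW])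
  have Kl: "K >= \<kappa> / 4 * rh0" using curvature_lower_bound[OF ric k wW] by (simp add: K2 rh0_def)
  have K0: "K > 0" using Kl mult_pos_pos[of "\<kappa>/4" rh0] \<kappa> rh0 by linarith
  have gauss: "gauss_curvature A \<omega> x = - (4 * K / rh0)"
   unfolding gauss_curvature_chart[OF k x xY] rho_snd[OF k x, symmetric] w_def[symmetric] rh0_def[symmetric] K2 by simp
  obtain G where G: "G holomorphic_on ball w (cmod w)"
   "!!v. cmod v <= cmod w / 2 ==> \<bar>(ln (rho k (w + v)) - ln 2) / 2 - Re (G (w + v)) - K * sq v\<bar> <= 2 * (a * (2 powr \<alpha> * r powr (- \<alpha>))) * cmod v ^ 3"
  proof (rule local_expansion[where M = "a * (2 powr \<alpha> * r powr (- \<alpha>))", OF w0 oD Bsub \<psi> \<phi>])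
   fix u m n assume u: "u : ball w (cmod w)" "cmod w / 2 <= cmod u" and mn: "m + n = (3::nat)"
   have "\<bar>partial m n \<psi> u\<bar> <= a * cmod u powr (- \<alpha>)" by (rule d3[OF _ mn]) (use Bsub u in blast)
   also have "... <= a * (2 powr \<alpha> * r powr (- \<alpha>))" using half[of u \<alpha>] u a by (intro mult_left_mono) (auto simp: r_def)
   finally show "\<bar>partial m n \<psi> u\<bar> <= a * (2 powr \<alpha> * r powr (- \<alpha>))" .
  qed (use K_def in auto)
  have eps: "real p * (2 * (a * (2 powr \<alpha> * r powr (- \<alpha>))) * s ^ 3) <= er"
  proof -
   have "real p * (2 * (a * (2 powr \<alpha> * r powr (- \<alpha>))) * s ^ 3) = A1 * ((real p * s ^ 3) * r powr (- \<alpha>))" by (simp add: A1_def)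
   also have "real p * s ^ 3 = real p powr (- 1/8)" unfolding s_def by (rule powr_eighth_powers) (use p1 in simp)
   finally show ?thesis unfolding er_def X1_def by (rule eq_refl)
  qed
  have lip: "\<bar>rho k (w + v) - rh0\<bar> <= eta * rh0" if v: "cmod v <= s" for v
  proof -
   have seg: "cmod (of_real t * v) <= r / 2" if "0 <= t" "t <= 1" for t
   proof -
    have "cmod (of_real t * v) <= cmod v" using that mult_left_le_one_le[of "cmod v" t] by (simp add: norm_mult)
    then show ?thesis using v s by linarith
   qed
   have "\<bar>rho k (w + v) - rho k w\<bar> <= 2 * (a' * (2 powr \<beta> * r powr (- \<beta>))) * cmod v"
   proof (rule taylor_first_order[where S = "W k"])
    show "Ck_on 1 (rho k) (W k)" by (rule rho_smooth[OF k])
    fix t :: real assume t: "0 <= t" "t <= 1"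
    have "cmod (of_real t * v) < r" using seg[OF t] r by linarith
    then have "w + of_real t * v : ball w (cmod w)" by (simp add: dist_norm r_def)
    then have u: "w + of_real t * v : ball 0 R' - {0}" using Bsub by blast
    then show "w + of_real t * v : W k" using D by blast
    fix m n assume mn: "m + n = (1::nat)"
    have c: "cmod (w + of_real t * v) >= r / 2" using seg[OF t] norm_diff_ineq[of w "of_real t * v"] by (simp add: r_def)
    have "\<bar>partial m n (rho k) (w + of_real t * v)\<bar> <= a' * cmod (w + of_real t * v) powr (- \<beta>)" by (rule d1[OF u mn])
    also have "... <= a' * (2 powr \<beta> * r powr (- \<beta>))" using half[OF c a(4)] a by (intro mult_left_mono) auto
    finally show "\<bar>partial m n (rho k) (w + of_real t * v)\<bar> <= a' * (2 powr \<beta> * r powr (- \<beta>))" .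
   qed
   also have "... <= 2 * (a' * (2 powr \<beta> * r powr (- \<beta>))) * s" using v a by (intro mult_left_mono) auto
   also have "... = eta * m" using m(1) by (simp add: eta_def A2_def X2_def s_def)
   also have "... <= eta * rh0" using rh0 eta by (intro mult_left_mono) auto
   finally show ?thesis unfolding rh0_def .
  qed
  have sr: "s < cmod w" using s r by (simp add: r_def)
  have expn: "\<bar>(ln (rho k (w + v)) - ln 2) / 2 - Re (G (w + v)) - K * sq v\<bar> <= 2 * (a * (2 powr \<alpha> * r powr (- \<alpha>))) * cmod v ^ 3"
   if "cmod v <= s" for v by (rule G(2)) (use that s in \<open>simp add: r_def\<close>)
  have M0: "2 * (a * (2 powr \<alpha> * r powr (- \<alpha>))) >= 0" using a by simp
  have e1: "er <= 1" and n2: "eta <= 1/2" using er eta by auto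
  note loc = k x xY w_def[symmetric] rh0_def[symmetric] subset_trans[OF Bsub D] s(1) sr G(1) K0 expn M0 eps e1 lip n2 q
  define Q where "Q = bergman_kernel A Y \<omega> p x * (pi * rh0 / (2 * real p * K))"
  define y where "y = real p * K * s^2"
  have ps: "real p * s^2 = real p powr (1/4)" unfolding s_def by (rule powr_eighth_powers) (use p1 in simp)
  \<comment> \<open>p to the power -1/8 is itself bounded by a multiple of the first error term, because r < R\<close>
  have p8: "real p powr (- 1/8) <= R powr \<alpha> * X1"
  proof -
   have "1 <= R powr \<alpha> * r powr (- \<alpha>)" using powr_mono2[of \<alpha> r R] r a by (simp add: powr_minus_divide le_divide_eq)
   from mult_left_mono[OF this, of "real p powr (- 1/8)"] show ?thesis by (simp add: X1_def mult_ac)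
  qed
  have nn: "0 <= A1 * X1" "0 <= A2 * X1" "0 <= A3 * X1" "0 <= A4 * X1" "0 <= A1 * X2" "0 <= A2 * X2" "0 <= A3 * X2" "0 <= A4 * X2"
   using A_pos X1(1) X2(1) by simp_all
  have C0X: "C0 * (X1 + X2) = 12 * (A1 * X1) + 6 * (A2 * X1) + 3 * (A4 * X1) + 2 * (A3 * X1)
   + (12 * (A1 * X2) + 6 * (A2 * X2) + 3 * (A4 * X2) + 2 * (A3 * X2))" by (simp add: C0_def algebra_simps)
  have upper: "Q <= exp (2 * er) / (1 - eta) * (1 + 1 / (2 * y))" unfolding Q_def y_def by (rule kernel_upper_explicit[OF loc])
  have y0: "y > 0" unfolding y_def using p1 K0 s by simp
  have tht: "1 / (2 * y) <= A4 * X1"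
  proof -
   have yl: "2 * y >= \<kappa> * m / 2 * real p powr (1/4)"
   proof -
    have "\<kappa> / 4 * m <= \<kappa> / 4 * rh0" using rh0(1) \<kappa> by (intro mult_left_mono) auto
    then have "\<kappa> / 4 * m <= K" using Kl by linarith
    from mult_left_mono[OF this, of "2 * real p powr (1/4)"] show ?thesis unfolding y_def ps[symmetric] by (simp add: mult_ac)
   qed
   have "1 / (2 * y) <= 1 / (\<kappa> * m / 2 * real p powr (1/4))"
   proof (rule divide_left_mono[OF yl])
    show "0 < 2 * y * (\<kappa> * m / 2 * real p powr (1/4))" using y0 \<kappa> m(1) p1 by (intro mult_pos_pos) auto
   qed simp
   also have "... = 2 / (\<kappa> * m) * real p powr (- 1/4)" by (simp add: powr_minus_divide field_simps)
   also have "... <= 2 / (\<kappa> * m) * real p powr (- 1/8)" using p1 \<kappa> m by (intro mult_left_mono powr_mono) auto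
   also have "... <= 2 / (\<kappa> * m) * (R powr \<alpha> * X1)" using p8 \<kappa> m by (intro mult_left_mono) auto
   finally show ?thesis by (simp add: A4_def)
  qed
  have "1 / (2 * y) <= 1" using tht small[OF A_pos(4) AL(4) X1] by linarith
  moreover have "0 <= 1 / (2 * y)" using y0 by simp
  ultimately have "Q <= 1 + (12 * er + 6 * eta + 3 * (1 / (2 * y)))" by (intro order_trans[OF upper product_upper] er eta(1) n2)
  then have U: "Q - 1 <= C0 * (X1 + X2)" using tht nn unfolding C0X er_def eta_def by linarith
  have curv: "\<exists>c. dzb (wG (rho k)) w = of_real c & c >= \<kappa> / 2 * rho k w" if "k : charts A" "w : W k" for k w
   using curvature_form[OF that] curvature_lower_bound[OF ric that] by blast
  obtain \<tau> where t: "\<tau> >= 0" "\<tau>\<^sup>2 <= 8192 * exp 4 / (\<kappa> * rh0 * (real p * s^2))" "\<tau> <= 1 ==> (1 - \<tau>)^2 <= Q * (exp (2 * er) * (1 + eta))"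
   unfolding Q_def by (rule kernel_lower_explicit[OF loc curv \<kappa>]) (assumption | blast)+
  have tau: "\<tau> <= A3 * X1"
  proof -
   have "8192 * exp 4 / (\<kappa> * rh0 * (real p * s^2)) <= 8192 * exp 4 / (\<kappa> * m * real p powr (1/4))"
    unfolding ps using \<kappa> m(1) rh0 p1 by (intro divide_left_mono mult_right_mono mult_left_mono mult_pos_pos) auto
   also have "... = (sqrt (8192 * exp 4 / (\<kappa> * m)) * real p powr (- 1/8))^2"
   proof -
    have "(real p powr (- 1/8))^2 = real p powr (- (1/4))" using p1 by (simp add: powr_numeral[symmetric] powr_powr del: powr_numeral)
    moreover have "(sqrt (8192 * exp 4 / (\<kappa> * m)))^2 = 8192 * exp 4 / (\<kappa> * m)" using \<kappa> m(1) by (intro real_sqrt_pow2) simp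
    ultimately have "(sqrt (8192 * exp 4 / (\<kappa> * m)) * real p powr (- 1/8))^2 = 8192 * exp 4 / (\<kappa> * m) * real p powr (- (1/4))"
     by (simp only: power_mult_distrib)
    also have "... = 8192 * exp 4 / (\<kappa> * m * real p powr (1/4))" by (simp add: powr_minus_divide)
    finally show ?thesis by (rule sym)
   qed
   finally have "\<tau>\<^sup>2 <= (sqrt (8192 * exp 4 / (\<kappa> * m)) * real p powr (- 1/8))^2" using t(2) by linarith
   then have "\<tau> <= sqrt (8192 * exp 4 / (\<kappa> * m)) * real p powr (- 1/8)" by (rule power2_le_imp_le) (use \<kappa> m(1) in simp)
   also have "... <= sqrt (8192 * exp 4 / (\<kappa> * m)) * (R powr \<alpha> * X1)" using p8 \<kappa> m by (intro mult_left_mono) auto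
   finally show ?thesis by (simp add: A3_def)
  qed
  have t4: "\<tau> <= 1/4" using tau small[OF A_pos(3) AL(3) X1] by linarith
  have "1 - (2 * \<tau> + 2 * er + eta) <= Q" by (rule product_lower[OF er eta(1) n2 t(1) _ t(3)]) (use t4 in auto)
  then have Lo: "1 - Q <= C0 * (X1 + X2)" using tau nn unfolding C0X er_def eta_def by linarith
  have "bergman_kernel A Y \<omega> p x / real p * (- (2 * pi / gauss_curvature A \<omega> x)) = Q" unfolding gauss Q_def using K0 rh0 p1 by (simp add: field_simps)
  then have "\<bar>bergman_kernel A Y \<omega> p x / real p * (- (2 * pi / gauss_curvature A \<omega> x)) - 1\<bar> <= C0 * (X1 + X2)"
   using U Lo by (simp only: abs_le_iff minus_diff_eq)
  also have "... <= C * (X1 + X2)" using C(6) X1 X2 by (intro mult_right_mono) auto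
  finally show "\<bar>bergman_kernel A Y \<omega> p x / real p * (- (2 * pi / gauss_curvature A \<omega> x)) - 1\<bar>
   <= C * (real p powr (- 1 / 8) * cmod (snd k x) powr (- \<alpha>) + real p powr (- 3 / 8) * cmod (snd k x) powr (- \<beta>))" by (simp add: X1_def X2_def r_def w_def)
 qed
qed

end

section \<open>The Bergman kernel near a singular point\<close>

theorem theorem1p2:
  fixes A :: "('a::{t2_space,second_countable_topology}) chart set"
    and \<Sigma> U :: "'a set" and z :: "'a \<Rightarrow> complex" and \<Omega> \<omega> :: "'a form11"
    and c :: "'a \<Rightarrow> real" and x\<^sub>j :: 'a and \<rho> \<phi> \<psi> :: "complex \<Rightarrow> real"
    and \<kappa> R \<nu> a a' \<alpha> \<beta> \<delta> :: real
  assumes "riemann_surface A"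
    and "closed \<Sigma>" and "discrete \<Sigma>"
    and "hermitian_metric_on A UNIV \<Omega>"
    and "hermitian_metric_on A (- \<Sigma>) \<omega>"
    and "continuous_on UNIV c" and "\<And>x. c x > 0"
    and "form_le_on A (- \<Sigma>) (\<lambda>k x. c x * \<Omega> k x) \<omega>"
    and "\<kappa> > 0" and "form_le_on A (- \<Sigma>) (ricci \<omega>) (\<lambda>k x. - \<kappa> * \<omega> k x)"
    and "x\<^sub>j \<in> \<Sigma>" and "R > 0"
    and "(U, z) \<in> charts A" and "x\<^sub>j \<in> U" and "z x\<^sub>j = 0"
    and "compact (closure (coord_disc (U, z) (2 * R)))"
    and "closure (coord_disc (U, z) (2 * R)) \<subseteq> U"
    and "\<And>x y. x \<in> coord_disc (U, z) (2 * R) \<Longrightarrow> y \<in> \<Sigma> - {x\<^sub>j} \<Longrightarrow> rdist A \<Omega> x y \<ge> R"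
    and "\<rho> = in_coord (U, z) (\<omega> (U, z))"
    and "\<phi> = (\<lambda>w. (ln (\<rho> w) - ln 2) / 2)"
    and "\<And>w. w \<in> ball 0 (2 * R) - {0} \<Longrightarrow> \<phi> w = \<nu> * ln (cmod w) + \<psi> w"
    and "Ck_on 3 \<psi> (ball 0 (2 * R) - {0})"
    and "a > 0" and "\<alpha> \<ge> 0" and "a' > 0" and "\<beta> \<ge> 0"
    and "\<And>w m n. w \<in> ball 0 (2 * R) - {0} \<Longrightarrow> m + n = 3 \<Longrightarrow>
           \<bar>partial m n \<psi> w\<bar> \<le> a * cmod w powr (- \<alpha>)"
    and "\<And>w m n. w \<in> ball 0 (2 * R) - {0} \<Longrightarrow> m + n = 1 \<Longrightarrow>
           \<bar>partial m n \<rho> w\<bar> \<le> a' * cmod w powr (- \<beta>)"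
    and "\<delta> = Max {8 / 3, 8 * \<beta> / 3, 8 * \<alpha>}"
  shows "\<exists>C>1. \<forall>x \<in> coord_disc (U, z) R - {x\<^sub>j}. \<forall>p::nat.
           real p > C * rdist A \<Omega> x x\<^sub>j powr (- \<delta>) \<longrightarrow>
           \<bar>bergman_kernel A (- \<Sigma>) \<omega> p x / real p * (- (2 * pi / gauss_curvature A \<omega> x)) - 1\<bar>
             \<le> C * (real p powr (- 1 / 8) * rdist A \<Omega> x x\<^sub>j powr (- \<alpha>)
                    + real p powr (- 3 / 8) * rdist A \<Omega> x x\<^sub>j powr (- \<beta>))"
proof -
 note RS = assms(1)
 note clo = assms(2)
 note hO = assms(4)
 note ho = assms(5)
 note cc = assms(6)
 note cpos = assms(7)
 note le = assms(8)
 note \<kappa> = assms(9)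
 note ric = assms(10)
 note xS = assms(11)
 note R = assms(12)
 note k = assms(13)
 note xU = assms(14)
 note zx = assms(15)
 note comp = assms(16)
 note csub = assms(17)
 note dist = assms(18)
 note \<rho>d = assms(19)
 note \<phi>d = assms(20)
 note \<phi>\<psi> = assms(21)
 note \<psi>3 = assms(22)
 note expos = assms(23-26)
 note d3 = assms(27)
 note d1 = assms(28)
 note \<delta>d = assms(29)
 let ?err = "%x p. \<bar>bergman_kernel A (- \<Sigma>) \<omega> p x / real p * (- (2 * pi / gauss_curvature A \<omega> x)) - 1\<bar>"
 let ?k = "(U, z)" and ?D = "coord_disc (U, z) (2 * R)"
 interpret O: surf A UNIV \<Omega> by standard (use RS hO in auto)
 have ck: "is_chart ?k" using k by (simp add: charts_def)
 have xk: "x\<^sub>j : fst ?k" "snd ?k x\<^sub>j = 0" using xU zx by auto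
 have csub': "closure ?D \<subseteq> fst ?k" using csub by simp
 have R2: "2 * R > 0" using R by simp
 have im: "snd ?k ` ?D = ball 0 (2 * R)" by (rule coordinate_disc_image[OF ck xk R2 comp csub'])
 have xD: "x\<^sub>j : ?D" using xU zx R by (simp add: coord_disc_def)
 \<comment> \<open>on the compact closure of the disc both metrics are bounded below, the smooth one also above\<close>
 have O_cont: "continuous_on (closure ?D) (\<Omega> ?k)"
 proof -
  have "continuous_on (closure ?D) (%y. O.rho ?k (z y))"
   by (rule continuous_on_compose2[OF O.rho_continuous[OF k] continuous_on_subset[OF O.chartD(4)[OF k, simplified] csub]]) (use csub in \<open>auto simp: O.W_def\<close>)
  then show ?thesis by (rule continuous_on_cong[THEN iffD1, OF refl, rotated]) (use O.rho_snd[OF k] csub in auto)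
 qed
 have ne: "closure ?D ~= {}" using xD closure_subset by blast
 have Opos: "\<Omega> ?k y > 0" if "y : closure ?D" for y by (rule O.omega_pos[OF k]) (use that csub in auto)
 obtain m1 where m1: "m1 > 0" "!!y. y : closure ?D ==> m1 <= \<Omega> ?k y" using continuous_attains_inf[OF comp ne O_cont] Opos by blast
 obtain m2 where m2: "!!y. y : closure ?D ==> \<Omega> ?k y <= m2" using continuous_attains_sup[OF comp ne O_cont] by blast
 have c_cont: "continuous_on (closure ?D) (%y. c y * \<Omega> ?k y)" by (intro continuous_intros O_cont continuous_on_subset[OF cc]) auto
 obtain m3 where m3: "m3 > 0" "!!y. y : closure ?D ==> m3 <= c y * \<Omega> ?k y"
  using continuous_attains_inf[OF comp ne c_cont] Opos cpos by (metis mult_pos_pos)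
 have DC: "y : closure ?D" if "y : ?D" for y using that closure_subset by blast
 note rd = O.rdist_upper(1)[OF refl k xk R2 im m1(1) m1(2)[OF DC] m2[OF DC]]
  O.rdist_pos[OF refl k xk R2 im m1(1) m1(2)[OF DC] m2[OF DC]]
 \<comment> \<open>a further point of the singular set in the disc would have distance 0 from itself\<close>
 have Dsing: "y : - \<Sigma>" if y: "y : ?D" "y ~= x\<^sub>j" for y using dist[OF y(1), of y] y(2) R O.rdist_refl[of y] by auto
 have punct: "ball 0 (2 * R) - {0} \<subseteq> snd ?k ` (fst ?k Int - \<Sigma>)"
 proof
  fix w :: complex assume w: "w : ball 0 (2 * R) - {0}"
  then obtain y where y: "y : ?D" "w = snd ?k y" using im by blast
  moreover have "y ~= x\<^sub>j" using w y xk by auto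
  ultimately show "w : snd ?k ` (fst ?k Int - \<Sigma>)" using Dsing by (auto simp: coord_disc_def)
 qed
 have "of_real R : ball (0::complex) (2 * R) - {0}" using R by simp
 then have "- \<Sigma> ~= {}" using punct by blast
 interpret S: surf A "- \<Sigma>" \<omega> by standard (use RS ho clo \<open>- \<Sigma> ~= {}\<close> in auto)
 have \<rho>S: "\<rho> = S.rho ?k" by (simp add: \<rho>d S.rho_def)
 have lower: "m3 <= S.rho ?k w" if w: "w : ball 0 (2 * R) - {0}" for w
 proof -
  obtain y where y: "y : ?D" "w = snd ?k y" using w im by blast
  have "y ~= x\<^sub>j" using w y xk by auto
  then have ys: "y : - \<Sigma>" using Dsing y by blast
  have yk: "y : fst ?k" using y by (simp add: coord_disc_def)
  have "c y * \<Omega> ?k y <= \<omega> ?k y" using le k ys yk unfolding form_le_on_def by blast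
  then show ?thesis using m3(2)[OF DC[OF y(1)]] S.rho_snd[OF k yk] y(2) by simp
 qed
 have \<delta>: "8 / 3 <= \<delta>" "8 * \<beta> / 3 <= \<delta>" "8 * \<alpha> <= \<delta>" by (auto simp: \<delta>d)
 obtain C1 where C1: "C1 > 1" "!!x p. x : fst ?k ==> 0 < cmod (snd ?k x) ==> cmod (snd ?k x) < R ==> real p > C1 * cmod (snd ?k x) powr (- \<delta>) ==>
  ?err x p
   <= C1 * (real p powr (- 1 / 8) * cmod (snd ?k x) powr (- \<alpha>) + real p powr (- 3 / 8) * cmod (snd ?k x) powr (- \<beta>))"
  using S.punctured_disc_estimate[OF ric \<kappa> k R order_refl punct[folded S.W_def] m3(1) lower \<phi>\<psi>[unfolded \<phi>d \<rho>S] \<psi>3 expos d3 d1[unfolded \<rho>S] \<delta>]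
  by blast
 define L where "L = max 1 (sqrt m2)"
 have L: "L >= 1" "sqrt m2 <= L" by (auto simp: L_def)
 define e where "e = \<delta> + \<alpha> + \<beta>"
 have Le: "L powr t <= L powr e" if "t <= e" for t using L(1) that by (intro powr_mono) auto
 have e0: "\<delta> <= e" "\<alpha> <= e" "\<beta> <= e" "0 <= e" using \<delta> expos by (auto simp: e_def)
 define C where "C = C1 * L powr e"
 have "1 <= L powr e" using Le[OF e0(4)] L by simp
 then have C: "C > 1" using C1(1) mult_mono[of 1 C1 1 "L powr e"] by (simp add: C_def) (metis less_le_trans mult.right_neutral mult_left_mono zero_less_one less_trans less_imp_le)
 show ?thesis
 proof (intro exI[of _ C] conjI C ballI allI impI)
  fix x and p :: nat
  assume x: "x : coord_disc ?k R - {x\<^sub>j}" and p: "real p > C * rdist A \<Omega> x x\<^sub>j powr (- \<delta>)"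
  define d where "d = rdist A \<Omega> x x\<^sub>j"
  define r where "r = cmod (snd ?k x)"
  have xD: "x : ?D" and xf: "x : fst ?k" and rR: "r < R" using x R by (auto simp: coord_disc_def r_def)
  have xne: "x ~= x\<^sub>j" using x by blast
  have d0: "d > 0" unfolding d_def by (rule rd(2)[OF _ _ xD xne])
  have "d <= sqrt m2 * r" unfolding d_def r_def by (rule rd(1)[OF _ _ xD])
  also have "... <= L * r" using L by (intro mult_right_mono) (auto simp: r_def)
  finally have dr: "d <= L * r" .
  have r0: "r > 0"
  proof (rule ccontr)
   assume "\<not> r > 0"
   then have "r = 0" by (simp add: r_def)
   then show False using dr d0 by simp
  qed
  have comp: "C1 * r powr (- t) <= C * d powr (- t)" if t: "0 <= t" "t <= e" for t
  proof -
   have "(L * r) powr (- t) <= d powr (- t)" using d0 dr t by (intro powr_mono2') auto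
   then have "L powr (- t) * r powr (- t) <= d powr (- t)" using L r0 by (simp add: powr_mult)
   then have "L powr t * (L powr (- t) * r powr (- t)) <= L powr t * d powr (- t)" by (intro mult_left_mono) auto
   moreover have "L powr t * L powr (- t) = 1" using L by (simp add: powr_add[symmetric])
   ultimately have "r powr (- t) <= L powr t * d powr (- t)" by (simp add: mult.assoc[symmetric])
   also have "... <= L powr e * d powr (- t)" using Le[OF t(2)] by (intro mult_right_mono) auto
   finally have "C1 * r powr (- t) <= C1 * (L powr e * d powr (- t))" using C1(1) by (intro mult_left_mono) auto
   then show ?thesis by (simp add: C_def mult.assoc)
  qed
  have dlow: "C1 * r powr (- \<delta>) <= C * d powr (- \<delta>)" by (rule comp) (use e0 \<delta> in auto)
  have "C1 * (real p powr (- 1 / 8) * r powr (- \<alpha>) + real p powr (- 3 / 8) * r powr (- \<beta>)) =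
    real p powr (- 1 / 8) * (C1 * r powr (- \<alpha>)) + real p powr (- 3 / 8) * (C1 * r powr (- \<beta>))" by (simp add: algebra_simps)
  also have "... <= real p powr (- 1 / 8) * (C * d powr (- \<alpha>)) + real p powr (- 3 / 8) * (C * d powr (- \<beta>))"
   by (intro add_mono mult_left_mono comp) (use e0 expos in auto)
  also have "... = C * (real p powr (- 1 / 8) * d powr (- \<alpha>) + real p powr (- 3 / 8) * d powr (- \<beta>))" by (simp add: algebra_simps)
  finally have fin: "C1 * (real p powr (- 1 / 8) * r powr (- \<alpha>) + real p powr (- 3 / 8) * r powr (- \<beta>)) \<le>
    C * (real p powr (- 1 / 8) * d powr (- \<alpha>) + real p powr (- 3 / 8) * d powr (- \<beta>))" .
  have "?err x p
   <= C1 * (real p powr (- 1 / 8) * r powr (- \<alpha>) + real p powr (- 3 / 8) * r powr (- \<beta>))"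
   unfolding r_def by (rule C1(2)[OF xf]) (use r0 rR dlow p in \<open>auto simp: r_def d_def\<close>)
  then show "?err x p
   <= C * (real p powr (- 1 / 8) * rdist A \<Omega> x x\<^sub>j powr (- \<alpha>) + real p powr (- 3 / 8) * rdist A \<Omega> x x\<^sub>j powr (- \<beta>))"
   using fin unfolding d_def by linarith
 qed
qed

end
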